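(* Assume that there is an algorithm which, given any graph with $m$ edges, lists up to $m$ of its triangles (all of them if there are fewer than $m$) in $\tilde O(m^c)$ time, for a constant $c$. Then, for any $t\ge m$, up to $t$ triangles of a graph with $m$ edges (all of them if there are fewer than $t$) can be listed by a randomized Monte Carlo algorithm in $\tilde O(m^{3c-3}t^{3-2c})$ time.
   Context: Graphs are undirected with no isolated vertices; $\tilde O$ hides polylogarithmic factors.
   Formalization: The claim is restricted to c ≤ 3/2 or t ≤ m^{3/2}; otherwise it fails: for c = 2 and t = m² it would list all Θ(m^{3/2}) triangles of a complete graph in Õ(m) time. The assumed algorithm is read as deterministic. *)

theory Defs
  imports "HOL-Probability.Probability" "HOL-Library.Log_Nat"
begin

section \<open>Graphs and triangles\<close>

text \<open>The second condition says that the vertex set is \<open>{0, ..., n - 1}\<close> and that no vertex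
  is isolated.\<close>

definition graph :: "nat \<Rightarrow> nat set set \<Rightarrow> bool" where
  "graph n E \<longleftrightarrow> (\<forall>e\<in>E. card e = 2) \<and> \<Union>E = {..<n}"

definition triangles :: "nat set set \<Rightarrow> nat set set" where
  "triangles E = {T. card T = 3 \<and> (\<forall>u\<in>T. \<forall>v\<in>T. u \<noteq> v \<longrightarrow> {u, v} \<in> E)}"

text \<open>An algorithm receives the edges in an arbitrary order, each edge once, with its two
  endpoints in an arbitrary order.\<close>

definition edge_list :: "nat set set \<Rightarrow> (nat \<times> nat) list \<Rightarrow> bool" where
  "edge_list E es \<longleftrightarrow>
     distinct (map (\<lambda>(u, v). {u, v}) es) \<and> set (map (\<lambda>(u, v). {u, v}) es) = E"


section \<open>Random access machines with logarithmic cost\<close>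

text \<open>
  The machine model is the random access machine with the logarithmic cost criterion,
  programmed in a structured language. A program has finitely many registers and finitely many
  unbounded arrays (both numbered, the numbers being constants of the program text), all of
  which hold natural numbers. An operation costs one plus the bit lengths of the numbers it
  handles. Thus arithmetic on large numbers is not free, and up to polylogarithmic
  factors the cost agrees with the number of steps of a word RAM with words of logarithmic
  length, which is the granularity of the soft-O bounds below.

  Randomness comes from an infinite sequence of coins, which is part of the state and can be
  accessed only by \<open>Flip\<close>, one coin at a time.
\<close>

datatype binop = Add | Sub | Mul | Div | Less | Equal

datatype aexp =
    Const nat
  | Reg nat
  | Arr nat aexp
  | Bin binop aexp aexp

datatype com =
    Skip
  | Assign nat aexp
  | Store nat aexp aexp
  | Flip nat
  | Seq com com
  | If aexp com com
  | While aexp com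

record state =
  regs :: "nat \<Rightarrow> nat"
  arrs :: "nat \<Rightarrow> nat \<Rightarrow> nat"
  coins :: "bool stream"

text \<open>Subtraction is truncated, and division by zero yields zero.\<close>

fun binop_val :: "binop \<Rightarrow> nat \<Rightarrow> nat \<Rightarrow> nat" where
  "binop_val Add a b = a + b"
| "binop_val Sub a b = a - b"
| "binop_val Mul a b = a * b"
| "binop_val Div a b = a div b"
| "binop_val Less a b = of_bool (a < b)"
| "binop_val Equal a b = of_bool (a = b)"

fun aval :: "aexp \<Rightarrow> state \<Rightarrow> nat" where
  "aval (Const k) s = k"
| "aval (Reg r) s = regs s r"
| "aval (Arr a e) s = arrs s a (aval e s)"
| "aval (Bin f e1 e2) s = binop_val f (aval e1 s) (aval e2 s)"

text \<open>\<open>floorlog 2 k\<close> is the bit length of \<open>k\<close>. Every node of an expression is charged for its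
  value, so operands and array indices are charged as well.\<close>

definition val_cost :: "nat \<Rightarrow> nat" where
  "val_cost k = 1 + floorlog 2 k"

fun acost :: "aexp \<Rightarrow> state \<Rightarrow> nat" where
  "acost (Const k) s = val_cost k"
| "acost (Reg r) s = val_cost (regs s r)"
| "acost (Arr a e) s = acost e s + val_cost (aval (Arr a e) s)"
| "acost (Bin f e1 e2) s = acost e1 s + acost e2 s + val_cost (aval (Bin f e1 e2) s)"

definition set_reg :: "nat \<Rightarrow> nat \<Rightarrow> state \<Rightarrow> state" where
  "set_reg r k s = s\<lparr>regs := (regs s)(r := k)\<rparr>"

definition set_arr :: "nat \<Rightarrow> nat \<Rightarrow> nat \<Rightarrow> state \<Rightarrow> state" where
  "set_arr a i k s = s\<lparr>arrs := (arrs s)(a := (arrs s a)(i := k))\<rparr>"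

text \<open>\<open>exec p s T s'\<close>: started in state \<open>s\<close>, program \<open>p\<close> halts in state \<open>s'\<close> after time \<open>T\<close>.
  Conditions are false if and only if they evaluate to zero.\<close>

inductive exec :: "com \<Rightarrow> state \<Rightarrow> nat \<Rightarrow> state \<Rightarrow> bool" where
  Skip: "exec Skip s 1 s"
| Assign: "exec (Assign r e) s (1 + acost e s) (set_reg r (aval e s) s)"
| Store: "exec (Store a e1 e2) s (1 + acost e1 s + acost e2 s)
            (set_arr a (aval e1 s) (aval e2 s) s)"
| Flip: "exec (Flip r) s 1 (set_reg r (of_bool (shd (coins s))) (s\<lparr>coins := stl (coins s)\<rparr>))"
| Seq: "exec p s T s' \<Longrightarrow> exec q s' T' s'' \<Longrightarrow> exec (Seq p q) s (T + T') s''"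
| IfTrue: "aval e s \<noteq> 0 \<Longrightarrow> exec p s T s' \<Longrightarrow> exec (If e p q) s (1 + acost e s + T) s'"
| IfFalse: "aval e s = 0 \<Longrightarrow> exec q s T s' \<Longrightarrow> exec (If e p q) s (1 + acost e s + T) s'"
| WhileFalse: "aval e s = 0 \<Longrightarrow> exec (While e p) s (1 + acost e s) s"
| WhileTrue: "aval e s \<noteq> 0 \<Longrightarrow> exec p s T s' \<Longrightarrow> exec (While e p) s' T' s'' \<Longrightarrow>
    exec (While e p) s (1 + acost e s + T + T') s''"

inductive_cases exec_elims:
  "exec Skip s T s'" "exec (Assign r e) s T s'" "exec (Store a e1 e2) s T s'"
  "exec (Flip r) s T s'" "exec (Seq p q) s T s'" "exec (If e p q) s T s'"
  "exec (While e p) s T s'"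

lemma exec_deterministic:
  "exec p s T s' \<Longrightarrow> exec p s T2 s2 \<Longrightarrow> T = T2 \<and> s' = s2"
proof (induction arbitrary: T2 s2 rule: exec.induct)
  case (Seq p s T s' q T' s'')
  from Seq.prems obtain T3 s3 T4 where "exec p s T3 s3" "exec q s3 T4 s2" "T2 = T3 + T4"
    by (rule exec_elims)
  with Seq.IH show ?case by metis
next
  case (IfTrue e s p T s' q)
  from IfTrue.prems IfTrue.hyps obtain T3 where "exec p s T3 s2" "T2 = 1 + acost e s + T3"
    by (auto elim: exec_elims(6))
  with IfTrue.IH show ?case by metis
next
  case (IfFalse e s q T s' p)
  from IfFalse.prems IfFalse.hyps obtain T3 where "exec q s T3 s2" "T2 = 1 + acost e s + T3"
    by (auto elim: exec_elims(6))
  with IfFalse.IH show ?case by metis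
next
  case (WhileFalse e s p)
  from WhileFalse.prems WhileFalse.hyps show ?case by (auto elim: exec_elims(7))
next
  case (WhileTrue e s p T s' T' s'')
  from WhileTrue.prems WhileTrue.hyps obtain T3 s3 T4 where
    "exec p s T3 s3" "exec (While e p) s3 T4 s2" "T2 = 1 + acost e s + T3 + T4"
    by (cases rule: exec_elims(7)) auto
  with WhileTrue.IH show ?case by metis
qed (auto elim: exec_elims(1,2,3,4))

fun deterministic :: "com \<Rightarrow> bool" where
  "deterministic (Flip r) \<longleftrightarrow> False"
| "deterministic (Seq p q) \<longleftrightarrow> deterministic p \<and> deterministic q"
| "deterministic (If e p q) \<longleftrightarrow> deterministic p \<and> deterministic q"
| "deterministic (While e p) \<longleftrightarrow> deterministic p"
| "deterministic _ \<longleftrightarrow> True"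

definition coin_space :: "bool stream measure" where
  "coin_space = stream_space (measure_pmf (bernoulli_pmf (1/2)))"


section \<open>Listing triangles\<close>

text \<open>Initially, the numbers \<open>xs\<close> are in registers \<open>0, 1, ...\<close> and edge number \<open>i\<close> is in cells
  \<open>2i\<close> and \<open>2i + 1\<close> of array \<open>0\<close>. All other memory is zero.\<close>

definition init :: "nat list \<Rightarrow> (nat \<times> nat) list \<Rightarrow> bool stream \<Rightarrow> state" where
  "init xs es \<omega> =
     \<lparr>regs = (\<lambda>r. if r < length xs then xs ! r else 0),
      arrs = (\<lambda>a i. if a = 0 \<and> i < 2 * length es
                    then (if even i then fst (es ! (i div 2)) else snd (es ! (i div 2))) else 0),
      coins = \<omega>\<rparr>"

text \<open>The number of listed triangles is returned in register \<open>0\<close>, and the vertices of triangle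
  number \<open>i\<close> in cells \<open>3i\<close>, \<open>3i + 1\<close> and \<open>3i + 2\<close> of array \<open>1\<close>.\<close>

definition listed :: "state \<Rightarrow> nat set list" where
  "listed s = map (\<lambda>i. {arrs s 1 (3 * i), arrs s 1 (3 * i + 1), arrs s 1 (3 * i + 2)})
                [0..<regs s 0]"

text \<open>Up to \<open>k\<close> triangles, all of them if there are fewer than \<open>k\<close>, without repetitions.\<close>

definition lists_up_to :: "nat \<Rightarrow> nat set set \<Rightarrow> nat set list \<Rightarrow> bool" where
  "lists_up_to k E Ts \<longleftrightarrow>
     distinct Ts \<and> set Ts \<subseteq> triangles E \<and> length Ts = min k (card (triangles E))"

definition halts_within :: "com \<Rightarrow> nat list \<Rightarrow> (nat \<times> nat) list \<Rightarrow> real \<Rightarrow> bool" where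
  "halts_within p xs es B \<longleftrightarrow> (\<forall>\<omega>. \<exists>T s. exec p (init xs es \<omega>) T s \<and> real T \<le> B)"

definition lists_correctly ::
  "com \<Rightarrow> nat list \<Rightarrow> (nat \<times> nat) list \<Rightarrow> nat \<Rightarrow> nat set set \<Rightarrow> bool stream \<Rightarrow> bool" where
  "lists_correctly p xs es k E \<omega> \<longleftrightarrow>
     (\<exists>T s. exec p (init xs es \<omega>) T s \<and> lists_up_to k E (listed s))"

text \<open>
  Besides the edges, the inputs are the number of vertices and
  the number of edges, and for the second notion also the number \<open>t\<close> of triangles requested.
  The empty graph is left out, so that \<open>log 2 (m + 1) \<ge> 1\<close> in the soft-O bounds and hence
  these need no separate treatment of small inputs.
\<close>

definition lists_m_triangles :: "com \<Rightarrow> (nat \<Rightarrow> real) \<Rightarrow> bool" where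
  "lists_m_triangles p B \<longleftrightarrow>
     (\<forall>n E es. graph n E \<and> E \<noteq> {} \<and> edge_list E es \<longrightarrow>
        (let m = card E in
           halts_within p [n, m] es (B m) \<and>
           (\<forall>\<omega>. lists_correctly p [n, m] es m E \<omega>)))"

text \<open>A Monte Carlo algorithm obeys its time bound for all outcomes of the coins, and is correct
  with probability at least \<open>2/3\<close> on every input. The set \<open>D\<close> consists of the pairs \<open>(m, t)\<close> for
  which this is demanded.\<close>

definition monte_carlo_lists_triangles ::
  "com \<Rightarrow> (nat \<times> nat) set \<Rightarrow> (nat \<Rightarrow> nat \<Rightarrow> real) \<Rightarrow> bool" where
  "monte_carlo_lists_triangles p D B \<longleftrightarrow>
     (\<forall>n E es t. graph n E \<and> E \<noteq> {} \<and> edge_list E es \<and> (card E, t) \<in> D \<longrightarrow>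
        (let m = card E in
           halts_within p [n, m, t] es (B m t) \<and>
           measure coin_space {\<omega> \<in> space coin_space. lists_correctly p [n, m, t] es t E \<omega>}
             \<ge> 2 / 3))"

end

theory Submission
  imports Defs
begin

text \<open>
  Three copies of the graph give a tripartite graph with three times as many edges and the same triangles. A
  depth-first search splits it recursively: in turn, the vertices of one of the three classes are distributed over
  two parts of about half the degree sum (apart from few vertices of high degree, which get parts of
  their own), so that every three levels multiply the number of subproblems by about eight and divide
  their sizes by about four. If \<open>c \<le> 3/2\<close>, then the given algorithm is run on each subproblem, and
  only if it finds as many triangles as there are edges the subproblem is split. Hence the total size of
  the subproblems split on one level is bounded both by about \<open>t\<close>, the number of triangles needed, and by the
  number of subproblems times their size. These bounds agree at size \<open>m\<^sup>3 / t\<^sup>2\<close>, where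
  the total cost is \<open>t * (m\<^sup>3 / t\<^sup>2) powr (c - 1)\<close>. If \<open>c > 3/2\<close>, then splitting down to
  single vertices takes time about \<open>m powr (3/2)\<close>, which suffices. Running the given
  algorithm on complete graphs shows that \<open>c < 1\<close> is impossible.
\<close>

section \<open>Counting steps instead of bits\<close>

text \<open>Each level distributes the vertices of a single class because this partitions the
  triangles: every triangle has exactly one vertex in the class, while edges avoiding the class are
  copied to every part. The distribution is greedy rather than random, and no coin is flipped at
  all. Its imbalance compounds over the L levels, where L is logarithmic in m. A relative error of
  1/L per level keeps the total distortion below a constant factor; the price is that vertices of
  degree above length / (36 * L^2) are heavy, which makes O(L^2) parts per split. A heavy vertex
  alone in its class leaves fewer triangles than edges, so only the two balanced parts are ever
  split again.

  The other obstacle is the logarithmic cost. The program uses additive assignments only, so its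
  numbers stay polynomial in t during polynomially many steps and all have logarithmic length. The
  given algorithm need not be of this form. Its own time is charged instead, up to a polylogarithmic
  slowdown, and each call works in memory never written before, because the cells touched by earlier
  calls are unknown to the caller.\<close>

lemma val_cost_mono: "a \<le> b \<Longrightarrow> val_cost a \<le> val_cost b"
  by (simp add: val_cost_def floorlog_mono)

lemma val_cost_ge_1: "1 \<le> val_cost a"
  by (simp add: val_cost_def)

lemma less_power_floorlog: "a < 2 ^ floorlog 2 a"
  using floorlog_leD[of 2 a "floorlog 2 a"] by simp

text \<open>A sum is less than (1 + a) * (1 + b), and these factors are at most the powers of two
  given by the two bit lengths.\<close>

lemma val_cost_add: "val_cost (a + b) \<le> val_cost a + val_cost b"
proof -
  let ?x = "floorlog 2 a" and ?y = "floorlog 2 b"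
  have "(1 + a) * (1 + b) \<le> 2 ^ ?x * 2 ^ ?y"
    using less_power_floorlog[of a] less_power_floorlog[of b] by (intro mult_mono) auto
  moreover have "a + b < (1 + a) * (1 + b)" by (simp add: algebra_simps)
  ultimately have "a + b < 2 ^ (?x + ?y)" unfolding power_add by linarith
  then show ?thesis by (simp add: val_cost_def floorlog_le_iff)
qed

lemma val_cost_mult: "val_cost (a * b) \<le> val_cost a + val_cost b"
proof -
  have "a * b < 2 ^ floorlog 2 a * 2 ^ floorlog 2 b"
    using less_power_floorlog[of a] less_power_floorlog[of b] by (intro mult_strict_mono) auto
  then show ?thesis by (simp add: val_cost_def floorlog_le_iff power_add)
qed

lemma val_cost_of_bool: "val_cost (of_bool P) \<le> 2"
  by (auto simp: val_cost_def floorlog_le_iff)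

fun main_exp :: "aexp \<Rightarrow> bool" where
  "main_exp (Const k) \<longleftrightarrow> True"
| "main_exp (Reg r) \<longleftrightarrow> r < 40"
| "main_exp (Arr a e) \<longleftrightarrow> a < 20 \<and> main_exp e"
| "main_exp (Bin f e1 e2) \<longleftrightarrow> main_exp e1 \<and> main_exp e2"

text \<open>The value of an additive expression exceeds the largest number in memory by at most a
  constant, so that memory grows only linearly with the number of assignments.\<close>

fun additive :: "aexp \<Rightarrow> bool" where
  "additive (Bin Add e1 e2) \<longleftrightarrow> additive e1 \<and> (\<exists>k. e2 = Const k)"
| "additive (Bin Mul e1 e2) \<longleftrightarrow> False"
| "additive (Bin Sub e1 e2) \<longleftrightarrow> additive e1"
| "additive (Bin Div e1 e2) \<longleftrightarrow> additive e1"
| "additive _ \<longleftrightarrow> True"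

fun incr :: "aexp \<Rightarrow> nat" where
  "incr (Const k) = k"
| "incr (Reg r) = 0"
| "incr (Arr a e) = 0"
| "incr (Bin Less e1 e2) = 1"
| "incr (Bin Equal e1 e2) = 1"
| "incr (Bin Add e1 e2) = incr e1 + incr e2"
| "incr (Bin Sub e1 e2) = incr e1"
| "incr (Bin Div e1 e2) = incr e1"
| "incr (Bin Mul e1 e2) = 0"

text \<open>The factor by which the bit length of the value may exceed that of a bound on memory.
  Truncated subtraction and division do not exceed their first operand, and comparisons yield a
  single bit. Summing over all nodes of an expression gives \<open>eweight\<close>, the
  corresponding factor for its cost.\<close>

fun vweight :: "aexp \<Rightarrow> nat" where
  "vweight (Const k) = val_cost k"
| "vweight (Reg r) = 1"
| "vweight (Arr a e) = 1"
| "vweight (Bin Add e1 e2) = vweight e1 + vweight e2"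
| "vweight (Bin Mul e1 e2) = vweight e1 + vweight e2"
| "vweight (Bin Sub e1 e2) = vweight e1"
| "vweight (Bin Div e1 e2) = vweight e1"
| "vweight (Bin f e1 e2) = 2"

fun eweight :: "aexp \<Rightarrow> nat" where
  "eweight (Const k) = val_cost k"
| "eweight (Reg r) = 1"
| "eweight (Arr a e) = eweight e + 1"
| "eweight (Bin f e1 e2) = eweight e1 + eweight e2 + vweight (Bin f e1 e2)"

fun cweight :: "com \<Rightarrow> nat" where
  "cweight (Assign r e) = 1 + eweight e"
| "cweight (Store a e1 e2) = 1 + eweight e1 + eweight e2"
| "cweight (Seq p q) = max (cweight p) (cweight q)"
| "cweight (If e p q) = max (1 + eweight e) (max (cweight p) (cweight q))"
| "cweight (While e p) = max (1 + eweight e) (cweight p)"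
| "cweight _ = 1"

fun cincr :: "com \<Rightarrow> nat" where
  "cincr (Assign r e) = incr e"
| "cincr (Store a e1 e2) = incr e2"
| "cincr (Seq p q) = max (cincr p) (cincr q)"
| "cincr (If e p q) = max (cincr p) (cincr q)"
| "cincr (While e p) = cincr p"
| "cincr _ = 0"

text \<open>Only registers below 40 and arrays below 20 belong to the program proper; the others are
  the memory of its subroutine.\<close>

definition bounded_mem :: "nat \<Rightarrow> state \<Rightarrow> bool" where
  "bounded_mem B s \<longleftrightarrow> (\<forall>r<40. regs s r \<le> B) \<and> (\<forall>a<20. \<forall>i. arrs s a i \<le> B)"

lemma val_cost_aval:
  "main_exp e \<Longrightarrow> bounded_mem B s \<Longrightarrow> val_cost (aval e s) \<le> vweight e * val_cost B"
proof (induction e)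
  case (Const k)
  then show ?case using val_cost_ge_1[of B] by simp
next
  case (Bin f e1 e2)
  then have IH: "val_cost (aval e1 s) \<le> vweight e1 * val_cost B"
    "val_cost (aval e2 s) \<le> vweight e2 * val_cost B" by auto
  have two: "val_cost (of_bool P) \<le> 2 * val_cost B" for P
    using val_cost_of_bool[of P] val_cost_ge_1[of B] by linarith
  show ?case
  proof (cases f)
    case Sub
    then show ?thesis using IH val_cost_mono[of "aval e1 s - aval e2 s" "aval e1 s"] by simp
  next
    case Div
    then show ?thesis using IH val_cost_mono[of "aval e1 s div aval e2 s" "aval e1 s"] by simp
  next
    case Add
    then show ?thesis using IH val_cost_add[of "aval e1 s" "aval e2 s"]
      by (simp add: add_mult_distrib)
  next
    case Mul
    then show ?thesis using IH val_cost_mult[of "aval e1 s" "aval e2 s"]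
      by (simp add: add_mult_distrib)
  qed (use two in simp_all)
qed (auto simp: bounded_mem_def intro: val_cost_mono)

lemma acost_le:
  "main_exp e \<Longrightarrow> bounded_mem B s \<Longrightarrow> acost e s \<le> eweight e * val_cost B"
proof (induction e)
  case (Const k)
  then show ?case using val_cost_ge_1[of B] by simp
next
  case (Reg r)
  then show ?case by (auto simp: bounded_mem_def intro: val_cost_mono)
next
  case (Arr a e)
  then show ?case using val_cost_aval[OF Arr.prems] by (simp add: add_mult_distrib)
next
  case (Bin f e1 e2)
  then show ?case using val_cost_aval[OF Bin.prems] by (simp add: add_mult_distrib)
qed

lemma aval_additive:
  "main_exp e \<Longrightarrow> additive e \<Longrightarrow> bounded_mem B s \<Longrightarrow> aval e s \<le> B + incr e"
proof (induction e rule: additive.induct)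
  case (3 e1 e2)
  then show ?case by (auto intro: order_trans[OF diff_le_self])
next
  case (4 e1 e2)
  then show ?case by (auto intro: order_trans[OF div_le_dividend])
qed (auto simp: bounded_mem_def)

text \<open>\<open>steps c s k u s'\<close>: a run of \<open>k\<close> elementary steps on numbers of bounded size, apart from
  parts of total time \<open>u\<close>.\<close>

inductive steps :: "com \<Rightarrow> state \<Rightarrow> nat \<Rightarrow> nat \<Rightarrow> state \<Rightarrow> bool" where
  Skip: "steps Skip s 1 0 s"
| Assign: "main_exp e \<Longrightarrow> additive e \<Longrightarrow> steps (Assign r e) s 1 0 (set_reg r (aval e s) s)"
| Store: "main_exp e1 \<Longrightarrow> main_exp e2 \<Longrightarrow> additive e2 \<Longrightarrow>
    steps (Store a e1 e2) s 1 0 (set_arr a (aval e1 s) (aval e2 s) s)"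
| Seq: "steps p s k u s' \<Longrightarrow> steps q s' k' u' s'' \<Longrightarrow> steps (Seq p q) s (k + k') (u + u') s''"
| IfTrue: "main_exp e \<Longrightarrow> aval e s \<noteq> 0 \<Longrightarrow> steps p s k u s' \<Longrightarrow> steps (If e p q) s (1 + k) u s'"
| IfFalse: "main_exp e \<Longrightarrow> aval e s = 0 \<Longrightarrow> steps q s k u s' \<Longrightarrow> steps (If e p q) s (1 + k) u s'"
| WhileFalse: "main_exp e \<Longrightarrow> aval e s = 0 \<Longrightarrow> steps (While e p) s 1 0 s"
| WhileTrue: "main_exp e \<Longrightarrow> aval e s \<noteq> 0 \<Longrightarrow> steps p s k u s' \<Longrightarrow>
    steps (While e p) s' k' u' s'' \<Longrightarrow> steps (While e p) s (1 + k + k') (u + u') s''"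
| Ext: "exec p s T s' \<Longrightarrow> (\<And>B. bounded_mem B s \<Longrightarrow> bounded_mem B s') \<Longrightarrow> steps p s 0 T s'"

lemma bounded_mem_set_reg: "bounded_mem B s \<Longrightarrow> v \<le> B' \<Longrightarrow> B \<le> B' \<Longrightarrow> bounded_mem B' (set_reg r v s)"
  unfolding bounded_mem_def set_reg_def by (auto intro: order_trans)

lemma bounded_mem_set_arr: "bounded_mem B s \<Longrightarrow> v \<le> B' \<Longrightarrow> B \<le> B' \<Longrightarrow> bounded_mem B' (set_arr a i v s)"
  unfolding bounded_mem_def set_arr_def by (auto intro: order_trans)

lemma bounded_mem_mono: "bounded_mem B s \<Longrightarrow> B \<le> B' \<Longrightarrow> bounded_mem B' s"
  unfolding bounded_mem_def by (blast intro: order_trans)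

lemma test_cost:
  assumes "main_exp e" "bounded_mem B s" "B \<le> M" "1 + eweight e \<le> w"
  shows "1 + acost e s \<le> w * val_cost M"
proof -
  have "acost e s \<le> eweight e * val_cost B" using assms by (intro acost_le) auto
  also have "\<dots> \<le> eweight e * val_cost M" using assms by (intro mult_left_mono val_cost_mono) auto
  finally have "1 + acost e s \<le> (1 + eweight e) * val_cost M"
    using val_cost_ge_1[of M] by (simp add: algebra_simps)
  also have "\<dots> \<le> w * val_cost M" using assms by (intro mult_right_mono) auto
  finally show ?thesis .
qed

text \<open>After j steps memory is bounded by B + g * j, since an additive assignment exceeds the
  largest number in memory by at most g. Hence no number in main memory ever exceeds M, and each of
  the k steps costs at most w times the bit length of M. External parts contribute their own time
  and do not raise the bound.\<close>

lemma steps_exec: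
  assumes "steps c s k u s'" "bounded_mem B s" "B + g * k \<le> M" "cincr c \<le> g" "cweight c \<le> w"
  shows "bounded_mem (B + g * k) s' \<and> (\<exists>T. exec c s T s' \<and> T \<le> k * (w * val_cost M) + u)"
  using assms
proof (induction arbitrary: B rule: steps.induct)
  case (Skip s)
  have "w * val_cost M \<ge> 1" using Skip val_cost_ge_1[of M] by (simp add: Suc_le_eq)
  moreover have "bounded_mem (B + g * 1) s" using Skip.prems(1) by (rule bounded_mem_mono) simp
  ultimately show ?case by (intro conjI exI[of _ 1] exec.Skip) auto
next
  case (Assign e r s)
  have "1 + acost e s \<le> w * val_cost M" using Assign by (intro test_cost[of e B]) auto
  moreover have "bounded_mem (B + g * 1) (set_reg r (aval e s) s)"
    by (rule bounded_mem_set_reg[of B s]) (use Assign aval_additive[of e B s] in auto)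
  ultimately show ?case by (intro conjI exI[of _ "1 + acost e s"] exec.Assign) auto
next
  case (Store e1 e2 a s)
  have "acost e1 s + acost e2 s \<le> eweight e1 * val_cost B + eweight e2 * val_cost B"
    using Store by (intro add_mono acost_le) auto
  also have "\<dots> \<le> eweight e1 * val_cost M + eweight e2 * val_cost M"
    using Store by (intro add_mono mult_left_mono val_cost_mono) auto
  finally have "1 + acost e1 s + acost e2 s \<le> (1 + eweight e1 + eweight e2) * val_cost M"
    using val_cost_ge_1[of M] by (simp add: algebra_simps)
  also have "\<dots> \<le> w * val_cost M" using Store by (intro mult_right_mono) auto
  finally have "1 + acost e1 s + acost e2 s \<le> w * val_cost M" .
  moreover have "bounded_mem (B + g * 1) (set_arr a (aval e1 s) (aval e2 s) s)"
    by (rule bounded_mem_set_arr[of B s]) (use Store aval_additive[of e2 B s] in auto)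
  ultimately show ?case by (intro conjI exI[of _ "1 + acost e1 s + acost e2 s"] exec.Store) auto
next
  case (Seq p s k u s' q k' u' s'')
  have 1: "bounded_mem (B + g * k) s' \<and> (\<exists>T. exec p s T s' \<and> T \<le> k * (w * val_cost M) + u)"
    using Seq.prems by (intro Seq.IH) (auto simp: algebra_simps)
  have 2: "bounded_mem (B + g * k + g * k') s'' \<and>
      (\<exists>T. exec q s' T s'' \<and> T \<le> k' * (w * val_cost M) + u')"
    using Seq.prems 1 by (intro Seq.IH) (auto simp: algebra_simps)
  from 1 2 obtain T T' where "exec p s T s'" "T \<le> k * (w * val_cost M) + u"
    "exec q s' T' s''" "T' \<le> k' * (w * val_cost M) + u'" by blast
  then show ?case using 2
    by (intro conjI exI[of _ "T + T'"] exec.Seq[of p s T s']) (auto simp: algebra_simps)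
next
  case (IfTrue e s p k u s' q)
  have 1: "bounded_mem (B + g * k) s' \<and> (\<exists>T. exec p s T s' \<and> T \<le> k * (w * val_cost M) + u)"
    using IfTrue.prems by (intro IfTrue.IH) (auto simp: algebra_simps)
  then obtain T where T: "exec p s T s'" "T \<le> k * (w * val_cost M) + u" by blast
  have "1 + acost e s \<le> w * val_cost M" using IfTrue by (intro test_cost[of e B]) auto
  moreover have "bounded_mem (B + g * (1 + k)) s'"
    using 1 by (auto elim!: bounded_mem_mono)
  ultimately show ?case using T
    by (intro conjI exI[of _ "1 + acost e s + T"] exec.IfTrue[OF IfTrue.hyps(2)]) (auto simp: algebra_simps)
next
  case (IfFalse e s q k u s' p)
  have 1: "bounded_mem (B + g * k) s' \<and> (\<exists>T. exec q s T s' \<and> T \<le> k * (w * val_cost M) + u)"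
    using IfFalse.prems by (intro IfFalse.IH) (auto simp: algebra_simps)
  then obtain T where T: "exec q s T s'" "T \<le> k * (w * val_cost M) + u" by blast
  have "1 + acost e s \<le> w * val_cost M" using IfFalse by (intro test_cost[of e B]) auto
  moreover have "bounded_mem (B + g * (1 + k)) s'"
    using 1 by (auto elim!: bounded_mem_mono)
  ultimately show ?case using T
    by (intro conjI exI[of _ "1 + acost e s + T"] exec.IfFalse[OF IfFalse.hyps(2)]) (auto simp: algebra_simps)
next
  case (WhileFalse e s p)
  have "1 + acost e s \<le> w * val_cost M" using WhileFalse by (intro test_cost[of e B]) auto
  moreover have "bounded_mem (B + g * 1) s" using WhileFalse.prems(1) by (rule bounded_mem_mono) simp
  ultimately show ?case
    by (intro conjI exI[of _ "1 + acost e s"] exec.WhileFalse[OF WhileFalse.hyps(2)]) auto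
next
  case (WhileTrue e s p k u s' k' u' s'')
  have 1: "bounded_mem (B + g * k) s' \<and> (\<exists>T. exec p s T s' \<and> T \<le> k * (w * val_cost M) + u)"
    using WhileTrue.prems by (intro WhileTrue.IH) (auto simp: algebra_simps)
  have 2: "bounded_mem (B + g * k + g * k') s'' \<and>
      (\<exists>T. exec (While e p) s' T s'' \<and> T \<le> k' * (w * val_cost M) + u')"
    using WhileTrue.prems 1 by (intro WhileTrue.IH) (auto simp: algebra_simps)
  from 1 2 obtain T T' where T: "exec p s T s'" "T \<le> k * (w * val_cost M) + u"
    "exec (While e p) s' T' s''" "T' \<le> k' * (w * val_cost M) + u'" by blast
  have "1 + acost e s \<le> w * val_cost M" using WhileTrue by (intro test_cost[of e B]) auto
  moreover have "bounded_mem (B + g * (1 + k + k')) s''"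
    using 2 by (auto elim!: bounded_mem_mono simp: algebra_simps)
  ultimately show ?case using T
    by (intro conjI exI[of _ "1 + acost e s + T + T'"] exec.WhileTrue[OF WhileTrue.hyps(2)])
      (auto simp: algebra_simps)
next
  case (Ext p s T s')
  have "bounded_mem (B + g * 0) s'" using Ext by simp
  then show ?case using Ext.hyps(1) by (intro conjI exI[of _ T]) auto
qed

text \<open>A total correctness triple: k bounds the elementary steps, u the time of external parts.
  Sequences are verified backwards, the postcondition of one command being the \<open>reach\<close>
  statement of the next.\<close>

definition reach :: "com \<Rightarrow> state \<Rightarrow> real \<Rightarrow> real \<Rightarrow> (state \<Rightarrow> bool) \<Rightarrow> bool" where
  "reach c s k u Q \<longleftrightarrow> (\<exists>k' u' s'. steps c s k' u' s' \<and> real k' \<le> k \<and> real u' \<le> u \<and> Q s')"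

lemma reach_mono:
  "reach c s k u Q \<Longrightarrow> k \<le> k' \<Longrightarrow> u \<le> u' \<Longrightarrow> (\<And>s'. Q s' \<Longrightarrow> Q' s') \<Longrightarrow> reach c s k' u' Q'"
  unfolding reach_def by (meson order_trans)

lemma reach_Seq:
  assumes "reach p s k u (\<lambda>s'. reach q s' k' u' Q)"
  shows "reach (Seq p q) s (k + k') (u + u') Q"
  using assms unfolding reach_def by (force intro: steps.Seq)

lemma reach_If:
  assumes "main_exp e" "aval e s \<noteq> 0 \<Longrightarrow> reach p s k u Q" "aval e s = 0 \<Longrightarrow> reach q s k u Q"
  shows "reach (If e p q) s (1 + k) u Q"
proof (cases "aval e s = 0")
  case True
  with assms(3) obtain k' u' s' where "steps q s k' u' s'" "real k' \<le> k" "real u' \<le> u" "Q s'"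
    unfolding reach_def by blast
  with steps.IfFalse[OF assms(1) True this(1), of p] show ?thesis
    unfolding reach_def by (intro exI[of _ "1 + k'"] exI[of _ u'] exI[of _ s']) auto
next
  case False
  with assms(2) obtain k' u' s' where "steps p s k' u' s'" "real k' \<le> k" "real u' \<le> u" "Q s'"
    unfolding reach_def by blast
  with steps.IfTrue[OF assms(1) False this(1), of q] show ?thesis
    unfolding reach_def by (intro exI[of _ "1 + k'"] exI[of _ u'] exI[of _ s']) auto
qed

text \<open>Loop-free code, whose effect \<open>sval\<close> is computed by rewriting. The count
  \<open>csize\<close> charges both branches of a conditional and is therefore only an upper bound
  on the steps.\<close>

fun straight :: "com \<Rightarrow> bool" where
  "straight Skip \<longleftrightarrow> True"
| "straight (Assign r e) \<longleftrightarrow> main_exp e \<and> additive e"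
| "straight (Store a e1 e2) \<longleftrightarrow> main_exp e1 \<and> main_exp e2 \<and> additive e2"
| "straight (Seq p q) \<longleftrightarrow> straight p \<and> straight q"
| "straight (If e p q) \<longleftrightarrow> main_exp e \<and> straight p \<and> straight q"
| "straight _ \<longleftrightarrow> False"

fun sval :: "com \<Rightarrow> state \<Rightarrow> state" where
  "sval (Assign r e) s = set_reg r (aval e s) s"
| "sval (Store a e1 e2) s = set_arr a (aval e1 s) (aval e2 s) s"
| "sval (Seq p q) s = sval q (sval p s)"
| "sval (If e p q) s = (if aval e s = 0 then sval q s else sval p s)"
| "sval _ s = s"

fun csize :: "com \<Rightarrow> nat" where
  "csize (Seq p q) = csize p + csize q"
| "csize (If e p q) = 1 + csize p + csize q"
| "csize _ = 1"

lemma reach_straight: "straight c \<Longrightarrow> Q (sval c s) \<Longrightarrow> reach c s (csize c) 0 Q"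
proof (induction c arbitrary: s Q)
  case (Seq p q)
  then have "reach p s (csize p) 0 (\<lambda>s'. reach q s' (csize q) 0 Q)" by simp
  from reach_Seq[OF this] show ?case by simp
next
  case (If e p q)
  have "aval e s \<noteq> 0 \<Longrightarrow> reach p s (real (csize p) + real (csize q)) 0 Q"
    "aval e s = 0 \<Longrightarrow> reach q s (real (csize p) + real (csize q)) 0 Q"
    using If by (auto intro: reach_mono[of p s "csize p" 0 Q] reach_mono[of q s "csize q" 0 Q])
  with If.prems reach_If[of e s p "real (csize p) + real (csize q)" 0 Q q] show ?case
    by (simp add: add.assoc)
next
  case Skip
  then show ?case unfolding reach_def by (auto intro!: exI steps.Skip)
next
  case (Assign r e)
  then show ?case unfolding reach_def by (auto intro!: exI steps.Assign)
next
  case (Store a e1 e2)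
  then show ?case unfolding reach_def by (auto intro!: exI steps.Store)
qed auto

section \<open>Rules for loops\<close>

lemma reach_While_False:
  "main_exp e \<Longrightarrow> aval e s = 0 \<Longrightarrow> Q s \<Longrightarrow> reach (While e b) s 1 0 Q"
  unfolding reach_def by (auto intro!: exI steps.WhileFalse)

lemma reach_While_True:
  assumes "main_exp e" "aval e s \<noteq> 0" "reach b s k u (\<lambda>s'. reach (While e b) s' k' u' Q)"
  shows "reach (While e b) s (1 + k + k') (u + u') Q"
proof -
  from assms(3) obtain k1 u1 s1 k2 u2 s2 where "steps b s k1 u1 s1" "real k1 \<le> k" "real u1 \<le> u"
    "steps (While e b) s1 k2 u2 s2" "real k2 \<le> k'" "real u2 \<le> u'" "Q s2"
    unfolding reach_def by blast
  with steps.WhileTrue[OF assms(1,2) this(1,4)] show ?thesis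
    unfolding reach_def by (intro exI[of _ "1 + k1 + k2"] exI[of _ "u1 + u2"] exI[of _ s2]) auto
qed

lemma reach_While:
  assumes "main_exp e" "P 0 s" "0 \<le> u"
    and "\<And>i s. i < N \<Longrightarrow> P i s \<Longrightarrow> aval e s \<noteq> 0 \<and> reach b s k u (P (Suc i))"
    and "\<And>s. P N s \<Longrightarrow> aval e s = 0 \<and> Q s"
  shows "reach (While e b) s (real N * (1 + k) + 1) (real N * u) Q"
proof -
  \<comment> \<open>Here d is the number of iterations still to come, so the invariant is entered at
    index N - d.\<close>
  have "reach (While e b) s (real d * (1 + k) + 1) (real d * u) Q" if "d \<le> N" "P (N - d) s" for d s
    using that
  proof (induction d arbitrary: s)
    case 0
    then show ?case using assms by (auto intro: reach_While_False)
  next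
    case (Suc d)
    have eq: "Suc (N - Suc d) = N - d" using Suc.prems by simp
    have "aval e s \<noteq> 0 \<and> reach b s k u (P (Suc (N - Suc d)))"
      using Suc.prems by (intro assms(4)) auto
    then have "aval e s \<noteq> 0" and "reach b s k u (\<lambda>s'. reach (While e b) s' (real d * (1 + k) + 1) (real d * u) Q)"
      using Suc.IH[OF Suc_leD[OF Suc.prems(1)]] eq by (auto intro: reach_mono)
    from reach_While_True[OF assms(1) this] show ?case by (simp add: algebra_simps)
  qed
  from this[of N s] assms show ?thesis by simp
qed

text \<open>Here the remaining step budgets \<open>k\<close> and \<open>u\<close> are part of the invariant.\<close>

lemma reach_While_budget:
  fixes I :: "nat \<Rightarrow> real \<Rightarrow> real \<Rightarrow> state \<Rightarrow> bool"
  assumes "main_exp e" "I n k u s"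
    and "\<And>n k u s. I n k u s \<Longrightarrow> aval e s = 0 \<Longrightarrow> 1 \<le> k \<and> 0 \<le> u \<and> Q s"
    and "\<And>n k u s. I n k u s \<Longrightarrow> aval e s \<noteq> 0 \<Longrightarrow>
      \<exists>kb ub. reach b s kb ub (\<lambda>s'. \<exists>n'<n. I n' (k - kb - 1) (u - ub) s')"
  shows "reach (While e b) s k u Q"
  using assms(2)
proof (induction n arbitrary: k u s rule: less_induct)
  case (less n)
  show ?case
  proof (cases "aval e s = 0")
    case True
    with assms(3)[OF less.prems] reach_While_False[OF assms(1) True] show ?thesis
      by (blast intro: reach_mono)
  next
    case False
    from assms(4)[OF less.prems False] obtain kb ub where
      "reach b s kb ub (\<lambda>s'. \<exists>n'<n. I n' (k - kb - 1) (u - ub) s')" by blast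
    then have "reach b s kb ub (\<lambda>s'. reach (While e b) s' (k - kb - 1) (u - ub) Q)"
      by (rule reach_mono) (use less.IH in blast)+
    from reach_While_True[OF assms(1) False this] show ?thesis by simp
  qed
qed

section \<open>Running a subroutine in fresh memory\<close>

text \<open>Cell \<open>i\<close> of an array in the call with number \<open>k\<close> is stored in cell \<open>i * K + k\<close>, where \<open>K\<close>
  exceeds the number of calls. The call number is kept in register 6.\<close>

fun rebase_exp :: "aexp \<Rightarrow> aexp \<Rightarrow> aexp" where
  "rebase_exp K (Const k) = Const k"
| "rebase_exp K (Reg r) = Reg (40 + r)"
| "rebase_exp K (Arr a e) = Arr (20 + a) (Bin Add (Bin Mul (rebase_exp K e) K) (Reg 6))"
| "rebase_exp K (Bin f e1 e2) = Bin f (rebase_exp K e1) (rebase_exp K e2)"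

fun rebase :: "aexp \<Rightarrow> com \<Rightarrow> com" where
  "rebase K (Assign r e) = Assign (40 + r) (rebase_exp K e)"
| "rebase K (Store a e1 e2) =
    Store (20 + a) (Bin Add (Bin Mul (rebase_exp K e1) K) (Reg 6)) (rebase_exp K e2)"
| "rebase K (Seq p q) = Seq (rebase K p) (rebase K q)"
| "rebase K (If e p q) = If (rebase_exp K e) (rebase K p) (rebase K q)"
| "rebase K (While e p) = While (rebase_exp K e) (rebase K p)"
| "rebase K p = Skip"

fun exp_regs :: "aexp \<Rightarrow> nat" where
  "exp_regs (Const k) = 0"
| "exp_regs (Reg r) = Suc r"
| "exp_regs (Arr a e) = exp_regs e"
| "exp_regs (Bin f e1 e2) = max (exp_regs e1) (exp_regs e2)"

fun com_regs :: "com \<Rightarrow> nat" where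
  "com_regs (Assign r e) = max (Suc r) (exp_regs e)"
| "com_regs (Store a e1 e2) = max (exp_regs e1) (exp_regs e2)"
| "com_regs (Seq p q) = max (com_regs p) (com_regs q)"
| "com_regs (If e p q) = max (exp_regs e) (max (com_regs p) (com_regs q))"
| "com_regs (While e p) = max (exp_regs e) (com_regs p)"
| "com_regs p = 0"

text \<open>The state s of the given algorithm laid out inside \<sigma>. Only the first R registers
  are compared, since a call can reset only finitely many of them, whereas all array cells of a
  fresh slice are zero from the start.\<close>

definition embedded :: "nat \<Rightarrow> nat \<Rightarrow> state \<Rightarrow> state \<Rightarrow> bool" where
  "embedded R K s \<sigma> \<longleftrightarrow> (\<forall>r<R. regs \<sigma> (40 + r) = regs s r) \<and>
     (\<forall>a i. arrs \<sigma> (20 + a) (i * K + regs \<sigma> 6) = arrs s a i)"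

definition same_main :: "state \<Rightarrow> state \<Rightarrow> bool" where
  "same_main s s' \<longleftrightarrow> (\<forall>r<40. regs s' r = regs s r) \<and> (\<forall>a<20. arrs s' a = arrs s a)"

text \<open>The other residues modulo K are the slices of other calls; those of later calls have to
  remain zero.\<close>

definition call_frame :: "nat \<Rightarrow> state \<Rightarrow> state \<Rightarrow> bool" where
  "call_frame K s s' \<longleftrightarrow> same_main s s' \<and>
     (\<forall>a i. i mod K \<noteq> regs s 6 \<longrightarrow> arrs s' a i = arrs s a i)"

lemma same_main_refl: "same_main s s"
  by (simp add: same_main_def)

lemma call_frame_refl: "call_frame K s s"
  by (simp add: call_frame_def same_main_refl)

lemma call_frame_trans: "call_frame K s s' \<Longrightarrow> call_frame K s' s'' \<Longrightarrow> call_frame K s s''"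
  by (simp add: call_frame_def same_main_def)

lemma aval_same_main: "main_exp e \<Longrightarrow> same_main s s' \<Longrightarrow> aval e s' = aval e s"
  by (induction e) (auto simp: same_main_def)

lemma acost_same_main: "main_exp e \<Longrightarrow> same_main s s' \<Longrightarrow> acost e s' = acost e s"
proof (induction e)
  case (Arr a e)
  then show ?case using aval_same_main[of "Arr a e" s s'] by simp
next
  case (Bin f e1 e2)
  then show ?case using aval_same_main[of "Bin f e1 e2" s s'] by simp
qed (auto simp: same_main_def)

lemma aval_rebase:
  assumes "embedded R (aval K \<sigma>) s \<sigma>" "exp_regs e \<le> R"
  shows "aval (rebase_exp K e) \<sigma> = aval e s"
  using assms(2) by (induction e) (use assms(1) in \<open>auto simp: embedded_def\<close>)

lemma val_cost_index:
  "k < K \<Longrightarrow> val_cost (i * K) + val_cost (i * K + k) + val_cost k \<le> 2 * val_cost i + 4 * val_cost K"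
  using val_cost_mult[of i K] val_cost_add[of "i * K" k] val_cost_mono[of k K] by linarith

text \<open>The value of an expression is charged twice more, since it may be used as an index.\<close>

lemma acost_rebase:
  assumes "embedded R (aval K \<sigma>) s \<sigma>" "regs \<sigma> 6 < aval K \<sigma>" "exp_regs e \<le> R"
    and G: "G = acost K \<sigma> + 4 * val_cost (aval K \<sigma>)"
  shows "acost (rebase_exp K e) \<sigma> + 2 * val_cost (aval e s) \<le> (G + 3) * acost e s"
  using assms(3)
proof (induction e)
  case (Arr a e)
  \<comment> \<open>G is the overhead of the index arithmetic in one array access. It is charged to
    the value v read, which costs at least 1.\<close>
  have arith: "A + 2 * v \<le> (G + 3) * (E + v)"
    if "A \<le> B + 2 * i + G + v" "B + 2 * i \<le> (G + 3) * E" "1 \<le> v" for A B E i v :: nat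
  proof -
    from that(3) obtain w where "v = Suc w" by (cases v) auto
    then show ?thesis using that(1,2) by (simp add: algebra_simps)
  qed
  have "acost (rebase_exp K e) \<sigma> + 2 * val_cost (aval e s) \<le> (G + 3) * acost e s"
    using Arr by simp
  moreover have "acost (rebase_exp K (Arr a e)) \<sigma> \<le> acost (rebase_exp K e) \<sigma> + 2 * val_cost (aval e s)
      + G + val_cost (aval (Arr a e) s)"
    using val_cost_index[OF assms(2), of "aval e s"] aval_rebase[OF assms(1), of e] Arr.prems
      aval_rebase[OF assms(1), of "Arr a e"] G by simp
  ultimately show ?case unfolding acost.simps(3) by (intro arith val_cost_ge_1)
next
  case (Bin f e1 e2)
  have "acost (rebase_exp K (Bin f e1 e2)) \<sigma> =
      acost (rebase_exp K e1) \<sigma> + acost (rebase_exp K e2) \<sigma> + val_cost (aval (Bin f e1 e2) s)"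
    using aval_rebase[OF assms(1), of "Bin f e1 e2"] Bin.prems by simp
  moreover have "acost (rebase_exp K e1) \<sigma> + 2 * val_cost (aval e1 s) \<le> (G + 3) * acost e1 s"
    "acost (rebase_exp K e2) \<sigma> + 2 * val_cost (aval e2 s) \<le> (G + 3) * acost e2 s"
    using Bin by simp_all
  ultimately show ?case by (simp add: algebra_simps)
qed (use aval_rebase[OF assms(1), of "Reg _"] assms(1) in \<open>auto simp: embedded_def algebra_simps\<close>)

lemma acost_rebase_le:
  assumes "embedded R (aval K \<sigma>) s \<sigma>" "regs \<sigma> 6 < aval K \<sigma>" "exp_regs e \<le> R"
    and "G = acost K \<sigma> + 4 * val_cost (aval K \<sigma>)"
  shows "acost (rebase_exp K e) \<sigma> \<le> (G + 3) * acost e s"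
  using acost_rebase[OF assms] by simp

lemma index_inj: "k < K \<Longrightarrow> i * K + k = j * K + k \<longleftrightarrow> i = j" for i j k K :: nat
  by auto

lemma embedded_set_reg: "embedded R K s \<sigma> \<Longrightarrow> embedded R K (set_reg r v s) (set_reg (40 + r) v \<sigma>)"
  by (auto simp: embedded_def set_reg_def)

lemma embedded_set_arr:
  "embedded R K s \<sigma> \<Longrightarrow> regs \<sigma> 6 < K \<Longrightarrow>
   embedded R K (set_arr a i v s) (set_arr (20 + a) (i * K + regs \<sigma> 6) v \<sigma>)"
  by (auto simp: embedded_def set_arr_def)

text \<open>A simulation by induction over the run. The simulated program never changes main memory,
  on which alone \<open>K\<close> depends, so \<open>K\<close> has the same value and cost at every
  access and the slowdown is a fixed factor. A coin flip has no counterpart in a slice, hence the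
  restriction to deterministic programs.\<close>

lemma exec_rebase:
  assumes "exec p s T s'" "deterministic p" "com_regs p \<le> R" "main_exp K"
    and "embedded R (aval K \<sigma>) s \<sigma>" "regs \<sigma> 6 < aval K \<sigma>"
    and "G = acost K \<sigma> + 4 * val_cost (aval K \<sigma>)"
  shows "\<exists>T' \<sigma>'. exec (rebase K p) \<sigma> T' \<sigma>' \<and> embedded R (aval K \<sigma>) s' \<sigma>' \<and>
    call_frame (aval K \<sigma>) \<sigma> \<sigma>' \<and> T' \<le> (G + 3) * T"
  using assms
proof (induction arbitrary: \<sigma> rule: exec.induct)
  case (Skip s)
  then show ?case by (intro exI[of _ 1] exI[of _ \<sigma>]) (auto simp: call_frame_refl intro: exec.Skip[simplified])
next
  case (Assign r e s)
  have v: "aval (rebase_exp K e) \<sigma> = aval e s"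
    using Assign by (intro aval_rebase) auto
  have c: "acost (rebase_exp K e) \<sigma> \<le> (G + 3) * acost e s"
    using Assign by (intro acost_rebase_le) auto
  show ?case
  proof (intro exI conjI)
    show "exec (rebase K (Assign r e)) \<sigma> (1 + acost (rebase_exp K e) \<sigma>) (set_reg (40 + r) (aval e s) \<sigma>)"
      using exec.Assign[of "40 + r" "rebase_exp K e" \<sigma>] v by simp
    show "embedded R (aval K \<sigma>) (set_reg r (aval e s) s) (set_reg (40 + r) (aval e s) \<sigma>)"
      using Assign by (intro embedded_set_reg)
    show "call_frame (aval K \<sigma>) \<sigma> (set_reg (40 + r) (aval e s) \<sigma>)"
      by (auto simp: call_frame_def same_main_def set_reg_def)
    show "1 + acost (rebase_exp K e) \<sigma> \<le> (G + 3) * (1 + acost e s)" using c by (simp add: algebra_simps)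
  qed
next
  case (Store a e1 e2 s)
  have v: "aval (rebase_exp K e1) \<sigma> = aval e1 s" "aval (rebase_exp K e2) \<sigma> = aval e2 s"
    using Store by (auto intro!: aval_rebase)
  have c: "acost (rebase_exp K e2) \<sigma> \<le> (G + 3) * acost e2 s"
    using Store by (intro acost_rebase_le) auto
  have c1: "acost (rebase_exp K e1) \<sigma> + 2 * val_cost (aval e1 s) \<le> (G + 3) * acost e1 s"
    using Store by (intro acost_rebase) auto
  let ?e = "Bin Add (Bin Mul (rebase_exp K e1) K) (Reg 6)"
  let ?s = "set_arr (20 + a) (aval e1 s * aval K \<sigma> + regs \<sigma> 6) (aval e2 s) \<sigma>"
  have "acost ?e \<sigma> \<le> acost (rebase_exp K e1) \<sigma> + 2 * val_cost (aval e1 s) + G"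
    using val_cost_index[OF Store.prems(5), of "aval e1 s"] v(1) Store.prems(6) by simp
  then have c': "1 + acost ?e \<sigma> + acost (rebase_exp K e2) \<sigma> \<le> (G + 3) * (1 + acost e1 s + acost e2 s)"
    using c c1 by (simp add: algebra_simps)
  show ?case
  proof (intro exI conjI)
    show "exec (rebase K (Store a e1 e2)) \<sigma> (1 + acost ?e \<sigma> + acost (rebase_exp K e2) \<sigma>) ?s"
      using exec.Store[of "20 + a" ?e "rebase_exp K e2" \<sigma>] v by simp
    show "embedded R (aval K \<sigma>) (set_arr a (aval e1 s) (aval e2 s) s) ?s"
      using Store by (intro embedded_set_arr)
    show "call_frame (aval K \<sigma>) \<sigma> ?s"
      using Store.prems(5) by (auto simp: call_frame_def same_main_def set_arr_def)
  qed (rule c')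
next
  case (Seq p s T s' q T' s'')
  have "\<exists>T1 \<sigma>'. exec (rebase K p) \<sigma> T1 \<sigma>' \<and> embedded R (aval K \<sigma>) s' \<sigma>' \<and>
    call_frame (aval K \<sigma>) \<sigma> \<sigma>' \<and> T1 \<le> (G + 3) * T"
    using Seq.prems by (intro Seq.IH) auto
  then obtain T1 \<sigma>1 where 1: "exec (rebase K p) \<sigma> T1 \<sigma>1" "embedded R (aval K \<sigma>) s' \<sigma>1"
    "call_frame (aval K \<sigma>) \<sigma> \<sigma>1" "T1 \<le> (G + 3) * T" by blast
  have m: "same_main \<sigma> \<sigma>1" using 1(3) by (simp add: call_frame_def)
  have eq: "aval K \<sigma>1 = aval K \<sigma>" "acost K \<sigma>1 = acost K \<sigma>" "regs \<sigma>1 6 = regs \<sigma> 6"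
    using aval_same_main[OF Seq.prems(3) m] acost_same_main[OF Seq.prems(3) m] m
    by (auto simp: same_main_def)
  have "\<exists>T2 \<sigma>'. exec (rebase K q) \<sigma>1 T2 \<sigma>' \<and> embedded R (aval K \<sigma>1) s'' \<sigma>' \<and>
    call_frame (aval K \<sigma>1) \<sigma>1 \<sigma>' \<and> T2 \<le> (G + 3) * T'"
    using Seq.prems 1 eq by (intro Seq.IH) auto
  then obtain T2 \<sigma>2 where 2: "exec (rebase K q) \<sigma>1 T2 \<sigma>2" "embedded R (aval K \<sigma>) s'' \<sigma>2"
    "call_frame (aval K \<sigma>) \<sigma>1 \<sigma>2" "T2 \<le> (G + 3) * T'" unfolding eq by blast
  show ?case
    using exec.Seq[OF 1(1) 2(1)] 2(2) call_frame_trans[OF 1(3) 2(3)] 1(4) 2(4)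
    by (intro exI[of _ "T1 + T2"] exI[of _ \<sigma>2]) (auto simp: algebra_simps)
next
  case (IfTrue e s p T s' q)
  have v: "aval (rebase_exp K e) \<sigma> = aval e s"
    using IfTrue by (intro aval_rebase) auto
  have c: "acost (rebase_exp K e) \<sigma> \<le> (G + 3) * acost e s"
    using IfTrue by (intro acost_rebase_le) auto
  have "\<exists>T1 \<sigma>'. exec (rebase K p) \<sigma> T1 \<sigma>' \<and> embedded R (aval K \<sigma>) s' \<sigma>' \<and>
    call_frame (aval K \<sigma>) \<sigma> \<sigma>' \<and> T1 \<le> (G + 3) * T"
    using IfTrue.prems by (intro IfTrue.IH) auto
  then obtain T1 \<sigma>1 where 1: "exec (rebase K p) \<sigma> T1 \<sigma>1" "embedded R (aval K \<sigma>) s' \<sigma>1"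
    "call_frame (aval K \<sigma>) \<sigma> \<sigma>1" "T1 \<le> (G + 3) * T" by blast
  have "aval (rebase_exp K e) \<sigma> \<noteq> 0" using v IfTrue.hyps(1) by simp
  from exec.IfTrue[OF this 1(1), of "rebase K q"] 1 c show ?case
    by (intro exI[of _ "1 + acost (rebase_exp K e) \<sigma> + T1"] exI[of _ \<sigma>1]) (auto simp: algebra_simps)
next
  case (IfFalse e s q T s' p)
  have v: "aval (rebase_exp K e) \<sigma> = aval e s"
    using IfFalse by (intro aval_rebase) auto
  have c: "acost (rebase_exp K e) \<sigma> \<le> (G + 3) * acost e s"
    using IfFalse by (intro acost_rebase_le) auto
  have "\<exists>T1 \<sigma>'. exec (rebase K q) \<sigma> T1 \<sigma>' \<and> embedded R (aval K \<sigma>) s' \<sigma>' \<and>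
    call_frame (aval K \<sigma>) \<sigma> \<sigma>' \<and> T1 \<le> (G + 3) * T"
    using IfFalse.prems by (intro IfFalse.IH) auto
  then obtain T1 \<sigma>1 where 1: "exec (rebase K q) \<sigma> T1 \<sigma>1" "embedded R (aval K \<sigma>) s' \<sigma>1"
    "call_frame (aval K \<sigma>) \<sigma> \<sigma>1" "T1 \<le> (G + 3) * T" by blast
  have "aval (rebase_exp K e) \<sigma> = 0" using v IfFalse.hyps(1) by simp
  from exec.IfFalse[OF this 1(1), of "rebase K p"] 1 c show ?case
    by (intro exI[of _ "1 + acost (rebase_exp K e) \<sigma> + T1"] exI[of _ \<sigma>1]) (auto simp: algebra_simps)
next
  case (WhileFalse e s p)
  have v: "aval (rebase_exp K e) \<sigma> = aval e s"
    using WhileFalse by (intro aval_rebase) auto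
  have c: "acost (rebase_exp K e) \<sigma> \<le> (G + 3) * acost e s"
    using WhileFalse by (intro acost_rebase_le) auto
  have "aval (rebase_exp K e) \<sigma> = 0" using v WhileFalse.hyps(1) by simp
  from exec.WhileFalse[OF this, of "rebase K p"] WhileFalse.prems c show ?case
    by (intro exI[of _ "1 + acost (rebase_exp K e) \<sigma>"] exI[of _ \<sigma>])
      (auto simp: algebra_simps call_frame_refl)
next
  case (WhileTrue e s p T s' T' s'')
  have v: "aval (rebase_exp K e) \<sigma> = aval e s"
    using WhileTrue by (intro aval_rebase) auto
  have c: "acost (rebase_exp K e) \<sigma> \<le> (G + 3) * acost e s"
    using WhileTrue by (intro acost_rebase_le) auto
  have "\<exists>T1 \<sigma>'. exec (rebase K p) \<sigma> T1 \<sigma>' \<and> embedded R (aval K \<sigma>) s' \<sigma>' \<and>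
    call_frame (aval K \<sigma>) \<sigma> \<sigma>' \<and> T1 \<le> (G + 3) * T"
    using WhileTrue.prems by (intro WhileTrue.IH) auto
  then obtain T1 \<sigma>1 where 1: "exec (rebase K p) \<sigma> T1 \<sigma>1" "embedded R (aval K \<sigma>) s' \<sigma>1"
    "call_frame (aval K \<sigma>) \<sigma> \<sigma>1" "T1 \<le> (G + 3) * T" by blast
  have m: "same_main \<sigma> \<sigma>1" using 1(3) by (simp add: call_frame_def)
  have eq: "aval K \<sigma>1 = aval K \<sigma>" "acost K \<sigma>1 = acost K \<sigma>" "regs \<sigma>1 6 = regs \<sigma> 6"
    using aval_same_main[OF WhileTrue.prems(3) m] acost_same_main[OF WhileTrue.prems(3) m] m
    by (auto simp: same_main_def)
  have "\<exists>T2 \<sigma>'. exec (rebase K (While e p)) \<sigma>1 T2 \<sigma>' \<and> embedded R (aval K \<sigma>1) s'' \<sigma>' \<and>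
    call_frame (aval K \<sigma>1) \<sigma>1 \<sigma>' \<and> T2 \<le> (G + 3) * T'"
    using WhileTrue.prems 1 eq by (intro WhileTrue.IH) auto
  then obtain T2 \<sigma>2 where 2: "exec (rebase K (While e p)) \<sigma>1 T2 \<sigma>2" "embedded R (aval K \<sigma>) s'' \<sigma>2"
    "call_frame (aval K \<sigma>) \<sigma>1 \<sigma>2" "T2 \<le> (G + 3) * T'" unfolding eq by blast
  have "aval (rebase_exp K e) \<sigma> \<noteq> 0" using v WhileTrue.hyps(1) by simp
  from exec.WhileTrue[OF this 1(1) 2(1)[unfolded rebase.simps]] 2(2,4) call_frame_trans[OF 1(3) 2(3)] 1(4) c show ?case
    by (intro exI[of _ "1 + acost (rebase_exp K e) \<sigma> + T1 + T2"] exI[of _ \<sigma>2])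
      (auto simp: algebra_simps)
qed auto

section \<open>Splitting tripartite graphs\<close>

text \<open>Vertices are numbers below \<open>3 * n\<close>, and \<open>x div n\<close> is the colour class of \<open>x\<close>.\<close>

definition edge_set :: "(nat \<times> nat) list \<Rightarrow> nat set set" where
  "edge_set l = set (map (\<lambda>(u, v). {u, v}) l)"

definition tripartite :: "nat \<Rightarrow> (nat \<times> nat) list \<Rightarrow> bool" where
  "tripartite n l \<longleftrightarrow> 0 < n \<and> distinct (map (\<lambda>(u, v). {u, v}) l) \<and>
     (\<forall>(u, v)\<in>set l. u < 3 * n \<and> v < 3 * n \<and> u div n \<noteq> v div n)"

definition touches :: "nat \<Rightarrow> nat \<Rightarrow> nat \<times> nat \<Rightarrow> bool" where
  "touches n \<tau> e \<longleftrightarrow> fst e div n = \<tau> \<or> snd e div n = \<tau>"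

text \<open>If no endpoint lies in class \<tau>, this is the first endpoint; thus the class of
  \<open>near\<close> alone decides whether the edge touches \<tau>.\<close>

definition near :: "nat \<Rightarrow> nat \<Rightarrow> nat \<times> nat \<Rightarrow> nat" where
  "near n \<tau> e = (if snd e div n = \<tau> then snd e else fst e)"

definition far :: "nat \<Rightarrow> nat \<Rightarrow> nat \<times> nat \<Rightarrow> nat" where
  "far n \<tau> e = (if snd e div n = \<tau> then fst e else snd e)"

definition part :: "nat \<Rightarrow> nat \<Rightarrow> (nat \<Rightarrow> nat) \<Rightarrow> nat \<Rightarrow> (nat \<times> nat) list \<Rightarrow> (nat \<times> nat) list" where
  "part n \<tau> sd i l = filter (\<lambda>e. touches n \<tau> e \<longrightarrow> sd (near n \<tau> e) = i) l"

text \<open>In a tripartite graph this is the number of edges between the two classes other than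
  \<tau>. Throughout, an edge class is named by the vertex class that it avoids.\<close>

definition avoiding :: "nat \<Rightarrow> nat \<Rightarrow> (nat \<times> nat) list \<Rightarrow> nat" where
  "avoiding n \<tau> l = length (filter (\<lambda>e. \<not> touches n \<tau> e) l)"

definition deg :: "nat \<Rightarrow> nat \<Rightarrow> nat \<Rightarrow> (nat \<times> nat) list \<Rightarrow> nat \<Rightarrow> nat" where
  "deg n \<tau> \<sigma> l a = length (filter (\<lambda>e. (touches n \<tau> e \<and> far n \<tau> e div n = \<sigma>) \<and> near n \<tau> e = a) l)"

lemma tripartite_filter: "tripartite n l \<Longrightarrow> tripartite n (filter P l)"
  by (auto simp: tripartite_def distinct_map intro: inj_on_subset)

lemma tripartite_part: "tripartite n l \<Longrightarrow> tripartite n (part n \<tau> sd i l)"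
  by (simp add: part_def tripartite_filter)

lemma tripartite_edge:
  assumes "tripartite n l" "e \<in> set l"
  shows "fst e < 3 * n" "snd e < 3 * n" "fst e div n \<noteq> snd e div n" "fst e div n < 3" "snd e div n < 3"
proof -
  from assms show "fst e < 3 * n" "snd e < 3 * n" "fst e div n \<noteq> snd e div n"
    by (cases e; force simp: tripartite_def)+
  then show "fst e div n < 3" "snd e div n < 3" by (simp_all add: less_mult_imp_div_less)
qed

lemma card_edge_set: "tripartite n l \<Longrightarrow> card (edge_set l) = length l"
  using distinct_card[of "map (\<lambda>(u, v). {u, v}) l"] by (simp add: edge_set_def tripartite_def)

lemma finite_edge_set [simp]: "finite (edge_set l)"
  by (simp add: edge_set_def)

text \<open>At most one endpoint of an edge lies in class \<tau>, so the test on \<open>near\<close>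
  is a condition on all endpoints in that class.\<close>

lemma edge_set_part:
  assumes "tripartite n l"
  shows "edge_set (part n \<tau> sd i l) = {e \<in> edge_set l. \<forall>x\<in>e. x div n = \<tau> \<longrightarrow> sd x = i}"
proof -
  have "(touches n \<tau> e \<longrightarrow> sd (near n \<tau> e) = i) \<longleftrightarrow> (\<forall>x\<in>{fst e, snd e}. x div n = \<tau> \<longrightarrow> sd x = i)"
    if "e \<in> set l" for e
    using tripartite_edge(3)[OF assms that] by (auto simp: touches_def near_def)
  then have "part n \<tau> sd i l = filter (\<lambda>e. \<forall>x\<in>{fst e, snd e}. x div n = \<tau> \<longrightarrow> sd x = i) l"
    unfolding part_def by (rule filter_cong[OF refl])
  then have "edge_set (part n \<tau> sd i l) =
      (\<lambda>e. {fst e, snd e}) ` {e \<in> set l. \<forall>x\<in>{fst e, snd e}. x div n = \<tau> \<longrightarrow> sd x = i}"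
    by (simp add: edge_set_def case_prod_beta)
  then show ?thesis by (auto simp: edge_set_def case_prod_beta)
qed

lemma triangles_iff:
  "T \<in> triangles F \<longleftrightarrow> (\<exists>a b c. T = {a, b, c} \<and> a \<noteq> b \<and> b \<noteq> c \<and> a \<noteq> c \<and>
     {a, b} \<in> F \<and> {b, c} \<in> F \<and> {a, c} \<in> F)"
proof
  assume "T \<in> triangles F"
  then have "card T = 3" "\<forall>u\<in>T. \<forall>v\<in>T. u \<noteq> v \<longrightarrow> {u, v} \<in> F" by (auto simp: triangles_def)
  then show "\<exists>a b c. T = {a, b, c} \<and> a \<noteq> b \<and> b \<noteq> c \<and> a \<noteq> c \<and>
     {a, b} \<in> F \<and> {b, c} \<in> F \<and> {a, c} \<in> F"
    by (auto simp: card_3_iff) blast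
qed (auto simp: triangles_def insert_commute)

lemma finite_triangles: "finite F \<Longrightarrow> (\<And>e. e \<in> F \<Longrightarrow> finite e) \<Longrightarrow> finite (triangles F)"
proof (rule finite_subset)
  show "triangles F \<subseteq> Pow (\<Union>F)"
  proof (intro subsetI PowI)
    fix T x assume "T \<in> triangles F" "x \<in> T"
    then obtain a b c where "x \<in> {a, b} \<union> {b, c}" "{a, b} \<in> F" "{b, c} \<in> F"
      unfolding triangles_iff by blast
    then show "x \<in> \<Union>F" by blast
  qed
qed simp

lemma finite_triangles_edge_set [simp]: "finite (triangles (edge_set l))"
  by (rule finite_triangles) (auto simp: edge_set_def)

lemma triangles_part:
  assumes "tripartite n l"
  shows "triangles (edge_set (part n \<tau> sd i l)) =
    {T \<in> triangles (edge_set l). \<forall>x\<in>T. x div n = \<tau> \<longrightarrow> sd x = i}"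
  unfolding edge_set_part[OF assms]
proof (intro set_eqI iffI)
  fix T assume "T \<in> triangles {e \<in> edge_set l. \<forall>x\<in>e. x div n = \<tau> \<longrightarrow> sd x = i}"
  then obtain a b c where "T = {a, b, c}" "a \<noteq> b" "b \<noteq> c" "a \<noteq> c"
    "{a, b} \<in> edge_set l" "{b, c} \<in> edge_set l" "{a, c} \<in> edge_set l"
    "\<forall>x\<in>{a, b}. x div n = \<tau> \<longrightarrow> sd x = i" "\<forall>x\<in>{b, c}. x div n = \<tau> \<longrightarrow> sd x = i"
    unfolding triangles_iff mem_Collect_eq by blast
  then show "T \<in> {T \<in> triangles (edge_set l). \<forall>x\<in>T. x div n = \<tau> \<longrightarrow> sd x = i}"
    unfolding mem_Collect_eq triangles_iff by blast
next
  fix T assume "T \<in> {T \<in> triangles (edge_set l). \<forall>x\<in>T. x div n = \<tau> \<longrightarrow> sd x = i}"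
  then show "T \<in> triangles {e \<in> edge_set l. \<forall>x\<in>e. x div n = \<tau> \<longrightarrow> sd x = i}"
    by (auto simp: triangles_def)
qed

lemma edge_set_classes:
  assumes "tripartite n l" "{a, b} \<in> edge_set l"
  shows "a div n \<noteq> b div n" "a div n < 3" "b div n < 3" "a < 3 * n" "b < 3 * n"
proof -
  from assms(2) obtain e where e: "e \<in> set l" "{a, b} = {fst e, snd e}"
    by (auto simp: edge_set_def)
  show "a div n \<noteq> b div n" "a div n < 3" "b div n < 3" "a < 3 * n" "b < 3 * n"
    using tripartite_edge[OF assms(1) e(1)] e(2) by (auto simp: doubleton_eq_iff)
qed

lemma triangle_vertex:
  assumes "tripartite n l" "T \<in> triangles (edge_set l)" "\<tau> < 3"
  obtains a b c where "T = {a, b, c}" "a div n = \<tau>" "b div n \<noteq> \<tau>" "c div n \<noteq> \<tau>" "b \<noteq> c"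
    "{a, b} \<in> edge_set l" "{b, c} \<in> edge_set l" "{a, c} \<in> edge_set l"
proof -
  from assms(2) obtain a b c where T: "T = {a, b, c}" "{a, b} \<in> edge_set l" "{b, c} \<in> edge_set l"
    "{a, c} \<in> edge_set l" "b \<noteq> c" "a \<noteq> b" "a \<noteq> c" unfolding triangles_iff by blast
  note c = edge_set_classes[OF assms(1) T(2)] edge_set_classes[OF assms(1) T(3)]
    edge_set_classes[OF assms(1) T(4)]
  from c assms(3) consider "a div n = \<tau>" | "b div n = \<tau>" | "c div n = \<tau>" by linarith
  then show thesis
  proof cases
    case 1
    with that[of a b c] T c show ?thesis by auto
  next
    case 2
    with that[of b a c] T c show ?thesis by (auto simp: insert_commute)
  next
    case 3
    with that[of c a b] T c show ?thesis by (auto simp: insert_commute)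
  qed
qed

text \<open>A triangle has exactly one vertex in class \<tau>, and it survives precisely in the part
  of this vertex. So the parts share edges but no triangles.\<close>

lemma triangles_parts:
  assumes "tripartite n l" "\<tau> < 3" "\<And>e. e \<in> set l \<Longrightarrow> touches n \<tau> e \<Longrightarrow> sd (near n \<tau> e) \<in> {1..r}"
  shows "length (filter (\<lambda>i. T \<in> triangles (edge_set (part n \<tau> sd i l))) [1..<Suc r]) =
    of_bool (T \<in> triangles (edge_set l))"
proof (cases "T \<in> triangles (edge_set l)")
  case True
  with assms obtain a b c where T: "T = {a, b, c}" "a div n = \<tau>" "b div n \<noteq> \<tau>" "c div n \<noteq> \<tau>"
    "{a, b} \<in> edge_set l" by (blast elim: triangle_vertex)
  from T(5) obtain e where e: "e \<in> set l" "{a, b} = {fst e, snd e}" by (auto simp: edge_set_def)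
  have "touches n \<tau> e" "near n \<tau> e = a" using e(2) T by (auto simp: touches_def near_def doubleton_eq_iff)
  with assms(3)[OF e(1)] have "sd a \<in> {1..r}" by simp
  then have "{i. sd a = i} \<inter> set [1..<Suc r] = {sd a}" by auto
  moreover have "(\<lambda>i. T \<in> triangles (edge_set (part n \<tau> sd i l))) = (\<lambda>i. sd a = i)"
    using True T by (auto simp: triangles_part[OF assms(1)])
  moreover have "length (filter (\<lambda>i. sd a = i) [1..<Suc r]) = card ({i. sd a = i} \<inter> set [1..<Suc r])"
    by (rule distinct_length_filter) simp
  ultimately show ?thesis using True by simp
next
  case False
  then show ?thesis by (auto simp: triangles_part[OF assms(1)] filter_empty_conv simp del: upt_Suc)
qed

text \<open>The second conjunct makes the count of triangles strictly smaller than that of edges,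
  which is what guarantees that such a subproblem is solved completely by the given
  algorithm.\<close>

definition single :: "nat \<Rightarrow> nat \<Rightarrow> (nat \<times> nat) list \<Rightarrow> bool" where
  "single n \<tau> l \<longleftrightarrow> (\<exists>h. \<forall>e\<in>set l. touches n \<tau> e \<longrightarrow> near n \<tau> e = h) \<and> (\<exists>e\<in>set l. touches n \<tau> e)"

lemma near_if: "{a, b} = {fst e, snd e} \<Longrightarrow> a div n = \<tau> \<Longrightarrow> b div n \<noteq> \<tau> \<Longrightarrow> touches n \<tau> e \<and> near n \<tau> e = a \<and> far n \<tau> e = b"
  by (auto simp: touches_def near_def far_def doubleton_eq_iff)

text \<open>A triangle through the only vertex of its class is determined by the opposite edge.\<close>

lemma card_triangles_single:
  assumes "tripartite n l" "\<tau> < 3" "single n \<tau> l"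
  shows "card (triangles (edge_set l)) < length l"
proof -
  from assms(3) obtain h e0 where h: "\<And>e. e \<in> set l \<Longrightarrow> touches n \<tau> e \<Longrightarrow> near n \<tau> e = h"
    "e0 \<in> set l" "touches n \<tau> e0" unfolding single_def by blast
  let ?F = "edge_set (filter (\<lambda>e. \<not> touches n \<tau> e) l)"
  have "triangles (edge_set l) \<subseteq> insert h ` ?F"
  proof
    fix T assume "T \<in> triangles (edge_set l)"
    with assms obtain a b c where T: "T = {a, b, c}" "a div n = \<tau>" "b div n \<noteq> \<tau>" "c div n \<noteq> \<tau>"
      "{a, b} \<in> edge_set l" "{b, c} \<in> edge_set l" by (blast elim: triangle_vertex)
    from T(5) obtain e where "e \<in> set l" "{a, b} = {fst e, snd e}" by (auto simp: edge_set_def)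
    with h(1) near_if[of a b e n \<tau>] T have "a = h" by blast
    moreover from T(6) obtain u v where uv: "(u, v) \<in> set l" "{b, c} = {u, v}"
      by (auto simp: edge_set_def)
    then have "\<not> touches n \<tau> (u, v)" using T(3,4) by (auto simp: touches_def doubleton_eq_iff)
    then have "{b, c} \<in> ?F" unfolding uv(2) edge_set_def using uv(1) by (auto intro!: rev_image_eqI)
    ultimately show "T \<in> insert h ` ?F" using T(1) by blast
  qed
  then have "card (triangles (edge_set l)) \<le> card (insert h ` ?F)" by (intro card_mono) auto
  also have "\<dots> \<le> card ?F" by (rule card_image_le) simp
  also have "\<dots> = length (filter (\<lambda>e. \<not> touches n \<tau> e) l)"
    by (rule card_edge_set) (rule tripartite_filter[OF assms(1)])
  also have "\<dots> < length l" using h(2,3) by (auto intro!: length_filter_less)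
  finally show ?thesis .
qed

section \<open>Degrees and edge classes\<close>

lemma length_filter_sum:
  "finite A \<Longrightarrow> (\<And>e. e \<in> set l \<Longrightarrow> P e \<Longrightarrow> f e \<in> A) \<Longrightarrow>
   length (filter P l) = (\<Sum>a\<in>A. length (filter (\<lambda>e. P e \<and> f e = a) l))"
proof (induction l)
  case (Cons e l)
  then have IH: "length (filter P l) = (\<Sum>a\<in>A. length (filter (\<lambda>e. P e \<and> f e = a) l))" by auto
  show ?case
  proof (cases "P e")
    case True
    have "(\<Sum>a\<in>A. length (filter (\<lambda>e. P e \<and> f e = a) (e # l))) =
        (\<Sum>a\<in>A. of_bool (f e = a) + length (filter (\<lambda>e. P e \<and> f e = a) l))"
      using True by (intro sum.cong) auto
    also have "\<dots> = 1 + length (filter P l)"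
      using Cons.prems True by (simp add: sum.distrib IH of_bool_def)
    finally show ?thesis using True by simp
  next
    case False
    then show ?thesis using IH by simp
  qed
qed simp

lemma class_cases:
  fixes \<tau> a b :: nat
  shows "\<tau> < 3 \<Longrightarrow> a < 3 \<Longrightarrow> b < 3 \<Longrightarrow>
   (\<tau> = 0 \<or> \<tau> = 1 \<or> \<tau> = 2) \<and> (a = 0 \<or> a = 1 \<or> a = 2) \<and> (b = 0 \<or> b = 1 \<or> b = 2)"
  by linarith

text \<open>Every edge joins two of the three classes and so avoids exactly one.\<close>

lemma length_classes:
  assumes "tripartite n l" "\<tau> < 3"
  shows "length l = avoiding n \<tau> l + avoiding n ((\<tau> + 1) mod 3) l + avoiding n ((\<tau> + 2) mod 3) l"
  using assms(1)
proof (induction l)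
  case (Cons e l)
  then have IH: "length l = avoiding n \<tau> l + avoiding n ((\<tau> + 1) mod 3) l + avoiding n ((\<tau> + 2) mod 3) l"
    by (auto simp: tripartite_def)
  have c: "fst e div n \<noteq> snd e div n" "fst e div n < 3" "snd e div n < 3"
    using tripartite_edge[OF Cons.prems] by auto
  have "of_bool (\<not> touches n \<tau> e) + of_bool (\<not> touches n ((\<tau> + 1) mod 3) e) +
      of_bool (\<not> touches n ((\<tau> + 2) mod 3) e) = (1::nat)"
    using class_cases[OF assms(2) c(2,3)] c(1) unfolding touches_def by (elim disjE conjE) simp_all
  moreover have "avoiding n \<sigma> (e # l) = of_bool (\<not> touches n \<sigma> e) + avoiding n \<sigma> l" for \<sigma>
    by (simp add: avoiding_def)
  ultimately show ?case using IH by simp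
qed (simp add: avoiding_def)

text \<open>The state consists of the part of each vertex (0 means not yet assigned), the number of
  parts opened so far, and the degree sums of parts 1 and 2, towards the next class (x1, x2) and
  towards the class after it (z1, z2). A vertex is assigned at the first edge through it. It is
  heavy if its degree exceeds a fraction 1/Q of all edges.\<close>

definition split_step ::
  "nat \<Rightarrow> nat \<Rightarrow> nat \<Rightarrow> (nat \<times> nat) list \<Rightarrow> nat \<times> nat \<Rightarrow>
   (nat \<Rightarrow> nat) \<times> nat \<times> nat \<times> nat \<times> nat \<times> nat \<Rightarrow> (nat \<Rightarrow> nat) \<times> nat \<times> nat \<times> nat \<times> nat \<times> nat" where
  "split_step n \<tau> Q l e = (\<lambda>(sd, r, x1, x2, z1, z2).
     let a = near n \<tau> e; x = deg n \<tau> ((\<tau> + 1) mod 3) l a; z = deg n \<tau> ((\<tau> + 2) mod 3) l a in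
     if \<not> touches n \<tau> e \<or> sd a \<noteq> 0 then (sd, r, x1, x2, z1, z2)
     else if length l < (x + z) * Q then (sd(a := Suc r), Suc r, x1, x2, z1, z2)
     else if x1 * x + z1 * z \<le> x2 * x + z2 * z then (sd(a := 1), r, x1 + x, x2, z1 + z, z2)
     else (sd(a := 2), r, x1, x2 + x, z1, z2 + z))"

text \<open>A vertex of high degree gets a part of its own. The other ones are assigned to parts 1 and 2
  greedily: the difference vector of the two parts has a nonpositive inner product with the degree vector
  that is added to it, so that the squared lengths add up.\<close>

definition split_inv ::
  "nat \<Rightarrow> nat \<Rightarrow> nat \<Rightarrow> (nat \<times> nat) list \<Rightarrow> nat set \<Rightarrow>
   (nat \<Rightarrow> nat) \<times> nat \<times> nat \<times> nat \<times> nat \<times> nat \<Rightarrow> bool" where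
  "split_inv n \<tau> Q l A = (\<lambda>(sd, r, x1, x2, z1, z2).
     let x = deg n \<tau> ((\<tau> + 1) mod 3) l; z = deg n \<tau> ((\<tau> + 2) mod 3) l in
     2 \<le> r \<and> (\<forall>a. sd a \<noteq> 0 \<longleftrightarrow> a \<in> A) \<and> (\<forall>a. sd a \<le> r) \<and>
     (\<forall>a b. sd a = sd b \<longrightarrow> 2 < sd a \<longrightarrow> a = b) \<and> (\<forall>i. 2 < i \<longrightarrow> i \<le> r \<longrightarrow> (\<exists>a\<in>A. sd a = i)) \<and>
     x1 = (\<Sum>a\<in>{a \<in> A. sd a = 1}. x a) \<and> x2 = (\<Sum>a\<in>{a \<in> A. sd a = 2}. x a) \<and>
     z1 = (\<Sum>a\<in>{a \<in> A. sd a = 1}. z a) \<and> z2 = (\<Sum>a\<in>{a \<in> A. sd a = 2}. z a) \<and>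
     ((real x1 - real x2)\<^sup>2 + (real z1 - real z2)\<^sup>2) * real Q \<le>
       real (length l) * (\<Sum>a\<in>{a \<in> A. sd a \<le> 2}. real (x a + z a)) \<and>
     (r - 2) * length l \<le> Q * (\<Sum>a\<in>{a \<in> A. 2 < sd a}. x a + z a))"

lemma greedy_square:
  fixes x1 x2 z1 z2 x z :: real
  assumes "x1 * x + z1 * z \<le> x2 * x + z2 * z"
  shows "(x1 + x - x2)\<^sup>2 + (z1 + z - z2)\<^sup>2 \<le> (x1 - x2)\<^sup>2 + (z1 - z2)\<^sup>2 + (x\<^sup>2 + z\<^sup>2)"
  using assms by (simp add: power2_eq_square algebra_simps)

text \<open>For a light vertex the squared length of its degree vector is at most length / Q times
  its degree. Summing over vertices, the squared imbalance of the two parts is at most length^2 /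
  Q.\<close>

lemma light_square:
  fixes x z Q len :: nat
  assumes "(x + z) * Q \<le> len"
  shows "((real x)\<^sup>2 + (real z)\<^sup>2) * real Q \<le> real len * real (x + z)"
proof -
  have "real ((x + z) * Q) \<le> real len" using assms by (simp only: of_nat_le_iff)
  then have "real ((x + z) * Q) * real (x + z) \<le> real len * real (x + z)"
    by (intro mult_right_mono) simp_all
  moreover have "((real x)\<^sup>2 + (real z)\<^sup>2) * real Q \<le> (real (x + z))\<^sup>2 * real Q"
    by (intro mult_right_mono) (simp_all add: power2_sum)
  moreover have "(real (x + z))\<^sup>2 * real Q = real ((x + z) * Q) * real (x + z)"
    by (simp add: power2_eq_square)
  ultimately show ?thesis by linarith
qed

lemma sum_fun_upd:
  fixes g :: "'a \<Rightarrow> 'b::comm_monoid_add"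
  assumes "finite A" "a \<notin> A"
  shows "(\<Sum>b\<in>{b \<in> insert a A. P ((sd(a := k)) b)}. g b) = (if P k then g a else 0) + (\<Sum>b\<in>{b \<in> A. P (sd b)}. g b)"
proof -
  have "{b \<in> insert a A. P ((sd(a := k)) b)} = (if P k then insert a {b \<in> A. P (sd b)} else {b \<in> A. P (sd b)})"
    using assms(2) by auto
  then show ?thesis using assms by simp
qed

lemma split_inv_step:
  assumes "split_inv n \<tau> Q l A st" "finite A"
  shows "split_inv n \<tau> Q l (if touches n \<tau> e then insert (near n \<tau> e) A else A) (split_step n \<tau> Q l e st)"
proof -
  obtain sd r x1 x2 z1 z2 where st: "st = (sd, r, x1, x2, z1, z2)" by (cases st)
  define a where "a = near n \<tau> e"
  define X where "X = deg n \<tau> ((\<tau> + 1) mod 3) l"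
  define Z where "Z = deg n \<tau> ((\<tau> + 2) mod 3) l"
  have inv: "2 \<le> r" "\<And>a. sd a \<noteq> 0 \<longleftrightarrow> a \<in> A" "\<And>a. sd a \<le> r"
    "\<And>a b. sd a = sd b \<Longrightarrow> 2 < sd a \<Longrightarrow> a = b" "\<And>i. 2 < i \<Longrightarrow> i \<le> r \<Longrightarrow> \<exists>a\<in>A. sd a = i"
    "x1 = (\<Sum>a\<in>{a \<in> A. sd a = 1}. X a)" "x2 = (\<Sum>a\<in>{a \<in> A. sd a = 2}. X a)"
    "z1 = (\<Sum>a\<in>{a \<in> A. sd a = 1}. Z a)" "z2 = (\<Sum>a\<in>{a \<in> A. sd a = 2}. Z a)"
    "((real x1 - real x2)\<^sup>2 + (real z1 - real z2)\<^sup>2) * real Q \<le>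
       real (length l) * (\<Sum>a\<in>{a \<in> A. sd a \<le> 2}. real (X a + Z a))"
    "(r - 2) * length l \<le> Q * (\<Sum>a\<in>{a \<in> A. 2 < sd a}. X a + Z a)"
    using assms(1) unfolding st split_inv_def X_def Z_def Let_def prod.case by blast+
  show ?thesis
  proof (cases "\<not> touches n \<tau> e \<or> sd a \<noteq> 0")
    case True
    then have "split_step n \<tau> Q l e st = st" unfolding st split_step_def a_def by simp
    moreover have "(if touches n \<tau> e then insert a A else A) = A" using True inv(2) by auto
    ultimately show ?thesis using assms(1) unfolding a_def by argo
  next
    case False
    then have t: "touches n \<tau> e" and sda: "sd a = 0" and aA: "a \<notin> A" using inv(2)[of a] by auto
    note upd = sum_fun_upd[OF assms(2) aA]
    note upd_eq = upd[where P = "\<lambda>y. y = 1"] upd[where P = "\<lambda>y. y = 2"] upd[where P = "\<lambda>y. y \<le> 2"] upd[where P = "\<lambda>y. 2 < y"]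
    consider (heavy) "length l < (X a + Z a) * Q"
      | (one) "(X a + Z a) * Q \<le> length l" "x1 * X a + z1 * Z a \<le> x2 * X a + z2 * Z a"
      | (two) "(X a + Z a) * Q \<le> length l" "x2 * X a + z2 * Z a \<le> x1 * X a + z1 * Z a"
          "\<not> x1 * X a + z1 * Z a \<le> x2 * X a + z2 * Z a"
      by linarith
    then show ?thesis
    proof cases
      case heavy
      have "split_step n \<tau> Q l e st = (sd(a := Suc r), Suc r, x1, x2, z1, z2)"
        using heavy t sda unfolding st split_step_def a_def X_def Z_def by (simp add: Let_def)
      moreover have "split_inv n \<tau> Q l (insert a A) (sd(a := Suc r), Suc r, x1, x2, z1, z2)"
        unfolding split_inv_def Let_def prod.case X_def[symmetric] Z_def[symmetric] upd_eq
      proof (intro conjI allI impI)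
        show "2 \<le> Suc r" using inv(1) by simp
        show "((sd(a := Suc r)) b \<noteq> 0) = (b \<in> insert a A)" for b using inv(2) by simp
        show "(sd(a := Suc r)) b \<le> Suc r" for b using inv(3)[of b] by simp
        show "b = b'" if "(sd(a := Suc r)) b = (sd(a := Suc r)) b'" "2 < (sd(a := Suc r)) b" for b b'
          using that inv(3)[of b] inv(3)[of b'] inv(4)[of b b'] by (auto split: if_splits)
        show "\<exists>b\<in>insert a A. (sd(a := Suc r)) b = i" if "2 < i" "i \<le> Suc r" for i
        proof (cases "i = Suc r")
          case False
          with that inv(5)[of i] obtain b where "b \<in> A" "sd b = i" by auto
          with aA show ?thesis by (intro bexI[of _ b]) auto
        qed simp
        \<comment> \<open>The heavy vertex pays for the part it opens: Q times its degree exceeds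
          the number of edges.\<close>
        have "Suc (r - 2) * length l \<le> Q * (X a + Z a + (\<Sum>a\<in>{a \<in> A. 2 < sd a}. X a + Z a))"
          using inv(11) heavy by (simp add: algebra_simps)
        moreover have e: "Suc r - 2 = Suc (r - 2)" "2 < Suc r" using inv(1) by auto
        ultimately show "(Suc r - 2) * length l \<le> Q * ((if 2 < Suc r then X a + Z a else 0) + (\<Sum>b\<in>{b \<in> A. 2 < sd b}. X b + Z b))"
          unfolding e(1) if_P[OF e(2)] by blast
        show "x1 = (if Suc r = 1 then X a else 0) + (\<Sum>b\<in>{b \<in> A. sd b = 1}. X b)"
          using inv(1) inv(6) by simp
        show "x2 = (if Suc r = 2 then X a else 0) + (\<Sum>b\<in>{b \<in> A. sd b = 2}. X b)"
          using inv(1) inv(7) by simp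
        show "z1 = (if Suc r = 1 then Z a else 0) + (\<Sum>b\<in>{b \<in> A. sd b = 1}. Z b)"
          using inv(1) inv(8) by simp
        show "z2 = (if Suc r = 2 then Z a else 0) + (\<Sum>b\<in>{b \<in> A. sd b = 2}. Z b)"
          using inv(1) inv(9) by simp
        have "\<not> Suc r \<le> 2" using inv(1) by simp
        from inv(10) show "((real x1 - real x2)\<^sup>2 + (real z1 - real z2)\<^sup>2) * real Q \<le>
            real (length l) * ((if Suc r \<le> 2 then real (X a + Z a) else 0) + (\<Sum>b\<in>{b \<in> A. sd b \<le> 2}. real (X b + Z b)))"
          unfolding if_not_P[OF \<open>\<not> Suc r \<le> 2\<close>] add_0 .
      qed
      ultimately show ?thesis using t a_def by simp
    next
      case one
      have "split_step n \<tau> Q l e st = (sd(a := 1), r, x1 + X a, x2, z1 + Z a, z2)"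
        using one t sda unfolding st split_step_def a_def X_def Z_def by (simp add: Let_def)
      moreover have "split_inv n \<tau> Q l (insert a A) (sd(a := 1), r, x1 + X a, x2, z1 + Z a, z2)"
        unfolding split_inv_def Let_def prod.case X_def[symmetric] Z_def[symmetric] upd_eq
      proof (intro conjI allI impI)
        show "((sd(a := 1)) b \<noteq> 0) = (b \<in> insert a A)" for b using inv(2) by simp
        show "(sd(a := 1)) b \<le> r" for b using inv(1) inv(3)[of b] by simp
        show "b = b'" if "(sd(a := 1)) b = (sd(a := 1)) b'" "2 < (sd(a := 1)) b" for b b'
          using that inv(4)[of b b'] by (auto split: if_splits)
        show "\<exists>b\<in>insert a A. (sd(a := 1)) b = i" if "2 < i" "i \<le> r" for i
        proof -
          from that inv(5)[of i] obtain b where "b \<in> A" "sd b = i" by auto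
          with aA show ?thesis by (intro bexI[of _ b]) auto
        qed
        have "real (x1 * X a + z1 * Z a) \<le> real (x2 * X a + z2 * Z a)" using one(2) by (simp only: of_nat_le_iff)
        then have "(real x1 + real (X a) - real x2)\<^sup>2 + (real z1 + real (Z a) - real z2)\<^sup>2 \<le>
            (real x1 - real x2)\<^sup>2 + (real z1 - real z2)\<^sup>2 + ((real (X a))\<^sup>2 + (real (Z a))\<^sup>2)"
          by (intro greedy_square) simp
        then have "((real x1 + real (X a) - real x2)\<^sup>2 + (real z1 + real (Z a) - real z2)\<^sup>2) * real Q \<le>
            ((real x1 - real x2)\<^sup>2 + (real z1 - real z2)\<^sup>2 + ((real (X a))\<^sup>2 + (real (Z a))\<^sup>2)) * real Q"
          by (rule mult_right_mono) simp
        also have "\<dots> \<le> real (length l) * (\<Sum>a\<in>{a \<in> A. sd a \<le> 2}. real (X a + Z a)) + real (length l) * real (X a + Z a)"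
          using light_square[OF one(1)] inv(10) by (simp add: distrib_right)
        finally show "((real (x1 + X a) - real x2)\<^sup>2 + (real (z1 + Z a) - real z2)\<^sup>2) * real Q \<le>
            real (length l) * ((if (1::nat) \<le> 2 then real (X a + Z a) else 0) + (\<Sum>b\<in>{b \<in> A. sd b \<le> 2}. real (X b + Z b)))"
          by (simp add: distrib_left)
        show "2 \<le> r" by (rule inv(1))
        show "x1 + X a = (if (1::nat) = 1 then X a else 0) + (\<Sum>b\<in>{b \<in> A. sd b = 1}. X b)"
          using inv(1) inv(6) by simp
        show "x2 = (if (1::nat) = 2 then X a else 0) + (\<Sum>b\<in>{b \<in> A. sd b = 2}. X b)"
          using inv(1) inv(7) by simp
        show "z1 + Z a = (if (1::nat) = 1 then Z a else 0) + (\<Sum>b\<in>{b \<in> A. sd b = 1}. Z b)"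
          using inv(1) inv(8) by simp
        show "z2 = (if (1::nat) = 2 then Z a else 0) + (\<Sum>b\<in>{b \<in> A. sd b = 2}. Z b)"
          using inv(1) inv(9) by simp
        show "(r - 2) * length l \<le> Q * ((if 2 < (1::nat) then X a + Z a else 0) + (\<Sum>b\<in>{b \<in> A. 2 < sd b}. X b + Z b))"
          using inv(11) by simp
      qed
      ultimately show ?thesis using t a_def by simp
    next
      case two
      have "split_step n \<tau> Q l e st = (sd(a := 2), r, x1, x2 + X a, z1, z2 + Z a)"
        using two t sda unfolding st split_step_def a_def X_def Z_def by (simp add: Let_def)
      moreover have "split_inv n \<tau> Q l (insert a A) (sd(a := 2), r, x1, x2 + X a, z1, z2 + Z a)"
        unfolding split_inv_def Let_def prod.case X_def[symmetric] Z_def[symmetric] upd_eq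
      proof (intro conjI allI impI)
        show "((sd(a := 2)) b \<noteq> 0) = (b \<in> insert a A)" for b using inv(2) by simp
        show "(sd(a := 2)) b \<le> r" for b using inv(1) inv(3)[of b] by simp
        show "b = b'" if "(sd(a := 2)) b = (sd(a := 2)) b'" "2 < (sd(a := 2)) b" for b b'
          using that inv(4)[of b b'] by (auto split: if_splits)
        show "\<exists>b\<in>insert a A. (sd(a := 2)) b = i" if "2 < i" "i \<le> r" for i
        proof -
          from that inv(5)[of i] obtain b where "b \<in> A" "sd b = i" by auto
          with aA show ?thesis by (intro bexI[of _ b]) auto
        qed
        have "real (x2 * X a + z2 * Z a) \<le> real (x1 * X a + z1 * Z a)" using two(2) by (simp only: of_nat_le_iff)
        \<comment> \<open>The same estimate with the two parts exchanged; the squares do not notice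
          the sign.\<close>
        then have "(real x2 + real (X a) - real x1)\<^sup>2 + (real z2 + real (Z a) - real z1)\<^sup>2 \<le>
            (real x2 - real x1)\<^sup>2 + (real z2 - real z1)\<^sup>2 + ((real (X a))\<^sup>2 + (real (Z a))\<^sup>2)"
          by (intro greedy_square) simp
        then have "((real x1 - real (x2 + X a))\<^sup>2 + (real z1 - real (z2 + Z a))\<^sup>2) * real Q \<le>
            ((real x1 - real x2)\<^sup>2 + (real z1 - real z2)\<^sup>2 + ((real (X a))\<^sup>2 + (real (Z a))\<^sup>2)) * real Q"
          by (intro mult_right_mono) (simp_all add: power2_commute)
        also have "\<dots> \<le> real (length l) * (\<Sum>a\<in>{a \<in> A. sd a \<le> 2}. real (X a + Z a)) + real (length l) * real (X a + Z a)"
          using light_square[OF two(1)] inv(10) by (simp add: distrib_right)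
        finally show "((real x1 - real (x2 + X a))\<^sup>2 + (real z1 - real (z2 + Z a))\<^sup>2) * real Q \<le>
            real (length l) * ((if (2::nat) \<le> 2 then real (X a + Z a) else 0) + (\<Sum>b\<in>{b \<in> A. sd b \<le> 2}. real (X b + Z b)))"
          by (simp add: distrib_left)
        show "2 \<le> r" by (rule inv(1))
        show "x1 = (if (2::nat) = 1 then X a else 0) + (\<Sum>b\<in>{b \<in> A. sd b = 1}. X b)"
          using inv(1) inv(6) by simp
        show "x2 + X a = (if (2::nat) = 2 then X a else 0) + (\<Sum>b\<in>{b \<in> A. sd b = 2}. X b)"
          using inv(1) inv(7) by simp
        show "z1 = (if (2::nat) = 1 then Z a else 0) + (\<Sum>b\<in>{b \<in> A. sd b = 1}. Z b)"
          using inv(1) inv(8) by simp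
        show "z2 + Z a = (if (2::nat) = 2 then Z a else 0) + (\<Sum>b\<in>{b \<in> A. sd b = 2}. Z b)"
          using inv(1) inv(9) by simp
        show "(r - 2) * length l \<le> Q * ((if 2 < (2::nat) then X a + Z a else 0) + (\<Sum>b\<in>{b \<in> A. 2 < sd b}. X b + Z b))"
          using inv(11) by simp
      qed
      ultimately show ?thesis using t a_def by simp
    qed
  qed
qed

section \<open>The completed distribution\<close>

definition split_fold ::
  "nat \<Rightarrow> nat \<Rightarrow> nat \<Rightarrow> (nat \<times> nat) list \<Rightarrow> (nat \<times> nat) list \<Rightarrow>
   (nat \<Rightarrow> nat) \<times> nat \<times> nat \<times> nat \<times> nat \<times> nat" where
  "split_fold n \<tau> Q l es = fold (split_step n \<tau> Q l) es (\<lambda>_. 0, 2, 0, 0, 0, 0)"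

lemma split_inv_fold:
  "split_inv n \<tau> Q l (near n \<tau> ` {e \<in> set es. touches n \<tau> e}) (split_fold n \<tau> Q l es)"
proof (induction es rule: rev_induct)
  case Nil
  then show ?case by (simp add: split_fold_def split_inv_def Let_def)
next
  case (snoc e es)
  have "(if touches n \<tau> e then insert (near n \<tau> e) (near n \<tau> ` {e \<in> set es. touches n \<tau> e})
      else near n \<tau> ` {e \<in> set es. touches n \<tau> e}) = near n \<tau> ` {e' \<in> set (es @ [e]). touches n \<tau> e'}"
    by auto
  with split_inv_step[OF snoc, of e] show ?case by (simp add: split_fold_def)
qed

text \<open>Edges joining class \<tau> to the next class are those avoiding \<tau> + 2 (mod 3), and
  conversely. The last condition thus says that parts 1 and 2 differ by at most length / sqrt Q in
  each of the two edge classes at \<tau>. All further parts have a single vertex in class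
  \<tau>.\<close>

definition good_split :: "nat \<Rightarrow> nat \<Rightarrow> nat \<Rightarrow> (nat \<times> nat) list \<Rightarrow> nat \<Rightarrow> (nat \<Rightarrow> nat) \<Rightarrow> bool" where
  "good_split n \<tau> Q l r sd \<longleftrightarrow> 2 \<le> r \<and> r \<le> Q + 2 \<and>
     (\<forall>e\<in>set l. touches n \<tau> e \<longrightarrow> sd (near n \<tau> e) \<in> {1..r}) \<and>
     (\<forall>i. 2 < i \<longrightarrow> i \<le> r \<longrightarrow> single n \<tau> (part n \<tau> sd i l)) \<and>
     ((real (avoiding n ((\<tau> + 2) mod 3) (part n \<tau> sd 1 l)) - real (avoiding n ((\<tau> + 2) mod 3) (part n \<tau> sd 2 l)))\<^sup>2 +
      (real (avoiding n ((\<tau> + 1) mod 3) (part n \<tau> sd 1 l)) - real (avoiding n ((\<tau> + 1) mod 3) (part n \<tau> sd 2 l)))\<^sup>2)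
       * real Q \<le> (real (length l))\<^sup>2"

lemma avoiding_part:
  assumes "tripartite n l" "\<tau> < 3" "\<sigma> = (\<tau> + 1) mod 3 \<and> \<sigma>' = (\<tau> + 2) mod 3 \<or> \<sigma> = (\<tau> + 2) mod 3 \<and> \<sigma>' = (\<tau> + 1) mod 3"
  shows "avoiding n \<sigma>' (part n \<tau> sd i l) =
    length (filter (\<lambda>e. (touches n \<tau> e \<and> far n \<tau> e div n = \<sigma>) \<and> sd (near n \<tau> e) = i) l)"
proof -
  have "(\<not> touches n \<sigma>' e \<and> (touches n \<tau> e \<longrightarrow> sd (near n \<tau> e) = i)) =
      ((touches n \<tau> e \<and> far n \<tau> e div n = \<sigma>) \<and> sd (near n \<tau> e) = i)" if "e \<in> set l" for e
  proof -
    have "\<not> touches n \<sigma>' e \<longleftrightarrow> touches n \<tau> e \<and> far n \<tau> e div n = \<sigma>"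
      using class_cases[OF assms(2) tripartite_edge(4,5)[OF assms(1) that]] tripartite_edge(3)[OF assms(1) that] assms(3)
      unfolding touches_def far_def by (elim disjE conjE) simp_all
    then show ?thesis by blast
  qed
  then show ?thesis unfolding avoiding_def part_def filter_filter by (intro arg_cong[of _ _ length] filter_cong) auto
qed

lemma sum_deg_part:
  assumes "A = near n \<tau> ` {e \<in> set l. touches n \<tau> e}" "finite A"
  shows "(\<Sum>a\<in>{a \<in> A. sd a = i}. deg n \<tau> \<sigma> l a) =
    length (filter (\<lambda>e. (touches n \<tau> e \<and> far n \<tau> e div n = \<sigma>) \<and> sd (near n \<tau> e) = i) l)"
proof -
  have "length (filter (\<lambda>e. (touches n \<tau> e \<and> far n \<tau> e div n = \<sigma>) \<and> sd (near n \<tau> e) = i) l) =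
    (\<Sum>a\<in>{a \<in> A. sd a = i}. length (filter (\<lambda>e. ((touches n \<tau> e \<and> far n \<tau> e div n = \<sigma>) \<and> sd (near n \<tau> e) = i) \<and> near n \<tau> e = a) l))"
    using assms by (intro length_filter_sum) auto
  also have "\<dots> = (\<Sum>a\<in>{a \<in> A. sd a = i}. deg n \<tau> \<sigma> l a)"
    unfolding deg_def by (intro sum.cong arg_cong[of _ _ length] filter_cong) auto
  finally show ?thesis ..
qed

lemma sum_deg_le:
  assumes "A = near n \<tau> ` {e \<in> set l. touches n \<tau> e}" "finite A" "\<sigma> \<noteq> \<sigma>'" "B \<subseteq> A"
  shows "(\<Sum>a\<in>B. deg n \<tau> \<sigma> l a + deg n \<tau> \<sigma>' l a) \<le> length l"
proof -
  have "(\<Sum>a\<in>B. deg n \<tau> \<sigma> l a + deg n \<tau> \<sigma>' l a) \<le> (\<Sum>a\<in>A. deg n \<tau> \<sigma> l a + deg n \<tau> \<sigma>' l a)"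
    using assms by (intro sum_mono2) auto
  also have "\<dots> = length (filter (\<lambda>e. touches n \<tau> e \<and> far n \<tau> e div n = \<sigma>) l) +
      length (filter (\<lambda>e. touches n \<tau> e \<and> far n \<tau> e div n = \<sigma>') l)"
    unfolding sum.distrib deg_def using assms by (subst (1 2) length_filter_sum[where A = A and f = "near n \<tau>"]) auto
  also have "\<dots> \<le> length l"
    using assms(3) by (induction l) auto
  finally show ?thesis .
qed

lemma good_split_fold:
  assumes "tripartite n l" "\<tau> < 3" "l \<noteq> []" "split_fold n \<tau> Q l l = (sd, r, x1, x2, z1, z2)"
  shows "good_split n \<tau> Q l r sd"
proof -
  let ?\<sigma> = "(\<tau> + 1) mod 3" and ?\<sigma>' = "(\<tau> + 2) mod 3"
  define A where "A = near n \<tau> ` {e \<in> set l. touches n \<tau> e}"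
  define X where "X = deg n \<tau> ?\<sigma> l"
  define Z where "Z = deg n \<tau> ?\<sigma>' l"
  have fin: "finite A" by (simp add: A_def)
  have ne: "?\<sigma> \<noteq> ?\<sigma>'" by presburger
  have inv: "2 \<le> r" "\<And>a. sd a \<noteq> 0 \<longleftrightarrow> a \<in> A" "\<And>a. sd a \<le> r"
    "\<And>a b. sd a = sd b \<Longrightarrow> 2 < sd a \<Longrightarrow> a = b" "\<And>i. 2 < i \<Longrightarrow> i \<le> r \<Longrightarrow> \<exists>a\<in>A. sd a = i"
    "x1 = (\<Sum>a\<in>{a \<in> A. sd a = 1}. X a)" "x2 = (\<Sum>a\<in>{a \<in> A. sd a = 2}. X a)"
    "z1 = (\<Sum>a\<in>{a \<in> A. sd a = 1}. Z a)" "z2 = (\<Sum>a\<in>{a \<in> A. sd a = 2}. Z a)"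
    "((real x1 - real x2)\<^sup>2 + (real z1 - real z2)\<^sup>2) * real Q \<le>
       real (length l) * (\<Sum>a\<in>{a \<in> A. sd a \<le> 2}. real (X a + Z a))"
    "(r - 2) * length l \<le> Q * (\<Sum>a\<in>{a \<in> A. 2 < sd a}. X a + Z a)"
    using split_inv_fold[of n \<tau> Q l l] unfolding assms(4) split_inv_def X_def Z_def A_def Let_def prod.case by blast+
  have ap:
    "avoiding n ?\<sigma>' (part n \<tau> sd i l) = length (filter (\<lambda>e. (touches n \<tau> e \<and> far n \<tau> e div n = ?\<sigma>) \<and> sd (near n \<tau> e) = i) l)"
    "avoiding n ?\<sigma> (part n \<tau> sd i l) = length (filter (\<lambda>e. (touches n \<tau> e \<and> far n \<tau> e div n = ?\<sigma>') \<and> sd (near n \<tau> e) = i) l)" for i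
    by (rule avoiding_part[OF assms(1,2)], simp)+
  have sums: "x1 = avoiding n ?\<sigma>' (part n \<tau> sd 1 l)" "x2 = avoiding n ?\<sigma>' (part n \<tau> sd 2 l)"
    "z1 = avoiding n ?\<sigma> (part n \<tau> sd 1 l)" "z2 = avoiding n ?\<sigma> (part n \<tau> sd 2 l)"
    unfolding inv X_def Z_def sum_deg_part[OF A_def fin] ap by (rule refl)+
  have le: "(\<Sum>a\<in>B. X a + Z a) \<le> length l" if "B \<subseteq> A" for B
    unfolding X_def Z_def using sum_deg_le[OF A_def fin ne that] .
  \<comment> \<open>The degrees of heavy vertices add up to at most the number of edges, so there
    are at most Q of them.\<close>
  have "(r - 2) * length l \<le> Q * length l"
    by (rule order_trans[OF inv(11) mult_le_mono2[OF le]]) auto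
  with assms(3) have "r \<le> Q + 2" by simp
  moreover have "sd (near n \<tau> e) \<in> {1..r}" if "e \<in> set l" "touches n \<tau> e" for e
  proof -
    have "near n \<tau> e \<in> A" using that by (auto simp: A_def)
    then show ?thesis using inv(2)[of "near n \<tau> e"] inv(3)[of "near n \<tau> e"] by auto
  qed
  moreover have "single n \<tau> (part n \<tau> sd i l)" if "2 < i" "i \<le> r" for i
  proof -
    from inv(5)[OF that] obtain e where e: "e \<in> set l" "touches n \<tau> e" "sd (near n \<tau> e) = i"
      by (auto simp: A_def)
    have "near n \<tau> e' = near n \<tau> e" if "sd (near n \<tau> e') = i" for e'
      using inv(4)[of "near n \<tau> e'" "near n \<tau> e"] that \<open>2 < i\<close> e(3) by simp
    moreover have "sd (near n \<tau> e') = i" if "e' \<in> set (part n \<tau> sd i l)" "touches n \<tau> e'" for e'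
      using that by (simp add: part_def)
    moreover have "e \<in> set (part n \<tau> sd i l)" using e by (simp add: part_def)
    ultimately show ?thesis unfolding single_def using e(2) by blast
  qed
  moreover have "((real x1 - real x2)\<^sup>2 + (real z1 - real z2)\<^sup>2) * real Q \<le> (real (length l))\<^sup>2"
  proof -
    have "(\<Sum>a\<in>{a \<in> A. sd a \<le> 2}. real (X a + Z a)) \<le> real (length l)"
      using le[of "{a \<in> A. sd a \<le> 2}"] unfolding of_nat_sum[symmetric] of_nat_le_iff by blast
    then have "real (length l) * (\<Sum>a\<in>{a \<in> A. sd a \<le> 2}. real (X a + Z a)) \<le> real (length l) * real (length l)"
      by (rule mult_left_mono) simp
    with inv(10) show ?thesis by (simp add: power2_eq_square)
  qed
  ultimately show ?thesis using inv(1) unfolding good_split_def sums by blast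
qed

text \<open>The factor by which sizes shrink per level. Each of the three edge classes is halved by
  two out of three consecutive splits, so three levels yield a factor 1/4.\<close>

definition mu :: real where "mu = root 3 (1 / 4)"

lemma mu_cube: "mu ^ 3 = 1 / 4"
  unfolding mu_def by (rule real_root_pow_pos2) simp_all

lemma mu_bounds: "1 / 2 \<le> mu" "mu\<^sup>2 \<le> 1 / 2" "mu < 1"
proof -
  have pos: "0 \<le> mu" by (simp add: mu_def)
  have "(1 / 2) ^ 3 \<le> mu ^ 3" unfolding mu_cube by (simp add: power3_eq_cube)
  then show "1 / 2 \<le> mu" using power_mono_iff[of "1 / 2" mu 3] pos by simp
  have "(mu\<^sup>2) ^ 3 = (mu ^ 3)\<^sup>2" by (simp only: power_mult[symmetric] mult.commute)
  also have "\<dots> \<le> (1 / 2) ^ 3" unfolding mu_cube by (simp add: power2_eq_square power3_eq_cube)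
  finally show "mu\<^sup>2 \<le> 1 / 2" using power_mono_iff[of "mu\<^sup>2" "1 / 2" 3] by simp
  show "mu < 1" by (rule power_less_imp_less_base[of _ 3]) (simp_all add: mu_cube)
qed

text \<open>The sizes of the three edge classes of a subproblem, starting with the one that has been split
  least recently. Splitting halves the first and the third class, and rotates the classes, so that the
  bounds shrink by the factor \<open>mu\<close>: indeed \<open>2 * mu\<^sup>2 / 2 = mu * mu\<close> and \<open>1 / 2 = mu * (2 * mu\<^sup>2)\<close>.\<close>

definition small :: "real \<Rightarrow> nat \<Rightarrow> nat \<Rightarrow> (nat \<times> nat) list \<Rightarrow> bool" where
  "small N n \<tau> l \<longleftrightarrow> real (avoiding n ((\<tau> + 2) mod 3) l) \<le> N \<and> real (avoiding n \<tau> l) \<le> mu * N \<and>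
     real (avoiding n ((\<tau> + 1) mod 3) l) \<le> 2 * mu\<^sup>2 * N"

lemma small_length:
  assumes "tripartite n l" "\<tau> < 3" "small N n \<tau> l"
  shows "real (length l) \<le> 3 * N"
proof -
  have N: "0 \<le> N" using assms(3) unfolding small_def by (meson of_nat_0_le_iff order_trans)
  have "mu * N \<le> 1 * N" "2 * mu\<^sup>2 * N \<le> 1 * N"
    using mult_right_mono[of mu 1 N] mult_right_mono[of "2 * mu\<^sup>2" 1 N] mu_bounds N by simp_all
  then show ?thesis using assms(3) unfolding small_def length_classes[OF assms(1,2)] by simp
qed

lemma part_const: "part n \<tau> (\<lambda>_. i) i l = l"
  by (simp add: part_def)

text \<open>The edges at heavy vertices lie in neither of the two parts, hence only an
  inequality.\<close>

lemma avoiding_parts: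
  assumes "tripartite n l" "\<tau> < 3" "\<sigma> = (\<tau> + 1) mod 3 \<or> \<sigma> = (\<tau> + 2) mod 3"
  shows "avoiding n \<sigma> (part n \<tau> sd 1 l) + avoiding n \<sigma> (part n \<tau> sd 2 l) \<le> avoiding n \<sigma> l"
proof -
  obtain \<sigma>' where s: "\<sigma>' = (\<tau> + 1) mod 3 \<and> \<sigma> = (\<tau> + 2) mod 3 \<or> \<sigma>' = (\<tau> + 2) mod 3 \<and> \<sigma> = (\<tau> + 1) mod 3"
    using assms(3) by blast
  have *: "avoiding n \<sigma> l = length (filter (\<lambda>e. (touches n \<tau> e \<and> far n \<tau> e div n = \<sigma>')) l)"
    using avoiding_part[OF assms(1,2) s, of "\<lambda>_. 0" 0] by (simp add: part_const)
  have "length (filter (\<lambda>e. P e \<and> f e = 1) l) + length (filter (\<lambda>e. P e \<and> f e = (2::nat)) l) \<le> length (filter P l)"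
    for P f by (induction l) auto
  then show ?thesis unfolding avoiding_part[OF assms(1,2) s] * .
qed

lemma avoiding_part_le: "avoiding n \<sigma> (part n \<tau> sd i l) \<le> avoiding n \<sigma> l"
  unfolding avoiding_def part_def by (induction l) auto

text \<open>The origin of the constant 36: as there are at most 3 * N edges, the threshold (6 *
  Lr)^2 bounds the imbalance by N / (2 * Lr), and half of it is the excess of the larger part over U
  / 2.\<close>

lemma half_plus_error:
  fixes u1 u2 U N Lr S len :: real
  assumes "u1 + u2 \<le> U" "((u1 - u2)\<^sup>2 + S) * (36 * Lr\<^sup>2) \<le> len\<^sup>2" "0 \<le> S" "len \<le> 3 * N" "0 \<le> len" "0 < Lr"
  shows "u1 \<le> U / 2 + N / (4 * Lr)" "u2 \<le> U / 2 + N / (4 * Lr)"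
proof -
  have "0 \<le> S * (36 * Lr\<^sup>2)" using assms by simp
  then have "(u1 - u2)\<^sup>2 * (36 * Lr\<^sup>2) \<le> len\<^sup>2" using assms(2) by (simp add: distrib_right)
  also have "\<dots> \<le> (3 * N)\<^sup>2" using assms by (intro power_mono)
  finally have "((u1 - u2) * (6 * Lr))\<^sup>2 \<le> (3 * N)\<^sup>2" by (simp add: power_mult_distrib)
  then have "\<bar>(u1 - u2) * (6 * Lr)\<bar> \<le> \<bar>3 * N\<bar>" by (rule abs_le_square_iff[THEN iffD2])
  then have "\<bar>(u1 - u2) * (6 * Lr)\<bar> \<le> 3 * N" using assms(4,5) by simp
  then have "\<bar>u1 - u2\<bar> * (6 * Lr) \<le> 3 * N" using assms(6) by (simp add: abs_mult)
  then have "\<bar>u1 - u2\<bar> \<le> N / (2 * Lr)" using assms(6) by (simp add: field_simps)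
  moreover have "N / (4 * Lr) = N / (2 * Lr) / 2" by simp
  ultimately show "u1 \<le> U / 2 + N / (4 * Lr)" "u2 \<le> U / 2 + N / (4 * Lr)" using assms(1) by linarith+
qed

text \<open>The edge class avoiding \<tau> is not touched by the split and takes over the leading
  position in the rotation. The other two are halved up to the error N / (4 * L), which the factor 1
  + 1/L absorbs.\<close>

lemma small_part:
  assumes "tripartite n l" "\<tau> < 3" "small N n \<tau> l" "good_split n \<tau> (36 * L\<^sup>2) l r sd" "0 < L" "i = 1 \<or> i = 2"
  shows "small ((1 + 1 / real L) * mu * N) n ((\<tau> + 1) mod 3) (part n \<tau> sd i l)"
proof -
  let ?a = "avoiding n ((\<tau> + 2) mod 3)" and ?b = "avoiding n ((\<tau> + 1) mod 3)"
  have s: "real (?a l) \<le> N" "real (avoiding n \<tau> l) \<le> mu * N" "real (?b l) \<le> 2 * mu\<^sup>2 * N"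
    using assms(3) by (auto simp: small_def)
  have N: "0 \<le> N" using s(1) by (meson of_nat_0_le_iff order_trans)
  have len: "real (length l) \<le> 3 * N" by (rule small_length[OF assms(1-3)])
  have g: "((real (?a (part n \<tau> sd 1 l)) - real (?a (part n \<tau> sd 2 l)))\<^sup>2 +
      (real (?b (part n \<tau> sd 1 l)) - real (?b (part n \<tau> sd 2 l)))\<^sup>2) * (36 * (real L)\<^sup>2) \<le> (real (length l))\<^sup>2"
    using assms(4) unfolding good_split_def by simp
  then have g': "((real (?b (part n \<tau> sd 1 l)) - real (?b (part n \<tau> sd 2 l)))\<^sup>2 +
      (real (?a (part n \<tau> sd 1 l)) - real (?a (part n \<tau> sd 2 l)))\<^sup>2) * (36 * (real L)\<^sup>2) \<le> (real (length l))\<^sup>2"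
    by (simp only: add.commute)
  have ab: "real (?a (part n \<tau> sd 1 l)) + real (?a (part n \<tau> sd 2 l)) \<le> N"
    "real (?b (part n \<tau> sd 1 l)) + real (?b (part n \<tau> sd 2 l)) \<le> 2 * mu\<^sup>2 * N"
    using of_nat_mono[OF avoiding_parts[OF assms(1,2) disjI2[OF refl], of sd], where 'a = real] s(1)
      of_nat_mono[OF avoiding_parts[OF assms(1,2) disjI1[OF refl], of sd], where 'a = real] s(3)
    unfolding of_nat_add by linarith+
  have a: "real (?a (part n \<tau> sd i l)) \<le> N / 2 + N / (4 * real L)"
    using half_plus_error[OF ab(1) g _ len] assms(5,6) by auto
  have b: "real (?b (part n \<tau> sd i l)) \<le> 2 * mu\<^sup>2 * N / 2 + N / (4 * real L)"
    using half_plus_error[OF ab(2) g' _ len] assms(5,6) by auto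
  have m: "((\<tau> + 1) mod 3 + 2) mod 3 = \<tau>" "((\<tau> + 1) mod 3 + 1) mod 3 = (\<tau> + 2) mod 3" using assms(2) by presburger+
  have mu4: "1 / 4 \<le> mu\<^sup>2" using power_mono[OF mu_bounds(1), of 2] by (simp add: power2_eq_square)
  show ?thesis unfolding small_def m
  proof (intro conjI)
    have "real (avoiding n \<tau> (part n \<tau> sd i l)) \<le> mu * N"
      using avoiding_part_le[of n \<tau> \<tau> sd i l] s(2) by linarith
    also have "\<dots> \<le> (1 + 1 / real L) * (mu * N)"
      using N mu_bounds by (simp add: distrib_right)
    finally show "real (avoiding n \<tau> (part n \<tau> sd i l)) \<le> (1 + 1 / real L) * mu * N" by (simp only: mult.assoc)
    \<comment> \<open>Since mu \<ge> 1/2, the error is at most a fraction 1/L of mu^2 * N, the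
      halved bound of this class.\<close>
    have "N / (4 * real L) = 1 / 4 * (N / real L)" by simp
    also have "\<dots> \<le> mu\<^sup>2 * (N / real L)" using mu4 N by (intro mult_right_mono) auto
    finally have "real (?b (part n \<tau> sd i l)) \<le> mu\<^sup>2 * N + mu\<^sup>2 * (N / real L)" using b by simp
    also have "\<dots> = mu * ((1 + 1 / real L) * mu * N)" by (simp add: power2_eq_square algebra_simps)
    finally show "real (?b (part n \<tau> sd i l)) \<le> mu * ((1 + 1 / real L) * mu * N)" .
    \<comment> \<open>The halved leading class is bounded by N / 2 = 2 * mu^3 * N, and the relative
      error is again below 1/L.\<close>
    have "N / (4 * real L) \<le> N / (2 * real L)" using N assms(5) by (intro divide_left_mono) auto
    with a have "real (?a (part n \<tau> sd i l)) \<le> 2 * mu ^ 3 * ((1 + 1 / real L) * N)"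
      by (simp add: mu_cube algebra_simps add_divide_distrib)
    also have "\<dots> = 2 * mu\<^sup>2 * ((1 + 1 / real L) * mu * N)" by (simp add: power2_eq_square power3_eq_cube)
    finally show "real (?a (part n \<tau> sd i l)) \<le> 2 * mu\<^sup>2 * ((1 + 1 / real L) * mu * N)" .
  qed
qed

section \<open>The search tree\<close>

text \<open>A level, a flag and an edge list. Flagged nodes are the parts of heavy vertices and are
  never split.\<close>

type_synonym node = "nat \<times> bool \<times> (nat \<times> nat) list"

text \<open>At the root, m / mu is the least N for which three edge classes of m edges each satisfy
  \<open>small\<close>; the binding condition is m \<le> mu * N.\<close>

definition level_bound :: "nat \<Rightarrow> nat \<Rightarrow> nat \<Rightarrow> real" where
  "level_bound m L h = real m / mu * ((1 + 1 / real L) * mu) ^ h"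

text \<open>The class to be split at level h is h mod 3. Hence (h + 2) mod 3 is the class that was
  split to obtain the node, in which a flagged node has only one vertex.\<close>

definition node_ok :: "nat \<Rightarrow> nat \<Rightarrow> nat \<Rightarrow> node \<Rightarrow> bool" where
  "node_ok n m L = (\<lambda>(h, f, l). tripartite n l \<and> length l \<le> 3 * m \<and> h \<le> L \<and>
     (if f then single n ((h + 2) mod 3) l else small (level_bound m L h) n (h mod 3) l))"

definition level_sum :: "nat \<Rightarrow> (nat \<times> nat) list \<Rightarrow> nat" where
  "level_sum h act = (\<Sum>(h', k)\<leftarrow>act. if h' = h then k else 0)"

definition level_count :: "nat \<Rightarrow> (nat \<times> nat) list \<Rightarrow> nat" where
  "level_count h act = length (filter (\<lambda>(h', k). h' = h) act)"

text \<open>Only unflagged nodes count, since only these can be split and contribute to the growth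
  of the tree.\<close>

definition node_count :: "nat \<Rightarrow> node list \<Rightarrow> nat" where
  "node_count h ns = length (filter (\<lambda>(h', f, l). h' = h \<and> \<not> f) ns)"

definition triangles_above :: "nat \<Rightarrow> node list \<Rightarrow> nat" where
  "triangles_above h ns = (\<Sum>(h', f, l)\<leftarrow>ns. if h < h' then card (triangles (edge_set l)) else 0)"

definition nodes_with :: "nat set \<Rightarrow> node list \<Rightarrow> nat" where
  "nodes_with T ns = length (filter (\<lambda>(h, f, l). T \<in> triangles (edge_set l)) ns)"

text \<open>The stack \<open>ns\<close> of subproblems of the depth-first search, the list \<open>Ts\<close> of triangles found, the
  levels and sizes \<open>act\<close> of the subproblems split so far, and the sizes \<open>done\<close> of all subproblems processed so
  far. If \<open>rich\<close> holds, then only subproblems with at least as many triangles as edges are split. Since the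
  levels increase towards the top of the stack, before a subproblem of level \<open>h\<close> is processed all triangles
  of the previously split subproblems of this level have been listed.\<close>

definition search_inv ::
  "nat \<Rightarrow> nat \<Rightarrow> nat \<Rightarrow> nat \<Rightarrow> bool \<Rightarrow> (nat \<times> nat) list \<Rightarrow>
   node list \<Rightarrow> nat set list \<Rightarrow> (nat \<times> nat) list \<Rightarrow> nat list \<Rightarrow> bool" where
  "search_inv n m L t rich l0 ns Ts act done \<longleftrightarrow>
     (\<forall>x\<in>set ns. node_ok n m L x) \<and> sorted (map fst ns) \<and>
     (\<forall>T. count_list Ts T + nodes_with T ns = of_bool (T \<in> triangles (edge_set l0))) \<and>
     (\<forall>(h, k)\<in>set act. h < L \<and> 1 \<le> k \<and> real k \<le> 3 * level_bound m L h) \<and>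
     (rich \<longrightarrow> (\<forall>h. level_sum h act \<le> length Ts + triangles_above h ns)) \<and>
     (rich \<longrightarrow> (\<forall>h. real (level_sum h act) \<le> real t + 3 * level_bound m L h)) \<and>
     level_count 0 act + node_count 0 ns \<le> 1 \<and>
     (\<forall>h. level_count (Suc h) act + node_count (Suc h) ns \<le> 2 * level_count h act) \<and>
     (\<forall>\<phi>::nat \<Rightarrow> real. mono \<phi> \<longrightarrow> (\<forall>x. 0 \<le> \<phi> x) \<longrightarrow>
        (\<Sum>k\<leftarrow>done. \<phi> k) + (\<Sum>(h, f, l)\<leftarrow>ns. \<phi> (length l)) \<le>
          \<phi> (length l0) + (36 * (real L)\<^sup>2 + 2) * (\<Sum>(h, k)\<leftarrow>act. \<phi> k))"

lemma nodes_with_append: "nodes_with T (ns @ ns') = nodes_with T ns + nodes_with T ns'"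
  by (simp add: nodes_with_def)

lemma nodes_with_single: "nodes_with T [(h, f, l)] = of_bool (T \<in> triangles (edge_set l))"
  by (cases "T \<in> triangles (edge_set l)") (simp_all add: nodes_with_def)

lemma level_bound_nonneg: "0 \<le> level_bound m L h"
  using mu_bounds by (simp add: level_bound_def)

lemma level_bound_Suc: "level_bound m L (Suc h) = (1 + 1 / real L) * mu * level_bound m L h"
  by (simp add: level_bound_def)

lemma search_inv_init:
  assumes "tripartite n l0" "length l0 = 3 * m"
    "\<And>\<sigma>. \<sigma> < 3 \<Longrightarrow> avoiding n \<sigma> l0 = m"
  shows "search_inv n m L t rich l0 [(0, False, l0)] [] [] []"
proof -
  have "small (real m / mu) n 0 l0"
  proof -
    have "real m \<le> real m / mu"
      using mu_bounds by (simp add: le_divide_eq mult_left_le)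
    moreover have "2 * mu\<^sup>2 * (real m / mu) = 2 * mu * real m"
      using mu_bounds by (simp add: power2_eq_square)
    moreover have "1 * real m \<le> 2 * mu * real m" using mu_bounds by (intro mult_right_mono) auto
    ultimately show ?thesis using mu_bounds assms(3) by (simp add: small_def)
  qed
  moreover have "level_bound m L 0 = real m / mu" by (simp add: level_bound_def)
  moreover have "0 \<le> real t + 3 * level_bound m L h" for h using level_bound_nonneg[of m L h] by simp
  ultimately show ?thesis using assms
    by (simp add: search_inv_def node_ok_def level_sum_def level_count_def node_count_def nodes_with_def
      triangles_above_def)
qed

lemma search_invD:
  assumes "search_inv n m L t rich l0 ns Ts act done"
  shows "\<And>x. x \<in> set ns \<Longrightarrow> node_ok n m L x" "sorted (map fst ns)"
    "\<And>T. count_list Ts T + nodes_with T ns = of_bool (T \<in> triangles (edge_set l0))"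
    "\<And>h k. (h, k) \<in> set act \<Longrightarrow> h < L \<and> 1 \<le> k \<and> real k \<le> 3 * level_bound m L h"
    "\<And>h. rich \<Longrightarrow> level_sum h act \<le> length Ts + triangles_above h ns"
    "\<And>h. rich \<Longrightarrow> real (level_sum h act) \<le> real t + 3 * level_bound m L h"
    "level_count 0 act + node_count 0 ns \<le> 1"
    "\<And>h. level_count (Suc h) act + node_count (Suc h) ns \<le> 2 * level_count h act"
    "\<And>\<phi>::nat \<Rightarrow> real. mono \<phi> \<Longrightarrow> (\<And>x. 0 \<le> \<phi> x) \<Longrightarrow>
        (\<Sum>k\<leftarrow>done. \<phi> k) + (\<Sum>(h, f, l)\<leftarrow>ns. \<phi> (length l)) \<le>
          \<phi> (length l0) + (36 * (real L)\<^sup>2 + 2) * (\<Sum>(h, k)\<leftarrow>act. \<phi> k)"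
  using assms unfolding search_inv_def by (blast+)

text \<open>The triangles of the removed node move from the stack into the list. This preserves the
  multiplicity of each triangle as well as the bound on \<open>level_sum\<close>.\<close>

lemma search_inv_complete:
  assumes "search_inv n m L t rich l0 (ns @ [(h, f, l)]) Ts act done"
    and "distinct Ls" "set Ls = triangles (edge_set l)"
  shows "search_inv n m L t rich l0 ns (Ts @ Ls) act (done @ [length l])"
proof -
  note I = search_invD[OF assms(1)]
  have len: "length Ls = card (triangles (edge_set l))"
    using distinct_card[OF assms(2)] assms(3) by simp
  have cnt: "count_list Ls T = of_bool (T \<in> triangles (edge_set l))" for T
    using assms(2) unfolding assms(3)[symmetric] by (induction Ls) auto
  show ?thesis unfolding search_inv_def
  proof (intro conjI ballI allI impI)
    show "node_ok n m L x" if "x \<in> set ns" for x using that I(1) by simp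
    show "sorted (map fst ns)" using I(2) by (simp add: sorted_append)
    show "count_list (Ts @ Ls) T + nodes_with T ns = of_bool (T \<in> triangles (edge_set l0))" for T
      using I(3)[of T] by (simp add: nodes_with_append nodes_with_single cnt)
    show "case x of (h, k) \<Rightarrow> h < L \<and> 1 \<le> k \<and> real k \<le> 3 * level_bound m L h" if "x \<in> set act" for x
      using I(4) that by (cases x) simp
    show "level_sum h' act \<le> length (Ts @ Ls) + triangles_above h' ns" if rich for h'
      using I(5)[OF that, of h'] by (simp add: triangles_above_def len split: if_splits)
    show "real (level_sum h' act) \<le> real t + 3 * level_bound m L h'" if rich for h'
      by (rule I(6)[OF that])
    show "level_count 0 act + node_count 0 ns \<le> 1" using I(7) by (simp add: node_count_def)
    show "level_count (Suc h') act + node_count (Suc h') ns \<le> 2 * level_count h' act" for h'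
      using I(8)[of h'] by (simp add: node_count_def)
    show "(\<Sum>k\<leftarrow>done @ [length l]. \<phi> k) + (\<Sum>(h, f, l)\<leftarrow>ns. \<phi> (length l)) \<le>
          \<phi> (length l0) + (36 * (real L)\<^sup>2 + 2) * (\<Sum>(h, k)\<leftarrow>act. \<phi> k)"
      if "mono \<phi>" "\<forall>x. 0 \<le> \<phi> x" for \<phi> :: "nat \<Rightarrow> real"
      using I(9)[of \<phi>] that by simp
  qed
qed

definition children :: "nat \<Rightarrow> nat \<Rightarrow> nat \<Rightarrow> (nat \<Rightarrow> nat) \<Rightarrow> (nat \<times> nat) list \<Rightarrow> node list" where
  "children n h r sd l = map (\<lambda>i. (Suc h, 2 < i, part n (h mod 3) sd i l)) [1..<Suc r]"

lemma sum_list_card_filter: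
  assumes "finite S" "\<And>i. i \<in> set xs \<Longrightarrow> A i \<subseteq> S"
  shows "(\<Sum>i\<leftarrow>xs. card (A i)) = (\<Sum>T\<in>S. length (filter (\<lambda>i. T \<in> A i) xs))"
  using assms(2)
proof (induction xs)
  case (Cons i xs)
  have "A i \<subseteq> S" using Cons.prems by simp
  then have "card (A i) = (\<Sum>T\<in>S. of_bool (T \<in> A i))"
    using assms(1) by (simp add: Int_absorb1 Int_commute flip: sum.inter_restrict)
  then show ?case using Cons by (simp add: sum.distrib[symmetric] of_bool_def if_distrib cong: if_cong) (intro sum.cong; simp)
qed simp

text \<open>A split adds the node to \<open>act\<close> and replaces it by children that share its
  triangles among themselves. If it had at least as many triangles as edges, these triangles, now
  lying above its level, pay for its size. The charging clause survives because there are at most 36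
  * L^2 + 2 children, none larger than the node.\<close>

lemma search_inv_split:
  assumes "search_inv n m L t rich l0 (ns @ [(h, False, l)]) Ts act done"
    and "l \<noteq> []" "rich \<Longrightarrow> length l \<le> card (triangles (edge_set l))" "length Ts < t"
    and "good_split n (h mod 3) (36 * L\<^sup>2) l r sd" "0 < L" "3 * level_bound m L L < 1"
  shows "search_inv n m L t rich l0 (ns @ children n h r sd l) Ts (act @ [(h, length l)]) (done @ [length l])"
proof -
  note I = search_invD[OF assms(1)]
  note part_def [simp del] upt_Suc [simp del]
  define \<tau> where "\<tau> = h mod 3"
  have \<tau>: "\<tau> < 3" by (simp add: \<tau>_def)
  have node: "tripartite n l" "h \<le> L" "small (level_bound m L h) n \<tau> l" "length l \<le> 3 * m"
    using I(1)[of "(h, False, l)"] by (auto simp: node_ok_def \<tau>_def)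
  have plen: "length (part n \<tau> sd i l) \<le> 3 * m" for i
    using node(4) length_filter_le[of _ l] unfolding part_def by (rule order_trans[rotated])
  have len: "real (length l) \<le> 3 * level_bound m L h" by (rule small_length[OF node(1) \<tau> node(3)])
  have len1: "1 \<le> length l" using assms(2) by (simp add: Suc_le_eq)
  \<comment> \<open>L is chosen so that a node of the last level would have less than one edge,
    whereas l is nonempty. So the children still have level at most L.\<close>
  have "h \<noteq> L" using len len1 assms(7) by (intro notI) simp
  with node(2) have hL: "h < L" by simp
  have gs: "2 \<le> r" "real r \<le> 36 * (real L)\<^sup>2 + 2" "\<And>e. e \<in> set l \<Longrightarrow> touches n \<tau> e \<Longrightarrow> sd (near n \<tau> e) \<in> {1..r}"
    "\<And>i. 2 < i \<Longrightarrow> i \<le> r \<Longrightarrow> single n \<tau> (part n \<tau> sd i l)"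
  proof -
    have "r \<le> 36 * L\<^sup>2 + 2" using assms(5) unfolding good_split_def by blast
    then have "real r \<le> real (36 * L\<^sup>2 + 2)" by (rule of_nat_mono)
    then show "real r \<le> 36 * (real L)\<^sup>2 + 2" by simp
  qed (use assms(5) in \<open>unfold good_split_def \<tau>_def, blast+\<close>)
  have ch: "children n h r sd l = map (\<lambda>i. (Suc h, 2 < i, part n \<tau> sd i l)) [1..<Suc r]"
    by (simp add: children_def \<tau>_def)
  have parts: "length (filter (\<lambda>i. T \<in> triangles (edge_set (part n \<tau> sd i l))) [1..<Suc r]) =
    of_bool (T \<in> triangles (edge_set l))" for T
    using gs(3) by (intro triangles_parts node(1) \<tau>)
  have cards: "(\<Sum>i\<leftarrow>[1..<Suc r]. card (triangles (edge_set (part n \<tau> sd i l)))) = card (triangles (edge_set l))"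
  proof -
    have "(\<Sum>i\<leftarrow>[1..<Suc r]. card (triangles (edge_set (part n \<tau> sd i l)))) = (\<Sum>T\<in>triangles (edge_set l).
        length (filter (\<lambda>i. T \<in> triangles (edge_set (part n \<tau> sd i l))) [1..<Suc r]))"
      by (rule sum_list_card_filter) (auto simp: triangles_part[OF node(1)])
    then show ?thesis unfolding parts by simp
  qed
  have sorted: "fst x \<le> h" if "x \<in> set ns" for x
    using I(2) that by (auto simp: sorted_append)
  show ?thesis unfolding search_inv_def
  proof (intro conjI ballI allI impI)
    fix x assume "x \<in> set (ns @ children n h r sd l)"
    then consider "x \<in> set ns" | i where "1 \<le> i" "i \<le> r" "x = (Suc h, 2 < i, part n \<tau> sd i l)"
      by (auto simp: ch)
    then show "node_ok n m L x"
    proof cases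
      case 1
      then show ?thesis using I(1) by simp
    next
      case 2
      have m3: "Suc h mod 3 = (\<tau> + 1) mod 3" "(Suc h + 2) mod 3 = \<tau>" unfolding \<tau>_def by presburger+
      show ?thesis
      proof (cases "2 < i")
        case True
        then show ?thesis using 2 gs(4)[of i] m3 hL plen tripartite_part[OF node(1)] by (simp add: node_ok_def)
      next
        case False
        then have "i = 1 \<or> i = 2" using 2(1) by linarith
        from small_part[OF node(1) \<tau> node(3) assms(5)[folded \<tau>_def] assms(6) this] False
        show ?thesis using 2 m3 hL plen tripartite_part[OF node(1)] by (simp add: node_ok_def level_bound_Suc)
      qed
    qed
  next
    show "sorted (map fst (ns @ children n h r sd l))"
      using I(2) sorted by (auto simp: sorted_append ch sorted_wrt_map comp_def map_replicate_const intro: le_SucI)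
  next
    fix T
    have "nodes_with T (children n h r sd l) = of_bool (T \<in> triangles (edge_set l))"
      using parts[of T] by (simp add: nodes_with_def ch filter_map comp_def)
    then show "count_list Ts T + nodes_with T (ns @ children n h r sd l) = of_bool (T \<in> triangles (edge_set l0))"
      using I(3)[of T] by (simp add: nodes_with_append nodes_with_single)
  next
    fix x assume "x \<in> set (act @ [(h, length l)])"
    then show "case x of (h, k) \<Rightarrow> h < L \<and> 1 \<le> k \<and> real k \<le> 3 * level_bound m L h"
      using I(4) hL len len1 by auto
  next
    fix h' assume r: rich
    \<comment> \<open>For h' = h the sum on the stack grows by all triangles of the node, matching
      the increase of \<open>level_sum\<close>; for other levels nothing changes.\<close>
    have "triangles_above h' (children n h r sd l) = (if h' < Suc h then card (triangles (edge_set l)) else 0)"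
      using cards by (simp add: triangles_above_def ch comp_def)
    then show "level_sum h' (act @ [(h, length l)]) \<le> length Ts + triangles_above h' (ns @ children n h r sd l)"
      using I(5)[OF r, of h'] assms(3)[OF r]
      by (auto simp: level_sum_def triangles_above_def split: if_splits)
  next
    fix h' assume r: rich
    show "real (level_sum h' (act @ [(h, length l)])) \<le> real t + 3 * level_bound m L h'"
    proof (cases "h' = h")
      case True
      \<comment> \<open>Nothing on the stack lies above level h, so what has been split on this
        level is bounded by the triangles already listed, fewer than t. Only the node itself is
        added on top.\<close>
      have "(case x of (h', f, l) \<Rightarrow> if h < h' then card (triangles (edge_set l)) else 0) = 0"
        if "x \<in> set ns" for x using sorted[OF that] by (cases x) simp
      then have "triangles_above h ns = (\<Sum>x\<leftarrow>ns. 0)"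
        unfolding triangles_above_def by (intro arg_cong[of _ _ sum_list] map_cong refl)
      then have "triangles_above h ns = 0" by simp
      then have "triangles_above h (ns @ [(h, False, l)]) = 0" by (simp add: triangles_above_def)
      then have "level_sum h act < t" using I(5)[OF r, of h] assms(4) by simp
      then show ?thesis using len True by (simp add: level_sum_def)
    next
      case False
      then show ?thesis using I(6)[OF r, of h'] by (simp add: level_sum_def)
    qed
  next
    show "level_count 0 (act @ [(h, length l)]) + node_count 0 (ns @ children n h r sd l) \<le> 1"
      using I(7) by (auto simp: level_count_def node_count_def ch filter_empty_conv)
  next
    fix h'
    have "node_count (Suc h') (children n h r sd l) \<le> (if h' = h then 2 else 0)"
    proof (cases "h' = h")
      case True
      \<comment> \<open>Precisely parts 1 and 2 are unflagged, so the number of nodes at most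
        doubles per level.\<close>
      have "filter (\<lambda>i. \<not> 2 < i) [1..<Suc r] = filter (\<lambda>i. \<not> 2 < i) ([1..<3] @ [3..<Suc r])"
        using gs(1) upt_add_eq_append[of 1 3 "r - 2"] by simp
      also have "[1..<3] = [1, 2 :: nat]" by (simp add: upt_conv_Cons)
      also have "filter (\<lambda>i. \<not> 2 < i) ([1, 2] @ [3..<Suc r]) = [1, 2]" by (simp add: filter_empty_conv)
      finally have "length (filter (\<lambda>i. \<not> 2 < i) [1..<Suc r]) = 2" by simp
      then show ?thesis using True by (simp add: node_count_def ch filter_map comp_def)
    qed (auto simp: node_count_def ch filter_empty_conv)
    then show "level_count (Suc h') (act @ [(h, length l)]) + node_count (Suc h') (ns @ children n h r sd l)
        \<le> 2 * level_count h' (act @ [(h, length l)])"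
      using I(8)[of h'] by (auto simp: level_count_def node_count_def split: if_splits)
  next
    fix \<phi> :: "nat \<Rightarrow> real" assume p: "mono \<phi>" "\<forall>x. 0 \<le> \<phi> x"
    have "length (part n \<tau> sd i l) \<le> length l" for i by (simp add: part_def)
    then have "\<phi> (length (part n \<tau> sd i l)) \<le> \<phi> (length l)" for i using p(1) by (simp add: monoD)
    then have "(\<Sum>i\<leftarrow>[1..<Suc r]. \<phi> (length (part n \<tau> sd i l))) \<le> (\<Sum>i\<leftarrow>[1..<Suc r]. \<phi> (length l))"
      by (intro sum_list_mono)
    also have "\<dots> = real r * \<phi> (length l)" by (simp add: sum_list_triv)
    also have "\<dots> \<le> (36 * (real L)\<^sup>2 + 2) * \<phi> (length l)" using gs(2) p(2) by (intro mult_right_mono) auto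
    finally have "(\<Sum>(h, f, l)\<leftarrow>children n h r sd l. \<phi> (length l)) \<le> (36 * (real L)\<^sup>2 + 2) * \<phi> (length l)"
      by (simp add: ch comp_def)
    then show "(\<Sum>k\<leftarrow>done @ [length l]. \<phi> k) + (\<Sum>(h, f, l)\<leftarrow>ns @ children n h r sd l. \<phi> (length l)) \<le>
          \<phi> (length l0) + (36 * (real L)\<^sup>2 + 2) * (\<Sum>(h, k)\<leftarrow>act @ [(h, length l)]. \<phi> k)"
      using I(9)[of \<phi>] p by (simp add: distrib_left)
  qed
qed

section \<open>Total cost of the search tree\<close>

lemma level_count_le:
  assumes "search_inv n m L t rich l0 ns Ts act done"
  shows "level_count h act \<le> 2 ^ h"
proof (induction h)
  case 0
  then show ?case using search_invD(7)[OF assms] by simp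
next
  case (Suc h)
  then show ?case using search_invD(8)[OF assms, of h] by simp
qed

lemma level_count_le_real:
  assumes "search_inv n m L t rich l0 ns Ts act done"
  shows "real (level_count h act) \<le> 2 ^ h"
  using of_nat_mono[OF level_count_le[OF assms, of h], where 'a = real] by simp

text \<open>The constant is 3 * 2 * 3: a node has at most 3 * N edges, 1 / mu \<le> 2, and the
  errors of all levels multiply to at most 3.\<close>

definition level_size :: "nat \<Rightarrow> nat \<Rightarrow> real" where
  "level_size m h = 18 * real m * mu ^ h"

text \<open>The accumulated imbalance stays below e, since the relative error per level is the
  reciprocal of the number of levels.\<close>

lemma one_plus_inverse_power: "0 < L \<Longrightarrow> h \<le> L \<Longrightarrow> (1 + 1 / real L) ^ h \<le> 3"
proof -
  assume "0 < L" "h \<le> L"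
  then have "(1 + 1 / real L) ^ h \<le> (1 + 1 / real L) ^ L" by (intro power_increasing) auto
  also have "\<dots> \<le> exp (1 / real L) ^ L" by (intro power_mono) auto
  also have "\<dots> = exp 1" using \<open>0 < L\<close> by (simp flip: exp_of_nat_mult)
  also have "\<dots> \<le> 3" by (rule exp_le)
  finally show ?thesis .
qed

lemma level_bound_le:
  assumes "0 < L" "h \<le> L"
  shows "3 * level_bound m L h \<le> level_size m h"
proof -
  have "1 * real m \<le> (2 * mu) * real m" using mu_bounds by (intro mult_right_mono) auto
  then have "real m / mu \<le> 2 * real m" using mu_bounds by (simp add: field_simps)
  then have "real m / mu * ((1 + 1 / real L) ^ h * mu ^ h) \<le> 2 * real m * (3 * mu ^ h)"
    using one_plus_inverse_power[OF assms] mu_bounds by (intro mult_mono) auto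
  then show ?thesis by (simp add: level_bound_def level_size_def power_mult_distrib)
qed

text \<open>From mu powr (3/2) = 1/2: the number of nodes doubles exactly when the size to the power
  3/2 is halved. Therefore 3/2 is the critical exponent, for which all levels cost the same.\<close>

lemma level_size_powr: "2 ^ h * level_size m h powr (3 / 2) = (18 * real m) powr (3 / 2)"
proof -
  have mu: "0 < mu" using mu_bounds by linarith
  have "(mu ^ h) powr (3 / 2) = (mu powr 3) powr (real h / 2)"
    unfolding powr_realpow[OF mu, symmetric] powr_powr by (rule arg_cong[of _ _ "(powr) mu"]) simp
  also have "mu powr 3 = 1 / 4" using powr_realpow[OF mu, of 3] mu_cube by simp
  also have "(1 / 4) powr (real h / 2) = ((1 / 4) powr (1 / 2)) powr real h"
    unfolding powr_powr by (rule arg_cong[of _ _ "(powr) (1 / 4)"]) simp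
  also have "(1 / 4) powr (1 / 2) = (1 / 2 :: real)"
    by (simp add: powr_half_sqrt real_sqrt_divide)
  finally have "2 ^ h * (mu ^ h) powr (3 / 2) = 1" by (simp add: powr_realpow power_divide)
  then show ?thesis using mu by (simp add: level_size_def powr_mult)
qed

lemma eighteen: "(18::real) powr (3 / 2) \<le> 100"
proof -
  have "(18::real) powr (3 / 2) = 18 powr (1 + 1 / 2)" by simp
  also have "\<dots> = 18 powr 1 * 18 powr (1 / 2)" by (rule powr_add)
  also have "(18::real) powr (1 / 2) \<le> 5" by (simp add: powr_half_sqrt real_le_lsqrt)
  finally show ?thesis by simp
qed

text \<open>\<open>x0\<close> is the size at which both estimates for a level of the tree agree.\<close>

lemma rich_level_cost:
  fixes c b m t :: real
  assumes c: "1 \<le> c" "c \<le> 3 / 2" and m: "1 \<le> m" "m \<le> t" and b: "0 < b" "b \<le> 18 * m"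
    and S: "S \<le> N * b powr c" "S \<le> (t + b) * b powr (c - 1)" and N: "N * b powr (3 / 2) \<le> (18 * m) powr (3 / 2)"
  shows "S \<le> 100 * (m powr (3 * c - 3) * t powr (3 - 2 * c))"
proof -
  define x0 where "x0 = m powr 3 * t powr (-2)"
  have x0: "0 < x0" using m by (simp add: x0_def)
  have x0p: "x0 powr y = m powr (3 * y) * t powr (- 2 * y)" for y
  proof -
    have "x0 powr y = (m powr 3) powr y * (t powr (-2)) powr y"
      unfolding x0_def by (rule powr_mult)
    then show ?thesis unfolding powr_powr by simp
  qed
  show ?thesis
  proof (cases "b \<ge> x0")
    case True
    have "(18 * m) powr (3 / 2) \<le> 100 * m powr (3 / 2)"
      using m eighteen by (simp add: powr_mult)
    with N have N': "N * b powr (3 / 2) \<le> 100 * m powr (3 / 2)" by linarith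
    have "N * b powr c = (N * b powr (3 / 2)) * b powr (c - 3 / 2)"
      using b by (simp flip: powr_add)
    also have "\<dots> \<le> 100 * m powr (3 / 2) * b powr (c - 3 / 2)" using N' by (intro mult_right_mono) auto
    \<comment> \<open>For c \<le> 3/2 this estimate decreases in b, so on large nodes it is worst at
      b = x0.\<close>
    also have "\<dots> \<le> 100 * m powr (3 / 2) * x0 powr (c - 3 / 2)"
      using True c x0 by (intro mult_left_mono powr_mono2') auto
    also have "\<dots> = 100 * (m powr (3 / 2 + 3 * (c - 3 / 2)) * t powr (- 2 * (c - 3 / 2)))"
      unfolding x0p powr_add by simp
    also have "3 / 2 + 3 * (c - 3 / 2) = 3 * c - 3" by simp
    also have "- 2 * (c - 3 / 2) = 3 - 2 * c" by simp
    finally show ?thesis using S(1) by linarith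
  next
    case False
    have "S \<le> (t + b) * b powr (c - 1)" by (rule S(2))
    \<comment> \<open>For c \<ge> 1 the other estimate increases in b, so on small nodes it is again
      worst at x0. The summand b is at most 18 * t.\<close>
    also have "\<dots> \<le> (100 * t) * x0 powr (c - 1)"
      using False c m b by (intro mult_mono powr_mono2) auto
    also have "\<dots> = 100 * (m powr (3 * (c - 1)) * (t powr 1 * t powr (- 2 * (c - 1))))"
      using m unfolding x0p by simp
    also have "t powr 1 * t powr (- 2 * (c - 1)) = t powr (1 - 2 * (c - 1))"
      unfolding powr_add[symmetric] by (rule arg_cong[of _ _ "(powr) t"]) simp
    also have "3 * (c - 1) = 3 * c - 3" by simp
    also have "1 - 2 * (c - 1) = 3 - 2 * c" by simp
    finally show ?thesis .
  qed
qed

text \<open>With linear cost per node the exponent 1 is below the critical 3/2, so no estimate in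
  terms of t is required.\<close>

lemma poor_level_cost:
  fixes b m :: real
  assumes m: "1 \<le> m" and b: "1 \<le> b" and N: "N * b powr (3 / 2) \<le> (18 * m) powr (3 / 2)" and S: "S \<le> N * b"
    and "0 \<le> N"
  shows "S \<le> 100 * m powr (3 / 2)"
proof -
  have "(18 * m) powr (3 / 2) \<le> 100 * m powr (3 / 2)"
    using m eighteen by (simp add: powr_mult)
  moreover have "N * b powr 1 \<le> N * b powr (3 / 2)" using assms(5) b by (intro mult_left_mono powr_mono) auto
  ultimately show ?thesis using S N b by simp
qed

lemma sum_list_levels:
  fixes g :: "nat \<Rightarrow> real" and act :: "(nat \<times> nat) list"
  assumes "\<And>h k. (h, k) \<in> set act \<Longrightarrow> h < L"
  shows "(\<Sum>(h, k)\<leftarrow>act. g k) = (\<Sum>h<L. \<Sum>(h', k)\<leftarrow>act. if h' = h then g k else 0)"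
  using assms
proof (induction act)
  case (Cons x act)
  obtain h k where x: "x = (h, k)" by (cases x)
  with Cons.prems have "h < L" by auto
  moreover have "(\<Sum>(h, k)\<leftarrow>act. g k) = (\<Sum>h<L. \<Sum>(h', k)\<leftarrow>act. if h' = h then g k else 0)"
    by (rule Cons.IH) (use Cons.prems in auto)
  moreover from \<open>h < L\<close> have "(\<Sum>j<L. if h = j then g k else 0) = g k" by (subst sum.delta') auto
  ultimately show ?case by (simp add: x sum.distrib)
qed simp

lemma sum_list_ones: "(\<Sum>(h, k)\<leftarrow>act. 1) = real (length act)"
  by (induction act) auto

lemma sum_list_level_le:
  fixes g :: "nat \<Rightarrow> real"
  assumes "\<And>k. (h, k) \<in> set act \<Longrightarrow> g k \<le> B"
  shows "(\<Sum>(h', k)\<leftarrow>act. if h' = h then g k else 0) \<le> real (level_count h act) * B"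
  using assms
proof (induction act)
  case (Cons x act)
  obtain h' k where x: "x = (h', k)" by (cases x)
  have "(\<Sum>(h', k)\<leftarrow>act. if h' = h then g k else 0) \<le> real (level_count h act) * B"
    by (rule Cons.IH) (use Cons.prems in auto)
  moreover have "h' = h \<Longrightarrow> g k \<le> B" using Cons.prems x by auto
  ultimately show ?case by (auto simp: x level_count_def algebra_simps)
qed (simp add: level_count_def)

lemma sum_list_level_sum_le:
  assumes "\<And>k. (h, k) \<in> set act \<Longrightarrow> g k \<le> real k * B"
  shows "(\<Sum>(h', k)\<leftarrow>act. if h' = h then g k else 0) \<le> real (level_sum h act) * B"
  using assms
proof (induction act)
  case (Cons x act)
  obtain h' k where x: "x = (h', k)" by (cases x)
  have "(\<Sum>(h', k)\<leftarrow>act. if h' = h then g k else 0) \<le> real (level_sum h act) * B"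
    by (rule Cons.IH) (use Cons.prems in auto)
  moreover have "h' = h \<Longrightarrow> g k \<le> real k * B" using Cons.prems x by auto
  ultimately show ?case by (auto simp: x level_sum_def algebra_simps)
qed (simp add: level_sum_def)

lemma length_act_le:
  assumes "search_inv n m L t rich l0 ns Ts act done"
  shows "real (length act) \<le> 2 ^ L"
proof -
  have "real (length act) = (\<Sum>(h, k)\<leftarrow>act. 1)" by (rule sum_list_ones[symmetric])
  also have "\<dots> = (\<Sum>h<L. \<Sum>(h', k)\<leftarrow>act. if h' = h then 1 else 0)"
    by (rule sum_list_levels) (use search_invD(4)[OF assms] in blast)
  also have "\<dots> \<le> (\<Sum>h<L. real (level_count h act) * 1)"
    by (intro sum_mono sum_list_level_le) simp
  also have "\<dots> \<le> (\<Sum>h<L. 2 ^ h)"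
    using level_count_le_real[OF assms] by (intro sum_mono) simp
  also have "\<dots> = real (\<Sum>h<L. 2 ^ h)" by simp
  also have "(\<Sum>h<L. 2 ^ h) = 2 ^ L - (1::nat)" by (rule sum_power2[unfolded atLeast0LessThan])
  also have "real (2 ^ L - 1) \<le> real (2 ^ L)" by (rule of_nat_mono) simp
  finally show ?thesis by simp
qed

text \<open>The charging clause with \<phi> = 1 counts visits. This bounds the number of memory
  slices that are needed.\<close>

lemma length_done_le:
  assumes "search_inv n m L t rich l0 ns Ts act done"
  shows "real (length done) \<le> 1 + (36 * (real L)\<^sup>2 + 2) * 2 ^ L"
proof -
  have "(\<Sum>k\<leftarrow>done. 1) + (\<Sum>(h, f, l)\<leftarrow>ns. 1) \<le> 1 + (36 * (real L)\<^sup>2 + 2) * (\<Sum>(h, k)\<leftarrow>act. 1)"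
    using search_invD(9)[OF assms, of "\<lambda>_. 1"] by (simp add: mono_def)
  moreover have "(\<Sum>(h, k)\<leftarrow>act. 1) = real (length act)" by (rule sum_list_ones)
  moreover have "0 \<le> (\<Sum>(h, f, l)\<leftarrow>ns. 1::real)" by (rule sum_list_nonneg) auto
  moreover have "(36 * (real L)\<^sup>2 + 2) * real (length act) \<le> (36 * (real L)\<^sup>2 + 2) * 2 ^ L"
    using length_act_le[OF assms] by (intro mult_left_mono) auto
  ultimately show ?thesis by (simp add: sum_list_triv)
qed

text \<open>Each of the L levels costs at most 100 times the target. Here d is the exponent of the
  cost of one node: c if the given algorithm is called, 1 if nodes are split down to single
  vertices.\<close>

lemma act_cost:
  assumes inv: "search_inv n m L t rich l0 ns Ts act done"
    and m: "1 \<le> m" "m \<le> t" and L: "0 < L"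
    and d: "rich \<and> d = c \<and> 1 \<le> c \<and> c \<le> 3 / 2 \<or> d = 1 \<and> 3 / 2 \<le> c \<and> real t \<le> real m powr (3 / 2)"
  shows "(\<Sum>(h, k)\<leftarrow>act. real k powr d) \<le> 100 * real L * (real m powr (3 * c - 3) * real t powr (3 - 2 * c))"
proof -
  note I = search_invD[OF inv]
  let ?T = "real m powr (3 * c - 3) * real t powr (3 - 2 * c)"
  have "(\<Sum>(h', k)\<leftarrow>act. if h' = h then real k powr d else 0) \<le> 100 * ?T" if h: "h < L" for h
  proof -
    define b where "b = level_size m h"
    have mu: "0 < mu" using mu_bounds by linarith
    have b: "0 < b" using m mu by (simp add: b_def level_size_def)
    have "mu ^ h \<le> 1" using mu mu_bounds by (intro power_le_one) auto
    then have b2: "b \<le> 18 * real m" by (simp add: b_def level_size_def mult_left_le)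
    have kb: "real k \<le> b \<and> 1 \<le> k" if "(h, k) \<in> set act" for k
      using I(4)[OF that] level_bound_le[of L h m] L h by (auto simp: b_def)
    have N: "real (level_count h act) * b powr (3 / 2) \<le> (18 * real m) powr (3 / 2)"
    proof -
      have "real (level_count h act) \<le> 2 ^ h" by (rule level_count_le_real[OF inv])
      then have "real (level_count h act) * b powr (3 / 2) \<le> 2 ^ h * b powr (3 / 2)" by (intro mult_right_mono) auto
      then show ?thesis by (simp add: level_size_powr b_def)
    qed
    have S: "(\<Sum>(h', k)\<leftarrow>act. if h' = h then real k powr d else 0) \<le> real (level_count h act) * b powr d"
      using kb d by (intro sum_list_level_le powr_mono2) auto
    from d show ?thesis
    proof (elim disjE conjE)
      assume r: rich and dc: "d = c" "1 \<le> c" "c \<le> 3 / 2"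
      have "real k powr d \<le> real k * b powr (c - 1)" if "(h, k) \<in> set act" for k
      proof -
        \<comment> \<open>One factor k is kept, to be summed up by \<open>level_sum\<close>; only
          the remaining power is estimated by the size bound of the level.\<close>
        have "real k powr d = real k * real k powr (c - 1)" using kb[OF that] dc by (simp add: powr_mult_base)
        also have "\<dots> \<le> real k * b powr (c - 1)" using kb[OF that] dc by (intro mult_left_mono powr_mono2) auto
        finally show ?thesis .
      qed
      then have "(\<Sum>(h', k)\<leftarrow>act. if h' = h then real k powr d else 0) \<le> real (level_sum h act) * b powr (c - 1)"
        by (rule sum_list_level_sum_le)
      also have "\<dots> \<le> (real t + b) * b powr (c - 1)"
        using I(6)[OF r, of h] level_bound_le[of L h m] L h by (intro mult_right_mono) (auto simp: b_def)
      finally show ?thesis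
        using S dc m b b2 N by (intro rich_level_cost[of c "real m" "real t" b _ "real (level_count h act)"]) auto
    next
      assume dc: "d = 1" "3 / 2 \<le> c" "real t \<le> real m powr (3 / 2)"
      \<comment> \<open>For c \<ge> 3/2 the target does not increase with t, and it equals m powr
        (3/2) at t = m powr (3/2). The assumed upper bound on t is exactly what is used
        here.\<close>
      have "real m powr (3 / 2) \<le> ?T"
      proof -
        have "real m powr (3 / 2) = real m powr (3 * c - 3) * (real m powr (3 / 2)) powr (3 - 2 * c)"
          unfolding powr_powr powr_add[symmetric] by (rule arg_cong[of _ _ "(powr) (real m)"]) (simp add: field_simps)
        also have "\<dots> \<le> ?T" using dc m by (intro mult_left_mono powr_mono2') auto
        finally show ?thesis .
      qed
      moreover have "(\<Sum>(h', k)\<leftarrow>act. if h' = h then real k powr d else 0) \<le> 100 * real m powr (3 / 2)"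
      \<comment> \<open>An empty level is set apart because its size bound b may be less than 1,
        where the comparison of powers would fail.\<close>
      proof (cases "level_count h act = 0")
        case True
        then have "(\<Sum>(h', k)\<leftarrow>act. if h' = h then real k powr d else 0) \<le> 0" using S by simp
        also have "0 \<le> 100 * real m powr (3 / 2)" by simp
        finally show ?thesis .
      next
        case False
        then obtain k where "(h, k) \<in> set act" by (auto simp: level_count_def filter_empty_conv)
        from kb[OF this] have "1 \<le> b" by linarith
        with S dc m b N show ?thesis by (intro poor_level_cost[of "real m" b "real (level_count h act)"]) auto
      qed
      ultimately show ?thesis by linarith
    qed
  qed
  then have "(\<Sum>h<L. \<Sum>(h', k)\<leftarrow>act. if h' = h then real k powr d else 0) \<le> (\<Sum>h<L. 100 * ?T)"
    by (intro sum_mono) auto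
  moreover have "(\<Sum>(h, k)\<leftarrow>act. real k powr d) = (\<Sum>h<L. \<Sum>(h', k)\<leftarrow>act. if h' = h then real k powr d else 0)"
    by (rule sum_list_levels) (use I(4) in blast)
  ultimately show ?thesis by (simp add: mult_ac)
qed

text \<open>The weight of all visited nodes is charged to the split ones and to the root. Empty
  nodes also take time to be visited, hence the maximum with 1, which makes the weight positive and
  keeps it monotone.\<close>

lemma done_cost:
  assumes inv: "search_inv n m L t rich l0 ns Ts act done"
    and m: "1 \<le> m" "m \<le> t" and L: "0 < L" and l0: "length l0 = 3 * m"
    and d: "rich \<and> d = c \<and> 1 \<le> c \<and> c \<le> 3 / 2 \<or> d = 1 \<and> 3 / 2 \<le> c \<and> real t \<le> real m powr (3 / 2)"
  shows "(\<Sum>k\<leftarrow>done. real (max 1 k) powr d) \<le>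
    100 * (36 * (real L)\<^sup>2 + 2) * (real L + 1) * (real m powr (3 * c - 3) * real t powr (3 - 2 * c))"
proof -
  let ?T = "real m powr (3 * c - 3) * real t powr (3 - 2 * c)" and ?\<phi> = "\<lambda>k. real (max 1 k) powr d"
  have d0: "0 \<le> d" "d \<le> 3 / 2" using d by auto
  have A: "(\<Sum>k\<leftarrow>done. ?\<phi> k) + (\<Sum>(h, f, l)\<leftarrow>ns. ?\<phi> (length l)) \<le>
      ?\<phi> (length l0) + (36 * (real L)\<^sup>2 + 2) * (\<Sum>(h, k)\<leftarrow>act. ?\<phi> k)"
    using d0 by (intro search_invD(9)[OF inv]) (auto simp: mono_def intro!: powr_mono2)
  moreover have "0 \<le> (\<Sum>(h, f, l)\<leftarrow>ns. ?\<phi> (length l))" by (rule sum_list_nonneg) auto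
  moreover have eq: "(\<Sum>(h, k)\<leftarrow>act. ?\<phi> k) = (\<Sum>(h, k)\<leftarrow>act. real k powr d)"
    by (intro arg_cong[of _ _ sum_list] map_cong) (use search_invD(4)[OF inv] in \<open>auto simp: max_def\<close>)
  moreover have "(36 * (real L)\<^sup>2 + 2) * (\<Sum>(h, k)\<leftarrow>act. real k powr d) \<le> (36 * (real L)\<^sup>2 + 2) * (100 * real L * ?T)"
    using act_cost[OF inv m L d] by (intro mult_left_mono) auto
  moreover have "?\<phi> (length l0) \<le> (36 * (real L)\<^sup>2 + 2) * (100 * ?T)"
  proof -
    have T: "real m powr d \<le> ?T"
      using d
    proof (elim disjE conjE)
      assume dc: "d = c" "c \<le> 3 / 2"
      have "real m powr d = real m powr (3 * c - 3) * real m powr (3 - 2 * c)"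
        using dc by (simp flip: powr_add)
      also have "\<dots> \<le> ?T" using dc m by (intro mult_left_mono powr_mono2) auto
      finally show ?thesis .
    next
      assume dc: "d = 1" "3 / 2 \<le> c" "real t \<le> real m powr (3 / 2)"
      have "real m powr d \<le> real m powr (3 / 2)" using dc m by (intro powr_mono) auto
      also have "\<dots> = real m powr (3 * c - 3) * (real m powr (3 / 2)) powr (3 - 2 * c)"
        unfolding powr_powr powr_add[symmetric] by (rule arg_cong[of _ _ "(powr) (real m)"]) (simp add: field_simps)
      also have "\<dots> \<le> ?T" using dc m by (intro mult_left_mono powr_mono2') auto
      finally show ?thesis .
    qed
    have "(3::real) powr d \<le> 3 powr 2" using d0 by (intro powr_mono) auto
    then have "(3::real) powr d \<le> 100" by simp
    then have "3 powr d * real m powr d \<le> 100 * ?T" using T by (intro mult_mono) auto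
    moreover have "?\<phi> (length l0) = 3 powr d * real m powr d" using l0 m by (simp add: powr_mult max_def)
    moreover have "1 * (100 * ?T) \<le> (36 * (real L)\<^sup>2 + 2) * (100 * ?T)" by (intro mult_right_mono) auto
    ultimately show ?thesis by linarith
  qed
  moreover have "100 * (36 * (real L)\<^sup>2 + 2) * (real L + 1) * ?T =
      (36 * (real L)\<^sup>2 + 2) * (100 * ?T) + (36 * (real L)\<^sup>2 + 2) * (100 * real L * ?T)"
    by (simp only: distrib_left distrib_right mult_ac mult_1_right mult_1_left)
  moreover note A[unfolded eq]
  ultimately show ?thesis by linarith
qed

section \<open>Correctness of the listed triangles\<close>

lemma distinct_if_count_list: "(\<And>x. count_list xs x \<le> 1) \<Longrightarrow> distinct xs"
proof (induction xs)
  case (Cons y xs)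
  have "count_list xs x \<le> 1" for x using Cons.prems[of x] by (simp split: if_splits)
  moreover have "y \<notin> set xs" using Cons.prems[of y] by (simp add: count_list_0_iff)
  ultimately show ?case using Cons.IH by simp
qed simp

text \<open>Each triangle occurs exactly once in the list or on the stack, and nothing else does; so
  an empty stack means completeness.\<close>

lemma search_inv_listed:
  assumes "search_inv n m L t rich l0 ns Ts act done"
  shows "distinct Ts" "set Ts \<subseteq> triangles (edge_set l0)" "ns = [] \<Longrightarrow> set Ts = triangles (edge_set l0)"
proof -
  note I = search_invD(3)[OF assms]
  have "count_list Ts T \<le> 1" for T using I[of T] by (cases "T \<in> triangles (edge_set l0)") auto
  then show "distinct Ts" by (rule distinct_if_count_list)
  have "T \<in> triangles (edge_set l0)" if "T \<in> set Ts" for T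
    using I[of T] that count_list_0_iff[of Ts T] by (cases "T \<in> triangles (edge_set l0)") auto
  then show "set Ts \<subseteq> triangles (edge_set l0)" by blast
  show "set Ts = triangles (edge_set l0)" if "ns = []"
  proof -
    have "T \<in> set Ts \<longleftrightarrow> T \<in> triangles (edge_set l0)" for T
      using I[of T] that count_list_0_iff[of Ts T] by (cases "T \<in> triangles (edge_set l0)") (auto simp: nodes_with_def)
    then show ?thesis by blast
  qed
qed

section \<open>The program\<close>

lemma set_reg_sel [simp]:
  "regs (set_reg r v s) = (regs s)(r := v)" "arrs (set_reg r v s) = arrs s"
  by (simp_all add: set_reg_def)

lemma set_arr_sel [simp]:
  "regs (set_arr a i v s) = regs s" "arrs (set_arr a i v s) = (arrs s)(a := (arrs s a)(i := v))"
  by (simp_all add: set_arr_def)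

section \<open>Frame conditions and counting loops\<close>

fun wregs :: "com \<Rightarrow> nat set" where
  "wregs (Assign r e) = {r}"
| "wregs (Flip r) = {r}"
| "wregs (Seq p q) = wregs p \<union> wregs q"
| "wregs (If e p q) = wregs p \<union> wregs q"
| "wregs (While e p) = wregs p"
| "wregs _ = {}"

fun warrs :: "com \<Rightarrow> nat set" where
  "warrs (Store a e1 e2) = {a}"
| "warrs (Seq p q) = warrs p \<union> warrs q"
| "warrs (If e p q) = warrs p \<union> warrs q"
| "warrs (While e p) = warrs p"
| "warrs _ = {}"

definition keeps :: "nat set \<Rightarrow> nat set \<Rightarrow> state \<Rightarrow> state \<Rightarrow> bool" where
  "keeps R A s s' \<longleftrightarrow> (\<forall>r. r \<notin> R \<longrightarrow> regs s' r = regs s r) \<and> (\<forall>a. a \<notin> A \<longrightarrow> arrs s' a = arrs s a)"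

lemma keeps_refl [simp]: "keeps R A s s"
  by (simp add: keeps_def)

lemma keeps_trans: "keeps R A s s' \<Longrightarrow> keeps R A s' s'' \<Longrightarrow> keeps R A s s''"
  by (simp add: keeps_def)

lemma keeps_mono: "keeps R A s s' \<Longrightarrow> R \<subseteq> R' \<Longrightarrow> A \<subseteq> A' \<Longrightarrow> keeps R' A' s s'"
  by (auto simp: keeps_def)

lemma keeps_regs: "keeps R A s s' \<Longrightarrow> r \<notin> R \<Longrightarrow> regs s' r = regs s r"
  by (simp add: keeps_def)

lemma keeps_arrs: "keeps R A s s' \<Longrightarrow> a \<notin> A \<Longrightarrow> arrs s' a = arrs s a"
  by (simp add: keeps_def)

lemma exec_keeps: "exec c s T s' \<Longrightarrow> keeps (wregs c) (warrs c) s s'"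
  by (induction rule: exec.induct) (auto simp: keeps_def)

lemma steps_keeps: "steps c s k u s' \<Longrightarrow> keeps (wregs c) (warrs c) s s'"
  by (induction rule: steps.induct) (auto simp: keeps_def exec_keeps[unfolded keeps_def])

lemma sval_keeps: "keeps (wregs c) (warrs c) s (sval c s)"
  by (induction c arbitrary: s) (auto simp: keeps_def)

text \<open>The frame condition follows from the syntax of the program, so specifications need to
  mention only what changes.\<close>

lemma reach_keeps:
  "reach c s k u Q \<Longrightarrow> reach c s k u (\<lambda>s'. Q s' \<and> keeps (wregs c) (warrs c) s s')"
  unfolding reach_def using steps_keeps by blast

definition for_loop :: "nat \<Rightarrow> nat \<Rightarrow> com \<Rightarrow> com" where
  "for_loop rj rh body = While (Bin Less (Reg rj) (Reg rh)) (Seq body (Assign rj (Bin Add (Reg rj) (Const 1))))"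

lemma for_loop_sets [simp]:
  "wregs (for_loop rj rh body) = insert rj (wregs body)" "warrs (for_loop rj rh body) = warrs body"
  by (auto simp: for_loop_def)

text \<open>The invariant is required in the state after the increment of the index, because it may
  depend on the whole state. The two additional steps per iteration are the test and the
  increment.\<close>

lemma reach_for:
  assumes "regs s rj = lo" "regs s rh = hi" "lo \<le> hi" "rj < 40" "rh < 40" "rj \<notin> wregs body" "rh \<notin> insert rj (wregs body)"
    and "P lo s" "0 \<le> kb" "0 \<le> ub"
    and step: "\<And>j s'. lo \<le> j \<Longrightarrow> j < hi \<Longrightarrow> regs s' rj = j \<Longrightarrow>
      keeps (insert rj (wregs body)) (warrs body) s s' \<Longrightarrow> P j s' \<Longrightarrow>
      reach body s' kb ub (\<lambda>s''. P (Suc j) (set_reg rj (Suc j) s''))"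
  shows "reach (for_loop rj rh body) s (real (hi - lo) * (kb + 2) + 1) (real (hi - lo) * ub)
    (\<lambda>s'. P hi s' \<and> regs s' rj = hi \<and> keeps (insert rj (wregs body)) (warrs body) s s')"
proof -
  let ?I = "\<lambda>i s'. P (lo + i) s' \<and> regs s' rj = lo + i \<and> keeps (insert rj (wregs body)) (warrs body) s s'"
  have "reach (for_loop rj rh body) s (real (hi - lo) * (1 + (kb + 1)) + 1) (real (hi - lo) * ub)
    (\<lambda>s'. P hi s' \<and> regs s' rj = hi \<and> keeps (insert rj (wregs body)) (warrs body) s s')"
    unfolding for_loop_def
  proof (rule reach_While[where P = ?I])
    show "main_exp (Bin Less (Reg rj) (Reg rh))" "0 \<le> ub" using assms by auto
    show "?I 0 s" using assms by simp
  next
    fix i s' assume i: "i < hi - lo" and I: "?I i s'"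
    then have rh: "regs s' rh = hi" using assms by (auto simp: keeps_def)
    have "reach body s' kb ub (\<lambda>s''. P (Suc (lo + i)) (set_reg rj (Suc (lo + i)) s''))"
      using i I by (intro step) auto
    then have "reach body s' kb ub (\<lambda>s''. P (Suc (lo + i)) (set_reg rj (Suc (lo + i)) s'') \<and>
        keeps (wregs body) (warrs body) s' s'')" by (rule reach_keeps)
    then have "reach body s' kb ub (\<lambda>s''. reach (Assign rj (Bin Add (Reg rj) (Const 1))) s'' 1 0 (?I (Suc i)))"
    proof (rule reach_mono)
      fix s'' assume s'': "P (Suc (lo + i)) (set_reg rj (Suc (lo + i)) s'') \<and> keeps (wregs body) (warrs body) s' s''"
      then have j: "regs s'' rj = lo + i" using I assms by (auto simp: keeps_def)
      have "?I (Suc i) (set_reg rj (Suc (lo + i)) s'')"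
        using s'' I by (auto simp: keeps_def)
      then have "?I (Suc i) (sval (Assign rj (Bin Add (Reg rj) (Const 1))) s'')"
        using j by simp
      then have "reach (Assign rj (Bin Add (Reg rj) (Const 1))) s'' (csize (Assign rj (Bin Add (Reg rj) (Const 1)))) 0 (?I (Suc i))"
        using assms by (intro reach_straight) auto
      then show "reach (Assign rj (Bin Add (Reg rj) (Const 1))) s'' 1 0 (?I (Suc i))" by simp
    qed auto
    from reach_Seq[OF this] rh I i
    show "aval (Bin Less (Reg rj) (Reg rh)) s' \<noteq> 0 \<and>
      reach (Seq body (Assign rj (Bin Add (Reg rj) (Const 1)))) s' (kb + 1) ub (?I (Suc i))" by simp
  next
    fix s' assume I: "?I (hi - lo) s'"
    then have "regs s' rh = hi" using assms by (auto simp: keeps_def)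
    with I assms show "aval (Bin Less (Reg rj) (Reg rh)) s' = 0 \<and>
      P hi s' \<and> regs s' rj = hi \<and> keeps (insert rj (wregs body)) (warrs body) s s'" by simp
  qed
  then show ?thesis by (simp add: add.commute)
qed

lemma reach_for_straight:
  assumes "regs s rj = lo" "regs s rh = hi" "lo \<le> hi" "rj < 40" "rh < 40" "rj \<notin> wregs body" "rh \<notin> insert rj (wregs body)"
    and "P lo s" "straight body"
    and step: "\<And>j s'. lo \<le> j \<Longrightarrow> j < hi \<Longrightarrow> regs s' rj = j \<Longrightarrow>
      keeps (insert rj (wregs body)) (warrs body) s s' \<Longrightarrow> P j s' \<Longrightarrow>
      P (Suc j) (set_reg rj (Suc j) (sval body s'))"
  shows "reach (for_loop rj rh body) s (real (hi - lo) * (real (csize body) + 2) + 1) 0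
    (\<lambda>s'. P hi s' \<and> regs s' rj = hi \<and> keeps (insert rj (wregs body)) (warrs body) s s')"
  using reach_for[where kb = "csize body" and ub = 0 and P = P, OF assms(1-8)] assms(9,10)
  by (auto intro: reach_straight)

text \<open>Arrays 2 and 3 hold the endpoints of the edges of all subproblems, each of which is a
  segment. New segments are appended at the end, kept in register 5, and old ones are never
  overwritten.\<close>

definition pool :: "state \<Rightarrow> nat \<Rightarrow> nat \<Rightarrow> (nat \<times> nat) list" where
  "pool s a b = map (\<lambda>i. (arrs s 2 i, arrs s 3 i)) [a..<b]"

lemma length_pool [simp]: "length (pool s a b) = b - a"
  by (simp add: pool_def)

lemma take_pool_Suc:
  "a \<le> j \<Longrightarrow> j < b \<Longrightarrow> take (Suc j - a) (pool s a b) = take (j - a) (pool s a b) @ [(arrs s 2 j, arrs s 3 j)]"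
  by (auto simp: pool_def le_iff_add take_Suc_conv_app_nth)

lemma pool_nth_mem: "a \<le> j \<Longrightarrow> j < b \<Longrightarrow> (arrs s 2 j, arrs s 3 j) \<in> set (pool s a b)"
  by (auto simp: pool_def)

lemma pool_cong:
  "(\<And>i. a \<le> i \<Longrightarrow> i < b \<Longrightarrow> arrs s' 2 i = arrs s 2 i \<and> arrs s' 3 i = arrs s 3 i) \<Longrightarrow> pool s' a b = pool s a b"
  by (auto simp: pool_def)

lemma pool_snoc: "a \<le> b \<Longrightarrow> pool s a (Suc b) = pool s a b @ [(arrs s 2 b, arrs s 3 b)]"
  by (simp add: pool_def)

text \<open>Each call gets its own part of the scratch arrays, which need not be cleared.\<close>

definition slot :: "nat \<Rightarrow> aexp" where
  "slot r = Bin Add (Bin Mul (Reg 6) (Bin Mul (Const 3) (Reg 0))) (Reg r)"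

lemma slot_simps [simp]:
  "main_exp (slot r) \<longleftrightarrow> r < 40" "aval (slot r) s = regs s 6 * (3 * regs s 0) + regs s r"
  by (simp_all add: slot_def)

definition load :: com where
  "load = Seq (Assign 13 (Arr 2 (Reg 12))) (Seq (Assign 14 (Arr 3 (Reg 12)))
     (If (Bin Equal (Bin Div (Reg 14) (Reg 0)) (Reg 9))
       (Seq (Assign 24 (Reg 13)) (Seq (Assign 13 (Reg 14)) (Assign 14 (Reg 24)))) Skip))"

lemma load_simps [simp]:
  "straight load" "csize load = 7" "wregs load = {13, 14, 24}" "warrs load = {}"
  "arrs (sval load s) = arrs s"
  "regs (sval load s) 13 = near (regs s 0) (regs s 9) (arrs s 2 (regs s 12), arrs s 3 (regs s 12))"
  "regs (sval load s) 14 = far (regs s 0) (regs s 9) (arrs s 2 (regs s 12), arrs s 3 (regs s 12))"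
  "r \<noteq> 13 \<Longrightarrow> r \<noteq> 14 \<Longrightarrow> r \<noteq> 24 \<Longrightarrow> regs (sval load s) r = regs s r"
  by (auto simp: load_def near_def far_def)

section \<open>Degrees of the vertices of one class\<close>

lemma touches_iff: "touches n \<tau> e \<longleftrightarrow> near n \<tau> e div n = \<tau>"
  by (auto simp: touches_def near_def)

lemma deg_snoc:
  "deg n \<tau> \<sigma> (l @ [e]) y = deg n \<tau> \<sigma> l y + of_bool (touches n \<tau> e \<and> far n \<tau> e div n = \<sigma> \<and> near n \<tau> e = y)"
  by (simp add: deg_def)

lemma far_class:
  assumes "tripartite n l" "e \<in> set l" "\<tau> < 3" "touches n \<tau> e"
  shows "far n \<tau> e div n = (\<tau> + 2) mod 3 \<longleftrightarrow> far n \<tau> e div n \<noteq> (\<tau> + 1) mod 3"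
  using class_cases[OF assms(3) tripartite_edge(4,5)[OF assms(1,2)]] tripartite_edge(3)[OF assms(1,2)] assms(4)
  unfolding touches_def far_def by (elim disjE conjE) simp_all

lemma near_less: "tripartite n l \<Longrightarrow> e \<in> set l \<Longrightarrow> near n \<tau> e < 3 * n"
  using tripartite_edge(1,2)[of n l e] by (simp add: near_def)

definition count_degrees :: com where
  "count_degrees = Seq load
     (If (Bin Equal (Bin Div (Reg 13) (Reg 0)) (Reg 9))
       (If (Bin Equal (Bin Div (Reg 14) (Reg 0)) (Reg 23))
         (Store 8 (slot 13) (Bin Add (Arr 8 (slot 13)) (Const 1)))
         (Store 9 (slot 13) (Bin Add (Arr 9 (slot 13)) (Const 1)))) Skip)"

lemma count_degrees_simps:
  "straight count_degrees" "csize count_degrees = 12" "wregs count_degrees = {13, 14, 24}" "warrs count_degrees = {8, 9}"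
  by (auto simp: count_degrees_def)

text \<open>The conclusion covers all y, also those beyond the slot of this call. There the degrees
  are zero, which shows that the slots of later calls are still clear.\<close>

lemma reach_count_degrees:
  assumes n: "regs s 0 = n" and \<tau>: "regs s 9 = \<tau>" "\<tau> < 3" "regs s 23 = (\<tau> + 1) mod 3"
    and l: "pool s (regs s 7) (regs s 8) = l" "regs s 7 \<le> regs s 8" "tripartite n l"
    and j: "regs s 12 = regs s 7"
    and fresh: "\<And>i. regs s 6 * (3 * n) \<le> i \<Longrightarrow> arrs s 8 i = 0 \<and> arrs s 9 i = 0"
  shows "reach (for_loop 12 8 count_degrees) s (real (length l) * 14 + 1) 0
    (\<lambda>s'. (\<forall>y. arrs s' 8 (regs s 6 * (3 * n) + y) = deg n \<tau> ((\<tau> + 1) mod 3) l y \<and>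
        arrs s' 9 (regs s 6 * (3 * n) + y) = deg n \<tau> ((\<tau> + 2) mod 3) l y) \<and>
      keeps {12, 13, 14, 24} {8, 9} s s')"
proof -
  let ?B = "regs s 6 * (3 * n)"
  let ?P = "\<lambda>j s'. \<forall>y. arrs s' 8 (?B + y) = deg n \<tau> ((\<tau> + 1) mod 3) (take (j - regs s 7) l) y \<and>
        arrs s' 9 (?B + y) = deg n \<tau> ((\<tau> + 2) mod 3) (take (j - regs s 7) l) y"
  have "reach (for_loop 12 8 count_degrees) s (real (regs s 8 - regs s 7) * (real (csize count_degrees) + 2) + 1) 0
    (\<lambda>s'. ?P (regs s 8) s' \<and> regs s' 12 = regs s 8 \<and> keeps (insert 12 (wregs count_degrees)) (warrs count_degrees) s s')"
  proof (rule reach_for_straight)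
    show "?P (regs s 7) s" using fresh by (simp add: deg_def)
    fix j s' assume jj: "regs s 7 \<le> j" "j < regs s 8" "regs s' 12 = j"
      and k: "keeps (insert 12 (wregs count_degrees)) (warrs count_degrees) s s'" and P: "?P j s'"
    note k' = keeps_regs[OF k] keeps_arrs[OF k]
    let ?e = "(arrs s 2 j, arrs s 3 j)"
    have eq: "regs s' 0 = n" "regs s' 9 = \<tau>" "regs s' 23 = (\<tau> + 1) mod 3" "regs s' 6 = regs s 6"
      "arrs s' 2 = arrs s 2" "arrs s' 3 = arrs s 3"
      using k' n \<tau> by (simp_all add: count_degrees_simps)
    have tk: "take (Suc j - regs s 7) l = take (j - regs s 7) l @ [?e]"
      using take_pool_Suc[OF jj(1,2), of s] l(1) by simp
    have "?e \<in> set l" using pool_nth_mem[OF jj(1,2), of s] l(1) by simp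
    note fc = far_class[OF l(3) this \<tau>(2)]
    show "?P (Suc j) (set_reg 12 (Suc j) (sval count_degrees s'))"
      unfolding tk deg_snoc using P fc eq jj(3)
      by (auto simp: count_degrees_def touches_iff)
  qed (use assms in \<open>auto simp: count_degrees_simps\<close>)
  then show ?thesis using l(1) by (auto simp: count_degrees_simps elim!: reach_mono)
qed

lemma reach_Seq_straight:
  assumes "straight p" "reach q (sval p s) k u Q"
  shows "reach (Seq p q) s (real (csize p) + k) u Q"
  using reach_Seq[of p s "csize p" 0 q k u Q] reach_straight[of p, OF assms(1)] assms(2) by simp

lemma reach_straight_Seq:
  assumes "straight q" "reach p s k u (\<lambda>s'. Q (sval q s'))"
  shows "reach (Seq p q) s (k + real (csize q)) u Q"
proof -
  have "reach p s k u (\<lambda>s'. reach q s' (csize q) 0 Q)"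
    by (rule reach_mono[OF assms(2)]) (use reach_straight[OF assms(1)] in auto)
  from reach_Seq[OF this] show ?thesis by simp
qed

text \<open>Degrees of different vertices towards one class add up to at most the number of edges.
  This is the fact that makes the additions by truncated subtraction exact.\<close>

lemma split_fold_sum_le:
  assumes "split_fold n \<tau> Q l (take k l) = (sd, r, x1, x2, z1, z2)"
  shows "x1 \<le> length l" "x2 \<le> length l" "z1 \<le> length l" "z2 \<le> length l"
proof -
  let ?\<sigma> = "(\<tau> + 1) mod 3" and ?\<sigma>' = "(\<tau> + 2) mod 3"
  define A where "A = near n \<tau> ` {e \<in> set l. touches n \<tau> e}"
  define A' where "A' = near n \<tau> ` {e \<in> set (take k l). touches n \<tau> e}"
  have fin: "finite A" by (simp add: A_def)
  have ne: "?\<sigma> \<noteq> ?\<sigma>'" by presburger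
  have sub: "{a \<in> A'. P a} \<subseteq> A" for P unfolding A_def A'_def by (auto dest: in_set_takeD)
  have le: "(\<Sum>a\<in>{a \<in> A'. P a}. deg n \<tau> ?\<sigma> l a) \<le> length l" "(\<Sum>a\<in>{a \<in> A'. P a}. deg n \<tau> ?\<sigma>' l a) \<le> length l" for P
    using sum_deg_le[OF A_def fin ne sub[of P]] unfolding sum.distrib by linarith+
  have "x1 = (\<Sum>a\<in>{a \<in> A'. sd a = 1}. deg n \<tau> ?\<sigma> l a)" "x2 = (\<Sum>a\<in>{a \<in> A'. sd a = 2}. deg n \<tau> ?\<sigma> l a)"
    "z1 = (\<Sum>a\<in>{a \<in> A'. sd a = 1}. deg n \<tau> ?\<sigma>' l a)" "z2 = (\<Sum>a\<in>{a \<in> A'. sd a = 2}. deg n \<tau> ?\<sigma>' l a)"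
    using split_inv_fold[of n \<tau> Q l "take k l"] unfolding assms split_inv_def A'_def Let_def prod.case by blast+
  with le show "x1 \<le> length l" "x2 \<le> length l" "z1 \<le> length l" "z2 \<le> length l" by simp_all
qed

section \<open>Assigning the vertices to parts\<close>

definition len :: aexp where "len = Bin Sub (Reg 8) (Reg 7)"

text \<open>Adding is expressed by truncated subtraction, because the sum is known not to exceed the
  number of edges.\<close>

definition add_to :: "nat \<Rightarrow> nat \<Rightarrow> com" where
  "add_to r r' = Assign r (Bin Sub len (Bin Sub len (Bin Add (Reg r) (Reg r'))))"

lemma sval_add_to:
  "regs s r + regs s r' \<le> regs s 8 - regs s 7 \<Longrightarrow> sval (add_to r r') s = set_reg r (regs s r + regs s r') s"
  by (simp only: add_to_def len_def sval.simps aval.simps binop_val.simps diff_diff_cancel)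

definition fetch_degrees :: com where
  "fetch_degrees = Seq (Assign 16 (Arr 8 (slot 13))) (Assign 28 (Arr 9 (slot 13)))"

text \<open>The comparison is strict, so it is the negation of the test in \<open>split_step\<close>
  and the last two branches are exchanged.\<close>

definition place :: com where
  "place = If (Bin Less len (Bin Mul (Bin Add (Reg 16) (Reg 28)) (Bin Mul (Const 36) (Bin Mul (Reg 15) (Reg 15)))))
     (Seq (Assign 17 (Bin Add (Reg 17) (Const 1))) (Store 10 (slot 13) (Reg 17)))
     (If (Bin Less (Bin Add (Bin Mul (Reg 19) (Reg 16)) (Bin Mul (Reg 21) (Reg 28)))
                   (Bin Add (Bin Mul (Reg 18) (Reg 16)) (Bin Mul (Reg 20) (Reg 28))))
       (Seq (Store 10 (slot 13) (Const 2)) (Seq (add_to 19 16) (add_to 21 28)))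
       (Seq (Store 10 (slot 13) (Const 1)) (Seq (add_to 18 16) (add_to 20 28))))"

definition assign_part :: com where
  "assign_part = Seq load
     (If (Bin Equal (Bin Div (Reg 13) (Reg 0)) (Reg 9))
       (If (Bin Equal (Arr 10 (slot 13)) (Const 0)) (Seq fetch_degrees place) Skip) Skip)"

lemma assign_part_simps:
  "straight assign_part" "csize assign_part = 23"
  "wregs assign_part = {13, 14, 24, 16, 28, 17, 18, 19, 20, 21}" "warrs assign_part = {10}"
  by (auto simp: assign_part_def fetch_degrees_def place_def add_to_def len_def)

lemma split_fold_snoc: "split_fold n \<tau> Q l (es @ [e]) = split_step n \<tau> Q l e (split_fold n \<tau> Q l es)"
  by (simp add: split_fold_def)

text \<open>The loop follows the fold of \<open>split_step\<close> literally: array 10 holds the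
  part of each vertex, register 17 the number of parts, and registers 18 to 21 the four degree
  sums.\<close>

lemma reach_assign_part:
  assumes n: "regs s 0 = n" and \<tau>: "regs s 9 = \<tau>" "\<tau> < 3" and L: "regs s 15 = L"
    and l: "pool s (regs s 7) (regs s 8) = l" "regs s 7 \<le> regs s 8" "tripartite n l"
    and j: "regs s 12 = regs s 7"
    and deg: "\<And>y. arrs s 8 (regs s 6 * (3 * n) + y) = deg n \<tau> ((\<tau> + 1) mod 3) l y"
      "\<And>y. arrs s 9 (regs s 6 * (3 * n) + y) = deg n \<tau> ((\<tau> + 2) mod 3) l y"
    and fresh: "\<And>i. regs s 6 * (3 * n) \<le> i \<Longrightarrow> arrs s 10 i = 0"
    and init: "regs s 17 = 2" "regs s 18 = 0" "regs s 19 = 0" "regs s 20 = 0" "regs s 21 = 0"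
  shows "reach (for_loop 12 8 assign_part) s (real (length l) * 25 + 1) 0
    (\<lambda>s'. (\<exists>x1 x2 z1 z2. split_fold n \<tau> (36 * L\<^sup>2) l l =
        (\<lambda>y. arrs s' 10 (regs s 6 * (3 * n) + y), regs s' 17, x1, x2, z1, z2)) \<and>
      keeps {12, 13, 14, 24, 16, 28, 17, 18, 19, 20, 21} {10} s s')"
proof -
  let ?B = "regs s 6 * (3 * n)" and ?Q = "36 * L\<^sup>2"
  let ?P = "\<lambda>j s'. split_fold n \<tau> ?Q l (take (j - regs s 7) l) =
     (\<lambda>y. arrs s' 10 (?B + y), regs s' 17, regs s' 18, regs s' 19, regs s' 20, regs s' 21)"
  have "reach (for_loop 12 8 assign_part) s (real (regs s 8 - regs s 7) * (real (csize assign_part) + 2) + 1) 0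
    (\<lambda>s'. ?P (regs s 8) s' \<and> regs s' 12 = regs s 8 \<and> keeps (insert 12 (wregs assign_part)) (warrs assign_part) s s')"
  proof (rule reach_for_straight)
    show "?P (regs s 7) s" using fresh init by (simp add: split_fold_def)
    fix j s' assume jj: "regs s 7 \<le> j" "j < regs s 8" "regs s' 12 = j"
      and k: "keeps (insert 12 (wregs assign_part)) (warrs assign_part) s s'" and P: "?P j s'"
    note k' = keeps_regs[OF k] keeps_arrs[OF k]
    let ?e = "(arrs s 2 j, arrs s 3 j)"
    define a where "a = near n \<tau> ?e"
    have eq: "regs s' 0 = n" "regs s' 9 = \<tau>" "regs s' 15 = L" "regs s' 6 = regs s 6" "regs s' 7 = regs s 7" "regs s' 8 = regs s 8"
      "arrs s' 2 = arrs s 2" "arrs s' 3 = arrs s 3" "arrs s' 8 = arrs s 8" "arrs s' 9 = arrs s 9"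
      using k' n \<tau> L by (simp_all add: assign_part_simps)
    have tk: "take (Suc j - regs s 7) l = take (j - regs s 7) l @ [?e]"
      using take_pool_Suc[OF jj(1,2), of s] l(1) by simp
    have ll: "length l = regs s 8 - regs s 7" using l(1) by auto
    let ?f = "\<lambda>y. arrs s' 10 (?B + y)"
    let ?x = "deg n \<tau> ((\<tau> + 1) mod 3) l a" and ?z = "deg n \<tau> ((\<tau> + 2) mod 3) l a"
    have new: "split_fold n \<tau> ?Q l (take (Suc j - regs s 7) l) =
      (if \<not> touches n \<tau> ?e \<or> ?f a \<noteq> 0 then (?f, regs s' 17, regs s' 18, regs s' 19, regs s' 20, regs s' 21)
       else if length l < (?x + ?z) * ?Q then (?f(a := Suc (regs s' 17)), Suc (regs s' 17), regs s' 18, regs s' 19, regs s' 20, regs s' 21)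
       else if regs s' 18 * ?x + regs s' 20 * ?z \<le> regs s' 19 * ?x + regs s' 21 * ?z
         then (?f(a := 1), regs s' 17, regs s' 18 + ?x, regs s' 19, regs s' 20 + ?z, regs s' 21)
       else (?f(a := 2), regs s' 17, regs s' 18, regs s' 19 + ?x, regs s' 20, regs s' 21 + ?z))"
      unfolding tk split_fold_snoc P split_step_def prod.case Let_def a_def by simp
    have ax: "regs s' 6 * (3 * n) = ?B" using eq by simp
    show "?P (Suc j) (set_reg 12 (Suc j) (sval assign_part s'))"
    proof (cases "touches n \<tau> ?e \<and> ?f a = 0")
      case False
      then have "sval assign_part s' = sval load s'"
        using eq jj(3) by (auto simp: assign_part_def touches_iff a_def)
      with False show ?thesis unfolding new by auto
    next
      case True
      define s1 where "s1 = set_reg 28 ?z (set_reg 16 ?x (sval load s'))"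
      have s1: "sval fetch_degrees (sval load s') = s1"
        using eq jj(3) deg by (simp add: fetch_degrees_def s1_def a_def)
      have r: "regs s1 13 = a" "regs s1 16 = ?x" "regs s1 28 = ?z" "regs s1 0 = n" "regs s1 6 = regs s 6" "regs s1 15 = L"
        "regs s1 7 = regs s 7" "regs s1 8 = regs s 8"
        "arrs s1 = arrs s'" "regs s1 17 = regs s' 17" "regs s1 18 = regs s' 18" "regs s1 19 = regs s' 19"
        "regs s1 20 = regs s' 20" "regs s1 21 = regs s' 21"
        using eq jj(3) by (simp_all add: s1_def a_def)
      have c: "aval (Bin Equal (Bin Div (Reg 13) (Reg 0)) (Reg 9)) (sval load s') \<noteq> 0"
        "aval (Bin Equal (Arr 10 (slot 13)) (Const 0)) (sval load s') \<noteq> 0"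
        using True eq jj(3) by (auto simp: touches_iff a_def)
      have sv: "sval assign_part s' = sval place s1"
        by (simp only: assign_part_def sval.simps(3,4) c s1 if_False)
      have Q: "36 * (L * L) = 36 * L\<^sup>2" by (simp add: power2_eq_square)
      consider (heavy) "length l < (?x + ?z) * ?Q"
        | (one) "\<not> length l < (?x + ?z) * ?Q" "regs s' 18 * ?x + regs s' 20 * ?z \<le> regs s' 19 * ?x + regs s' 21 * ?z"
        | (two) "\<not> length l < (?x + ?z) * ?Q" "\<not> regs s' 18 * ?x + regs s' 20 * ?z \<le> regs s' 19 * ?x + regs s' 21 * ?z"
        by blast
      then show ?thesis
      proof cases
        case heavy
        then have "sval assign_part s' = sval (Seq (Assign 17 (Bin Add (Reg 17) (Const 1))) (Store 10 (slot 13) (Reg 17))) s1"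
          unfolding sv place_def by (simp add: r len_def Q ll)
        then show ?thesis unfolding new using True heavy by (simp add: r fun_eq_iff)
      next
        case one
        then have "sval assign_part s' = sval (Seq (Store 10 (slot 13) (Const 1)) (Seq (add_to 18 16) (add_to 20 28))) s1"
          unfolding sv place_def by (simp add: r len_def Q ll)
        moreover have nw: "split_fold n \<tau> ?Q l (take (Suc j - regs s 7) l) =
           (?f(a := 1), regs s' 17, regs s' 18 + ?x, regs s' 19, regs s' 20 + ?z, regs s' 21)"
          unfolding new using one True by simp
        ultimately show ?thesis using split_fold_sum_le[OF nw, unfolded ll]
          by (simp add: sval_add_to r fun_eq_iff)
      next
        case two
        then have "sval assign_part s' = sval (Seq (Store 10 (slot 13) (Const 2)) (Seq (add_to 19 16) (add_to 21 28))) s1"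
          unfolding sv place_def by (simp add: r len_def Q ll)
        moreover have nw: "split_fold n \<tau> ?Q l (take (Suc j - regs s 7) l) =
           (?f(a := 2), regs s' 17, regs s' 18, regs s' 19 + ?x, regs s' 20, regs s' 21 + ?z)"
          unfolding new using two True by simp
        ultimately show ?thesis using split_fold_sum_le[OF nw, unfolded ll]
          by (simp add: sval_add_to r fun_eq_iff)
      qed
    qed
  qed (use assms in \<open>auto simp: assign_part_simps\<close>)
  then show ?thesis using l(1) by (auto simp: assign_part_simps elim!: reach_mono)
qed

section \<open>Writing the parts onto the stack\<close>

definition copy_edge :: com where
  "copy_edge = Seq load (Seq (Assign 16 (Const 1))
     (Seq (If (Bin Equal (Bin Div (Reg 13) (Reg 0)) (Reg 9)) (Assign 16 (Bin Equal (Arr 10 (slot 13)) (Reg 22))) Skip)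
       (If (Reg 16) (Seq (Store 2 (Reg 5) (Arr 2 (Reg 12))) (Seq (Store 3 (Reg 5) (Arr 3 (Reg 12)))
          (Assign 5 (Bin Add (Reg 5) (Const 1))))) Skip)))"

lemma copy_edge_simps:
  "straight copy_edge" "csize copy_edge = 16" "wregs copy_edge = {13, 14, 24, 16, 5}" "warrs copy_edge = {2, 3}"
  by (auto simp: copy_edge_def)

text \<open>The segment read ends before the place where edges are appended, so it is not
  overwritten while it is being filtered.\<close>

lemma reach_copy_edges:
  assumes n: "regs s 0 = n" and \<tau>: "regs s 9 = \<tau>" and i: "regs s 22 = i"
    and l: "pool s (regs s 7) (regs s 8) = l" "regs s 7 \<le> regs s 8" "regs s 8 \<le> regs s 5"
    and j: "regs s 12 = regs s 7"
    and sd: "\<And>y. arrs s 10 (regs s 6 * (3 * n) + y) = sd y"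
  shows "reach (for_loop 12 8 copy_edge) s (real (length l) * 18 + 1) 0
    (\<lambda>s'. regs s 5 \<le> regs s' 5 \<and> pool s' (regs s 5) (regs s' 5) = part n \<tau> sd i l \<and>
      (\<forall>q<regs s 5. arrs s' 2 q = arrs s 2 q \<and> arrs s' 3 q = arrs s 3 q) \<and>
      keeps {12, 13, 14, 24, 16, 5} {2, 3} s s')"
proof -
  let ?P = "\<lambda>j s'. regs s 5 \<le> regs s' 5 \<and> pool s' (regs s 5) (regs s' 5) = part n \<tau> sd i (take (j - regs s 7) l) \<and>
      (\<forall>q<regs s 5. arrs s' 2 q = arrs s 2 q \<and> arrs s' 3 q = arrs s 3 q)"
  have "reach (for_loop 12 8 copy_edge) s (real (regs s 8 - regs s 7) * (real (csize copy_edge) + 2) + 1) 0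
    (\<lambda>s'. ?P (regs s 8) s' \<and> regs s' 12 = regs s 8 \<and> keeps (insert 12 (wregs copy_edge)) (warrs copy_edge) s s')"
  proof (rule reach_for_straight)
    show "?P (regs s 7) s" by (simp add: part_def pool_def)
    fix j s' assume jj: "regs s 7 \<le> j" "j < regs s 8" "regs s' 12 = j"
      and k: "keeps (insert 12 (wregs copy_edge)) (warrs copy_edge) s s'" and P: "?P j s'"
    note k' = keeps_regs[OF k] keeps_arrs[OF k]
    let ?e = "(arrs s 2 j, arrs s 3 j)"
    have eq: "regs s' 0 = n" "regs s' 9 = \<tau>" "regs s' 22 = i" "regs s' 6 = regs s 6" "arrs s' 10 = arrs s 10"
      using k' n \<tau> i by (simp_all add: copy_edge_simps)
    have e: "arrs s' 2 j = arrs s 2 j" "arrs s' 3 j = arrs s 3 j" using P jj l(3) by auto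
    have tk: "take (Suc j - regs s 7) l = take (j - regs s 7) l @ [?e]"
      using take_pool_Suc[OF jj(1,2), of s] l(1) by simp
    define keep where "keep \<longleftrightarrow> (touches n \<tau> ?e \<longrightarrow> sd (near n \<tau> ?e) = i)"
    have pt: "part n \<tau> sd i (take (Suc j - regs s 7) l) = part n \<tau> sd i (take (j - regs s 7) l) @ (if keep then [?e] else [])"
      unfolding tk by (simp add: part_def keep_def)
    define s1 where "s1 = set_reg 16 (of_bool keep) (sval load s')"
    have s1: "sval (If (Bin Equal (Bin Div (Reg 13) (Reg 0)) (Reg 9)) (Assign 16 (Bin Equal (Arr 10 (slot 13)) (Reg 22))) Skip)
        (sval (Assign 16 (Const 1)) (sval load s')) = s1"
      using eq e jj(3) sd by (auto simp: s1_def keep_def touches_iff set_reg_def)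
    have sv: "sval copy_edge s' = (if keep then sval (Seq (Store 2 (Reg 5) (Arr 2 (Reg 12))) (Seq (Store 3 (Reg 5) (Arr 3 (Reg 12)))
          (Assign 5 (Bin Add (Reg 5) (Const 1))))) s1 else s1)"
      unfolding copy_edge_def sval.simps(3) s1 by (simp add: s1_def)
    show "?P (Suc j) (set_reg 12 (Suc j) (sval copy_edge s'))"
    proof (cases keep)
      case False
      then show ?thesis unfolding pt sv using P by (simp add: s1_def pool_def)
    next
      case True
      let ?s = "set_reg 12 (Suc j) (sval copy_edge s')"
      have r: "regs ?s 5 = Suc (regs s' 5)" "arrs ?s 2 = (arrs s' 2)(regs s' 5 := arrs s 2 j)"
        "arrs ?s 3 = (arrs s' 3)(regs s' 5 := arrs s 3 j)"
        unfolding sv using True jj(3) e P jj(2) l(3) by (simp_all add: s1_def)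
      have "pool ?s (regs s 5) (regs s' 5) = pool s' (regs s 5) (regs s' 5)"
        by (rule pool_cong) (simp only: r, simp)
      then have "pool ?s (regs s 5) (regs ?s 5) = pool s' (regs s 5) (regs s' 5) @ [?e]"
        unfolding r(1) using P by (subst pool_snoc) (simp_all only: r, simp_all)
      then show ?thesis unfolding pt using P True by (simp only: r if_True) auto
    qed
  qed (use assms in \<open>auto simp: copy_edge_simps\<close>)
  then show ?thesis using l(1) by (auto simp: copy_edge_simps elim!: reach_mono)
qed

text \<open>Arrays 4 and 5 delimit the segment of a node, array 6 holds the class to be split next,
  and array 7 the flag. The program knows the level only modulo 3; the level itself belongs to the
  analysis.\<close>

definition stack_ok :: "state \<Rightarrow> node list \<Rightarrow> bool" where
  "stack_ok s ns \<longleftrightarrow> regs s 4 = length ns \<and> (\<forall>i<length ns. case ns ! i of (h, f, l) \<Rightarrow>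
     arrs s 6 i = h mod 3 \<and> arrs s 7 i = of_bool f \<and> arrs s 4 i \<le> arrs s 5 i \<and> arrs s 5 i \<le> regs s 5 \<and>
     pool s (arrs s 4 i) (arrs s 5 i) = l)"

definition push_part :: com where
  "push_part = Seq (Seq (Store 4 (Reg 4) (Reg 5)) (Assign 12 (Reg 7)))
     (Seq (for_loop 12 8 copy_edge)
       (Seq (Store 5 (Reg 4) (Reg 5)) (Seq (Store 6 (Reg 4) (Reg 23))
         (Seq (Store 7 (Reg 4) (Bin Less (Const 2) (Reg 22))) (Assign 4 (Bin Add (Reg 4) (Const 1)))))))"

lemma push_part_sets [simp]:
  "wregs push_part = {4, 5, 12, 13, 14, 16, 24}" "warrs push_part = {2, 3, 4, 5, 6, 7}"
  by (auto simp: push_part_def copy_edge_simps)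

lemma reach_push_part:
  assumes n: "regs s 0 = n" and \<tau>: "regs s 9 = \<tau>" "regs s 23 = Suc h mod 3" and i: "regs s 22 = i"
    and l: "pool s (regs s 7) (regs s 8) = l" "regs s 7 \<le> regs s 8" "regs s 8 \<le> regs s 5"
    and sd: "\<And>y. arrs s 10 (regs s 6 * (3 * n) + y) = sd y"
    and stack: "stack_ok s ns"
  shows "reach push_part s (real (length l) * 18 + 7) 0
    (\<lambda>s'. stack_ok s' (ns @ [(Suc h, 2 < i, part n \<tau> sd i l)]) \<and>
      pool s' (regs s 7) (regs s 8) = l \<and> regs s 8 \<le> regs s' 5)"
proof -
  let ?post = "Seq (Store 5 (Reg 4) (Reg 5)) (Seq (Store 6 (Reg 4) (Reg 23))
         (Seq (Store 7 (Reg 4) (Bin Less (Const 2) (Reg 22))) (Assign 4 (Bin Add (Reg 4) (Const 1)))))"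
  let ?pre = "Seq (Store 4 (Reg 4) (Reg 5)) (Assign 12 (Reg 7))"
  define s0 where "s0 = sval ?pre s"
  have s0: "s0 = set_reg 12 (regs s 7) (set_arr 4 (length ns) (regs s 5) s)"
    using stack by (simp add: s0_def stack_ok_def)
  have "reach (for_loop 12 8 copy_edge) s0 (real (length l) * 18 + 1) 0
    (\<lambda>s'. regs s0 5 \<le> regs s' 5 \<and> pool s' (regs s0 5) (regs s' 5) = part n \<tau> sd i l \<and>
      (\<forall>q<regs s0 5. arrs s' 2 q = arrs s0 2 q \<and> arrs s' 3 q = arrs s0 3 q) \<and>
      keeps {12, 13, 14, 24, 16, 5} {2, 3} s0 s')"
    by (rule reach_copy_edges) (use assms in \<open>simp_all add: s0 pool_def\<close>)
  then have "reach (for_loop 12 8 copy_edge) s0 (real (length l) * 18 + 1) 0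
    (\<lambda>s'. stack_ok (sval ?post s') (ns @ [(Suc h, 2 < i, part n \<tau> sd i l)]) \<and>
      pool (sval ?post s') (regs s 7) (regs s 8) = l \<and> regs s 8 \<le> regs (sval ?post s') 5)"
  proof (rule reach_mono)
    fix s' assume A: "regs s0 5 \<le> regs s' 5 \<and> pool s' (regs s0 5) (regs s' 5) = part n \<tau> sd i l \<and>
      (\<forall>q<regs s0 5. arrs s' 2 q = arrs s0 2 q \<and> arrs s' 3 q = arrs s0 3 q) \<and>
      keeps {12, 13, 14, 24, 16, 5} {2, 3} s0 s'"
    then have k: "keeps {12, 13, 14, 24, 16, 5} {2, 3} s0 s'" by blast
    note k' = keeps_regs[OF k] keeps_arrs[OF k]
    define s2 where "s2 = sval ?post s'"
    have r: "regs s' 4 = length ns" "regs s' 23 = Suc h mod 3" "regs s' 22 = i"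
      using k' stack \<tau> i by (simp_all add: s0 stack_ok_def)
    have a: "arrs s2 2 = arrs s' 2" "arrs s2 3 = arrs s' 3" "regs s2 4 = Suc (length ns)" "regs s2 5 = regs s' 5"
      "arrs s2 4 = (arrs s 4)(length ns := regs s 5)" "arrs s2 5 = (arrs s 5)(length ns := regs s' 5)"
      "arrs s2 6 = (arrs s 6)(length ns := Suc h mod 3)" "arrs s2 7 = (arrs s 7)(length ns := of_bool (2 < i))"
      using r k'(2)[of 4] k'(2)[of 5] k'(2)[of 6] k'(2)[of 7] by (simp_all add: s2_def s0)
    have fp: "regs s0 5 = regs s 5" "arrs s0 2 = arrs s 2" "arrs s0 3 = arrs s 3" by (simp_all add: s0)
    \<comment> \<open>Segments ending before the old end of the pool are unaffected by
      appending.\<close>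
    have pool2: "pool s2 x y = pool s x y" if "y \<le> regs s 5" for x y
      using A that by (intro pool_cong) (simp add: a fp)
    have pool3: "pool s2 x y = pool s' x y" for x y by (intro pool_cong) (simp add: a)
    have "stack_ok s2 (ns @ [(Suc h, 2 < i, part n \<tau> sd i l)])"
      unfolding stack_ok_def
    proof (intro conjI allI impI)
      fix q assume "q < length (ns @ [(Suc h, 2 < i, part n \<tau> sd i l)])"
      then consider "q < length ns" | "q = length ns" by force
      then show "case (ns @ [(Suc h, 2 < i, part n \<tau> sd i l)]) ! q of (h, f, l) \<Rightarrow>
         arrs s2 6 q = h mod 3 \<and> arrs s2 7 q = of_bool f \<and> arrs s2 4 q \<le> arrs s2 5 q \<and>
         arrs s2 5 q \<le> regs s2 5 \<and> pool s2 (arrs s2 4 q) (arrs s2 5 q) = l"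
      proof cases
        case 1
        obtain h' f' l' where x: "ns ! q = (h', f', l')" by (cases "ns ! q")
        have "arrs s 6 q = h' mod 3 \<and> arrs s 7 q = of_bool f' \<and> arrs s 4 q \<le> arrs s 5 q \<and>
           arrs s 5 q \<le> regs s 5 \<and> pool s (arrs s 4 q) (arrs s 5 q) = l'"
          using stack 1 x unfolding stack_ok_def by fastforce
        then show ?thesis using 1 A x by (simp add: a fp nth_append pool2)
      next
        case 2
        then show ?thesis using A by (simp add: a fp pool3)
      qed
    qed (simp add: a)
    moreover have "pool s2 (regs s 7) (regs s 8) = l" using l by (simp add: pool2)
    moreover have "regs s 8 \<le> regs s2 5" using A l(3) by (simp add: a fp)
    ultimately show "stack_ok (sval ?post s') (ns @ [(Suc h, 2 < i, part n \<tau> sd i l)]) \<and>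
      pool (sval ?post s') (regs s 7) (regs s 8) = l \<and> regs s 8 \<le> regs (sval ?post s') 5"
      unfolding s2_def by blast
  qed auto
  then have "reach (Seq (for_loop 12 8 copy_edge) ?post) s0 (real (length l) * 18 + 1 + real (csize ?post)) 0
    (\<lambda>s'. stack_ok s' (ns @ [(Suc h, 2 < i, part n \<tau> sd i l)]) \<and>
      pool s' (regs s 7) (regs s 8) = l \<and> regs s 8 \<le> regs s' 5)"
    by (intro reach_straight_Seq) auto
  then have "reach push_part s (real (csize ?pre) + (real (length l) * 18 + 1 + real (csize ?post))) 0
    (\<lambda>s'. stack_ok s' (ns @ [(Suc h, 2 < i, part n \<tau> sd i l)]) \<and>
      pool s' (regs s 7) (regs s 8) = l \<and> regs s 8 \<le> regs s' 5)"
    unfolding push_part_def s0_def by (rule reach_Seq_straight[rotated]) simp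
  then show ?thesis by (rule reach_mono) auto
qed

definition split_node :: com where
  "split_node =
     Seq (Seq (Assign 23 (Bin Add (Reg 9) (Const 1))) (Seq (If (Bin Equal (Reg 23) (Const 3)) (Assign 23 (Const 0)) Skip) (Assign 12 (Reg 7))))
    (Seq (for_loop 12 8 count_degrees)
    (Seq (Seq (Assign 17 (Const 2)) (Seq (Assign 18 (Const 0)) (Seq (Assign 19 (Const 0))
           (Seq (Assign 20 (Const 0)) (Seq (Assign 21 (Const 0)) (Assign 12 (Reg 7)))))))
    (Seq (for_loop 12 8 assign_part)
    (Seq (Seq (Assign 22 (Const 1)) (Assign 29 (Bin Add (Reg 17) (Const 1))))
      (for_loop 22 29 push_part)))))"

lemma split_node_sets [simp]:
  "wregs split_node = {4, 5, 12, 13, 14, 16, 17, 18, 19, 20, 21, 22, 23, 24, 28, 29}"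
  "warrs split_node = {2, 3, 4, 5, 6, 7, 8, 9, 10}"
  by (auto simp: split_node_def count_degrees_simps assign_part_simps)

text \<open>Needed to see that counting degrees leaves the slots of later calls at zero.\<close>

lemma deg_outside:
  assumes "tripartite n l" "3 * n \<le> y"
  shows "deg n \<tau> \<sigma> l y = 0"
  using near_less[OF assms(1)] assms(2) unfolding deg_def length_0_conv filter_empty_conv
  by (metis linorder_not_le)

lemma stack_ok_cong:
  "stack_ok s ns \<Longrightarrow> keeps R A s s' \<Longrightarrow> R \<inter> {4, 5} = {} \<Longrightarrow> A \<inter> {2, 3, 4, 5, 6, 7} = {} \<Longrightarrow> stack_ok s' ns"
proof -
  assume s: "stack_ok s ns" and k: "keeps R A s s'" and "R \<inter> {4, 5} = {}" "A \<inter> {2, 3, 4, 5, 6, 7} = {}"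
  then have "4 \<notin> R" "5 \<notin> R" "2 \<notin> A" "3 \<notin> A" "4 \<notin> A" "5 \<notin> A" "6 \<notin> A" "7 \<notin> A" by blast+
  with k have "regs s' 4 = regs s 4" "regs s' 5 = regs s 5" "arrs s' 2 = arrs s 2" "arrs s' 3 = arrs s 3"
    "arrs s' 4 = arrs s 4" "arrs s' 5 = arrs s 5" "arrs s' 6 = arrs s 6" "arrs s' 7 = arrs s 7"
    by (simp_all add: keeps_def)
  with s show ?thesis by (simp add: stack_ok_def pool_def)
qed

text \<open>Two passes over the edges determine the parts, and one further pass writes each of the
  at most 36 * L^2 + 2 parts.\<close>

lemma reach_split_node:
  assumes n: "regs s 0 = n" and \<tau>: "regs s 9 = h mod 3" and L: "regs s 15 = L"
    and l: "pool s (regs s 7) (regs s 8) = l" "regs s 7 \<le> regs s 8" "regs s 8 \<le> regs s 5" "tripartite n l" "l \<noteq> []"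
    and fresh: "\<And>a i. a \<in> {8, 9, 10} \<Longrightarrow> regs s 6 * (3 * n) \<le> i \<Longrightarrow> arrs s a i = 0"
    and stack: "stack_ok s ns"
  shows "reach split_node s ((36 * (real L)\<^sup>2 + 4) * (20 * real (length l) + 20)) 0
    (\<lambda>s'. \<exists>r sd. good_split n (h mod 3) (36 * L\<^sup>2) l r sd \<and> stack_ok s' (ns @ children n h r sd l) \<and>
      (\<forall>a\<in>{8, 9, 10}. \<forall>i. (regs s 6 + 1) * (3 * n) \<le> i \<longrightarrow> arrs s' a i = 0) \<and>
      keeps (wregs split_node) (warrs split_node) s s')"
proof -
  let ?\<tau> = "h mod 3" and ?B = "regs s 6 * (3 * n)"
  let ?p1 = "Seq (Assign 23 (Bin Add (Reg 9) (Const 1))) (Seq (If (Bin Equal (Reg 23) (Const 3)) (Assign 23 (Const 0)) Skip) (Assign 12 (Reg 7)))"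
  let ?p2 = "Seq (Assign 17 (Const 2)) (Seq (Assign 18 (Const 0)) (Seq (Assign 19 (Const 0))
           (Seq (Assign 20 (Const 0)) (Seq (Assign 21 (Const 0)) (Assign 12 (Reg 7))))))"
  let ?p3 = "Seq (Assign 22 (Const 1)) (Assign 29 (Bin Add (Reg 17) (Const 1)))"
  let ?Q = "\<lambda>s'. \<exists>r sd. good_split n ?\<tau> (36 * L\<^sup>2) l r sd \<and> stack_ok s' (ns @ children n h r sd l) \<and>
      (\<forall>a\<in>{8, 9, 10}. \<forall>i. (regs s 6 + 1) * (3 * n) \<le> i \<longrightarrow> arrs s' a i = 0)"
  have \<tau>3: "?\<tau> < 3" by simp
  define s1 where "s1 = sval ?p1 s"
  have "regs s1 23 = (?\<tau> + 1) mod 3" using \<tau> \<tau>3 by (simp add: s1_def)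
  moreover have "keeps {12, 23} {} s s1" using sval_keeps[of ?p1 s] by (simp add: s1_def insert_commute)
  moreover have "regs s1 12 = regs s 7" by (simp add: s1_def)
  ultimately have s1: "regs s1 23 = (?\<tau> + 1) mod 3" "keeps {12, 23} {} s s1" "regs s1 12 = regs s 7" by blast+
  note k1 = keeps_regs[OF s1(2)] keeps_arrs[OF s1(2)]
  have pool1: "pool s1 x y = pool s x y" for x y by (rule pool_cong) (simp add: k1)
  have 3: "reach (for_loop 22 29 push_part) s3
      (real r * (real (length l) * 18 + 9) + 1) 0 ?Q"
    if s3: "keeps {12, 13, 14, 16, 17, 18, 19, 20, 21, 22, 23, 24, 28, 29} {8, 9, 10} s s3"
      "regs s3 22 = 1" "regs s3 29 = r + 1" "regs s3 23 = Suc h mod 3" and g: "good_split n ?\<tau> (36 * L\<^sup>2) l r sd"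
      and sd: "\<And>y. arrs s3 10 (?B + y) = sd y" and fr: "\<And>a i. a \<in> {8, 9, 10} \<Longrightarrow> (regs s 6 + 1) * (3 * n) \<le> i \<Longrightarrow> arrs s3 a i = 0"
    for s3 r sd
  proof -
    note k3 = keeps_regs[OF s3(1)] keeps_arrs[OF s3(1)]
    let ?P = "\<lambda>i s'. stack_ok s' (ns @ map (\<lambda>i. (Suc h, 2 < i, part n ?\<tau> sd i l)) [1..<i]) \<and>
        pool s' (regs s 7) (regs s 8) = l \<and> regs s 8 \<le> regs s' 5"
    have "reach (for_loop 22 29 push_part) s3 (real (r + 1 - 1) * ((real (length l) * 18 + 7) + 2) + 1) (real (r + 1 - 1) * 0)
      (\<lambda>s'. ?P (r + 1) s' \<and> regs s' 22 = r + 1 \<and> keeps (insert 22 (wregs push_part)) (warrs push_part) s3 s')"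
    proof (rule reach_for)
      have "stack_ok s3 ns" by (rule stack_ok_cong[OF stack s3(1)]) auto
      moreover have "pool s3 (regs s 7) (regs s 8) = l" using l(1) k3 by (simp add: pool_def)
      ultimately show "?P 1 s3" using k3 l(3) by simp
      fix i s' assume i: "1 \<le> i" "i < r + 1" "regs s' 22 = i" and k: "keeps (insert 22 (wregs push_part)) (warrs push_part) s3 s'"
        and P: "?P i s'"
      note k' = keeps_regs[OF k] keeps_arrs[OF k]
      have e: "regs s' 0 = n" "regs s' 9 = ?\<tau>" "regs s' 23 = Suc h mod 3" "regs s' 7 = regs s 7" "regs s' 8 = regs s 8"
        "regs s' 6 = regs s 6" "\<And>y. arrs s' 10 (regs s' 6 * (3 * n) + y) = sd y"
        using k' k3 n \<tau> sd s3 by simp_all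
      have "reach push_part s' (real (length l) * 18 + 7) 0
        (\<lambda>s''. stack_ok s'' ((ns @ map (\<lambda>i. (Suc h, 2 < i, part n ?\<tau> sd i l)) [1..<i]) @ [(Suc h, 2 < i, part n ?\<tau> sd i l)]) \<and>
          pool s'' (regs s' 7) (regs s' 8) = l \<and> regs s' 8 \<le> regs s'' 5)"
        using P e i l(2) by (intro reach_push_part) simp_all
      then show "reach push_part s' (real (length l) * 18 + 7) 0 (\<lambda>s''. ?P (Suc i) (set_reg 22 (Suc i) s''))"
        by (rule reach_mono) (use i e in \<open>simp_all add: stack_ok_def pool_def\<close>)
    qed (use s3 in auto)
    then show ?thesis
    proof (rule reach_mono)
      fix s' assume A: "?P (r + 1) s' \<and> regs s' 22 = r + 1 \<and> keeps (insert 22 (wregs push_part)) (warrs push_part) s3 s'"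
      then have k: "keeps (insert 22 (wregs push_part)) (warrs push_part) s3 s'" by blast
      have "arrs s' a = arrs s3 a" if "a \<in> {8, 9, 10}" for a using keeps_arrs[OF k, of a] that by auto
      with A g fr show "?Q s'" by (intro exI[of _ r] exI[of _ sd]) (simp add: children_def)
    qed (simp_all add: algebra_simps)
  qed
  have 2: "reach (Seq (for_loop 12 8 assign_part) (Seq ?p3 (for_loop 22 29 push_part))) s2
      ((real (length l) * 25 + 1) + (2 + ((36 * (real L)\<^sup>2 + 2) * (real (length l) * 18 + 9) + 1))) (0 + 0) ?Q"
    if s2: "keeps {12, 13, 14, 17, 18, 19, 20, 21, 23, 24} {8, 9} s s2" "regs s2 23 = Suc h mod 3"
      "\<forall>y. arrs s2 8 (?B + y) = deg n ?\<tau> ((?\<tau> + 1) mod 3) l y \<and> arrs s2 9 (?B + y) = deg n ?\<tau> ((?\<tau> + 2) mod 3) l y"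
      "regs s2 12 = regs s 7" "regs s2 17 = 2" "regs s2 18 = 0" "regs s2 19 = 0" "regs s2 20 = 0" "regs s2 21 = 0"
    for s2
  proof -
    note k2 = keeps_regs[OF s2(1)] keeps_arrs[OF s2(1)]
    have e: "regs s2 0 = n" "regs s2 9 = ?\<tau>" "regs s2 15 = L" "regs s2 7 = regs s 7" "regs s2 8 = regs s 8" "regs s2 6 = regs s 6"
      "arrs s2 10 = arrs s 10" "arrs s2 2 = arrs s 2" "arrs s2 3 = arrs s 3"
      using k2 n \<tau> L by simp_all
    have "reach (for_loop 12 8 assign_part) s2 (real (length l) * 25 + 1) 0
      (\<lambda>s'. (\<exists>x1 x2 z1 z2. split_fold n ?\<tau> (36 * L\<^sup>2) l l =
          (\<lambda>y. arrs s' 10 (regs s2 6 * (3 * n) + y), regs s' 17, x1, x2, z1, z2)) \<and>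
        keeps {12, 13, 14, 24, 16, 28, 17, 18, 19, 20, 21} {10} s2 s')"
      using e s2 l fresh by (intro reach_assign_part) (simp_all add: pool_def)
    then have "reach (for_loop 12 8 assign_part) s2 (real (length l) * 25 + 1) 0
      (\<lambda>s'. reach (Seq ?p3 (for_loop 22 29 push_part)) s' (2 + ((36 * (real L)\<^sup>2 + 2) * (real (length l) * 18 + 9) + 1)) 0 ?Q)"
    proof (rule reach_mono)
      fix s' assume "(\<exists>x1 x2 z1 z2. split_fold n ?\<tau> (36 * L\<^sup>2) l l =
          (\<lambda>y. arrs s' 10 (regs s2 6 * (3 * n) + y), regs s' 17, x1, x2, z1, z2)) \<and>
        keeps {12, 13, 14, 24, 16, 28, 17, 18, 19, 20, 21} {10} s2 s'"
      then obtain x1 x2 z1 z2 where f: "split_fold n ?\<tau> (36 * L\<^sup>2) l l = (\<lambda>y. arrs s' 10 (?B + y), regs s' 17, x1, x2, z1, z2)"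
        and k: "keeps {12, 13, 14, 24, 16, 28, 17, 18, 19, 20, 21} {10} s2 s'" using e by auto
      note k' = keeps_regs[OF k] keeps_arrs[OF k]
      have g: "good_split n ?\<tau> (36 * L\<^sup>2) l (regs s' 17) (\<lambda>y. arrs s' 10 (?B + y))"
        by (rule good_split_fold[OF l(4) \<tau>3 l(5) f])
      \<comment> \<open>Entries of the part array beyond the own slot must still be zero, as they
        belong to later calls; nonzero entries arise only at endpoints of edges.\<close>
      have sd0: "arrs s' 10 (?B + y) = 0" if "3 * n \<le> y" for y
      proof -
        have "arrs s' 10 (?B + y) \<noteq> 0 \<longleftrightarrow> y \<in> near n ?\<tau> ` {e \<in> set l. touches n ?\<tau> e}"
          using split_inv_fold[of n ?\<tau> "36 * L\<^sup>2" l l] unfolding f split_inv_def Let_def prod.case by blast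
        moreover have "y \<notin> near n ?\<tau> ` {e \<in> set l. touches n ?\<tau> e}"
        proof
          assume "y \<in> near n ?\<tau> ` {e \<in> set l. touches n ?\<tau> e}"
          then obtain e where "e \<in> set l" "y = near n ?\<tau> e" by blast
          with near_less[OF l(4) this(1), of ?\<tau>] that show False by simp
        qed
        ultimately show ?thesis by blast
      qed
      have r: "real (regs s' 17) \<le> 36 * (real L)\<^sup>2 + 2"
      proof -
        have "regs s' 17 \<le> 36 * L\<^sup>2 + 2" using g unfolding good_split_def by blast
        then have "real (regs s' 17) \<le> real (36 * L\<^sup>2 + 2)" by (rule of_nat_mono)
        then show ?thesis by simp
      qed
      define s3 where "s3 = sval ?p3 s'"
      have ks: "keeps {12, 13, 14, 16, 17, 18, 19, 20, 21, 22, 23, 24, 28, 29} {8, 9, 10} s s3"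
        using s2(1) k unfolding s3_def keeps_def by simp
      have "arrs s3 a i = 0" if "a \<in> {8, 9, 10}" "(regs s 6 + 1) * (3 * n) \<le> i" for a i
      proof -
        from that(2) obtain y where y: "i = ?B + y" "3 * n \<le> y"
          by (auto simp: le_iff_add add_mult_distrib add.assoc)
        have "arrs s3 8 = arrs s2 8" "arrs s3 9 = arrs s2 9" "arrs s3 10 = arrs s' 10" using k' by (simp_all add: s3_def)
        with that(1) y s2(3) deg_outside[OF l(4) y(2)] sd0[OF y(2)] show ?thesis by auto
      qed
      then have "reach (for_loop 22 29 push_part) s3 (real (regs s' 17) * (real (length l) * 18 + 9) + 1) 0 ?Q"
        using k' s2(2) by (intro 3[OF ks _ _ _ g]) (simp_all add: s3_def)
      then have "reach (Seq ?p3 (for_loop 22 29 push_part)) s' (real (csize ?p3) + (real (regs s' 17) * (real (length l) * 18 + 9) + 1)) 0 ?Q"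
        unfolding s3_def by (rule reach_Seq_straight[rotated]) simp
      moreover have "real (regs s' 17) * (real (length l) * 18 + 9) \<le> (36 * (real L)\<^sup>2 + 2) * (real (length l) * 18 + 9)"
        using r by (intro mult_right_mono) auto
      ultimately show "reach (Seq ?p3 (for_loop 22 29 push_part)) s' (2 + ((36 * (real L)\<^sup>2 + 2) * (real (length l) * 18 + 9) + 1)) 0 ?Q"
        by (elim reach_mono) auto
    qed auto
    then show ?thesis by (rule reach_Seq)
  qed
  let ?k2 = "(real (length l) * 25 + 1) + (2 + ((36 * (real L)\<^sup>2 + 2) * (real (length l) * 18 + 9) + 1))"
  have "reach (for_loop 12 8 count_degrees) s1 (real (length l) * 14 + 1) 0
    (\<lambda>s'. (\<forall>y. arrs s' 8 (regs s1 6 * (3 * n) + y) = deg n ?\<tau> ((?\<tau> + 1) mod 3) l y \<and>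
        arrs s' 9 (regs s1 6 * (3 * n) + y) = deg n ?\<tau> ((?\<tau> + 2) mod 3) l y) \<and>
      keeps {12, 13, 14, 24} {8, 9} s1 s')"
    using s1 k1 n \<tau> l fresh by (intro reach_count_degrees) (simp_all add: pool1)
  then have "reach (for_loop 12 8 count_degrees) s1 (real (length l) * 14 + 1) 0
    (\<lambda>s'. reach (Seq ?p2 (Seq (for_loop 12 8 assign_part) (Seq ?p3 (for_loop 22 29 push_part)))) s' (6 + ?k2) 0 ?Q)"
  proof (rule reach_mono)
    fix s' assume A: "(\<forall>y. arrs s' 8 (regs s1 6 * (3 * n) + y) = deg n ?\<tau> ((?\<tau> + 1) mod 3) l y \<and>
        arrs s' 9 (regs s1 6 * (3 * n) + y) = deg n ?\<tau> ((?\<tau> + 2) mod 3) l y) \<and>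
      keeps {12, 13, 14, 24} {8, 9} s1 s'"
    then have k: "keeps {12, 13, 14, 24} {8, 9} s1 s'" by blast
    note k' = keeps_regs[OF k] keeps_arrs[OF k]
    define s2 where "s2 = sval ?p2 s'"
    have "keeps {12, 13, 14, 17, 18, 19, 20, 21, 23, 24} {8, 9} s s2"
      using s1(2) k unfolding s2_def keeps_def by simp
    moreover have "regs s2 23 = Suc h mod 3" using k'(1)[of 23] s1(1) by (simp add: s2_def) presburger
    moreover have "arrs s2 = arrs s'" by (simp add: s2_def)
    moreover have "regs s2 12 = regs s 7" using k'(1)[of 7] k1(1)[of 7] by (simp add: s2_def)
    ultimately have "reach (Seq (for_loop 12 8 assign_part) (Seq ?p3 (for_loop 22 29 push_part))) s2 ?k2 (0 + 0) ?Q"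
      using A k1(1)[of 6] by (intro 2) (simp_all add: s2_def)
    then have "reach (Seq ?p2 (Seq (for_loop 12 8 assign_part) (Seq ?p3 (for_loop 22 29 push_part)))) s' (real (csize ?p2) + ?k2) (0 + 0) ?Q"
      unfolding s2_def by (rule reach_Seq_straight[rotated]) simp
    then show "reach (Seq ?p2 (Seq (for_loop 12 8 assign_part) (Seq ?p3 (for_loop 22 29 push_part)))) s' (6 + ?k2) 0 ?Q"
      by simp
  qed auto
  then have "reach (Seq (for_loop 12 8 count_degrees) (Seq ?p2 (Seq (for_loop 12 8 assign_part) (Seq ?p3 (for_loop 22 29 push_part))))) s1
    ((real (length l) * 14 + 1) + (6 + ?k2)) (0 + 0) ?Q" by (rule reach_Seq)
  then have "reach split_node s (real (csize ?p1) + ((real (length l) * 14 + 1) + (6 + ?k2))) (0 + 0) ?Q"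
    unfolding split_node_def s1_def by (rule reach_Seq_straight[rotated]) simp
  then have "reach split_node s ((36 * (real L)\<^sup>2 + 4) * (20 * real (length l) + 20)) 0 ?Q"
  proof (rule reach_mono)
    have "0 \<le> (real L)\<^sup>2 * real (length l)" by simp
    then show "real (csize ?p1) + ((real (length l) * 14 + 1) + (6 + ?k2)) \<le> (36 * (real L)\<^sup>2 + 4) * (20 * real (length l) + 20)"
      by (simp add: algebra_simps)
  qed auto
  from reach_keeps[OF this] show ?thesis by (rule reach_mono) blast+
qed

definition olist :: "state \<Rightarrow> nat set list" where
  "olist s = map (\<lambda>i. {arrs s 1 (3 * i), arrs s 1 (3 * i + 1), arrs s 1 (3 * i + 2)}) [0..<regs s 3]"

text \<open>Two layouts meet here. The scratch arrays 8 to 13 give call k a block of length 3 * n,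
  whereas the arrays of the given algorithm, of unknown extent, are interleaved with period
  K.\<close>

definition fresh_from :: "nat \<Rightarrow> nat \<Rightarrow> nat \<Rightarrow> state \<Rightarrow> bool" where
  "fresh_from n K k s \<longleftrightarrow> (\<forall>a\<in>{8..13}. \<forall>i\<ge>k * (3 * n). arrs s a i = 0) \<and>
     (\<forall>a\<ge>20. \<forall>i. k \<le> i mod K \<longrightarrow> arrs s a i = 0)"

text \<open>A solver either lists all triangles of a subproblem, or asks in register 11 for splitting it.\<close>

definition solver :: "com \<Rightarrow> nat \<Rightarrow> nat \<Rightarrow> nat \<Rightarrow> nat \<Rightarrow> bool \<Rightarrow> real \<Rightarrow> (nat \<Rightarrow> real) \<Rightarrow> bool" where
  "solver S n m L K rich ks us \<longleftrightarrow>
     wregs S \<inter> {0, 1, 2, 4, 5, 6, 7, 8, 10, 15} = {} \<and> warrs S \<inter> {0, 2, 3, 4, 5, 6, 7, 8, 9, 10} = {} \<and>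
     (\<forall>s h f l. regs s 0 = n \<and> regs s 1 = m \<and> regs s 15 = L \<and> regs s 9 = h mod 3 \<and> regs s 10 = of_bool f \<and>
        pool s (regs s 7) (regs s 8) = l \<and> regs s 7 \<le> regs s 8 \<and> tripartite n l \<and> length l \<le> 3 * m \<and>
        (f \<longrightarrow> single n ((h + 2) mod 3) l) \<and> fresh_from n K (regs s 6) s \<and> regs s 6 < K \<longrightarrow>
        reach S s (ks * (real (length l) + 1)) (us (length l)) (\<lambda>s'.
          (\<forall>a\<in>{11, 12, 13}. \<forall>i\<ge>(regs s 6 + 1) * (3 * n). arrs s' a i = 0) \<and>
          (\<forall>a\<ge>20. \<forall>i. regs s 6 < i mod K \<longrightarrow> arrs s' a i = 0) \<and>
          (if regs s' 11 = 0
           then \<not> f \<and> l \<noteq> [] \<and> (rich \<longrightarrow> length l \<le> card (triangles (edge_set l))) \<and> olist s' = olist s \<and> regs s' 9 = h mod 3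
           else \<exists>Ls. distinct Ls \<and> set Ls = triangles (edge_set l) \<and>
             olist s' = olist s @ map (\<lambda>T. (\<lambda>x. x mod n) ` T) Ls)))"

text \<open>Register 6 is incremented with every visit, so calls are numbered from 1 and block 0 of
  the scratch arrays stays empty.\<close>

definition pop :: com where
  "pop = Seq (Assign 4 (Bin Sub (Reg 4) (Const 1))) (Seq (Assign 7 (Arr 4 (Reg 4))) (Seq (Assign 8 (Arr 5 (Reg 4)))
     (Seq (Assign 9 (Arr 6 (Reg 4))) (Seq (Assign 10 (Arr 7 (Reg 4))) (Assign 6 (Bin Add (Reg 6) (Const 1)))))))"

definition visit :: "com \<Rightarrow> com" where
  "visit S = Seq pop (Seq S (If (Reg 11) Skip split_node))"

definition search :: "com \<Rightarrow> com" where
  "search S = While (Bin Mul (Bin Less (Reg 3) (Reg 2)) (Bin Less (Const 0) (Reg 4))) (visit S)"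

text \<open>The output already consists of vertices of the original graph, obtained modulo n from
  those of the tripartite one. Since register 6 is incremented before each visit, the next fresh
  slot is one past the number of visits.\<close>

definition search_state ::
  "nat \<Rightarrow> nat \<Rightarrow> nat \<Rightarrow> nat \<Rightarrow> nat \<Rightarrow> node list \<Rightarrow> nat set list \<Rightarrow> nat list \<Rightarrow> state \<Rightarrow> bool" where
  "search_state n m t L K ns Ts done s \<longleftrightarrow> regs s 0 = n \<and> regs s 1 = m \<and> regs s 2 = t \<and> regs s 15 = L \<and>
     stack_ok s ns \<and> olist s = map (\<lambda>T. (\<lambda>x. x mod n) ` T) Ts \<and> regs s 6 = length done \<and>
     fresh_from n K (length done + 1) s"

lemma olist_length: "length (olist s) = regs s 3"
  by (simp add: olist_def)

text \<open>The subtracted step is left for the loop test, so that one iteration costs at most a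
  constant times the weight of the node.\<close>

lemma reach_visit:
  assumes S: "solver S n m L K rich ks us"
    and st: "search_state n m t L K (ns @ [(h, f, l)]) Ts done s" and ok: "node_ok n m L (h, f, l)"
    and K: "length done + 1 < K" and "0 \<le> ks" "\<And>k. 0 \<le> us k"
  shows "reach (visit S) s ((36 * (real L)\<^sup>2 + 4) * (2 * ks + 42) * real (max 1 (length l)) - 1) (us (length l)) (\<lambda>s'.
    (\<exists>Ls. distinct Ls \<and> set Ls = triangles (edge_set l) \<and> search_state n m t L K ns (Ts @ Ls) (done @ [length l]) s') \<or>
    (\<exists>r sd. \<not> f \<and> l \<noteq> [] \<and> (rich \<longrightarrow> length l \<le> card (triangles (edge_set l))) \<and> good_split n (h mod 3) (36 * L\<^sup>2) l r sd \<and>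
       search_state n m t L K (ns @ children n h r sd l) Ts (done @ [length l]) s'))"
proof -
  let ?Q = "\<lambda>s'. (\<exists>Ls. distinct Ls \<and> set Ls = triangles (edge_set l) \<and> search_state n m t L K ns (Ts @ Ls) (done @ [length l]) s') \<or>
    (\<exists>r sd. \<not> f \<and> l \<noteq> [] \<and> (rich \<longrightarrow> length l \<le> card (triangles (edge_set l))) \<and> good_split n (h mod 3) (36 * L\<^sup>2) l r sd \<and>
       search_state n m t L K (ns @ children n h r sd l) Ts (done @ [length l]) s')"
  let ?n = "length ns" and ?k = "length done + 1"
  have w: "wregs S \<inter> {0, 1, 2, 4, 5, 6, 7, 8, 10, 15} = {}" "warrs S \<inter> {0, 2, 3, 4, 5, 6, 7, 8, 9, 10} = {}"
    by (rule conjunct1[OF S[unfolded solver_def]] conjunct1[OF conjunct2[OF S[unfolded solver_def]]])+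
  have stk: "stack_ok s (ns @ [(h, f, l)])" using st by (simp add: search_state_def)
  have top: "arrs s 6 ?n = h mod 3" "arrs s 7 ?n = of_bool f" "arrs s 4 ?n \<le> arrs s 5 ?n" "arrs s 5 ?n \<le> regs s 5"
    "pool s (arrs s 4 ?n) (arrs s 5 ?n) = l" "regs s 4 = Suc ?n"
    using stk unfolding stack_ok_def by (auto dest!: spec[of _ ?n])
  define s1 where "s1 = sval pop s"
  have s1: "regs s1 4 = ?n" "regs s1 7 = arrs s 4 ?n" "regs s1 8 = arrs s 5 ?n" "regs s1 9 = h mod 3" "regs s1 10 = of_bool f"
    "regs s1 6 = ?k" "arrs s1 = arrs s" "regs s1 0 = n" "regs s1 1 = m" "regs s1 2 = t" "regs s1 15 = L" "regs s1 3 = regs s 3" "regs s1 5 = regs s 5"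
    using top st by (simp_all add: s1_def pop_def search_state_def)
  have pl: "pool s1 x y = pool s x y" for x y by (simp add: pool_def s1)
  have stk1: "stack_ok s1 ns"
    unfolding stack_ok_def
  proof (intro conjI allI impI)
    fix i assume "i < ?n"
    then show "case ns ! i of (h, f, l) \<Rightarrow>
     arrs s1 6 i = h mod 3 \<and> arrs s1 7 i = of_bool f \<and> arrs s1 4 i \<le> arrs s1 5 i \<and> arrs s1 5 i \<le> regs s1 5 \<and>
     pool s1 (arrs s1 4 i) (arrs s1 5 i) = l"
      using stk unfolding stack_ok_def s1 pl by (auto simp: nth_append dest!: spec[of _ i])
  qed (rule s1)
  have fr: "fresh_from n K ?k s1" using st by (simp add: search_state_def fresh_from_def s1)
  have node: "tripartite n l" "length l \<le> 3 * m" "f \<longrightarrow> single n ((h + 2) mod 3) l"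
    using ok by (auto simp: node_ok_def)
  have ol1: "olist s1 = olist s" by (simp add: olist_def s1)
  have "reach S s1 (ks * (real (length l) + 1)) (us (length l)) (\<lambda>s'.
          (\<forall>a\<in>{11, 12, 13}. \<forall>i\<ge>(regs s1 6 + 1) * (3 * n). arrs s' a i = 0) \<and>
          (\<forall>a\<ge>20. \<forall>i. regs s1 6 < i mod K \<longrightarrow> arrs s' a i = 0) \<and>
          (if regs s' 11 = 0
           then \<not> f \<and> l \<noteq> [] \<and> (rich \<longrightarrow> length l \<le> card (triangles (edge_set l))) \<and> olist s' = olist s1 \<and> regs s' 9 = h mod 3
           else \<exists>Ls. distinct Ls \<and> set Ls = triangles (edge_set l) \<and>
             olist s' = olist s1 @ map (\<lambda>T. (\<lambda>x. x mod n) ` T) Ls))"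
    by (rule conjunct2[OF conjunct2[OF S[unfolded solver_def]], THEN spec[of _ s1], THEN spec[of _ h],
          THEN spec[of _ f], THEN spec[of _ l], THEN mp]) (use s1 node fr K top(3,5) pl in simp)
  from reach_keeps[OF this]
  have "reach S s1 (ks * (real (length l) + 1)) (us (length l))
    (\<lambda>s'. reach (If (Reg 11) Skip split_node) s' (1 + (36 * (real L)\<^sup>2 + 4) * (20 * real (length l) + 20)) 0 ?Q)"
  proof (rule reach_mono)
    fix s' assume A: "((\<forall>a\<in>{11, 12, 13}. \<forall>i\<ge>(regs s1 6 + 1) * (3 * n). arrs s' a i = 0) \<and>
          (\<forall>a\<ge>20. \<forall>i. regs s1 6 < i mod K \<longrightarrow> arrs s' a i = 0) \<and>
          (if regs s' 11 = 0
           then \<not> f \<and> l \<noteq> [] \<and> (rich \<longrightarrow> length l \<le> card (triangles (edge_set l))) \<and> olist s' = olist s1 \<and> regs s' 9 = h mod 3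
           else \<exists>Ls. distinct Ls \<and> set Ls = triangles (edge_set l) \<and>
             olist s' = olist s1 @ map (\<lambda>T. (\<lambda>x. x mod n) ` T) Ls)) \<and> keeps (wregs S) (warrs S) s1 s'"
    note A1 = conjunct1[OF conjunct1[OF A], unfolded s1] and A2 = conjunct1[OF conjunct2[OF conjunct1[OF A]], unfolded s1]
      and A3 = conjunct2[OF conjunct2[OF conjunct1[OF A]]]
    have k: "keeps (wregs S) (warrs S) s1 s'" by (rule conjunct2[OF A])
    have nw: "0 \<notin> wregs S" "1 \<notin> wregs S" "2 \<notin> wregs S" "4 \<notin> wregs S" "5 \<notin> wregs S" "6 \<notin> wregs S" "7 \<notin> wregs S" "8 \<notin> wregs S" "15 \<notin> wregs S"
      "2 \<notin> warrs S" "3 \<notin> warrs S" "4 \<notin> warrs S" "5 \<notin> warrs S" "6 \<notin> warrs S" "7 \<notin> warrs S" "8 \<notin> warrs S" "9 \<notin> warrs S" "10 \<notin> warrs S"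
      using w by blast+
    have e: "regs s' 0 = n" "regs s' 1 = m" "regs s' 2 = t" "regs s' 6 = ?k" "regs s' 7 = arrs s 4 ?n" "regs s' 8 = arrs s 5 ?n"
      "regs s' 15 = L" "regs s' 5 = regs s 5" "arrs s' 2 = arrs s 2" "arrs s' 3 = arrs s 3" "arrs s' 8 = arrs s 8" "arrs s' 9 = arrs s 9"
      "arrs s' 10 = arrs s 10"
      using k nw s1 by (simp_all add: keeps_def)
    have stk': "stack_ok s' ns" by (rule stack_ok_cong[OF stk1 k]) (use nw in simp_all)
    have fr8: "arrs s' a i = 0" if "a \<in> {8, 9, 10}" "?k * (3 * n) \<le> i" for a i
      using that fr e unfolding fresh_from_def s1 by auto
    have frs: "fresh_from n K (?k + 1) s'"
      unfolding fresh_from_def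
    proof (intro conjI ballI allI impI)
      fix a i assume ai: "a \<in> {8..13::nat}" "(?k + 1) * (3 * n) \<le> i"
      then have "?k * (3 * n) \<le> i" by (simp add: add_mult_distrib)
      from ai(1) consider "a \<in> {8, 9, 10}" | "a \<in> {11, 12, 13}" by force
      then show "arrs s' a i = 0"
      proof cases
        case 1
        then show ?thesis by (rule fr8) fact
      next
        case 2
        then show ?thesis by (rule A1[rule_format]) (rule ai(2))
      qed
    next
      fix a i :: nat assume "20 \<le> a" "?k + 1 \<le> i mod K"
      then show "arrs s' a i = 0" using A2 by simp
    qed
    have Ts: "olist s = map (\<lambda>T. (\<lambda>x. x mod n) ` T) Ts" using st by (simp add: search_state_def)
    show "reach (If (Reg 11) Skip split_node) s' (1 + (36 * (real L)\<^sup>2 + 4) * (20 * real (length l) + 20)) 0 ?Q"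
    proof (rule reach_If)
      assume "aval (Reg 11) s' \<noteq> 0"
      then obtain Ls where "distinct Ls" "set Ls = triangles (edge_set l)" "olist s' = olist s @ map (\<lambda>T. (\<lambda>x. x mod n) ` T) Ls"
        using A3 ol1 by auto
      then have "?Q s'" using e stk' frs Ts by (auto simp: search_state_def)
      then have "reach Skip s' (csize Skip) 0 ?Q" by (intro reach_straight) auto
      moreover have "1 * 1 \<le> (36 * (real L)\<^sup>2 + 4) * (20 * real (length l) + 20)" by (intro mult_mono) auto
      ultimately show "reach Skip s' ((36 * (real L)\<^sup>2 + 4) * (20 * real (length l) + 20)) 0 ?Q"
        by (elim reach_mono) auto
    next
      assume "aval (Reg 11) s' = 0"
      then have B: "\<not> f" "l \<noteq> []" "rich \<longrightarrow> length l \<le> card (triangles (edge_set l))" "olist s' = olist s" "regs s' 9 = h mod 3"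
        using A3 ol1 by auto
      have "reach split_node s' ((36 * (real L)\<^sup>2 + 4) * (20 * real (length l) + 20)) 0
        (\<lambda>s''. \<exists>r sd. good_split n (h mod 3) (36 * L\<^sup>2) l r sd \<and> stack_ok s'' (ns @ children n h r sd l) \<and>
          (\<forall>a\<in>{8, 9, 10}. \<forall>i. (regs s' 6 + 1) * (3 * n) \<le> i \<longrightarrow> arrs s'' a i = 0) \<and>
          keeps (wregs split_node) (warrs split_node) s' s'')"
        using e B top node(1) stk' fr8 by (intro reach_split_node) (simp_all add: pool_def)
      then show "reach split_node s' ((36 * (real L)\<^sup>2 + 4) * (20 * real (length l) + 20)) 0 ?Q"
      proof (rule reach_mono)
        fix s'' assume "\<exists>r sd. good_split n (h mod 3) (36 * L\<^sup>2) l r sd \<and> stack_ok s'' (ns @ children n h r sd l) \<and>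
          (\<forall>a\<in>{8, 9, 10}. \<forall>i. (regs s' 6 + 1) * (3 * n) \<le> i \<longrightarrow> arrs s'' a i = 0) \<and>
          keeps (wregs split_node) (warrs split_node) s' s''"
        then obtain r sd where g: "good_split n (h mod 3) (36 * L\<^sup>2) l r sd" and stk'': "stack_ok s'' (ns @ children n h r sd l)"
          and f8: "\<forall>a\<in>{8, 9, 10}. \<forall>i. (regs s' 6 + 1) * (3 * n) \<le> i \<longrightarrow> arrs s'' a i = 0"
          and k2: "keeps (wregs split_node) (warrs split_node) s' s''" by blast
        note k2' = keeps_regs[OF k2] keeps_arrs[OF k2]
        have "olist s'' = olist s" using B(4) k2'(1)[of 3] k2'(2)[of 1] by (simp add: olist_def)
        moreover have "fresh_from n K (?k + 1) s''"
          unfolding fresh_from_def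
        proof (intro conjI ballI allI impI)
          fix a i assume ai: "a \<in> {8..13::nat}" "(?k + 1) * (3 * n) \<le> i"
          then consider "a \<in> {8, 9, 10}" | "a \<in> {11, 12, 13}" by force
          then show "arrs s'' a i = 0"
          proof cases
            case 1
            then show ?thesis by (rule f8[rule_format]) (use ai(2) e in simp)
          next
            case 2
            then have "arrs s'' a = arrs s' a" by (intro k2'(2)) auto
            moreover have "arrs s' a i = 0" using frs ai unfolding fresh_from_def by blast
            ultimately show ?thesis by simp
          qed
        next
          fix a i assume "20 \<le> (a::nat)" "?k + 1 \<le> i mod K"
          then show "arrs s'' a i = 0" using frs k2'(2)[of a] unfolding fresh_from_def by simp
        qed
        ultimately have "search_state n m t L K (ns @ children n h r sd l) Ts (done @ [length l]) s''"
          using stk'' Ts k2'(1) e by (simp add: search_state_def)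
        then show "?Q s''" using B g by blast
      qed auto
    qed simp
  qed auto
  then have "reach (Seq S (If (Reg 11) Skip split_node)) s1
    (ks * (real (length l) + 1) + (1 + (36 * (real L)\<^sup>2 + 4) * (20 * real (length l) + 20))) (us (length l) + 0) ?Q"
    by (rule reach_Seq)
  then have "reach (visit S) s (real (csize pop) + (ks * (real (length l) + 1) + (1 + (36 * (real L)\<^sup>2 + 4) * (20 * real (length l) + 20)))) (us (length l) + 0) ?Q"
    unfolding visit_def s1_def by (rule reach_Seq_straight[rotated]) (simp add: pop_def)
  then show ?thesis
  proof (rule reach_mono)
    define M where "M = real (max 1 (length l))"
    have M: "real (length l) + 1 \<le> 2 * M" "1 \<le> M" by (auto simp: M_def)
    define P where "P = 36 * (real L)\<^sup>2 + 4"
    have P: "4 \<le> P" by (simp add: P_def)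
    have "ks * (real (length l) + 1) \<le> ks * (2 * M)" using M assms(5) by (intro mult_left_mono) auto
    also have "1 * (ks * (2 * M)) \<le> P * (ks * (2 * M))" using P M assms(5) by (intro mult_right_mono) auto
    finally have 1: "ks * (real (length l) + 1) \<le> P * (2 * ks) * M" by (simp add: mult_ac)
    have "P * (20 * (real (length l) + 1)) \<le> P * (20 * (2 * M))" using M P by (intro mult_left_mono) auto
    then have 2: "P * (20 * real (length l) + 20) \<le> P * 40 * M" by (simp add: algebra_simps)
    have "4 * 1 \<le> P * M" using M P by (intro mult_mono) auto
    then have 3: "8 \<le> P * 2 * M" by (simp add: algebra_simps)
    have "real (csize pop) = 6" by (simp add: pop_def)
    \<comment> \<open>The three summands pay for the solver, for splitting, and for the remaining
      constant overhead.\<close>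
    moreover have "P * (2 * ks + 42) * M = P * (2 * ks) * M + P * 40 * M + P * 2 * M" by (simp add: algebra_simps)
    ultimately show "real (csize pop) + (ks * (real (length l) + 1) + (1 + (36 * (real L)\<^sup>2 + 4) * (20 * real (length l) + 20)))
      \<le> (36 * (real L)\<^sup>2 + 4) * (2 * ks + 42) * real (max 1 (length l)) - 1"
      unfolding M_def[symmetric] P_def[symmetric] using 1 2 3 by linarith
  qed auto
qed

lemma reach_search:
  assumes S: "solver S n m L K rich ks us"
    and init: "search_state n m t L K [(0, False, l0)] [] [] s" "search_inv n m L t rich l0 [(0, False, l0)] [] [] []"
    and K: "1 + (36 * (real L)\<^sup>2 + 2) * 2 ^ L + 1 < real K"
    and L: "0 < L" "3 * level_bound m L L < 1" and ks: "0 \<le> ks" and us: "\<And>k. 0 \<le> us k" "\<And>k. k \<le> 3 * m \<Longrightarrow> us k \<le> Ub * \<phi> k"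
    and \<phi>: "\<And>k. real (max 1 k) \<le> \<phi> k" and Ub: "0 \<le> Ub"
    and W: "\<And>ns Ts act done. search_inv n m L t rich l0 ns Ts act done \<Longrightarrow> (\<Sum>k\<leftarrow>done. \<phi> k) \<le> W"
  shows "reach (search S) s ((36 * (real L)\<^sup>2 + 4) * (2 * ks + 42) * W + 1) (Ub * W) (\<lambda>s'. \<exists>Ts.
    regs s' 2 = t \<and> olist s' = map (\<lambda>T. (\<lambda>x. x mod n) ` T) Ts \<and> distinct Ts \<and> set Ts \<subseteq> triangles (edge_set l0) \<and>
    (t \<le> length Ts \<or> set Ts = triangles (edge_set l0)))"
proof -
  define C where "C = (36 * (real L)\<^sup>2 + 4) * (2 * ks + 42)"
  have C: "0 \<le> C" using ks by (simp add: C_def)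
  let ?Q = "\<lambda>s'. \<exists>Ts. regs s' 2 = t \<and> olist s' = map (\<lambda>T. (\<lambda>x. x mod n) ` T) Ts \<and> distinct Ts \<and> set Ts \<subseteq> triangles (edge_set l0) \<and>
    (t \<le> length Ts \<or> set Ts = triangles (edge_set l0))"
  let ?I = "\<lambda>q k u s. \<exists>ns Ts act done. search_state n m t L K ns Ts done s \<and> search_inv n m L t rich l0 ns Ts act done \<and>
    q = K - length done \<and> k = C * (W - (\<Sum>k\<leftarrow>done. \<phi> k)) + 1 \<and> u = Ub * (W - (\<Sum>k\<leftarrow>done. \<phi> k))"
  have "reach (search S) s (C * W + 1) (Ub * W) ?Q"
    unfolding search_def
  proof (rule reach_While_budget[where I = ?I and n = K])
    show "?I K (C * W + 1) (Ub * W) s"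
      using init by (intro exI[of _ "[(0, False, l0)]"] exI[of _ "[]"]) simp
  next
    fix q k u s assume "?I q k u s" and stop: "aval (Bin Mul (Bin Less (Reg 3) (Reg 2)) (Bin Less (Const 0) (Reg 4))) s = 0"
    then obtain ns Ts act dn where I: "search_state n m t L K ns Ts dn s" "search_inv n m L t rich l0 ns Ts act dn"
      "k = C * (W - (\<Sum>k\<leftarrow>dn. \<phi> k)) + 1" "u = Ub * (W - (\<Sum>k\<leftarrow>dn. \<phi> k))" by blast
    have "0 \<le> W - (\<Sum>k\<leftarrow>dn. \<phi> k)" using W[OF I(2)] by simp
    then have "1 \<le> k" "0 \<le> u" using I(3,4) C Ub by auto
    moreover have "regs s 3 = length Ts" using I(1) olist_length[of s] by (simp add: search_state_def)
    \<comment> \<open>The loop has two ways to stop: enough triangles, or none left.\<close>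
    then have "t \<le> length Ts \<or> ns = []" using stop I(1) by (auto simp: search_state_def stack_ok_def split: if_splits)
    then have "?Q s" using I(1) search_inv_listed[OF I(2)] by (auto simp: search_state_def)
    ultimately show "1 \<le> k \<and> 0 \<le> u \<and> ?Q s" by blast
  next
    fix q k u s assume "?I q k u s" and go: "aval (Bin Mul (Bin Less (Reg 3) (Reg 2)) (Bin Less (Const 0) (Reg 4))) s \<noteq> 0"
    then obtain ns Ts act dn where I: "search_state n m t L K ns Ts dn s" "search_inv n m L t rich l0 ns Ts act dn"
      "q = K - length dn" "k = C * (W - (\<Sum>k\<leftarrow>dn. \<phi> k)) + 1" "u = Ub * (W - (\<Sum>k\<leftarrow>dn. \<phi> k))" by blast
    have "regs s 3 = length Ts" using I(1) olist_length[of s] by (simp add: search_state_def)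
    then have less: "length Ts < t" "ns \<noteq> []" using go I(1) by (auto simp: search_state_def stack_ok_def split: if_splits)
    then obtain ns' h f l where ns: "ns = ns' @ [(h, f, l)]" by (metis prod_cases3 rev_exhaust)
    have ok: "node_ok n m L (h, f, l)" using search_invD(1)[OF I(2)] ns by simp
    then have l3: "length l \<le> 3 * m" by (simp add: node_ok_def)
    \<comment> \<open>There is a slot left for the next visit, because the number of visits is
      bounded by the size of the tree.\<close>
    have "real (length dn) + 1 < real K" using length_done_le[OF I(2)] K by linarith
    then have dk: "length dn + 1 < K" by linarith
    have "reach (visit S) s (C * real (max 1 (length l)) - 1) (us (length l)) (\<lambda>s'.
      (\<exists>Ls. distinct Ls \<and> set Ls = triangles (edge_set l) \<and> search_state n m t L K ns' (Ts @ Ls) (dn @ [length l]) s') \<or>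
      (\<exists>r sd. \<not> f \<and> l \<noteq> [] \<and> (rich \<longrightarrow> length l \<le> card (triangles (edge_set l))) \<and> good_split n (h mod 3) (36 * L\<^sup>2) l r sd \<and>
        search_state n m t L K (ns' @ children n h r sd l) Ts (dn @ [length l]) s'))"
      unfolding C_def by (rule reach_visit[OF S I(1)[unfolded ns] ok dk ks us(1)])
    then have "reach (visit S) s (C * \<phi> (length l) - 1) (Ub * \<phi> (length l))
        (\<lambda>s'. \<exists>q'<q. ?I q' (k - (C * \<phi> (length l) - 1) - 1) (u - Ub * \<phi> (length l)) s')"
    proof (rule reach_mono)
      show "C * real (max 1 (length l)) - 1 \<le> C * \<phi> (length l) - 1" using \<phi>[of "length l"] C by (simp add: mult_left_mono)
      show "us (length l) \<le> Ub * \<phi> (length l)" by (rule us(2)[OF l3])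
      fix s' assume "(\<exists>Ls. distinct Ls \<and> set Ls = triangles (edge_set l) \<and> search_state n m t L K ns' (Ts @ Ls) (dn @ [length l]) s') \<or>
      (\<exists>r sd. \<not> f \<and> l \<noteq> [] \<and> (rich \<longrightarrow> length l \<le> card (triangles (edge_set l))) \<and> good_split n (h mod 3) (36 * L\<^sup>2) l r sd \<and>
        search_state n m t L K (ns' @ children n h r sd l) Ts (dn @ [length l]) s')"
      then obtain ns'' Ts'' act'' where new: "search_state n m t L K ns'' Ts'' (dn @ [length l]) s'"
        "search_inv n m L t rich l0 ns'' Ts'' act'' (dn @ [length l])"
      proof (elim disjE exE conjE)
        fix Ls assume "distinct Ls" "set Ls = triangles (edge_set l)"
          and *: "search_state n m t L K ns' (Ts @ Ls) (dn @ [length l]) s'"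
        from search_inv_complete[OF I(2)[unfolded ns] this(1,2)] * that show thesis by blast
      next
        fix r sd assume "\<not> f" "l \<noteq> []" "rich \<longrightarrow> length l \<le> card (triangles (edge_set l))"
          and g: "good_split n (h mod 3) (36 * L\<^sup>2) l r sd"
          and *: "search_state n m t L K (ns' @ children n h r sd l) Ts (dn @ [length l]) s'"
        then show thesis using search_inv_split[of n m L t rich l0 ns' h l Ts act dn r sd] I(2)[unfolded ns] less(1) L that by auto
      qed
      have "K - length (dn @ [length l]) < q" using dk I(3) by simp
      moreover have "k - (C * \<phi> (length l) - 1) - 1 = C * (W - (\<Sum>k\<leftarrow>dn @ [length l]. \<phi> k)) + 1"
        "u - Ub * \<phi> (length l) = Ub * (W - (\<Sum>k\<leftarrow>dn @ [length l]. \<phi> k))"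
        unfolding I(4,5) by (simp_all add: algebra_simps)
      ultimately show "\<exists>q'<q. ?I q' (k - (C * \<phi> (length l) - 1) - 1) (u - Ub * \<phi> (length l)) s'"
        using new by blast
    qed
    then show "\<exists>kb ub. reach (visit S) s kb ub (\<lambda>s'. \<exists>q'<q. ?I q' (k - kb - 1) (u - ub) s')" by blast
  qed simp
  then show ?thesis unfolding C_def .
qed

section \<open>Solving subproblems by the given algorithm\<close>

lemma triangle_subset: "T \<in> triangles F \<Longrightarrow> T \<subseteq> \<Union>F"
  unfolding triangles_iff by blast

lemma triangles_image:
  assumes "inj_on f (\<Union>F)"
  shows "triangles ((`) f ` F) = (`) f ` triangles F"
proof (intro equalityI subsetI)
  fix T assume "T \<in> triangles ((`) f ` F)"
  then obtain a b c where T: "T = {a, b, c}" "a \<noteq> b" "b \<noteq> c" "a \<noteq> c" "{a, b} \<in> (`) f ` F" "{b, c} \<in> (`) f ` F" "{a, c} \<in> (`) f ` F"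
    unfolding triangles_iff by blast
  have "\<Union>((`) f ` F) = f ` \<Union>F" by blast
  with T(5,6) have "a \<in> f ` \<Union>F" "b \<in> f ` \<Union>F" "c \<in> f ` \<Union>F" by blast+
  then obtain x y z where x: "x \<in> \<Union>F" "y \<in> \<Union>F" "z \<in> \<Union>F" "a = f x" "b = f y" "c = f z" by blast
  have F: "{u, v} \<in> F" if "{f u, f v} \<in> (`) f ` F" "u \<in> \<Union>F" "v \<in> \<Union>F" for u v
  proof -
    from that(1) obtain e where e: "e \<in> F" "f ` {u, v} = f ` e" by auto
    have "{u, v} = e" using inj_on_image_eq_iff[OF assms, of "{u, v}" e] e that(2,3) by blast
    with e show ?thesis by simp
  qed
  have "{x, y} \<in> F" "{y, z} \<in> F" "{x, z} \<in> F" using F x T by auto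
  moreover have "x \<noteq> y" "y \<noteq> z" "x \<noteq> z" using T x by auto
  ultimately have "{x, y, z} \<in> triangles F" unfolding triangles_iff by blast
  then have "f ` {x, y, z} \<in> (`) f ` triangles F" by (rule imageI)
  then show "T \<in> (`) f ` triangles F" using T(1) x by simp
next
  fix T assume "T \<in> (`) f ` triangles F"
  then obtain S where S: "S \<in> triangles F" "T = f ` S" by blast
  from S(1)[unfolded triangles_iff] obtain a b c where
    T: "S = {a, b, c}" "a \<noteq> b" "b \<noteq> c" "a \<noteq> c" "{a, b} \<in> F" "{b, c} \<in> F" "{a, c} \<in> F"
    by (elim exE conjE) (rule that)
  have ne: "f u \<noteq> f v" if "{u, v} \<in> F" "u \<noteq> v" for u v
  proof -
    have "u \<in> \<Union>F" "v \<in> \<Union>F" using UnionI[OF that(1)] by simp_all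
    with inj_onD[OF assms, of u v] that(2) show ?thesis by blast
  qed
  have "f a \<noteq> f b" "f b \<noteq> f c" "f a \<noteq> f c" using ne T by simp_all
  moreover have "{f a, f b} \<in> (`) f ` F" "{f b, f c} \<in> (`) f ` F" "{f a, f c} \<in> (`) f ` F"
    using imageI[OF T(5), of "(`) f"] imageI[OF T(6), of "(`) f"] imageI[OF T(7), of "(`) f"] by auto
  ultimately show "T \<in> triangles ((`) f ` F)" unfolding triangles_iff S(2) T(1)
    by (intro exI[of _ "f a"] exI[of _ "f b"] exI[of _ "f c"]) auto
qed

lemma inj_image_triangles:
  assumes "inj_on f (\<Union>F)"
  shows "inj_on ((`) f) (triangles F)"
proof (rule inj_onI)
  fix S T assume "S \<in> triangles F" "T \<in> triangles F" "f ` S = f ` T"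
  then show "S = T" using inj_on_image_eq_iff[OF assms, of S T] triangle_subset[of S F] triangle_subset[of T F] by blast
qed

text \<open>Labels are stored increased by one, so that 0, the initial content of memory, means no
  label. The inverse \<open>old\<close> is zero from c on, which keeps later slots clear.\<close>

definition labelled :: "nat \<Rightarrow> (nat \<Rightarrow> nat) \<Rightarrow> (nat \<Rightarrow> nat) \<Rightarrow> nat set \<Rightarrow> bool" where
  "labelled c lab old V \<longleftrightarrow> (\<forall>q<c. lab (old q) = Suc q) \<and> (\<forall>y. lab y \<noteq> 0 \<longleftrightarrow> y \<in> V) \<and>
     (\<forall>y\<in>V. lab y \<le> c \<and> old (lab y - 1) = y) \<and> (\<forall>q\<ge>c. old q = 0)"

lemma labelled_insert:
  assumes "labelled c lab old V" "lab y = 0"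
  shows "labelled (Suc c) (lab(y := Suc c)) (old(c := y)) (insert y V)"
proof -
  have *: "\<forall>q<c. lab (old q) = Suc q" "\<forall>y. lab y \<noteq> 0 \<longleftrightarrow> y \<in> V"
     "\<forall>y\<in>V. lab y \<le> c \<and> old (lab y - 1) = y" "\<forall>q\<ge>c. old q = 0"
    using assms(1) unfolding labelled_def by blast+
  have "lab (old q) = Suc q \<and> old q \<noteq> y" if "q < c" for q using *(1) that assms(2) by fastforce
  moreover have "lab z \<le> c \<and> lab z - 1 \<noteq> c \<and> old (lab z - 1) = z" if "z \<in> V" for z
  proof -
    have "lab z \<noteq> 0" "lab z \<le> c" "old (lab z - 1) = z" using *(2,3) that by blast+
    then show ?thesis by linarith
  qed
  moreover have "y \<notin> V" using *(2) assms(2) by blast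
  ultimately show ?thesis unfolding labelled_def using *(2,4) by (auto simp: less_Suc_eq le_Suc_eq)
qed

lemma labelled_bij:
  assumes "labelled c lab old V"
  shows "bij_betw (\<lambda>y. lab y - 1) V {..<c}" "\<And>y. y \<in> V \<Longrightarrow> old (lab y - 1) = y" "\<And>q. q < c \<Longrightarrow> old q \<in> V"
proof -
  have *: "\<And>q. q < c \<Longrightarrow> lab (old q) = Suc q" "\<And>y. lab y \<noteq> 0 \<longleftrightarrow> y \<in> V"
     "\<And>y. y \<in> V \<Longrightarrow> lab y \<le> c \<and> old (lab y - 1) = y"
    using assms unfolding labelled_def by blast+
  show inv: "\<And>y. y \<in> V \<Longrightarrow> old (lab y - 1) = y" using *(3) by blast
  show V: "\<And>q. q < c \<Longrightarrow> old q \<in> V" using *(1,2) by (metis nat.distinct(1))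
  have "lab y - 1 < c" if "y \<in> V" for y
  proof -
    have "lab y \<noteq> 0" "lab y \<le> c" using *(2,3) that by blast+
    then show ?thesis by linarith
  qed
  then show "bij_betw (\<lambda>y. lab y - 1) V {..<c}"
    using inv V *(1) by (intro bij_betw_byWitness[where f' = old]) auto
qed

section \<open>Computing the labels\<close>

definition label :: "nat \<Rightarrow> com" where
  "label r = If (Bin Equal (Arr 11 (slot r)) (Const 0))
     (Seq (Store 12 (slot 25) (Reg r)) (Seq (Assign 25 (Bin Add (Reg 25) (Const 1))) (Store 11 (slot r) (Reg 25)))) Skip"

definition label_edge :: com where
  "label_edge = Seq (Seq (Assign 13 (Arr 2 (Reg 12))) (Assign 14 (Arr 3 (Reg 12)))) (Seq (label 13) (label 14))"

lemma label_edge_simps: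
  "straight label_edge" "csize label_edge = 12" "wregs label_edge = {13, 14, 25}" "warrs label_edge = {11, 12}"
  by (auto simp: label_edge_def label_def)

lemma sval_label:
  assumes "labelled (regs s 25) (\<lambda>y. arrs s 11 (B + y)) (\<lambda>q. arrs s 12 (B + q)) V" "B = regs s 6 * (3 * regs s 0)" "r \<noteq> 25"
    "y = regs s r"
  defines "s' \<equiv> sval (label r) s"
  shows "labelled (regs s' 25) (\<lambda>y. arrs s' 11 (B + y)) (\<lambda>q. arrs s' 12 (B + q)) (insert y V)"
    "\<forall>r. r \<noteq> 25 \<longrightarrow> regs s' r = regs s r"
proof -
  show "labelled (regs s' 25) (\<lambda>y. arrs s' 11 (B + y)) (\<lambda>q. arrs s' 12 (B + q)) (insert y V)"
  proof (cases "arrs s 11 (B + y) = 0")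
    case True
    have "regs s' 25 = Suc (regs s 25)" "(\<lambda>y. arrs s' 11 (B + y)) = (\<lambda>y. arrs s 11 (B + y))(y := Suc (regs s 25))"
      "(\<lambda>q. arrs s' 12 (B + q)) = (\<lambda>q. arrs s 12 (B + q))(regs s 25 := y)"
      using True assms(2-4) by (auto simp: s'_def label_def fun_eq_iff)
    with labelled_insert[OF assms(1), of y] True show ?thesis by simp
  next
    case False
    then have "s' = s" using assms(2-4) by (simp add: s'_def label_def)
    moreover have "insert y V = V" using assms(1) False unfolding labelled_def by blast
    ultimately show ?thesis using assms(1) by simp
  qed
  show "\<forall>r. r \<noteq> 25 \<longrightarrow> regs s' r = regs s r" by (simp add: s'_def label_def)
qed

lemma reach_label_edges:
  assumes n: "regs s 0 = n" and l: "pool s (regs s 7) (regs s 8) = l" "regs s 7 \<le> regs s 8"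
    and j: "regs s 12 = regs s 7" "regs s 25 = 0" and B: "B = regs s 6 * (3 * n)"
    and fresh: "\<And>a i. a \<in> {11, 12} \<Longrightarrow> B \<le> i \<Longrightarrow> arrs s a i = 0"
  shows "reach (for_loop 12 8 label_edge) s (real (length l) * 14 + 1) 0
    (\<lambda>s'. labelled (regs s' 25) (\<lambda>y. arrs s' 11 (B + y)) (\<lambda>q. arrs s' 12 (B + q)) (\<Union>(edge_set l)) \<and>
      keeps {12, 13, 14, 25} {11, 12} s s')"
proof -
  let ?P = "\<lambda>j s'. labelled (regs s' 25) (\<lambda>y. arrs s' 11 (B + y)) (\<lambda>q. arrs s' 12 (B + q)) (\<Union>(edge_set (take (j - regs s 7) l)))"
  have "reach (for_loop 12 8 label_edge) s (real (regs s 8 - regs s 7) * (real (csize label_edge) + 2) + 1) 0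
    (\<lambda>s'. ?P (regs s 8) s' \<and> regs s' 12 = regs s 8 \<and> keeps (insert 12 (wregs label_edge)) (warrs label_edge) s s')"
  proof (rule reach_for_straight)
    show "?P (regs s 7) s" using fresh j by (simp add: labelled_def edge_set_def)
    fix j s' assume jj: "regs s 7 \<le> j" "j < regs s 8" "regs s' 12 = j"
      and k: "keeps (insert 12 (wregs label_edge)) (warrs label_edge) s s'" and P: "?P j s'"
    note k' = keeps_regs[OF k] keeps_arrs[OF k]
    define s1 where "s1 = sval (Seq (Assign 13 (Arr 2 (Reg 12))) (Assign 14 (Arr 3 (Reg 12)))) s'"
    have eq: "regs s1 0 = n" "regs s1 6 = regs s 6" "regs s1 13 = arrs s 2 j" "regs s1 14 = arrs s 3 j"
      "regs s1 25 = regs s' 25" "arrs s1 = arrs s'"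
      using k' n jj by (simp_all add: s1_def label_edge_simps)
    define s2 where "s2 = sval (label 13) s1"
    have 1: "labelled (regs s2 25) (\<lambda>y. arrs s2 11 (B + y)) (\<lambda>q. arrs s2 12 (B + q)) (insert (arrs s 2 j) (\<Union>(edge_set (take (j - regs s 7) l))))"
      "\<forall>r. r \<noteq> 25 \<longrightarrow> regs s2 r = regs s1 r"
      unfolding s2_def using P eq B by (intro sval_label; simp)+
    define s3 where "s3 = sval (label 14) s2"
    have 2: "labelled (regs s3 25) (\<lambda>y. arrs s3 11 (B + y)) (\<lambda>q. arrs s3 12 (B + q)) (insert (arrs s 3 j) (insert (arrs s 2 j) (\<Union>(edge_set (take (j - regs s 7) l)))))"
      unfolding s3_def using 1 eq B by (intro sval_label) simp_all
    have "take (Suc j - regs s 7) l = take (j - regs s 7) l @ [(arrs s 2 j, arrs s 3 j)]"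
      using take_pool_Suc[OF jj(1,2), of s] l(1) by simp
    then have V: "\<Union>(edge_set (take (Suc j - regs s 7) l)) = insert (arrs s 3 j) (insert (arrs s 2 j) (\<Union>(edge_set (take (j - regs s 7) l))))"
      by (auto simp: edge_set_def)
    have "sval label_edge s' = s3" by (simp add: label_edge_def s3_def s2_def s1_def)
    then show "?P (Suc j) (set_reg 12 (Suc j) (sval label_edge s'))" unfolding V using 2 by simp
  qed (use assms in \<open>auto simp: label_edge_simps\<close>)
  then show ?thesis using l(1) by (auto simp: label_edge_simps elim!: reach_mono)
qed

section \<open>Passing a subproblem to the given algorithm\<close>

definition sub_cell :: "aexp \<Rightarrow> aexp \<Rightarrow> aexp" where
  "sub_cell K e = Bin Add (Bin Mul e K) (Reg 6)"

text \<open>Array 20 is array 0 of the given algorithm. Subtracting 1 turns a stored label into a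
  vertex.\<close>

definition write_edge :: "aexp \<Rightarrow> com" where
  "write_edge K = Seq (Seq (Assign 13 (Arr 2 (Reg 12))) (Assign 14 (Arr 3 (Reg 12))))
     (Seq (Store 20 (sub_cell K (Bin Mul (Const 2) (Bin Sub (Reg 12) (Reg 7)))) (Bin Sub (Arr 11 (slot 13)) (Const 1)))
       (Store 20 (sub_cell K (Bin Add (Bin Mul (Const 2) (Bin Sub (Reg 12) (Reg 7))) (Const 1))) (Bin Sub (Arr 11 (slot 14)) (Const 1))))"

lemma write_edge_simps:
  "main_exp K \<Longrightarrow> straight (write_edge K)" "csize (write_edge K) = 4" "wregs (write_edge K) = {13, 14}" "warrs (write_edge K) = {20}"
  by (auto simp: write_edge_def sub_cell_def)

text \<open>\<open>K\<close> is an expression evaluated anew at each access. Depending only on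
  register 1, which contains m, it has the same value and cost during the whole run.\<close>

definition reads_only :: "aexp \<Rightarrow> nat \<Rightarrow> bool" where
  "reads_only K r \<longleftrightarrow> (\<forall>s s'. regs s' r = regs s r \<longrightarrow> aval K s' = aval K s \<and> acost K s' = acost K s)"

lemma reach_write_edges:
  assumes n: "regs s 0 = n" and l: "pool s (regs s 7) (regs s 8) = l" "regs s 7 \<le> regs s 8"
    and j: "regs s 12 = regs s 7" and K: "main_exp Ke" "reads_only Ke 1" "aval Ke s = K" "regs s 6 < K"
    and fresh: "\<And>i. arrs s 20 (i * K + regs s 6) = 0"
    and f: "\<And>y. f y = arrs s 11 (regs s 6 * (3 * n) + y) - 1"
  shows "reach (for_loop 12 8 (write_edge Ke)) s (real (length l) * 6 + 1) 0
    (\<lambda>s'. (\<forall>i. arrs s' 20 (i * K + regs s 6) =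
        (if i < 2 * length l then (if even i then f (fst (l ! (i div 2))) else f (snd (l ! (i div 2)))) else 0)) \<and>
      (\<forall>i. i mod K \<noteq> regs s 6 \<longrightarrow> arrs s' 20 i = arrs s 20 i) \<and>
      keeps {12, 13, 14} {20} s s')"
proof -
  let ?P = "\<lambda>j s'. (\<forall>i. arrs s' 20 (i * K + regs s 6) =
        (if i < 2 * (j - regs s 7) then (if even i then f (fst (l ! (i div 2))) else f (snd (l ! (i div 2)))) else 0)) \<and>
      (\<forall>i. i mod K \<noteq> regs s 6 \<longrightarrow> arrs s' 20 i = arrs s 20 i)"
  have "reach (for_loop 12 8 (write_edge Ke)) s (real (regs s 8 - regs s 7) * (real (csize (write_edge Ke)) + 2) + 1) 0
    (\<lambda>s'. ?P (regs s 8) s' \<and> regs s' 12 = regs s 8 \<and> keeps (insert 12 (wregs (write_edge Ke))) (warrs (write_edge Ke)) s s')"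
  proof (rule reach_for_straight)
    show "?P (regs s 7) s" using fresh by simp
    fix j s' assume jj: "regs s 7 \<le> j" "j < regs s 8" "regs s' 12 = j"
      and k: "keeps (insert 12 (wregs (write_edge Ke))) (warrs (write_edge Ke)) s s'" and P: "?P j s'"
    note k' = keeps_regs[OF k] keeps_arrs[OF k]
    define q where "q = j - regs s 7"
    have lq: "l ! q = (arrs s 2 j, arrs s 3 j)" using jj l(1) by (auto simp: q_def pool_def)
    let ?s1 = "set_reg 14 (arrs s 3 j) (set_reg 13 (arrs s 2 j) s')"
    have Ks: "aval Ke s'' = K" if "regs s'' 1 = regs s 1" for s''
      using K(2,3) that unfolding reads_only_def by metis
    have K1: "aval Ke ?s1 = K" "aval Ke (set_arr a i v ?s1) = K" for a i v
      by (rule Ks; use k'(1)[of 1] in \<open>simp add: write_edge_simps\<close>)+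
    have eq: "regs s' 0 = n" "regs s' 6 = regs s 6" "regs s' 7 = regs s 7" "arrs s' 2 = arrs s 2" "arrs s' 3 = arrs s 3" "arrs s' 11 = arrs s 11"
      using k' n by (simp_all add: write_edge_simps)
    have "arrs (sval (write_edge Ke) s') 20 = (arrs s' 20)((2 * q) * K + regs s 6 := f (arrs s 2 j), (2 * q + 1) * K + regs s 6 := f (arrs s 3 j))"
      using K1 eq jj(3) by (simp add: write_edge_def sub_cell_def q_def f)
    note new = this
    have inj: "(i * K + regs s 6 = i' * K + regs s 6) = (i = i')" for i i' by (rule index_inj[OF K(4)])
    show "?P (Suc j) (set_reg 12 (Suc j) (sval (write_edge Ke) s'))"
    proof (intro conjI allI impI)
      fix i
      have "Suc j - regs s 7 = Suc q" using jj by (simp add: q_def)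
      moreover consider "i < 2 * q" | "i = 2 * q" | "i = 2 * q + 1" | "2 * q + 2 \<le> i" by linarith
      ultimately show "arrs (set_reg 12 (Suc j) (sval (write_edge Ke) s')) 20 (i * K + regs s 6) =
        (if i < 2 * (Suc j - regs s 7) then (if even i then f (fst (l ! (i div 2))) else f (snd (l ! (i div 2)))) else 0)"
        using P lq unfolding set_reg_sel new fun_upd_apply inj by (cases; simp add: q_def[symmetric])
    next
      fix i assume i: "i mod K \<noteq> regs s 6"
      have "i \<noteq> i' * K + regs s 6" for i' using K(4) i by auto
      then have "arrs (set_reg 12 (Suc j) (sval (write_edge Ke) s')) 20 i = arrs s' 20 i"
        unfolding set_reg_sel new by (simp only: fun_upd_apply if_False)
      then show "arrs (set_reg 12 (Suc j) (sval (write_edge Ke) s')) 20 i = arrs s 20 i" using P i by simp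
    qed
  qed (use assms in \<open>auto simp: write_edge_simps\<close>)
  then show ?thesis using l(1) by (auto simp: write_edge_simps elim!: reach_mono)
qed

section \<open>Copying the answer to the output\<close>

lemma reach_Ext:
  "exec c s T s' \<Longrightarrow> (\<And>B. bounded_mem B s \<Longrightarrow> bounded_mem B s') \<Longrightarrow> real T \<le> u \<Longrightarrow> Q s' \<Longrightarrow> reach c s 0 u Q"
  unfolding reach_def by (force intro: steps.Ext)

lemma olist_snoc:
  assumes "regs s' 3 = Suc (regs s 3)"
    "arrs s' 1 = (arrs s 1)(3 * regs s 3 := x, 3 * regs s 3 + 1 := y, 3 * regs s 3 + 2 := z)"
  shows "olist s' = olist s @ [{x, y, z}]"
proof -
  have "arrs s' 1 (3 * i) = arrs s 1 (3 * i) \<and> arrs s' 1 (3 * i + 1) = arrs s 1 (3 * i + 1) \<and>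
      arrs s' 1 (3 * i + 2) = arrs s 1 (3 * i + 2)" if "i < regs s 3" for i
    using that unfolding assms(2) by simp
  then show ?thesis unfolding olist_def assms(1) by (simp add: assms(2)[unfolded One_nat_def])
qed

definition modn :: "aexp \<Rightarrow> aexp" where
  "modn e = Bin Sub e (Bin Mul (Reg 0) (Bin Div e (Reg 0)))"

lemma modn_simps [simp]:
  "main_exp (modn e) \<longleftrightarrow> main_exp e" "additive (modn e) \<longleftrightarrow> additive e" "aval (modn e) s = aval e s mod regs s 0"
  by (auto simp: modn_def minus_mult_div_eq_mod)

text \<open>Array 21 is array 1 of the given algorithm. Its entries are outside main memory and have
  no a priori bound, so reading them is treated as an external part.\<close>

definition read_vertex :: "aexp \<Rightarrow> nat \<Rightarrow> com" where
  "read_vertex K q = Assign 13 (Arr 21 (sub_cell K (Bin Add (Bin Mul (Const 3) (Reg 28)) (Const q))))"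

definition write_vertex :: "nat \<Rightarrow> com" where
  "write_vertex q = Store 1 (Bin Add (Bin Mul (Const 3) (Reg 3)) (Const q)) (modn (Arr 12 (slot 13)))"

definition output_triangle :: "aexp \<Rightarrow> com" where
  "output_triangle K = Seq (read_vertex K 0) (Seq (write_vertex 0) (Seq (read_vertex K 1) (Seq (write_vertex 1)
     (Seq (read_vertex K 2) (Seq (write_vertex 2) (Assign 3 (Bin Add (Reg 3) (Const 1))))))))"

lemma output_triangle_sets: "wregs (output_triangle K) = {3, 13}" "warrs (output_triangle K) = {1}"
  by (auto simp: output_triangle_def read_vertex_def write_vertex_def)

definition read_weight :: "aexp \<Rightarrow> nat" where
  "read_weight K = 2 + eweight (sub_cell K (Bin Add (Bin Mul (Const 3) (Reg 28)) (Const 2))) + val_cost 2"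

lemma reach_read_vertex:
  assumes "main_exp Ke" "reads_only Ke 1" "aval Ke s = K" "regs s 6 < K" "regs s 1 \<le> K" "regs s 28 \<le> K" "q \<le> 2"
    and v: "v = arrs s 21 ((3 * regs s 28 + q) * K + regs s 6)" "v \<le> regs s 25" "regs s 25 \<le> K"
    and Q: "Q (set_reg 13 v s)"
  shows "reach (read_vertex Ke q) s 0 (real (read_weight Ke * val_cost K)) Q"
proof (rule reach_Ext)
  let ?e = "sub_cell Ke (Bin Add (Bin Mul (Const 3) (Reg 28)) (Const q))"
  have av: "aval ?e s = (3 * regs s 28 + q) * K + regs s 6" using assms by (simp add: sub_cell_def)
  show "exec (read_vertex Ke q) s (1 + acost (Arr 21 ?e) s) (set_reg 13 v s)"
    using exec.Assign[of 13 "Arr 21 ?e" s] av v(1) unfolding read_vertex_def by simp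
  show "bounded_mem B (set_reg 13 v s)" if "bounded_mem B s" for B
    using that v(2) by (intro bounded_mem_set_reg[OF that]) (auto simp: bounded_mem_def intro: order_trans)
  \<comment> \<open>The cost is computed in a state in which all memory not read by the index
    expression is zero. This one is bounded by \<open>K\<close>, while s may contain larger
    numbers.\<close>
  define s0 where "s0 = s\<lparr>regs := (\<lambda>r. if r \<in> {1, 6, 28} then regs s r else 0), arrs := (\<lambda>_ _. 0)\<rparr>"
  have "acost Ke s0 = acost Ke s" "aval Ke s0 = aval Ke s"
    using assms(2)[unfolded reads_only_def, THEN spec[of _ s], THEN spec[of _ s0]] by (simp_all add: s0_def)
  then have "acost ?e s = acost ?e s0" by (simp add: sub_cell_def s0_def)
  also have "\<dots> \<le> eweight ?e * val_cost K"
    using assms by (intro acost_le) (auto simp: sub_cell_def bounded_mem_def s0_def)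
  also have "\<dots> \<le> (eweight (sub_cell Ke (Bin Add (Bin Mul (Const 3) (Reg 28)) (Const 2))) + val_cost 2) * val_cost K"
  proof -
    have "q = 0 \<or> q = 1 \<or> q = 2" using \<open>q \<le> 2\<close> by linarith
    then have "val_cost q \<le> val_cost 2" by (auto intro: val_cost_mono)
    then show ?thesis by (intro mult_right_mono) (auto simp: sub_cell_def)
  qed
  finally have 1: "acost ?e s \<le> (eweight (sub_cell Ke (Bin Add (Bin Mul (Const 3) (Reg 28)) (Const 2))) + val_cost 2) * val_cost K" .
  have 2: "val_cost v \<le> val_cost K" using v by (intro val_cost_mono) simp
  have "acost (Arr 21 ?e) s = acost ?e s + val_cost v" using av v(1) by simp
  then have "1 + acost (Arr 21 ?e) s \<le> read_weight Ke * val_cost K"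
    using 1 2 val_cost_ge_1[of K] by (simp add: read_weight_def add_mult_distrib)
  then show "real (1 + acost (Arr 21 ?e) s) \<le> real (read_weight Ke * val_cost K)" by (rule of_nat_mono)
qed (rule Q)

lemma reach_output_triangle:
  assumes K: "main_exp Ke" "reads_only Ke 1" "aval Ke s = K" "regs s 6 < K" "regs s 1 \<le> K" "regs s 28 \<le> K" "regs s 25 \<le> K"
    and n: "regs s 0 = n" and B: "B = regs s 6 * (3 * n)"
    and v: "\<And>q. q \<le> 2 \<Longrightarrow> v q = arrs s 21 ((3 * regs s 28 + q) * K + regs s 6) \<and> v q \<le> regs s 25"
  shows "reach (output_triangle Ke) s 4 (3 * real (read_weight Ke * val_cost K))
    (\<lambda>s'. olist s' = olist s @ [(\<lambda>x. x mod n) ` (\<lambda>q. arrs s 12 (B + q)) ` {v 0, v 1, v 2}])"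
proof -
  let ?Q = "\<lambda>s'. olist s' = olist s @ [(\<lambda>x. x mod n) ` (\<lambda>q. arrs s 12 (B + q)) ` {v 0, v 1, v 2}]"
  let ?w = "real (read_weight Ke * val_cost K)"
  define s1 where "s1 = set_reg 13 (v 0) s"
  define s2 where "s2 = sval (write_vertex 0) s1"
  define s3 where "s3 = set_reg 13 (v 1) s2"
  define s4 where "s4 = sval (write_vertex 1) s3"
  define s5 where "s5 = set_reg 13 (v 2) s4"
  let ?last = "Seq (write_vertex 2) (Assign 3 (Bin Add (Reg 3) (Const 1)))"
  have st: "straight (write_vertex q)" "csize (write_vertex q) = 1" for q by (simp_all add: write_vertex_def)
  have r2: "regs s2 = (regs s)(13 := v 0)" "arrs s2 = (arrs s)(1 := (arrs s 1)(3 * regs s 3 := arrs s 12 (B + v 0) mod n))"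
    using n B by (simp_all add: s2_def s1_def write_vertex_def)
  have r4: "regs s4 = (regs s)(13 := v 1)"
    "arrs s4 = (arrs s)(1 := (arrs s 1)(3 * regs s 3 := arrs s 12 (B + v 0) mod n, 3 * regs s 3 + 1 := arrs s 12 (B + v 1) mod n))"
    using n B by (simp_all add: s4_def s3_def r2 write_vertex_def)
  have K2: "aval Ke s2 = K" "aval Ke s4 = K"
    using K(2,3) unfolding reads_only_def by (metis r2(1) r4(1) fun_upd_apply one_eq_numeral_iff semiring_norm(84))+
  have "?Q (sval ?last s5)"
    by (rule olist_snoc[THEN trans]) (use n B in \<open>simp_all add: s5_def r4 write_vertex_def\<close>)
  then have "reach ?last s5 (real (csize ?last)) 0 ?Q" by (intro reach_straight) (simp add: st)
  then have 1: "reach ?last s5 2 0 ?Q" by (simp add: st)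
  have "reach (read_vertex Ke 2) s4 0 ?w (\<lambda>s'. reach ?last s' 2 0 ?Q)"
    by (rule reach_read_vertex[where v = "v 2"]) (use K K2 v[of 2] 1 in \<open>simp_all add: r4 s5_def\<close>)
  then have 2: "reach (Seq (read_vertex Ke 2) ?last) s4 (0 + 2) (?w + 0) ?Q" by (rule reach_Seq)
  have 3: "reach (Seq (write_vertex 1) (Seq (read_vertex Ke 2) ?last)) s3 (1 + 2) ?w ?Q"
    using reach_Seq_straight[OF st(1), of "Seq (read_vertex Ke 2) ?last" 1 s3 2 ?w ?Q] 2 by (simp add: s4_def st)
  have "reach (read_vertex Ke 1) s2 0 ?w (\<lambda>s'. reach (Seq (write_vertex 1) (Seq (read_vertex Ke 2) ?last)) s' (1 + 2) ?w ?Q)"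
    by (rule reach_read_vertex[where v = "v 1"]) (use K K2 v[of 1] 3 in \<open>simp_all add: r2 s3_def\<close>)
  then have 4: "reach (Seq (read_vertex Ke 1) (Seq (write_vertex 1) (Seq (read_vertex Ke 2) ?last))) s2 (0 + (1 + 2)) (?w + ?w) ?Q"
    by (rule reach_Seq)
  have 5: "reach (Seq (write_vertex 0) (Seq (read_vertex Ke 1) (Seq (write_vertex 1) (Seq (read_vertex Ke 2) ?last)))) s1 (1 + 3) (?w + ?w) ?Q"
    using reach_Seq_straight[OF st(1), of "Seq (read_vertex Ke 1) (Seq (write_vertex 1) (Seq (read_vertex Ke 2) ?last))" 0 s1 3 "?w + ?w" ?Q] 4
    by (simp add: s2_def st)
  have "reach (read_vertex Ke 0) s 0 ?w (\<lambda>s'. reach (Seq (write_vertex 0) (Seq (read_vertex Ke 1) (Seq (write_vertex 1) (Seq (read_vertex Ke 2) ?last)))) s' (1 + 3) (?w + ?w) ?Q)"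
    by (rule reach_read_vertex[where v = "v 0"]) (use K v[of 0] 5 in \<open>simp_all add: s1_def\<close>)
  then have "reach (output_triangle Ke) s (0 + (1 + 3)) (?w + (?w + ?w)) ?Q"
    unfolding output_triangle_def by (rule reach_Seq)
  then show ?thesis by (rule reach_mono) auto
qed

lemma reach_output_triangles:
  assumes K: "main_exp Ke" "reads_only Ke 1" "aval Ke s = K" "regs s 6 < K" "regs s 1 \<le> K" "regs s 27 \<le> K" "regs s 25 \<le> K"
    and n: "regs s 0 = n" and B: "B = regs s 6 * (3 * n)" and i: "regs s 28 = 0"
    and v: "\<And>i. i < 3 * regs s 27 \<Longrightarrow> v i = arrs s 21 (i * K + regs s 6) \<and> v i \<le> regs s 25"
  shows "reach (for_loop 28 27 (output_triangle Ke)) s (real (regs s 27) * 6 + 1) (real (regs s 27) * (3 * real (read_weight Ke * val_cost K)))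
    (\<lambda>s'. olist s' = olist s @ map (\<lambda>i. (\<lambda>x. x mod n) ` (\<lambda>q. arrs s 12 (B + q)) ` {v (3 * i), v (3 * i + 1), v (3 * i + 2)}) [0..<regs s 27])"
proof -
  let ?w = "3 * real (read_weight Ke * val_cost K)"
  let ?T = "\<lambda>i. (\<lambda>x. x mod n) ` (\<lambda>q. arrs s 12 (B + q)) ` {v (3 * i), v (3 * i + 1), v (3 * i + 2)}"
  let ?P = "\<lambda>i s'. olist s' = olist s @ map ?T [0..<i]"
  have "reach (for_loop 28 27 (output_triangle Ke)) s (real (regs s 27 - 0) * (4 + 2) + 1) (real (regs s 27 - 0) * ?w)
    (\<lambda>s'. ?P (regs s 27) s' \<and> regs s' 28 = regs s 27 \<and> keeps (insert 28 (wregs (output_triangle Ke))) (warrs (output_triangle Ke)) s s')"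
  proof (rule reach_for)
    show "?P 0 s" by simp
    fix i s' assume ii: "0 \<le> i" "i < regs s 27" "regs s' 28 = i"
      and k: "keeps (insert 28 (wregs (output_triangle Ke))) (warrs (output_triangle Ke)) s s'" and P: "?P i s'"
    note k' = keeps_regs[OF k] keeps_arrs[OF k]
    have eq: "regs s' 0 = n" "regs s' 1 = regs s 1" "regs s' 6 = regs s 6" "regs s' 25 = regs s 25" "arrs s' 12 = arrs s 12" "arrs s' 21 = arrs s 21"
      using k' n by (simp_all add: output_triangle_sets)
    have vq: "v (3 * i + q) = arrs s 21 ((3 * i + q) * K + regs s 6) \<and> v (3 * i + q) \<le> regs s 25" if "q \<le> 2" for q
      using v[of "3 * i + q"] that ii(2) by simp
    have vq': "v (3 * i + q) = arrs s' 21 ((3 * regs s' 28 + q) * K + regs s' 6) \<and> v (3 * i + q) \<le> regs s' 25" if "q \<le> 2" for q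
      using vq[OF that] eq ii(3) by simp
    have KS: "aval Ke s' = K" using K(2,3) eq unfolding reads_only_def by metis
    have "reach (output_triangle Ke) s' 4 ?w
      (\<lambda>s''. olist s'' = olist s' @ [(\<lambda>x. x mod n) ` (\<lambda>q. arrs s' 12 (B + q)) ` {v (3 * i + 0), v (3 * i + 1), v (3 * i + 2)}])"
    proof (rule reach_output_triangle[where v = "\<lambda>q. v (3 * i + q)"])
      show "v (3 * i + q) = arrs s' 21 ((3 * regs s' 28 + q) * K + regs s' 6) \<and> v (3 * i + q) \<le> regs s' 25" if "q \<le> 2" for q
        by (rule vq'[OF that])
    qed (use K KS eq ii B in simp_all)
    then show "reach (output_triangle Ke) s' 4 ?w (\<lambda>s''. ?P (Suc i) (set_reg 28 (Suc i) s''))"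
      by (rule reach_mono) (use P eq in \<open>simp_all add: olist_def\<close>)
  qed (use i in \<open>simp_all add: output_triangle_sets\<close>)
  then show ?thesis by (rule reach_mono) auto
qed

text \<open>Unlike the arrays, the registers of the given algorithm are reused by all calls and have
  to be reset.\<close>

fun zero_regs :: "nat \<Rightarrow> com" where
  "zero_regs 0 = Skip"
| "zero_regs (Suc r) = Seq (zero_regs r) (Assign (40 + r) (Const 0))"

lemma zero_regs_simps:
  "straight (zero_regs R)" "csize (zero_regs R) = Suc R" "wregs (zero_regs R) = {40..<40 + R}" "warrs (zero_regs R) = {}"
  "arrs (sval (zero_regs R) s) = arrs s" "regs (sval (zero_regs R) s) r = (if 40 \<le> r \<and> r < 40 + R then 0 else regs s r)"
  by (induction R arbitrary: s) auto

text \<open>The given algorithm returns the minimum of the numbers of edges and of triangles. An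
  answer below the number of edges is therefore complete and is copied; otherwise the subproblem has
  at least as many triangles as edges and is to be split.\<close>

definition solve_by :: "com \<Rightarrow> aexp \<Rightarrow> com" where
  "solve_by p K = If (Bin Less (Reg 7) (Reg 8))
    (Seq (Seq (Assign 12 (Reg 7)) (Assign 25 (Const 0)))
    (Seq (for_loop 12 8 label_edge)
    (Seq (Assign 12 (Reg 7))
    (Seq (for_loop 12 8 (write_edge K))
    (Seq (Seq (zero_regs (max 2 (com_regs p))) (Seq (Assign 40 (Reg 25)) (Assign 41 (Bin Sub (Reg 8) (Reg 7)))))
    (Seq (rebase K p)
    (Seq (Assign 27 (Reg 40))
      (If (Bin Less (Reg 27) (Bin Sub (Reg 8) (Reg 7)))
        (Seq (Assign 28 (Const 0)) (Seq (for_loop 28 27 (output_triangle K)) (Assign 11 (Const 1))))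
        (Assign 11 (Const 0))))))))))
    (Assign 11 (Const 1))"

lemma rebase_sets: "wregs (rebase K p) \<subseteq> {40..}" "warrs (rebase K p) \<subseteq> {20..}"
  by (induction p) auto

lemma solve_by_sets:
  "wregs (solve_by p K) \<subseteq> {3, 11, 12, 13, 14, 25, 27, 28} \<union> {40..}" "warrs (solve_by p K) \<subseteq> {1, 11, 12} \<union> {20..}"
  using rebase_sets[of K p]
  by (auto simp: solve_by_def label_edge_simps write_edge_simps zero_regs_simps output_triangle_sets)

text \<open>The time bound and the correctness are assumed for separate runs, which coincide because
  execution is deterministic for fixed coins.\<close>

lemma call_result:
  assumes p: "deterministic p" "lists_m_triangles p (\<lambda>m. Bp m)" and F: "finite F" "F \<noteq> {}" and g: "graph n F" and es: "edge_list F es"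
  shows "\<exists>T s. exec p (init [n, card F] es \<omega>) T s \<and> real T \<le> Bp (card F) \<and> lists_up_to (card F) F (listed s)"
proof -
  have "halts_within p [n, card F] es (Bp (card F))" "lists_correctly p [n, card F] es (card F) F \<omega>"
    using p(2) F g es unfolding lists_m_triangles_def Let_def by blast+
  then obtain T s T' s' where "exec p (init [n, card F] es \<omega>) T s" "real T \<le> Bp (card F)"
    "exec p (init [n, card F] es \<omega>) T' s'" "lists_up_to (card F) F (listed s')"
    unfolding halts_within_def lists_correctly_def by blast
  then show ?thesis using exec_deterministic by blast
qed

text \<open>The given algorithm expects the vertices 0 to c - 1, none of them isolated. Numbering
  the endpoints that occur achieves this, and \<open>old\<close> translates the triangles
  back.\<close>

lemma relabelled_graph:
  assumes l: "tripartite n l" and lab: "labelled c lab old (\<Union>(edge_set l))"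
  defines "f \<equiv> \<lambda>y. lab y - 1"
  defines "F \<equiv> (`) f ` edge_set l" and "es \<equiv> map (\<lambda>(u, v). (f u, f v)) l"
  shows "graph c F" "edge_list F es" "card F = length l" "(\<lambda>T. old ` T) ` triangles F = triangles (edge_set l)"
    "inj_on (\<lambda>T. old ` T) (triangles F)" "card (triangles F) = card (triangles (edge_set l))" "\<And>T. T \<in> triangles F \<Longrightarrow> T \<subseteq> {..<c}"
proof -
  let ?V = "\<Union>(edge_set l)"
  note bij = labelled_bij[OF lab, folded f_def]
  have inj: "inj_on f ?V" using bij(1) unfolding f_def by (rule bij_betw_imp_inj_on)
  have img: "f ` ?V = {..<c}" using bij(1) unfolding f_def by (rule bij_betw_imp_surj_on)
  have inv: "old (f y) = y" if "y \<in> ?V" for y using bij(2)[OF that] by (simp add: f_def)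
  have inj2: "inj_on ((`) f) (edge_set l)"
    by (rule inj_onI) (metis Union_upper inj_on_image_eq_iff[OF inj])
  have "card e = 2" if "e \<in> edge_set l" for e
    using that tripartite_edge(3)[OF l] by (force simp: edge_set_def card_2_iff)
  moreover have "card (f ` e) = card e" if "e \<in> edge_set l" for e
    using that inj by (intro card_image) (meson Union_upper inj_on_subset)
  moreover have "\<Union>F = f ` ?V" by (auto simp: F_def)
  ultimately show "graph c F" unfolding graph_def img by (auto simp: F_def)
  have eq: "map (\<lambda>(u, v). {u, v}) es = map ((`) f) (map (\<lambda>(u, v). {u, v}) l)"
    by (auto simp: es_def)
  show "edge_list F es" unfolding edge_list_def eq
    using l inj2 by (simp add: tripartite_def distinct_map[of "(`) f"] F_def edge_set_def del: map_map)
  show "card F = length l" unfolding F_def using card_image[OF inj2] card_edge_set[OF l] by simp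
  have T: "triangles F = (`) f ` triangles (edge_set l)" unfolding F_def by (rule triangles_image[OF inj])
  have old_f: "old ` f ` S = S" if "S \<in> triangles (edge_set l)" for S
    using triangle_subset[OF that] inv by (force simp: image_image)
  show "(\<lambda>T. old ` T) ` triangles F = triangles (edge_set l)"
  proof -
    have "(\<lambda>T. old ` T) ` triangles F = (\<lambda>S. old ` f ` S) ` triangles (edge_set l)"
      unfolding T by (simp only: image_image)
    also have "\<dots> = (\<lambda>S. S) ` triangles (edge_set l)" by (rule image_cong[OF refl old_f])
    finally show ?thesis by simp
  qed
  show "inj_on (\<lambda>T. old ` T) (triangles F)"
    unfolding T using old_f by (intro inj_onI) auto
  show "card (triangles F) = card (triangles (edge_set l))"
    unfolding T by (rule card_image) (rule inj_image_triangles[OF inj])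
  show "T \<subseteq> {..<c}" if "T \<in> triangles F" for T
    using triangle_subset[OF that] \<open>\<Union>F = f ` ?V\<close> img by simp
qed

text \<open>Thus the inverse labelling fits into one slot of length 3 * n.\<close>

lemma card_labelled:
  assumes "tripartite n l" "labelled c lab old (\<Union>(edge_set l))"
  shows "c \<le> 3 * n"
proof -
  have "c = card (\<Union>(edge_set l))"
    using bij_betw_same_card[OF labelled_bij(1)[OF assms(2)]] by simp
  also have "\<Union>(edge_set l) \<subseteq> {..<3 * n}"
    using tripartite_edge(1,2)[OF assms(1)] by (force simp: edge_set_def)
  then have "card (\<Union>(edge_set l)) \<le> 3 * n" using card_mono[of "{..<3 * n}"] by simp
  finally show ?thesis .
qed

lemma embedded_init:
  assumes "\<forall>r<R. regs \<sigma> (40 + r) = (if r = 0 then c else if r = 1 then e else 0)"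
    and "\<forall>i. arrs \<sigma> 20 (i * K + regs \<sigma> 6) = (if i < 2 * length l then (if even i then f (fst (l ! (i div 2))) else f (snd (l ! (i div 2)))) else 0)"
    and "\<forall>a>20. \<forall>i. arrs \<sigma> a (i * K + regs \<sigma> 6) = 0"
  shows "embedded R K (init [c, e] (map (\<lambda>(u, v). (f u, f v)) l) \<omega>) \<sigma>"
  unfolding embedded_def init_def
proof (intro conjI allI impI)
  fix r assume "r < R"
  with assms(1) show "regs \<sigma> (40 + r) = regs \<lparr>regs = \<lambda>r. if r < length [c, e] then [c, e] ! r else 0,
      arrs = \<lambda>a i. if a = 0 \<and> i < 2 * length (map (\<lambda>(u, v). (f u, f v)) l) then
        if even i then fst (map (\<lambda>(u, v). (f u, f v)) l ! (i div 2)) else snd (map (\<lambda>(u, v). (f u, f v)) l ! (i div 2)) else 0,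
      coins = \<omega>\<rparr> r"
    by (auto simp: less_Suc_eq nth_Cons')
next
  fix a i
  have "i div 2 < length l" if "i < 2 * length l" using that by linarith
  with assms(2,3) show "arrs \<sigma> (20 + a) (i * K + regs \<sigma> 6) = arrs \<lparr>regs = \<lambda>r. if r < length [c, e] then [c, e] ! r else 0,
      arrs = \<lambda>a i. if a = 0 \<and> i < 2 * length (map (\<lambda>(u, v). (f u, f v)) l) then
        if even i then fst (map (\<lambda>(u, v). (f u, f v)) l ! (i div 2)) else snd (map (\<lambda>(u, v). (f u, f v)) l ! (i div 2)) else 0,
      coins = \<omega>\<rparr> a i"
    by (cases "a = 0") (auto simp: case_prod_beta)
qed

text \<open>The external time has three parts: the simulated call, fetching the number of triangles
  it returns, and reading their vertices, of which there are fewer than three times the number of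
  edges. Labelling, writing and output are elementary steps.\<close>

lemma reach_solve_by:
  assumes p: "deterministic p" "lists_m_triangles p Bp" and Ke: "main_exp Ke" "reads_only Ke 1"
    and K: "aval Ke s = K" "G = acost Ke s + 4 * val_cost K" "m \<le> K" "3 * n \<le> K" "3 * m \<le> K"
    and s: "regs s 0 = n" "regs s 1 = m" "regs s 9 = h mod 3" "regs s 10 = of_bool f"
      "pool s (regs s 7) (regs s 8) = l" "regs s 7 \<le> regs s 8" "tripartite n l" "length l \<le> 3 * m"
      "f \<longrightarrow> single n ((h + 2) mod 3) l" "fresh_from n K (regs s 6) s" "regs s 6 < K"
    and Bp: "\<And>k. 0 \<le> Bp k"
  shows "reach (solve_by p Ke) s (real (70 + max 2 (com_regs p)) * (real (length l) + 1))
     (real (G + 3) * Bp (length l) + real (val_cost K + 1) + real (length l) * (3 * real (read_weight Ke * val_cost K)))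
     (\<lambda>s'. (\<forall>a\<in>{11, 12, 13}. \<forall>i\<ge>(regs s 6 + 1) * (3 * n). arrs s' a i = 0) \<and>
        (\<forall>a\<ge>20. \<forall>i. regs s 6 < i mod K \<longrightarrow> arrs s' a i = 0) \<and>
        (if regs s' 11 = 0
         then \<not> f \<and> l \<noteq> [] \<and> (True \<longrightarrow> length l \<le> card (triangles (edge_set l))) \<and> olist s' = olist s \<and> regs s' 9 = h mod 3
         else \<exists>Ls. distinct Ls \<and> set Ls = triangles (edge_set l) \<and>
           olist s' = olist s @ map (\<lambda>T. (\<lambda>x. x mod n) ` T) Ls))"
    (is "reach _ _ ?k ?u ?Q")
proof -
  define \<kappa> where "\<kappa> = regs s 6"
  define B where "B = \<kappa> * (3 * n)"
  define R where "R = max 2 (com_regs p)"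
  have fr: "\<And>a i. a \<in> {8..13} \<Longrightarrow> B \<le> i \<Longrightarrow> arrs s a i = 0" "\<And>a i. 20 \<le> a \<Longrightarrow> \<kappa> \<le> i mod K \<Longrightarrow> arrs s a i = 0"
    using s(10) unfolding fresh_from_def B_def \<kappa>_def by blast+
  have KK: "\<kappa> < K" using s(11) by (simp add: \<kappa>_def)
  have Ks: "aval Ke s' = K \<and> acost Ke s' = acost Ke s" if "regs s' 1 = m" for s'
    using Ke(2)[unfolded reads_only_def, THEN spec[of _ s], THEN spec[of _ s']] that s(2) K(1) by simp
  have u0: "0 \<le> ?u" using Bp by simp
  show ?thesis
  proof (cases "l = []")
    case True
    let ?s = "sval (Assign 11 (Const 1)) s"
    have "edge_set l = {}" by (simp add: True edge_set_def)
    then have "triangles (edge_set l) = {}" by (auto simp: triangles_iff)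
    then have "?Q ?s" using fr by (simp add: olist_def \<kappa>_def[symmetric] B_def algebra_simps)
    then have "reach (Assign 11 (Const 1)) s (csize (Assign 11 (Const 1))) 0 ?Q" by (intro reach_straight) auto
    then have "reach (Assign 11 (Const 1)) s 1 ?u ?Q" by (rule reach_mono) (use u0 in auto)
    moreover have "aval (Bin Less (Reg 7) (Reg 8)) s = 0" using True s(5) by (auto simp: pool_def)
    ultimately have "reach (solve_by p Ke) s (1 + 1) ?u ?Q" unfolding solve_by_def by (intro reach_If) auto
    then show ?thesis by (rule reach_mono) (simp add: True, rule order_refl, assumption)
  next
    case False
    define len where "len = length l"
    have len: "regs s 8 - regs s 7 = len" "1 \<le> len" "regs s 7 < regs s 8"
      using s(5) False by (auto simp: len_def Suc_le_eq pool_def)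
    define s1 where "s1 = sval (Seq (Assign 12 (Reg 7)) (Assign 25 (Const 0))) s"
    have s1: "regs s1 = (regs s)(12 := regs s 7, 25 := 0)" "arrs s1 = arrs s" by (simp_all add: s1_def)
    define RES where "RES = If (Bin Less (Reg 27) (Bin Sub (Reg 8) (Reg 7)))
        (Seq (Assign 28 (Const 0)) (Seq (for_loop 28 27 (output_triangle Ke)) (Assign 11 (Const 1)))) (Assign 11 (Const 0))"
    define ZERO where "ZERO = Seq (zero_regs R) (Seq (Assign 40 (Reg 25)) (Assign 41 (Bin Sub (Reg 8) (Reg 7))))"
    have split: "reach (for_loop 12 8 label_edge) s1 (real len * 14 + 1) 0
      (\<lambda>s'. labelled (regs s' 25) (\<lambda>y. arrs s' 11 (B + y)) (\<lambda>q. arrs s' 12 (B + q)) (\<Union>(edge_set l)) \<and>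
        keeps {12, 13, 14, 25} {11, 12} s1 s')"
      unfolding len_def
    proof (rule reach_label_edges)
      show "arrs s1 a i = 0" if "a \<in> {11, 12}" "B \<le> i" for a i using fr(1)[of a i] that by (auto simp: s1)
      show "regs s1 0 = n" "pool s1 (regs s1 7) (regs s1 8) = l" "regs s1 7 \<le> regs s1 8" "regs s1 12 = regs s1 7"
        "regs s1 25 = 0" "B = regs s1 6 * (3 * n)"
        using s by (simp_all add: s1 pool_def B_def \<kappa>_def)
    qed
    let ?u1 = "real (G + 3) * Bp len" and ?u2 = "real (val_cost K + 1)" and ?u3 = "real len * (3 * real (read_weight Ke * val_cost K))"
    let ?kz = "real (R + 3)"
    have main: "reach (Seq (Assign 12 (Reg 7)) (Seq (for_loop 12 8 (write_edge Ke)) (Seq ZERO (Seq (rebase Ke p) (Seq (Assign 27 (Reg 40)) RES))))) s2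
        (1 + ((real len * 6 + 1) + (?kz + (0 + (0 + (1 + (1 + ((real len * 6 + 1) + 1)))))))) (0 + (?u1 + (?u2 + ?u3))) ?Q"
      if lab: "labelled (regs s2 25) (\<lambda>y. arrs s2 11 (B + y)) (\<lambda>q. arrs s2 12 (B + q)) (\<Union>(edge_set l))" and k2: "keeps {12, 13, 14, 25} {11, 12} s1 s2" for s2
    proof -
      define cnt where "cnt = regs s2 25"
      define lb where "lb = (\<lambda>y. arrs s2 11 (B + y))"
      define old where "old = (\<lambda>q. arrs s2 12 (B + q))"
      have lab: "labelled cnt lb old (\<Union>(edge_set l))" using lab by (simp add: cnt_def lb_def old_def)
      note k2' = keeps_regs[OF k2] keeps_arrs[OF k2]
      have cn: "cnt \<le> 3 * n" by (rule card_labelled[OF s(7) lab])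
      have e2: "regs s2 0 = n" "regs s2 1 = m" "regs s2 3 = regs s 3" "regs s2 6 = \<kappa>" "regs s2 7 = regs s 7" "regs s2 8 = regs s 8" "regs s2 9 = h mod 3"
        "arrs s2 1 = arrs s 1" "arrs s2 2 = arrs s 2" "arrs s2 3 = arrs s 3" "arrs s2 13 = arrs s 13" "\<And>a. 20 \<le> a \<Longrightarrow> arrs s2 a = arrs s a"
        using k2' s by (simp_all add: s1 \<kappa>_def)
      define ff where "ff = (\<lambda>y. lb y - 1)"
      define F where "F = (`) ff ` edge_set l"
      define es where "es = map (\<lambda>(u, v). (ff u, ff v)) l"
      note rel = relabelled_graph[OF s(7) lab, folded ff_def, folded F_def es_def]
      have rel2: "edge_list F es" using rel(2) unfolding es_def ff_def by simp
      define s3 where "s3 = sval (Assign 12 (Reg 7)) s2"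
      have s3: "regs s3 = (regs s2)(12 := regs s 7)" "arrs s3 = arrs s2" by (simp_all add: s3_def e2)
      have mod_lem: "(i * K + \<kappa>) mod K = \<kappa>" for i using KK by simp
      have "reach (for_loop 12 8 (write_edge Ke)) s3 (real (length l) * 6 + 1) 0
        (\<lambda>s'. (\<forall>i. arrs s' 20 (i * K + regs s3 6) =
            (if i < 2 * length l then (if even i then ff (fst (l ! (i div 2))) else ff (snd (l ! (i div 2)))) else 0)) \<and>
          (\<forall>i. i mod K \<noteq> regs s3 6 \<longrightarrow> arrs s' 20 i = arrs s3 20 i) \<and>
          keeps {12, 13, 14} {20} s3 s')"
      proof (rule reach_write_edges)
        show "aval Ke s3 = K" using Ks[of s3] e2 by (simp add: s3)
        show "arrs s3 20 (i * K + regs s3 6) = 0" for i using fr(2)[of 20 "i * K + \<kappa>"] mod_lem e2 by (simp add: s3)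
        show "ff y = arrs s3 11 (regs s3 6 * (3 * n) + y) - 1" for y by (simp add: s3 e2 ff_def lb_def B_def)
        show "pool s3 (regs s3 7) (regs s3 8) = l" using s(5) e2 by (simp add: s3 pool_def)
      qed (use e2 s KK Ke in \<open>simp_all add: s3\<close>)
      then have "reach (for_loop 12 8 (write_edge Ke)) s3 (real len * 6 + 1) 0
        (\<lambda>s'. reach (Seq ZERO (Seq (rebase Ke p) (Seq (Assign 27 (Reg 40)) RES))) s' (?kz + (0 + (0 + (1 + (1 + ((real len * 6 + 1) + 1)))))) (?u1 + (?u2 + ?u3)) ?Q)"
      proof (rule reach_mono)
        fix s4 assume A: "(\<forall>i. arrs s4 20 (i * K + regs s3 6) =
            (if i < 2 * length l then (if even i then ff (fst (l ! (i div 2))) else ff (snd (l ! (i div 2)))) else 0)) \<and>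
          (\<forall>i. i mod K \<noteq> regs s3 6 \<longrightarrow> arrs s4 20 i = arrs s3 20 i) \<and>
          keeps {12, 13, 14} {20} s3 s4"
        then have k4: "keeps {12, 13, 14} {20} s3 s4" by blast
        note k4' = keeps_regs[OF k4] keeps_arrs[OF k4]
        define s5 where "s5 = sval ZERO s4"
        have r5: "regs s5 r = regs s4 r" if "r < 40" for r using that by (simp add: s5_def ZERO_def zero_regs_simps)
        have a5: "arrs s5 = arrs s4" by (simp add: s5_def ZERO_def zero_regs_simps)
        have e5: "regs s5 0 = n" "regs s5 1 = m" "regs s5 3 = regs s 3" "regs s5 6 = \<kappa>" "regs s5 7 = regs s 7" "regs s5 8 = regs s 8"
          "regs s5 9 = h mod 3" "regs s5 25 = cnt"
          using r5 k4'(1) e2 by (simp_all add: s3 cnt_def)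
        have b5: "arrs s5 1 = arrs s 1" "arrs s5 11 = arrs s2 11" "arrs s5 12 = arrs s2 12" "arrs s5 13 = arrs s 13" "\<And>a. 20 < a \<Longrightarrow> arrs s5 a = arrs s a"
          using k4'(2) e2 by (simp_all add: a5 s3)
        have b20: "arrs s5 20 i = 0" if "\<kappa> < i mod K" for i
        proof -
          have "arrs s5 20 i = arrs s3 20 i" using A that e2(4) unfolding a5 s3 by simp
          also have "\<dots> = arrs s 20 i" by (simp add: s3 e2)
          finally show ?thesis using fr(2)[of 20 i] that by simp
        qed
        \<comment> \<open>Any coin sequence will do, since the given algorithm is correct for all of
          them.\<close>
        obtain \<omega> where emb: "embedded R K (init [cnt, len] es \<omega>) s5"
        proof -
          have "embedded R K (init [cnt, len] es undefined) s5" unfolding es_def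
          proof (rule embedded_init)
            show "\<forall>r<R. regs s5 (40 + r) = (if r = 0 then cnt else if r = 1 then len else 0)"
              using k4'(1) e2 len(1) by (auto simp: s5_def ZERO_def zero_regs_simps s3 cnt_def)
            show "\<forall>i. arrs s5 20 (i * K + regs s5 6) = (if i < 2 * length l then (if even i then ff (fst (l ! (i div 2))) else ff (snd (l ! (i div 2)))) else 0)"
              using A e2(4) e5(4) unfolding a5 s3 by simp
            show "\<forall>a>20. \<forall>i. arrs s5 a (i * K + regs s5 6) = 0"
              using b5(5) fr(2) mod_lem e5(4) by simp
          qed
          then show thesis by (rule that)
        qed
        have K5: "aval Ke s5 = K" "acost Ke s5 = acost Ke s" using Ks[of s5] e5 by auto
        have Fne: "F \<noteq> {}" "finite F" using rel(3) len(2) len_def by (auto simp: F_def)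
        obtain T t where T: "exec p (init [cnt, len] es \<omega>) T t" "real T \<le> Bp len" "lists_up_to len F (listed t)"
          using call_result[OF p Fne(2,1) rel(1) rel2, of \<omega>] rel(3) unfolding len_def by auto
        obtain T' s6 where s6: "exec (rebase Ke p) s5 T' s6" "embedded R K t s6" "call_frame K s5 s6" "T' \<le> (G + 3) * T"
          using exec_rebase[OF T(1) p(1), of R Ke s5 G] Ke emb KK e5 K5 K(2) R_def by auto
        have sm: "same_main s5 s6" using s6(3) by (simp add: call_frame_def)
        have r6: "regs s6 r = regs s5 r" if "r < 40" for r using sm that by (simp add: same_main_def)
        have a6: "arrs s6 a = arrs s5 a" if "a < 20" for a using sm that by (simp add: same_main_def)
        have o6: "arrs s6 a i = arrs s5 a i" if "i mod K \<noteq> \<kappa>" for a i using s6(3) that e5(4) by (simp add: call_frame_def)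
        have "real T' \<le> real ((G + 3) * T)" using s6(4) by (rule of_nat_mono)
        also have "\<dots> \<le> ?u1" unfolding of_nat_mult by (intro mult_left_mono T(2)) simp
        finally have T'u: "real T' \<le> ?u1" .
        define c where "c = regs t 0"
        have c: "regs s6 40 = c" using s6(2) unfolding embedded_def R_def c_def by (metis add.right_neutral max.strict_coboundedI1 zero_less_numeral)
        have tri: "distinct (listed t)" "set (listed t) \<subseteq> triangles F" "length (listed t) = min len (card (triangles F))"
          using T(3) unfolding lists_up_to_def by blast+
        have c_min: "c = min len (card (triangles F))" using tri(3) by (simp add: listed_def c_def)
        define s7 where "s7 = set_reg 27 c s6"
        have ex7: "exec (Assign 27 (Reg 40)) s6 (1 + acost (Reg 40) s6) s7"
          using exec.Assign[of 27 "Reg 40" s6] c by (simp add: s7_def)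
        have post: "(\<forall>a\<in>{11, 12, 13}. \<forall>i\<ge>(regs s 6 + 1) * (3 * n). arrs s' a i = 0) \<and> (\<forall>a\<ge>20. \<forall>i. regs s 6 < i mod K \<longrightarrow> arrs s' a i = 0)"
          if "\<And>a. a \<noteq> 1 \<Longrightarrow> arrs s' a = arrs s6 a" for s'
        proof (intro conjI ballI allI impI)
          fix a i assume a: "a \<in> {11, 12, 13::nat}" and i: "(regs s 6 + 1) * (3 * n) \<le> i"
          obtain y where y: "i = B + y" "3 * n \<le> y"
            using i by (auto simp: le_iff_add B_def \<kappa>_def add_mult_distrib add.assoc)
          \<comment> \<open>Beyond the own slot nothing has been written: only vertices below 3 * n
            get labels, and there are at most 3 * n of them.\<close>
          have "lb y = 0"
          proof -
            have "y \<notin> \<Union>(edge_set l)" using y(2) tripartite_edge(1,2)[OF s(7)] by (force simp: edge_set_def)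
            then show ?thesis using lab unfolding labelled_def by blast
          qed
          moreover have "old y = 0" using lab cn y(2) unfolding labelled_def by (meson order_trans)
          moreover have "arrs s 13 i = 0" using fr(1)[of 13 i] y by simp
          moreover have "arrs s' a = arrs s5 a" using that[of a] a6[of a] a by auto
          ultimately show "arrs s' a i = 0" using a b5 y(1) by (auto simp: lb_def old_def)
        next
          fix a i assume a: "20 \<le> (a::nat)" and i: "regs s 6 < i mod K"
          have "arrs s' a i = arrs s5 a i" using that[of a] o6[of i a] a i by (auto simp: \<kappa>_def)
          also have "\<dots> = 0" using b20[of i] b5(5)[of a] fr(2)[of a i] a i by (cases "a = 20") (auto simp: \<kappa>_def)
          finally show "arrs s' a i = 0" .
        qed
        have r7: "regs s7 0 = n" "regs s7 1 = m" "regs s7 3 = regs s 3" "regs s7 6 = \<kappa>" "regs s7 7 = regs s 7" "regs s7 8 = regs s 8"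
          "regs s7 9 = h mod 3" "regs s7 25 = cnt" "regs s7 27 = c" "arrs s7 = arrs s6"
          using r6 e5 by (simp_all add: s7_def)
        have o7: "olist s7 = olist s" using a6[of 1] b5(1) r7 by (simp add: olist_def)
        have R7: "reach RES s7 (1 + (1 + ((real len * 6 + 1) + 1))) ?u3 ?Q"
          unfolding RES_def
        proof (rule reach_If)
          assume "aval (Bin Less (Reg 27) (Bin Sub (Reg 8) (Reg 7))) s7 \<noteq> 0"
          then have cl: "c < len" using r7 len(1) by (simp split: if_splits)
          \<comment> \<open>As c is the minimum of the numbers of edges and of triangles, being
            below the former it equals the latter.\<close>
          then have ct: "c = card (triangles F)" using c_min by simp
          have "finite (triangles F)" using finite_imageD[OF _ rel(5)] rel(4) by simp
          then have lset: "set (listed t) = triangles F"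
            using tri(2,3) c_min ct distinct_card[OF tri(1)] by (intro card_subset_eq) simp_all
          define s8 where "s8 = set_reg 28 0 s7"
          define v where "v = arrs t 1"
          have vv: "v i = arrs s8 21 (i * K + regs s8 6)" for i
          proof -
            have "regs s6 6 = \<kappa>" using r6 e5 by simp
            moreover have "arrs s6 (20 + 1) (i * K + regs s6 6) = arrs t 1 i" using s6(2) unfolding embedded_def by blast
            ultimately show ?thesis using r7 by (simp add: v_def s8_def)
          qed
          \<comment> \<open>Every cell read belongs to a listed triangle, so it contains a label
            below cnt; this bounds the values that enter main memory.\<close>
          have vle: "v i \<le> regs s8 25" if "i < 3 * c" for i
          proof -
            have i3: "i div 3 < regs t 0" using that by (simp add: c_def div_less_iff_less_mult mult.commute)
            have "listed t ! (i div 3) = {v (3 * (i div 3)), v (3 * (i div 3) + 1), v (3 * (i div 3) + 2)}"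
              using i3 by (simp add: listed_def v_def)
            moreover have "listed t ! (i div 3) \<in> set (listed t)" using i3 by (intro nth_mem) (simp add: listed_def)
            then have "listed t ! (i div 3) \<subseteq> {..<cnt}" using tri(2) by (intro rel(7)) (rule subsetD)
            ultimately have sub: "{v (3 * (i div 3)), v (3 * (i div 3) + 1), v (3 * (i div 3) + 2)} \<subseteq> {..<cnt}" by simp
            have "v i \<in> {v (3 * q), v (3 * q + 1), v (3 * q + 2)}" if "i = 3 * q \<or> i = 3 * q + 1 \<or> i = 3 * q + 2" for q
              using that by auto
            moreover have "i = 3 * (i div 3) \<or> i = 3 * (i div 3) + 1 \<or> i = 3 * (i div 3) + 2" by linarith
            ultimately have "v i \<in> {v (3 * (i div 3)), v (3 * (i div 3) + 1), v (3 * (i div 3) + 2)}" by blast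
            with sub have "v i < cnt" by blast
            then show ?thesis using r7 by (simp add: s8_def)
          qed
          have "reach (for_loop 28 27 (output_triangle Ke)) s8 (real (regs s8 27) * 6 + 1) (real (regs s8 27) * (3 * real (read_weight Ke * val_cost K)))
            (\<lambda>s'. olist s' = olist s8 @ map (\<lambda>i. (\<lambda>x. x mod n) ` (\<lambda>q. arrs s8 12 (B + q)) ` {v (3 * i), v (3 * i + 1), v (3 * i + 2)}) [0..<regs s8 27])"
          proof (rule reach_output_triangles)
            show "aval Ke s8 = K" using Ks[of s8] r7 by (simp add: s8_def)
            show "v i = arrs s8 21 (i * K + regs s8 6) \<and> v i \<le> regs s8 25" if "i < 3 * regs s8 27" for i
              using vv vle[of i] that r7 by (simp add: s8_def)
          qed (use Ke r7 KK K cn cl s(8) in \<open>simp_all add: s8_def B_def len_def\<close>)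
          from reach_keeps[OF this]
          have "reach (for_loop 28 27 (output_triangle Ke)) s8 (real len * 6 + 1) ?u3 (\<lambda>s'. ?Q (sval (Assign 11 (Const 1)) s'))"
          proof (rule reach_mono)
            show "real (regs s8 27) * 6 + 1 \<le> real len * 6 + 1" using cl r7 by (simp add: s8_def)
            show "real (regs s8 27) * (3 * real (read_weight Ke * val_cost K)) \<le> ?u3"
              using cl r7 by (intro mult_right_mono) (simp_all add: s8_def)
            fix s' assume S': "olist s' = olist s8 @ map (\<lambda>i. (\<lambda>x. x mod n) ` (\<lambda>q. arrs s8 12 (B + q)) ` {v (3 * i), v (3 * i + 1), v (3 * i + 2)}) [0..<regs s8 27]
              \<and> keeps (wregs (for_loop 28 27 (output_triangle Ke))) (warrs (for_loop 28 27 (output_triangle Ke))) s8 s'"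
            have arr: "arrs s' a = arrs s6 a" if "a \<noteq> 1" for a
              using S' that r7 by (simp add: keeps_def output_triangle_sets s8_def)
            have old12: "arrs s8 12 (B + q) = old q" for q using r7 a6[of 12] b5 by (simp add: s8_def old_def)
            define Ls where "Ls = map (\<lambda>T. old ` T) (listed t)"
            have "map (\<lambda>T. (\<lambda>x. x mod n) ` T) Ls = map (\<lambda>i. (\<lambda>x. x mod n) ` (\<lambda>q. arrs s8 12 (B + q)) ` {v (3 * i), v (3 * i + 1), v (3 * i + 2)}) [0..<regs s8 27]"
              unfolding Ls_def listed_def old12 using r7 by (simp add: s8_def c_def v_def)
            moreover have "olist s8 = olist s" using o7 by (simp add: s8_def olist_def)
            ultimately have "olist s' = olist s @ map (\<lambda>T. (\<lambda>x. x mod n) ` T) Ls" using S' by simp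
            moreover have "distinct Ls" unfolding Ls_def using tri(1) rel(5) lset by (simp add: distinct_map)
            moreover have "set Ls = triangles (edge_set l)" unfolding Ls_def using rel(4) lset by simp
            moreover have "olist (sval (Assign 11 (Const 1)) s') = olist s'" by (simp add: olist_def)
            moreover note post[of "sval (Assign 11 (Const 1)) s'"]
            ultimately show "?Q (sval (Assign 11 (Const 1)) s')" using arr by (auto intro!: exI[of _ Ls])
          qed
          then have "reach (Seq (for_loop 28 27 (output_triangle Ke)) (Assign 11 (Const 1))) s8 ((real len * 6 + 1) + real (csize (Assign 11 (Const 1)))) ?u3 ?Q"
            by (rule reach_straight_Seq[rotated]) simp
          then have "reach (Seq (Assign 28 (Const 0)) (Seq (for_loop 28 27 (output_triangle Ke)) (Assign 11 (Const 1)))) s7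
              (real (csize (Assign 28 (Const 0))) + ((real len * 6 + 1) + real (csize (Assign 11 (Const 1))))) ?u3 ?Q"
            by (intro reach_Seq_straight) (simp_all add: s8_def)
          then show "reach (Seq (Assign 28 (Const 0)) (Seq (for_loop 28 27 (output_triangle Ke)) (Assign 11 (Const 1)))) s7
              (1 + ((real len * 6 + 1) + 1)) ?u3 ?Q" by simp
        next
          assume "aval (Bin Less (Reg 27) (Bin Sub (Reg 8) (Reg 7))) s7 = 0"
          then have cl: "len \<le> c" using r7 len(1) by (simp split: if_splits)
          then have many: "length l \<le> card (triangles (edge_set l))" using c_min rel(6) by (simp add: len_def)
          \<comment> \<open>The triangles of a flagged node are fewer than its edges, so the call
            always completes it.\<close>
          have "\<not> f"
          proof
            assume f
            then have "card (triangles (edge_set l)) < length l" using s(9) by (intro card_triangles_single[OF s(7), of "(h + 2) mod 3"]) auto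
            with many show False by simp
          qed
          moreover have "olist (sval (Assign 11 (Const 0)) s7) = olist s" using o7 by (simp add: olist_def)
          moreover note post[of "sval (Assign 11 (Const 0)) s7"]
          ultimately have "?Q (sval (Assign 11 (Const 0)) s7)" using many False r7 by simp
          then have "reach (Assign 11 (Const 0)) s7 (csize (Assign 11 (Const 0))) 0 ?Q" by (intro reach_straight) auto
          then show "reach (Assign 11 (Const 0)) s7 (1 + ((real len * 6 + 1) + 1)) ?u3 ?Q" by (rule reach_mono) auto
        qed simp
        \<comment> \<open>Register 40 is outside main memory, hence an external step; the value fits
          because it is at most the number of edges.\<close>
        have "reach (Assign 27 (Reg 40)) s6 0 ?u2 (\<lambda>s'. reach RES s' (1 + (1 + ((real len * 6 + 1) + 1))) ?u3 ?Q)"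
        proof (rule reach_Ext[OF ex7])
          fix M assume M: "bounded_mem M s6"
          have "c \<le> regs s6 8" using c_min len(1) r6[of 8] e5 by simp
          also have "\<dots> \<le> M" using M by (simp add: bounded_mem_def)
          finally show "bounded_mem M s7" unfolding s7_def by (intro bounded_mem_set_reg[OF M]) auto
        next
          have "c \<le> K" using c_min s(8) K(5) by (simp add: len_def)
          then have "val_cost c \<le> val_cost K" by (rule val_cost_mono)
          then show "real (1 + acost (Reg 40) s6) \<le> ?u2" using c by simp
        qed (rule R7)
        then have R6: "reach (Seq (Assign 27 (Reg 40)) RES) s6 (0 + (1 + (1 + ((real len * 6 + 1) + 1)))) (?u2 + ?u3) ?Q"
          by (rule reach_Seq)
        have "reach (rebase Ke p) s5 0 ?u1 (\<lambda>s'. reach (Seq (Assign 27 (Reg 40)) RES) s' (0 + (1 + (1 + ((real len * 6 + 1) + 1)))) (?u2 + ?u3) ?Q)"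
        proof (rule reach_Ext[OF s6(1)])
          show "bounded_mem M s6" if "bounded_mem M s5" for M using that sm by (simp add: bounded_mem_def same_main_def)
        qed (rule T'u R6)+
        then have "reach (Seq (rebase Ke p) (Seq (Assign 27 (Reg 40)) RES)) s5 (0 + (0 + (1 + (1 + ((real len * 6 + 1) + 1))))) (?u1 + (?u2 + ?u3)) ?Q"
          by (rule reach_Seq)
        then have "reach (Seq ZERO (Seq (rebase Ke p) (Seq (Assign 27 (Reg 40)) RES))) s4 (real (csize ZERO) + (0 + (0 + (1 + (1 + ((real len * 6 + 1) + 1)))))) (?u1 + (?u2 + ?u3)) ?Q"
          unfolding s5_def by (intro reach_Seq_straight) (simp_all add: ZERO_def zero_regs_simps)
        then show "reach (Seq ZERO (Seq (rebase Ke p) (Seq (Assign 27 (Reg 40)) RES))) s4 (?kz + (0 + (0 + (1 + (1 + ((real len * 6 + 1) + 1)))))) (?u1 + (?u2 + ?u3)) ?Q"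
          by (rule reach_mono) (simp_all add: ZERO_def zero_regs_simps)
      qed (simp_all add: len_def)
      then have "reach (Seq (for_loop 12 8 (write_edge Ke)) (Seq ZERO (Seq (rebase Ke p) (Seq (Assign 27 (Reg 40)) RES)))) s3
        ((real len * 6 + 1) + (?kz + (0 + (0 + (1 + (1 + ((real len * 6 + 1) + 1))))))) (0 + (?u1 + (?u2 + ?u3))) ?Q" by (rule reach_Seq)
      then have "reach (Seq (Assign 12 (Reg 7)) (Seq (for_loop 12 8 (write_edge Ke)) (Seq ZERO (Seq (rebase Ke p) (Seq (Assign 27 (Reg 40)) RES))))) s2
        (real (csize (Assign 12 (Reg 7))) + ((real len * 6 + 1) + (?kz + (0 + (0 + (1 + (1 + ((real len * 6 + 1) + 1)))))))) (0 + (?u1 + (?u2 + ?u3))) ?Q"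
        unfolding s3_def by (intro reach_Seq_straight) simp_all
      then show ?thesis by simp
    qed
    let ?k = "1 + ((real len * 6 + 1) + (?kz + (0 + (0 + (1 + (1 + ((real len * 6 + 1) + 1)))))))"
    have "reach (for_loop 12 8 label_edge) s1 (real len * 14 + 1) 0
      (\<lambda>s'. reach (Seq (Assign 12 (Reg 7)) (Seq (for_loop 12 8 (write_edge Ke)) (Seq ZERO (Seq (rebase Ke p) (Seq (Assign 27 (Reg 40)) RES))))) s'
        ?k (0 + (?u1 + (?u2 + ?u3))) ?Q)"
      by (rule reach_mono[OF split]) (use main in blast)+
    then have "reach (Seq (for_loop 12 8 label_edge) (Seq (Assign 12 (Reg 7)) (Seq (for_loop 12 8 (write_edge Ke)) (Seq ZERO (Seq (rebase Ke p) (Seq (Assign 27 (Reg 40)) RES)))))) s1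
        ((real len * 14 + 1) + ?k) (0 + (0 + (?u1 + (?u2 + ?u3)))) ?Q" by (rule reach_Seq)
    then have "reach (Seq (Seq (Assign 12 (Reg 7)) (Assign 25 (Const 0))) (Seq (for_loop 12 8 label_edge) (Seq (Assign 12 (Reg 7)) (Seq (for_loop 12 8 (write_edge Ke)) (Seq ZERO (Seq (rebase Ke p) (Seq (Assign 27 (Reg 40)) RES))))))) s
        (real (csize (Seq (Assign 12 (Reg 7)) (Assign 25 (Const 0)))) + ((real len * 14 + 1) + ?k)) (0 + (0 + (?u1 + (?u2 + ?u3)))) ?Q"
      unfolding s1_def by (intro reach_Seq_straight) simp_all
    then have "reach (solve_by p Ke) s (1 + (real (csize (Seq (Assign 12 (Reg 7)) (Assign 25 (Const 0)))) + ((real len * 14 + 1) + ?k))) (0 + (0 + (?u1 + (?u2 + ?u3)))) ?Q"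
      unfolding solve_by_def RES_def ZERO_def R_def using len(3) by (intro reach_If) auto
    then show ?thesis
    proof (rule reach_mono)
      have "real R * 1 \<le> real R * (real len + 1)" by (intro mult_left_mono) auto
      then show "1 + (real (csize (Seq (Assign 12 (Reg 7)) (Assign 25 (Const 0)))) + ((real len * 14 + 1) + ?k)) \<le> real (70 + max 2 (com_regs p)) * (real (length l) + 1)"
        unfolding R_def[symmetric] len_def[symmetric] using len(2) by (simp add: algebra_simps)
    qed (simp_all add: len_def)
  qed
qed

lemma solver_solve_by:
  assumes p: "deterministic p" "lists_m_triangles p Bp" and Ke: "main_exp Ke" "reads_only Ke 1"
    and K: "\<And>s. regs s 1 = m \<Longrightarrow> aval Ke s = K \<and> acost Ke s = aK" "m \<le> K" "3 * n \<le> K" "3 * m \<le> K"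
    and Bp: "\<And>k. 0 \<le> Bp k"
  shows "solver (solve_by p Ke) n m L K True (real (70 + max 2 (com_regs p)))
     (\<lambda>k. real (aK + 4 * val_cost K + 3) * Bp k + real (val_cost K + 1) + real k * (3 * real (read_weight Ke * val_cost K)))"
  unfolding solver_def
proof (intro conjI allI impI; (elim conjE)?)
  show "wregs (solve_by p Ke) \<inter> {0, 1, 2, 4, 5, 6, 7, 8, 10, 15} = {}" "warrs (solve_by p Ke) \<inter> {0, 2, 3, 4, 5, 6, 7, 8, 9, 10} = {}"
    using solve_by_sets[of p Ke] by auto
qed (rule reach_solve_by[OF p Ke, where m = m]; use K Bp in \<open>simp\<close>)

section \<open>Subproblems with a single vertex in one class\<close>

definition mark_neighbours :: com where
  "mark_neighbours = Seq load (If (Bin Equal (Bin Div (Reg 13) (Reg 0)) (Reg 9))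
     (Seq (Store 13 (slot 14) (Const 1)) (Assign 16 (Reg 13))) Skip)"

definition list_edge :: com where
  "list_edge = Seq (Store 1 (Bin Add (Bin Mul (Const 3) (Reg 3)) (Const 0)) (modn (Reg 16)))
     (Seq (Store 1 (Bin Add (Bin Mul (Const 3) (Reg 3)) (Const 1)) (modn (Reg 13)))
     (Seq (Store 1 (Bin Add (Bin Mul (Const 3) (Reg 3)) (Const 2)) (modn (Reg 14)))
       (Assign 3 (Bin Add (Reg 3) (Const 1)))))"

definition scan_edge :: com where
  "scan_edge = Seq load (If (Bin Equal (Bin Div (Reg 13) (Reg 0)) (Reg 9)) Skip
     (If (Bin Mul (Arr 13 (slot 13)) (Arr 13 (slot 14))) list_edge Skip))"

definition previous_class :: com where
  "previous_class = Seq (Assign 9 (Bin Add (Reg 9) (Const 2)))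
     (Seq (If (Bin Less (Const 2) (Reg 9)) (Assign 9 (Bin Sub (Reg 9) (Const 3))) Skip) (Assign 12 (Reg 7)))"

text \<open>The solver for c > 3/2. It never calls the given algorithm: every nonempty unflagged
  node is split, and a flagged one is solved in linear time.\<close>

definition solve_single :: com where
  "solve_single = If (Bin Less (Reg 7) (Reg 8))
     (If (Reg 10)
       (Seq previous_class (Seq (for_loop 12 8 mark_neighbours)
         (Seq (Assign 12 (Reg 7)) (Seq (for_loop 12 8 scan_edge) (Assign 11 (Const 1))))))
       (Assign 11 (Const 0)))
     (Assign 11 (Const 1))"

lemma single_simps:
  "straight mark_neighbours" "csize mark_neighbours = 11" "wregs mark_neighbours = {13, 14, 16, 24}" "warrs mark_neighbours = {13}"
  "straight scan_edge" "csize scan_edge = 15" "wregs scan_edge = {3, 13, 14, 24}" "warrs scan_edge = {1}"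
  "straight previous_class" "csize previous_class = 5" "wregs previous_class = {9, 12}" "warrs previous_class = {}"
  by (auto simp: mark_neighbours_def scan_edge_def list_edge_def previous_class_def)

definition marked :: "nat \<Rightarrow> nat \<Rightarrow> (nat \<times> nat) list \<Rightarrow> nat \<Rightarrow> bool" where
  "marked n \<tau> l y \<longleftrightarrow> (\<exists>e\<in>set l. touches n \<tau> e \<and> far n \<tau> e = y)"

definition opposite :: "nat \<Rightarrow> nat \<Rightarrow> (nat \<times> nat) list \<Rightarrow> nat \<times> nat \<Rightarrow> bool" where
  "opposite n \<tau> l e \<longleftrightarrow> \<not> touches n \<tau> e \<and> marked n \<tau> l (fst e) \<and> marked n \<tau> l (snd e)"

lemma edge_set_mem: "e \<in> set l \<Longrightarrow> {fst e, snd e} \<in> edge_set l"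
  unfolding edge_set_def set_map by (rule image_eqI[of _ _ e]) (simp_all add: case_prod_beta)

text \<open>All triangles pass through the only vertex h of its class, so they correspond to the
  edges opposite to h both of whose endpoints are neighbours of h. Marking the neighbours makes this
  a linear scan.\<close>

lemma triangles_single:
  assumes "tripartite n l" "\<tau> < 3" and h: "\<And>e. e \<in> set l \<Longrightarrow> touches n \<tau> e \<Longrightarrow> near n \<tau> e = h" and "e0 \<in> set l" "touches n \<tau> e0"
  defines "Ls \<equiv> map (\<lambda>e. {h, fst e, snd e}) (filter (opposite n \<tau> l) l)"
  shows "distinct Ls" "set Ls = triangles (edge_set l)"
proof -
  have ht: "h div n = \<tau>" using h[OF assms(4,5)] assms(5) by (simp add: touches_iff)
  have mk: "marked n \<tau> l y \<longleftrightarrow> {h, y} \<in> edge_set l" if "y div n \<noteq> \<tau>" for y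
  proof
    assume "marked n \<tau> l y"
    then obtain e where e: "e \<in> set l" "touches n \<tau> e" "far n \<tau> e = y" unfolding marked_def by blast
    then have "{h, y} = {fst e, snd e}" using h[OF e(1,2)] by (auto simp: near_def far_def split: if_splits)
    with edge_set_mem[OF e(1)] show "{h, y} \<in> edge_set l" by simp
  next
    assume "{h, y} \<in> edge_set l"
    then obtain e where "e \<in> set l" "{h, y} = {fst e, snd e}" by (auto simp: edge_set_def)
    with near_if[of h y e n \<tau>] ht that show "marked n \<tau> l y" unfolding marked_def by blast
  qed
  have op: "opposite n \<tau> l e \<longleftrightarrow> fst e div n \<noteq> \<tau> \<and> snd e div n \<noteq> \<tau> \<and> {h, fst e} \<in> edge_set l \<and> {h, snd e} \<in> edge_set l" for e
    using mk[of "fst e"] mk[of "snd e"] unfolding opposite_def touches_def by blast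
  have "distinct (map (\<lambda>e. {fst e, snd e}) l)"
    using assms(1) by (simp add: tripartite_def case_prod_beta')
  then have inj: "inj_on (\<lambda>e. {fst e, snd e}) (set l)" "distinct l" by (auto simp: distinct_map)
  have "inj_on (\<lambda>e. {h, fst e, snd e}) (set (filter (opposite n \<tau> l) l))"
  proof (rule inj_onI)
    fix e e' assume e: "e \<in> set (filter (opposite n \<tau> l) l)" "e' \<in> set (filter (opposite n \<tau> l) l)"
      and eq: "{h, fst e, snd e} = {h, fst e', snd e'}"
    have "h \<notin> {fst e, snd e}" "h \<notin> {fst e', snd e'}" using e op ht by auto
    with eq have "{fst e, snd e} = {fst e', snd e'}" by (metis insert_ident)
    with inj(1) e show "e = e'" by (simp add: inj_on_def)
  qed
  then show "distinct Ls" using inj(2) by (simp add: Ls_def distinct_map)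
  show "set Ls = triangles (edge_set l)"
  proof (intro equalityI subsetI)
    fix T assume "T \<in> set Ls"
    then obtain e where e: "e \<in> set l" "opposite n \<tau> l e" "T = {h, fst e, snd e}" by (auto simp: Ls_def)
    have "{fst e, snd e} \<in> edge_set l" by (rule edge_set_mem[OF e(1)])
    moreover have "fst e \<noteq> snd e" using tripartite_edge(3)[OF assms(1) e(1)] by auto
    ultimately show "T \<in> triangles (edge_set l)"
      using e op ht unfolding triangles_iff by (intro exI[of _ h] exI[of _ "fst e"] exI[of _ "snd e"]) auto
  next
    fix T assume T0: "T \<in> triangles (edge_set l)"
    obtain a b c where T: "T = {a, b, c}" "a div n = \<tau>" "b div n \<noteq> \<tau>" "c div n \<noteq> \<tau>" "b \<noteq> c"
      "{a, b} \<in> edge_set l" "{b, c} \<in> edge_set l" "{a, c} \<in> edge_set l"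
      by (rule triangle_vertex[OF assms(1) T0 assms(2)])
    from T(6) obtain e where "e \<in> set l" "{a, b} = {fst e, snd e}" by (auto simp: edge_set_def)
    with h near_if[of a b e n \<tau>] T have ah: "a = h" by blast
    from T(7) obtain e where e: "e \<in> set l" "{b, c} = {fst e, snd e}" by (auto simp: edge_set_def)
    then have "opposite n \<tau> l e" unfolding op using T ah by (auto simp: doubleton_eq_iff)
    moreover have "T = {h, fst e, snd e}" using T(1) ah e(2) by auto
    ultimately show "T \<in> set Ls" using e(1) by (auto simp: Ls_def)
  qed
qed

lemma reach_solve_single:
  assumes s: "regs s 0 = n" "regs s 9 = h mod 3" "regs s 10 = of_bool f"
      "pool s (regs s 7) (regs s 8) = l" "regs s 7 \<le> regs s 8" "tripartite n l"
      "f \<longrightarrow> single n ((h + 2) mod 3) l" "fresh_from n K (regs s 6) s"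
  shows "reach solve_single s (40 * (real (length l) + 1)) 0
     (\<lambda>s'. (\<forall>a\<in>{11, 12, 13}. \<forall>i\<ge>(regs s 6 + 1) * (3 * n). arrs s' a i = 0) \<and>
        (\<forall>a\<ge>20. \<forall>i. regs s 6 < i mod K \<longrightarrow> arrs s' a i = 0) \<and>
        (if regs s' 11 = 0
         then \<not> f \<and> l \<noteq> [] \<and> (False \<longrightarrow> length l \<le> card (triangles (edge_set l))) \<and> olist s' = olist s \<and> regs s' 9 = h mod 3
         else \<exists>Ls. distinct Ls \<and> set Ls = triangles (edge_set l) \<and>
           olist s' = olist s @ map (\<lambda>T. (\<lambda>x. x mod n) ` T) Ls))"
    (is "reach _ _ _ _ ?Q")
proof -
  define B where "B = regs s 6 * (3 * n)"
  have fr: "\<And>a i. a \<in> {8..13} \<Longrightarrow> B \<le> i \<Longrightarrow> arrs s a i = 0" "\<And>a i. 20 \<le> a \<Longrightarrow> regs s 6 \<le> i mod K \<Longrightarrow> arrs s a i = 0"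
    using s(8) unfolding fresh_from_def B_def by blast+
  have post: "(\<forall>a\<in>{11, 12, 13}. \<forall>i\<ge>(regs s 6 + 1) * (3 * n). arrs s' a i = 0) \<and> (\<forall>a\<ge>20. \<forall>i. regs s 6 < i mod K \<longrightarrow> arrs s' a i = 0)"
    if "\<And>a. a \<notin> {1, 13} \<Longrightarrow> arrs s' a = arrs s a" "\<And>y. 3 * n \<le> y \<Longrightarrow> arrs s' 13 (B + y) = 0" for s'
  proof (intro conjI ballI allI impI)
    fix a i assume a: "a \<in> {11, 12, 13::nat}" and i: "(regs s 6 + 1) * (3 * n) \<le> i"
    obtain y where y: "i = B + y" "3 * n \<le> y" using i by (auto simp: le_iff_add B_def add_mult_distrib add.assoc)
    show "arrs s' a i = 0"
    proof (cases "a = 13")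
      case True
      then show ?thesis using that(2)[OF y(2)] y(1) by simp
    next
      case False
      then have "arrs s' a = arrs s a" using a by (intro that(1)) auto
      then show ?thesis using fr(1)[of a i] a y(1) by auto
    qed
  next
    fix a i assume a: "20 \<le> (a::nat)" "regs s 6 < i mod K"
    then have "arrs s' a = arrs s a" by (intro that(1)) auto
    then show "arrs s' a i = 0" using fr(2)[of a i] a by simp
  qed
  show ?thesis
  proof (cases "l = []")
    case True
    have "edge_set l = {}" by (simp add: True edge_set_def)
    then have tr: "triangles (edge_set l) = {}" by (auto simp: triangles_iff)
    let ?s = "sval (Assign 11 (Const 1)) s"
    have "?Q ?s" using post[of ?s] fr(1)[of 13] by (simp add: olist_def tr)
    then have "reach (Assign 11 (Const 1)) s (csize (Assign 11 (Const 1))) 0 ?Q" by (intro reach_straight) auto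
    moreover have "aval (Bin Less (Reg 7) (Reg 8)) s = 0" using True s(4) by (auto simp: pool_def)
    ultimately have "reach solve_single s (1 + 1) 0 ?Q" unfolding solve_single_def by (intro reach_If) auto
    then show ?thesis by (rule reach_mono) (simp add: True, rule order_refl, assumption)
  next
    case ne: False
    have lt: "regs s 7 < regs s 8" using ne s(4) by (auto simp: pool_def)
    show ?thesis
    proof (cases f)
      case False
      let ?s = "sval (Assign 11 (Const 0)) s"
      have "?Q ?s" using post[of ?s] fr(1)[of 13] False ne s(2) by (simp add: olist_def)
      then have "reach (Assign 11 (Const 0)) s (csize (Assign 11 (Const 0))) 0 ?Q" by (intro reach_straight) auto
      then have "reach solve_single s (1 + (1 + 1)) 0 ?Q" unfolding solve_single_def using lt False s(3) by (intro reach_If) auto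
      then show ?thesis by (rule reach_mono) (simp, rule order_refl, assumption)
    next
      case True
      define \<tau> where "\<tau> = (h + 2) mod 3"
      have \<tau>3: "\<tau> < 3" by (simp add: \<tau>_def)
      from s(7) True obtain v e0 where v: "\<And>e. e \<in> set l \<Longrightarrow> touches n \<tau> e \<Longrightarrow> near n \<tau> e = v" "e0 \<in> set l" "touches n \<tau> e0"
        unfolding single_def \<tau>_def by blast
      define s1 where "s1 = sval previous_class s"
      have "(if 2 < h mod 3 + 2 then h mod 3 + 2 - 3 else h mod 3 + 2) = \<tau>" unfolding \<tau>_def by presburger
      then have s1: "regs s1 9 = \<tau>" "regs s1 12 = regs s 7" "\<And>r. r \<notin> {9, 12} \<Longrightarrow> regs s1 r = regs s r" "arrs s1 = arrs s"
        using s(2) by (auto simp: s1_def previous_class_def)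
      let ?P = "\<lambda>j s'. (\<forall>y. arrs s' 13 (B + y) = of_bool (marked n \<tau> (take (j - regs s 7) l) y)) \<and>
        ((\<exists>e\<in>set (take (j - regs s 7) l). touches n \<tau> e) \<longrightarrow> regs s' 16 = v)"
      have "reach (for_loop 12 8 mark_neighbours) s1 (real (regs s 8 - regs s 7) * (real (csize mark_neighbours) + 2) + 1) 0
        (\<lambda>s'. ?P (regs s 8) s' \<and> regs s' 12 = regs s 8 \<and> keeps (insert 12 (wregs mark_neighbours)) (warrs mark_neighbours) s1 s')"
      proof (rule reach_for_straight)
        show "?P (regs s 7) s1" using fr(1) by (simp add: marked_def s1)
        fix j s' assume jj: "regs s 7 \<le> j" "j < regs s 8" "regs s' 12 = j"
          and k: "keeps (insert 12 (wregs mark_neighbours)) (warrs mark_neighbours) s1 s'" and P: "?P j s'"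
        note k' = keeps_regs[OF k] keeps_arrs[OF k]
        let ?e = "(arrs s 2 j, arrs s 3 j)"
        have eq: "regs s' 0 = n" "regs s' 9 = \<tau>" "regs s' 6 = regs s 6" "arrs s' 2 = arrs s 2" "arrs s' 3 = arrs s 3"
          using k' s s1 by (simp_all add: single_simps)
        have tk: "take (Suc j - regs s 7) l = take (j - regs s 7) l @ [?e]"
          using take_pool_Suc[OF jj(1,2), of s] s(4) by simp
        have "?e \<in> set l" using pool_nth_mem[OF jj(1,2), of s] s(4) by simp
        note ve = v(1)[OF this]
        show "?P (Suc j) (set_reg 12 (Suc j) (sval mark_neighbours s'))"
        proof (cases "touches n \<tau> ?e")
          case True
          then have sv: "sval mark_neighbours s' = set_reg 16 (near n \<tau> ?e) (set_arr 13 (B + far n \<tau> ?e) 1 (sval load s'))"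
            using eq jj(3) by (simp add: mark_neighbours_def touches_iff B_def)
          have m: "marked n \<tau> (take (j - regs s 7) l @ [?e]) y \<longleftrightarrow> marked n \<tau> (take (j - regs s 7) l) y \<or> y = far n \<tau> ?e" for y
            using True by (auto simp: marked_def)
          show ?thesis unfolding tk m sv using P ve[OF True] by simp
        next
          case False
          then have "sval mark_neighbours s' = sval load s'"
            using eq jj(3) by (simp add: mark_neighbours_def touches_iff)
          then show ?thesis unfolding tk using P False by (simp add: marked_def)
        qed
      qed (use s1 s in \<open>simp_all add: single_simps\<close>)
      then have "reach (for_loop 12 8 mark_neighbours) s1 (real (length l) * 13 + 1) 0
        (\<lambda>s'. reach (Seq (Assign 12 (Reg 7)) (Seq (for_loop 12 8 scan_edge) (Assign 11 (Const 1)))) s' (1 + ((real (length l) * 17 + 1) + 1)) 0 ?Q)"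
      proof (rule reach_mono)
        fix s2 assume A: "?P (regs s 8) s2 \<and> regs s2 12 = regs s 8 \<and> keeps (insert 12 (wregs mark_neighbours)) (warrs mark_neighbours) s1 s2"
        then have k2: "keeps (insert 12 (wregs mark_neighbours)) (warrs mark_neighbours) s1 s2" by blast
        note k2' = keeps_regs[OF k2] keeps_arrs[OF k2]
        have tl: "take (regs s 8 - regs s 7) l = l" using s(4) by auto
        have mk: "arrs s2 13 (B + y) = of_bool (marked n \<tau> l y)" for y using A unfolding tl by blast
        have v16: "regs s2 16 = v" using A v(2,3) unfolding tl by blast
        define s3 where "s3 = set_reg 12 (regs s 7) s2"
        have e3: "regs s3 0 = n" "regs s3 9 = \<tau>" "regs s3 6 = regs s 6" "regs s3 7 = regs s 7" "regs s3 8 = regs s 8" "regs s3 3 = regs s 3" "regs s3 16 = v" "regs s3 12 = regs s 7"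
          "arrs s3 2 = arrs s 2" "arrs s3 3 = arrs s 3" "arrs s3 1 = arrs s 1" "arrs s3 13 = arrs s2 13" "\<And>a. a \<noteq> 13 \<Longrightarrow> arrs s3 a = arrs s a"
          using k2' s s1 v16 by (simp_all add: single_simps s3_def)
        let ?T = "\<lambda>e. {v, fst e, snd e}"
        let ?R = "\<lambda>j s'. olist s' = olist s @ map (\<lambda>T. (\<lambda>x. x mod n) ` T) (map ?T (filter (opposite n \<tau> l) (take (j - regs s 7) l)))"
        have "reach (for_loop 12 8 scan_edge) s3 (real (regs s 8 - regs s 7) * (real (csize scan_edge) + 2) + 1) 0
          (\<lambda>s'. ?R (regs s 8) s' \<and> regs s' 12 = regs s 8 \<and> keeps (insert 12 (wregs scan_edge)) (warrs scan_edge) s3 s')"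
        proof (rule reach_for_straight)
          show "?R (regs s 7) s3" by (simp add: olist_def e3)
          fix j s' assume jj: "regs s 7 \<le> j" "j < regs s 8" "regs s' 12 = j"
            and k: "keeps (insert 12 (wregs scan_edge)) (warrs scan_edge) s3 s'" and R: "?R j s'"
          note k' = keeps_regs[OF k] keeps_arrs[OF k]
          let ?e = "(arrs s 2 j, arrs s 3 j)"
          have eq: "regs s' 0 = n" "regs s' 9 = \<tau>" "regs s' 6 = regs s 6" "regs s' 16 = v" "arrs s' 2 = arrs s 2" "arrs s' 3 = arrs s 3" "arrs s' 13 = arrs s2 13"
            using k' e3 by (simp_all add: single_simps)
          have tk: "take (Suc j - regs s 7) l = take (j - regs s 7) l @ [?e]"
            using take_pool_Suc[OF jj(1,2), of s] s(4) by simp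
          show "?R (Suc j) (set_reg 12 (Suc j) (sval scan_edge s'))"
          proof (cases "opposite n \<tau> l ?e")
            case True
            then have t: "\<not> touches n \<tau> ?e" and m: "marked n \<tau> l (arrs s 2 j)" "marked n \<tau> l (arrs s 3 j)" by (auto simp: opposite_def)
            then have nf: "near n \<tau> ?e = arrs s 2 j" "far n \<tau> ?e = arrs s 3 j" by (auto simp: near_def far_def touches_def)
            have "sval scan_edge s' = sval list_edge (sval load s')"
              using t m mk[of "arrs s 2 j"] mk[of "arrs s 3 j"] nf eq jj(3) by (simp add: scan_edge_def touches_iff B_def)
            moreover have "olist (set_reg 12 (Suc j) (sval list_edge (sval load s'))) =
                olist s' @ [{v mod n, arrs s 2 j mod n, arrs s 3 j mod n}]"
              by (rule olist_snoc) (use nf eq jj(3) in \<open>simp_all add: list_edge_def\<close>)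
            ultimately show ?thesis unfolding tk using R True by simp
          next
            case False
            have "sval scan_edge s' = sval load s'"
            proof (cases "touches n \<tau> ?e")
              case True
              then show ?thesis using eq jj(3) by (simp add: scan_edge_def touches_iff)
            next
              case t: False
              then have nf: "near n \<tau> ?e = arrs s 2 j" "far n \<tau> ?e = arrs s 3 j" by (auto simp: near_def far_def touches_def)
              from t False have "\<not> marked n \<tau> l (arrs s 2 j) \<or> \<not> marked n \<tau> l (arrs s 3 j)" by (auto simp: opposite_def)
              then show ?thesis using t mk[of "arrs s 2 j"] mk[of "arrs s 3 j"] nf eq jj(3)
                by (auto simp: scan_edge_def touches_iff B_def)
            qed
            moreover have "olist (set_reg 12 (Suc j) (sval load s')) = olist s'" by (simp add: olist_def)
            ultimately show ?thesis unfolding tk using R False by simp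
          qed
        qed (use e3 s in \<open>simp_all add: single_simps\<close>)
        then have "reach (for_loop 12 8 scan_edge) s3 (real (length l) * 17 + 1) 0 (\<lambda>s'. ?Q (sval (Assign 11 (Const 1)) s'))"
        proof (rule reach_mono)
          fix s' assume R: "?R (regs s 8) s' \<and> regs s' 12 = regs s 8 \<and> keeps (insert 12 (wregs scan_edge)) (warrs scan_edge) s3 s'"
          then have k: "keeps (insert 12 (wregs scan_edge)) (warrs scan_edge) s3 s'" by blast
          let ?s = "sval (Assign 11 (Const 1)) s'"
          have "arrs ?s a = arrs s a" if "a \<notin> {1, 13}" for a using keeps_arrs[OF k, of a] e3(13)[of a] that by (simp add: single_simps)
          moreover have "arrs ?s 13 (B + y) = 0" if "3 * n \<le> y" for y
          proof -
            have far_less: "far n \<tau> e < 3 * n" if "e \<in> set l" for e using tripartite_edge(1,2)[OF s(6) that] by (simp add: far_def)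
            have "\<not> marked n \<tau> l y"
            proof
              assume "marked n \<tau> l y"
              then obtain e where "e \<in> set l" "far n \<tau> e = y" unfolding marked_def by blast
              with far_less[of e] that show False by simp
            qed
            then show ?thesis using keeps_arrs[OF k, of 13] e3(12) mk[of y] by (simp add: single_simps)
          qed
          moreover note post[of ?s]
          moreover have "olist ?s = olist s @ map (\<lambda>T. (\<lambda>x. x mod n) ` T) (map ?T (filter (opposite n \<tau> l) l))"
            using R unfolding tl by (simp add: olist_def)
          ultimately show "?Q ?s" using triangles_single[OF s(6) \<tau>3 v] by auto
        qed (use s(4) in \<open>auto simp: single_simps\<close>)
        then have "reach (Seq (for_loop 12 8 scan_edge) (Assign 11 (Const 1))) s3 ((real (length l) * 17 + 1) + real (csize (Assign 11 (Const 1)))) 0 ?Q"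
          by (rule reach_straight_Seq[rotated]) simp
        then have "reach (Seq (Assign 12 (Reg 7)) (Seq (for_loop 12 8 scan_edge) (Assign 11 (Const 1)))) s2
            (real (csize (Assign 12 (Reg 7))) + ((real (length l) * 17 + 1) + real (csize (Assign 11 (Const 1))))) 0 ?Q"
          by (intro reach_Seq_straight) (use k2'(1)[of 7] s1 in \<open>simp_all add: s3_def single_simps\<close>)
        then show "reach (Seq (Assign 12 (Reg 7)) (Seq (for_loop 12 8 scan_edge) (Assign 11 (Const 1)))) s2 (1 + ((real (length l) * 17 + 1) + 1)) 0 ?Q"
          by simp
      qed (use s(4) in \<open>auto simp: single_simps\<close>)
      then have "reach (Seq (for_loop 12 8 mark_neighbours) (Seq (Assign 12 (Reg 7)) (Seq (for_loop 12 8 scan_edge) (Assign 11 (Const 1))))) s1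
        ((real (length l) * 13 + 1) + (1 + ((real (length l) * 17 + 1) + 1))) (0 + 0) ?Q" by (rule reach_Seq)
      then have "reach (Seq previous_class (Seq (for_loop 12 8 mark_neighbours) (Seq (Assign 12 (Reg 7)) (Seq (for_loop 12 8 scan_edge) (Assign 11 (Const 1)))))) s
        (real (csize previous_class) + ((real (length l) * 13 + 1) + (1 + ((real (length l) * 17 + 1) + 1)))) (0 + 0) ?Q"
        unfolding s1_def by (intro reach_Seq_straight) (simp_all add: single_simps)
      then have "reach solve_single s (1 + (1 + (real (csize previous_class) + ((real (length l) * 13 + 1) + (1 + ((real (length l) * 17 + 1) + 1)))))) (0 + 0) ?Q"
        unfolding solve_single_def using lt True s(3) by (intro reach_If) auto
      then show ?thesis by (rule reach_mono) (simp add: single_simps, simp, assumption)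
    qed
  qed
qed

lemma solver_solve_single: "solver solve_single n m L K False 40 (\<lambda>_. 0)"
  unfolding solver_def
proof (intro conjI allI impI; (elim conjE)?)
  show "wregs solve_single \<inter> {0, 1, 2, 4, 5, 6, 7, 8, 10, 15} = {}" "warrs solve_single \<inter> {0, 2, 3, 4, 5, 6, 7, 8, 9, 10} = {}"
    by (auto simp: solve_single_def single_simps)
qed (rule reach_solve_single; simp)

section \<open>The tripartite version of a graph\<close>

text \<open>Edges lead from the smaller endpoint in a lower class to the larger endpoint in a higher
  class. So of the six ways to distribute a triangle over the classes only the increasing one
  remains, and each triangle is counted once.\<close>

definition lift_edge :: "nat \<Rightarrow> nat \<times> nat \<Rightarrow> (nat \<times> nat) list" where
  "lift_edge n = (\<lambda>(u, v). [(min u v, max u v + n), (min u v + n, max u v + 2 * n), (min u v, max u v + 2 * n)])"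

definition lift_edges :: "nat \<Rightarrow> (nat \<times> nat) list \<Rightarrow> (nat \<times> nat) list" where
  "lift_edges n es = concat (map (lift_edge n) es)"

lemma lift_edges_snoc: "lift_edges n (es @ [e]) = lift_edges n es @ lift_edge n e"
  by (simp add: lift_edges_def)

lemma length_lift_edges: "length (lift_edges n es) = 3 * length es"
  by (induction es) (auto simp: lift_edges_def lift_edge_def)

lemma class_simps:
  assumes "x < (n::nat)"
  shows "x div n = 0" "(x + n) div n = 1" "(x + 2 * n) div n = 2" "x mod n = x" "(x + n) mod n = x" "(x + 2 * n) mod n = x"
  using assms by (simp_all add: div_add_self2 div_mult_self2 del: div_mult_self1 mod_mult_self1) (simp_all add: div_add1_eq mod_mult_self1 mod_mult_self2)

lemma class_image:
  assumes "a < n" "b < (n::nat)" "e \<in> {(a, b + n), (a + n, b + 2 * n), (a, b + 2 * n)}"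
  shows "(\<lambda>x. x mod n) ` {fst e, snd e} = {a, b}"
  using assms(3) class_simps[OF assms(1)] class_simps[OF assms(2)] by (elim insertE emptyE) simp_all

lemma doubleton_min_max: "{min u v, max u v} = {u, v :: nat}"
  by (auto simp: min_def max_def)

lemma lift_edge_mod:
  assumes "u < n" "v < n" "e \<in> set (lift_edge n (u, v))"
  shows "(\<lambda>x. x mod n) ` {fst e, snd e} = {u, v}"
proof -
  have "(\<lambda>x. x mod n) ` {fst e, snd e} = {min u v, max u v}"
  proof (rule class_image)
    show "e \<in> {(min u v, max u v + n), (min u v + n, max u v + 2 * n), (min u v, max u v + 2 * n)}"
      using assms(3) unfolding lift_edge_def by simp
  qed (use assms(1,2) in simp_all)
  then show ?thesis unfolding doubleton_min_max .
qed

lemma avoiding_append: "avoiding n \<sigma> (l @ l') = avoiding n \<sigma> l + avoiding n \<sigma> l'"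
  by (simp add: avoiding_def)

lemma lift_edges_props:
  assumes "0 < n" "\<And>u v. (u, v) \<in> set es \<Longrightarrow> u < n \<and> v < n \<and> u \<noteq> v" "distinct (map (\<lambda>(u, v). {u, v}) es)"
  shows "tripartite n (lift_edges n es) \<and> (\<forall>\<sigma><3. avoiding n \<sigma> (lift_edges n es) = length es) \<and>
    (\<forall>e\<in>set (lift_edges n es). (\<lambda>x. x mod n) ` {fst e, snd e} \<in> edge_set es)"
  using assms(2,3)
proof (induction es rule: rev_induct)
  case Nil
  then show ?case using assms(1) by (simp add: lift_edges_def tripartite_def avoiding_def)
next
  case (snoc e es)
  obtain u v where e: "e = (u, v)" by (cases e)
  have uv: "u < n" "v < n" "u \<noteq> v" using snoc.prems(1)[of u v] e by auto
  have IH: "tripartite n (lift_edges n es)" "\<And>\<sigma>. \<sigma> < 3 \<Longrightarrow> avoiding n \<sigma> (lift_edges n es) = length es"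
    "\<And>e. e \<in> set (lift_edges n es) \<Longrightarrow> (\<lambda>x. x mod n) ` {fst e, snd e} \<in> edge_set es"
    using snoc.IH snoc.prems by auto
  have new: "{u, v} \<notin> edge_set es" using snoc.prems(2) e by (auto simp: edge_set_def)
  define a b where "a = min u v" and "b = max u v"
  have mm: "a < n" "b < n" using uv by (auto simp: a_def b_def)
  have l: "lift_edge n (u, v) = [(a, b + n), (a + n, b + 2 * n), (a, b + 2 * n)]"
    by (simp add: lift_edge_def a_def b_def)
  note c = class_simps[OF mm(1)] class_simps[OF mm(2)]
  let ?set = "\<lambda>e. {fst e, snd e}"
  have dj: "?set e1 \<noteq> ?set e2" if "e1 \<in> set (lift_edges n es)" "e2 \<in> set (lift_edge n (u, v))" for e1 e2
  proof
    assume "?set e1 = ?set e2"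
    then have "(\<lambda>x. x mod n) ` ?set e1 = {u, v}" using lift_edge_mod[OF uv(1,2) that(2)] by simp
    with IH(3)[OF that(1)] new show False by simp
  qed
  have d3: "distinct (map ?set (lift_edge n (u, v)))"
  proof -
    have "distinct (map (\<lambda>S. (\<lambda>x. x div n) ` S) (map ?set (lift_edge n (u, v))))"
      using c by (simp add: l doubleton_eq_iff)
    then show ?thesis by (simp only: distinct_map)
  qed
  have "distinct (map ?set (lift_edges n es))" using IH(1) by (simp add: tripartite_def case_prod_beta')
  then have "distinct (map ?set (lift_edges n (es @ [e])))"
    using d3 dj unfolding lift_edges_snoc e by auto
  moreover have "fst e' < 3 * n \<and> snd e' < 3 * n \<and> fst e' div n \<noteq> snd e' div n" if "e' \<in> set (lift_edge n (u, v))" for e'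
    using that c mm unfolding l by (simp, elim disjE) simp_all
  ultimately have "tripartite n (lift_edges n (es @ [e]))"
    using IH(1) unfolding tripartite_def lift_edges_snoc e by (auto simp: case_prod_beta')
  moreover have "avoiding n \<sigma> (lift_edge n (u, v)) = 1" if "\<sigma> < 3" for \<sigma>
  proof -
    have "\<sigma> = 0 \<or> \<sigma> = 1 \<or> \<sigma> = 2" using that by linarith
    then show ?thesis using c by (elim disjE) (simp_all add: avoiding_def l touches_def)
  qed
  moreover have "(\<lambda>x. x mod n) ` ?set e' \<in> edge_set (es @ [e])" if "e' \<in> set (lift_edges n (es @ [e]))" for e'
  proof (cases "e' \<in> set (lift_edges n es)")
    case True
    from IH(3)[OF this] show ?thesis by (auto simp only: edge_set_def map_append set_append)
  next
    case False
    then have "e' \<in> set (lift_edge n (u, v))" using that unfolding lift_edges_snoc e by simp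
    from lift_edge_mod[OF uv(1,2) this] have "(\<lambda>x. x mod n) ` ?set e' = {u, v}" .
    then show ?thesis unfolding e edge_set_def by simp
  qed
  ultimately show ?case using IH(2) unfolding lift_edges_snoc avoiding_append e by auto
qed

lemma pair_eq:
  assumes "a < n" "b < n" "c < n" "d < (n::nat)"
  shows "{a, b + n} = {c, d + n} \<longleftrightarrow> a = c \<and> b = d" "{a, b + n} \<noteq> {c + n, d + 2 * n}" "{a, b + n} \<noteq> {c, d + 2 * n}"
    "{a + n, b + 2 * n} \<noteq> {c, d + n}" "{a + n, b + 2 * n} = {c + n, d + 2 * n} \<longleftrightarrow> a = c \<and> b = d" "{a + n, b + 2 * n} \<noteq> {c, d + 2 * n}"
    "{a, b + 2 * n} \<noteq> {c, d + n}" "{a, b + 2 * n} \<noteq> {c + n, d + 2 * n}" "{a, b + 2 * n} = {c, d + 2 * n} \<longleftrightarrow> a = c \<and> b = d"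
  using assms unfolding doubleton_eq_iff by linarith+

lemma lift_edges_mem:
  assumes es: "\<And>u v. (u, v) \<in> set es \<Longrightarrow> u < n \<and> v < n \<and> u \<noteq> v" and x: "x < n" "y < n"
  shows "{x, y + n} \<in> edge_set (lift_edges n es) \<longleftrightarrow> x < y \<and> {x, y} \<in> edge_set es"
    "{x + n, y + 2 * n} \<in> edge_set (lift_edges n es) \<longleftrightarrow> x < y \<and> {x, y} \<in> edge_set es"
    "{x, y + 2 * n} \<in> edge_set (lift_edges n es) \<longleftrightarrow> x < y \<and> {x, y} \<in> edge_set es"
proof -
  have *: "(\<exists>(u, v)\<in>set es. x = min u v \<and> y = max u v) \<longleftrightarrow> x < y \<and> {x, y} \<in> edge_set es"
  proof
    assume "\<exists>(u, v)\<in>set es. x = min u v \<and> y = max u v"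
    then obtain u v where uv: "(u, v) \<in> set es" "x = min u v" "y = max u v" by blast
    have "{x, y} = {u, v}" unfolding uv(2,3) by (auto simp: min_def max_def)
    moreover have "{u, v} \<in> edge_set es" using edge_set_mem[OF uv(1)] by simp
    ultimately show "x < y \<and> {x, y} \<in> edge_set es" using es[OF uv(1)] uv(2,3) by (auto simp: min_def max_def)
  next
    assume a: "x < y \<and> {x, y} \<in> edge_set es"
    then obtain u v where "(u, v) \<in> set es" "{x, y} = {u, v}" by (auto simp: edge_set_def)
    with a show "\<exists>(u, v)\<in>set es. x = min u v \<and> y = max u v"
      by (intro bexI[of _ "(u, v)"]) (auto simp: doubleton_eq_iff min_def max_def)
  qed
  have E: "e \<in> edge_set (lift_edges n es) \<longleftrightarrow> (\<exists>(u, v)\<in>set es. e = {min u v, max u v + n} \<or>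
      e = {min u v + n, max u v + 2 * n} \<or> e = {min u v, max u v + 2 * n})" for e
  proof -
    have "e \<in> edge_set (lift_edges n es) \<longleftrightarrow> (\<exists>p\<in>set es. e \<in> edge_set (lift_edge n p))"
      by (auto simp: edge_set_def lift_edges_def)
    also have "\<dots> \<longleftrightarrow> (\<exists>(u, v)\<in>set es. e = {min u v, max u v + n} \<or>
      e = {min u v + n, max u v + 2 * n} \<or> e = {min u v, max u v + 2 * n})"
    proof (rule bex_cong[OF refl])
      fix p assume "p \<in> set es"
      obtain u v where uv: "p = (u, v)" by (cases p)
      show "e \<in> edge_set (lift_edge n p) \<longleftrightarrow> (case p of (u, v) \<Rightarrow> e = {min u v, max u v + n} \<or>
          e = {min u v + n, max u v + 2 * n} \<or> e = {min u v, max u v + 2 * n})"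
        by (simp only: uv prod.case lift_edge_def edge_set_def list.map list.set insert_iff empty_iff simp_thms)
    qed
    finally show ?thesis .
  qed
  have b: "min u v < n \<and> max u v < n" if "(u, v) \<in> set es" for u v using es[OF that] by auto
  show "{x, y + n} \<in> edge_set (lift_edges n es) \<longleftrightarrow> x < y \<and> {x, y} \<in> edge_set es"
    unfolding *[symmetric] E
  proof (rule bex_cong[OF refl])
    fix e assume e: "e \<in> set es"
    obtain u v where uv: "e = (u, v)" by (cases e)
    note pe = pair_eq[OF x conjunct1[OF b[OF e[unfolded uv]]] conjunct2[OF b[OF e[unfolded uv]]]]
    show "(case e of (u, v) \<Rightarrow> {x, y + n} = {min u v, max u v + n} \<or> {x, y + n} = {min u v + n, max u v + 2 * n} \<or> {x, y + n} = {min u v, max u v + 2 * n}) =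
        (case e of (u, v) \<Rightarrow> x = min u v \<and> y = max u v)"
      unfolding uv prod.case by (simp only: pe simp_thms)
  qed
  show "{x + n, y + 2 * n} \<in> edge_set (lift_edges n es) \<longleftrightarrow> x < y \<and> {x, y} \<in> edge_set es"
    unfolding *[symmetric] E
  proof (rule bex_cong[OF refl])
    fix e assume e: "e \<in> set es"
    obtain u v where uv: "e = (u, v)" by (cases e)
    note pe = pair_eq[OF x conjunct1[OF b[OF e[unfolded uv]]] conjunct2[OF b[OF e[unfolded uv]]]]
    show "(case e of (u, v) \<Rightarrow> {x + n, y + 2 * n} = {min u v, max u v + n} \<or> {x + n, y + 2 * n} = {min u v + n, max u v + 2 * n} \<or> {x + n, y + 2 * n} = {min u v, max u v + 2 * n}) =
        (case e of (u, v) \<Rightarrow> x = min u v \<and> y = max u v)"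
      unfolding uv prod.case by (simp only: pe simp_thms)
  qed
  show "{x, y + 2 * n} \<in> edge_set (lift_edges n es) \<longleftrightarrow> x < y \<and> {x, y} \<in> edge_set es"
    unfolding *[symmetric] E
  proof (rule bex_cong[OF refl])
    fix e assume e: "e \<in> set es"
    obtain u v where uv: "e = (u, v)" by (cases e)
    note pe = pair_eq[OF x conjunct1[OF b[OF e[unfolded uv]]] conjunct2[OF b[OF e[unfolded uv]]]]
    show "(case e of (u, v) \<Rightarrow> {x, y + 2 * n} = {min u v, max u v + n} \<or> {x, y + 2 * n} = {min u v + n, max u v + 2 * n} \<or> {x, y + 2 * n} = {min u v, max u v + 2 * n}) =
        (case e of (u, v) \<Rightarrow> x = min u v \<and> y = max u v)"
      unfolding uv prod.case by (simp only: pe simp_thms)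
  qed
qed

text \<open>Sorting determines the triple from the set. This makes the projection of lifted
  triangles injective.\<close>

lemma increasing_triple_eq:
  fixes x y z x' y' z' :: nat
  assumes "{x, y, z} = {x', y', z'}" "x < y" "y < z" "x' < y'" "y' < z'"
  shows "x = x' \<and> y = y' \<and> z = z'"
proof -
  have "x \<in> {x', y', z'}" "y \<in> {x', y', z'}" "z \<in> {x', y', z'}" unfolding assms(1)[symmetric] by auto
  then show ?thesis using assms(2-5) by auto
qed

text \<open>Every lifted triangle has the form {x, y + n, z + 2 * n} with x < y < z, as
  \<open>form\<close> shows, and is recovered from its projection by sorting.\<close>

lemma triangles_lift:
  assumes n: "0 < n" and es: "\<And>u v. (u, v) \<in> set es \<Longrightarrow> u < n \<and> v < n \<and> u \<noteq> v" "distinct (map (\<lambda>(u, v). {u, v}) es)"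
  shows "(\<lambda>T. (\<lambda>x. x mod n) ` T) ` triangles (edge_set (lift_edges n es)) = triangles (edge_set es)"
    "inj_on (\<lambda>T. (\<lambda>x. x mod n) ` T) (triangles (edge_set (lift_edges n es)))"
proof -
  let ?l = "lift_edges n es"
  have tp: "tripartite n ?l" using lift_edges_props[OF n es] by blast
  have form: "\<exists>x y z. T = {x, y + n, z + 2 * n} \<and> x < y \<and> y < z \<and> z < n \<and> (\<lambda>x. x mod n) ` T = {x, y, z} \<and>
      {x, y} \<in> edge_set es \<and> {y, z} \<in> edge_set es \<and> {x, z} \<in> edge_set es"
    if T0: "T \<in> triangles (edge_set ?l)" for T
  proof -
    obtain a b c where T: "T = {a, b, c}" "a div n = 0" "b div n \<noteq> 0" "c div n \<noteq> 0" "b \<noteq> c"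
      "{a, b} \<in> edge_set ?l" "{b, c} \<in> edge_set ?l" "{a, c} \<in> edge_set ?l"
      by (rule triangle_vertex[OF tp T0, of 0]) auto
    have "\<exists>b c. T = {a, b, c} \<and> b div n = 1 \<and> c div n = 2 \<and> {a, b} \<in> edge_set ?l \<and> {b, c} \<in> edge_set ?l \<and> {a, c} \<in> edge_set ?l"
    proof (cases "b div n = 1")
      case True
      then have "c div n = 2" using edge_set_classes[OF tp T(7)] T(4) by linarith
      with True T show ?thesis by blast
    next
      case False
      then have "b div n = 2" "c div n = 1" using edge_set_classes[OF tp T(7)] T(3,4) by linarith+
      moreover have "T = {a, c, b}" "{c, b} \<in> edge_set ?l" using T(1,7) by (auto simp: insert_commute)
      ultimately show ?thesis using T(6,8) by blast
    qed
    then obtain b c where T': "T = {a, b, c}" "b div n = 1" "c div n = 2" "{a, b} \<in> edge_set ?l" "{b, c} \<in> edge_set ?l" "{a, c} \<in> edge_set ?l"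
      by blast
    define x y z where "x = a mod n" and "y = b mod n" and "z = c mod n"
    have "x < n" "y < n" "z < n" using n by (simp_all add: x_def y_def z_def)
    moreover have "a = x" "b = y + n" "c = z + 2 * n"
      using T(2) T'(2,3) div_mult_mod_eq[of a n] div_mult_mod_eq[of b n] div_mult_mod_eq[of c n]
      by (simp_all add: x_def y_def z_def)
    ultimately have xyz: "x < n" "y < n" "z < n" "a = x" "b = y + n" "c = z + 2 * n" by blast+
    note mem = lift_edges_mem[OF es(1)]
    have "x < y \<and> {x, y} \<in> edge_set es" using mem(1)[OF _ xyz(1,2)] T'(4) unfolding xyz(4,5) by blast
    moreover have "y < z \<and> {y, z} \<in> edge_set es" using mem(2)[OF _ xyz(2,3)] T'(5) unfolding xyz(5,6) by blast
    moreover have "x < z \<and> {x, z} \<in> edge_set es" using mem(3)[OF _ xyz(1,3)] T'(6) unfolding xyz(4,6) by blast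
    moreover have "(\<lambda>x. x mod n) ` T = {x, y, z}" unfolding T'(1) by (simp add: x_def y_def z_def)
    ultimately show ?thesis using T'(1) xyz by blast
  qed
  show "inj_on (\<lambda>T. (\<lambda>x. x mod n) ` T) (triangles (edge_set ?l))"
  proof (rule inj_onI)
    fix S T assume S: "S \<in> triangles (edge_set ?l)" and T: "T \<in> triangles (edge_set ?l)"
      and eq: "(\<lambda>x. x mod n) ` S = (\<lambda>x. x mod n) ` T"
    from form[OF S] obtain x y z where 1: "S = {x, y + n, z + 2 * n}" "x < y" "y < z" "(\<lambda>x. x mod n) ` S = {x, y, z}" by blast
    from form[OF T] obtain x' y' z' where 2: "T = {x', y' + n, z' + 2 * n}" "x' < y'" "y' < z'" "(\<lambda>x. x mod n) ` T = {x', y', z'}" by blast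
    have "x = x' \<and> y = y' \<and> z = z'" by (rule increasing_triple_eq) (use 1 2 eq in auto)
    then show "S = T" using 1 2 by simp
  qed
  show "(\<lambda>T. (\<lambda>x. x mod n) ` T) ` triangles (edge_set ?l) = triangles (edge_set es)"
  proof (intro equalityI subsetI)
    fix S assume "S \<in> (\<lambda>T. (\<lambda>x. x mod n) ` T) ` triangles (edge_set ?l)"
    then obtain T where "T \<in> triangles (edge_set ?l)" "S = (\<lambda>x. x mod n) ` T" by blast
    with form[OF this(1)] obtain x y z where "S = {x, y, z}" "x < y" "y < z" "{x, y} \<in> edge_set es" "{y, z} \<in> edge_set es" "{x, z} \<in> edge_set es"
      by blast
    then show "S \<in> triangles (edge_set es)" unfolding triangles_iff
      by (intro exI[of _ x] exI[of _ y] exI[of _ z]) auto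
  next
    fix S assume S: "S \<in> triangles (edge_set es)"
    then have S3: "finite S" "card S = 3" "\<And>u v. u \<in> S \<Longrightarrow> v \<in> S \<Longrightarrow> u \<noteq> v \<Longrightarrow> {u, v} \<in> edge_set es"
      by (auto simp: triangles_def card_eq_0_iff intro: card_ge_0_finite)
    have three: "\<exists>x y z. xs = [x, y, z]" if "length xs = 3" for xs :: "nat list"
      using that by (auto simp: numeral_3_eq_3 length_Suc_conv)
    have "length (sorted_list_of_set S) = 3" using S3 by simp
    from three[OF this] obtain x y z where xs: "sorted_list_of_set S = [x, y, z]" by blast
    have "sorted_wrt (<) [x, y, z]" using strict_sorted_list_of_set[of S] xs by simp
    then have lt: "x < y" "y < z" "x < z" by auto
    have Sx: "S = {x, y, z}" using set_sorted_list_of_set[OF S3(1)] xs by auto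
    have E: "{x, y} \<in> edge_set es" "{y, z} \<in> edge_set es" "{x, z} \<in> edge_set es" using S3(3) Sx lt by auto
    obtain e where "e \<in> set es" "{y, z} = {fst e, snd e}" using E(2) by (auto simp: edge_set_def)
    then have zn: "z < n" using es(1)[of "fst e" "snd e"] by (auto simp: doubleton_eq_iff)
    then have yn: "y < n" "x < n" using lt by auto
    let ?T = "{x, y + n, z + 2 * n}"
    have "{x, y + n} \<in> edge_set ?l" "{y + n, z + 2 * n} \<in> edge_set ?l" "{x, z + 2 * n} \<in> edge_set ?l"
      using lift_edges_mem[OF es(1) yn(2) yn(1)] lift_edges_mem[OF es(1) yn(1) zn] lift_edges_mem[OF es(1) yn(2) zn] lt E by blast+
    then have "?T \<in> triangles (edge_set ?l)" unfolding triangles_iff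
      using lt by (intro exI[of _ x] exI[of _ "y + n"] exI[of _ "z + 2 * n"]) auto
    moreover have "(\<lambda>x. x mod n) ` ?T = S" using class_simps[OF zn] class_simps[OF yn(1)] class_simps[OF yn(2)] Sx by simp
    ultimately show "S \<in> (\<lambda>T. (\<lambda>x. x mod n) ` T) ` triangles (edge_set ?l)" by blast
  qed
qed

section \<open>The exponent is at least one\<close>

definition changed :: "nat \<Rightarrow> state \<Rightarrow> state \<Rightarrow> nat set" where
  "changed a s s' = {i. arrs s' a i \<noteq> arrs s a i}"

lemma changed_trans:
  assumes "finite (changed a s s') \<and> card (changed a s s') \<le> T"
    "finite (changed a s' s'') \<and> card (changed a s' s'') \<le> T'" "T + T' \<le> U"
  shows "finite (changed a s s'') \<and> card (changed a s s'') \<le> U"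
proof -
  have sub: "changed a s s'' \<subseteq> changed a s s' \<union> changed a s' s''" by (auto simp: changed_def)
  have fin: "finite (changed a s s' \<union> changed a s' s'')" using assms by simp
  have "card (changed a s s'') \<le> card (changed a s s' \<union> changed a s' s'')" by (rule card_mono[OF fin sub])
  also have "\<dots> \<le> card (changed a s s') + card (changed a s' s'')" by (rule card_Un_le)
  finally show ?thesis using assms finite_subset[OF sub fin] by linarith
qed

text \<open>Only a store alters an array, one cell at a time, and it costs at least 1.\<close>

lemma exec_changed: "exec c s T s' \<Longrightarrow> finite (changed a s s') \<and> card (changed a s s') \<le> T"
proof (induction rule: exec.induct)
  case (Store b e1 e2 s)
  have sub: "changed a s (set_arr b (aval e1 s) (aval e2 s) s) \<subseteq> {aval e1 s}"
    by (auto simp: changed_def set_arr_def split: if_splits)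
  have "card (changed a s (set_arr b (aval e1 s) (aval e2 s) s)) \<le> card {aval e1 s}"
    by (rule card_mono[OF _ sub]) simp
  then show ?case using finite_subset[OF sub] by simp
next
  case (Seq p s T s' q T' s'')
  show ?case by (rule changed_trans[OF Seq.IH]) simp
next
  case (WhileTrue e s p T s' T' s'')
  show ?case by (rule changed_trans[OF WhileTrue.IH]) simp
qed (auto simp: changed_def set_reg_def)

text \<open>Output takes time: among the first two cells of each triple at least one has been
  changed, and the triples occupy disjoint cells.\<close>

lemma length_listed_le:
  assumes "exec c s T s'" "\<And>i. arrs s 1 i = 0" "\<And>S. S \<in> set (listed s') \<Longrightarrow> card S = 3"
  shows "length (listed s') \<le> T"
proof -
  have ch: "finite (changed 1 s s')" "card (changed 1 s s') \<le> T" using exec_changed[OF assms(1)] by auto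
  have "{..<regs s' 0} \<subseteq> (\<lambda>j. j div 3) ` changed 1 s s'"
  proof
    fix i assume i: "i \<in> {..<regs s' 0}"
    let ?S = "{arrs s' 1 (3 * i), arrs s' 1 (3 * i + 1), arrs s' 1 (3 * i + 2)}"
    have "?S \<in> set (listed s')" using i by (auto simp: listed_def)
    then have c: "card ?S = 3" by (rule assms(3))
    \<comment> \<open>Of three distinct numbers at most one is 0, the initial content.\<close>
    have "arrs s' 1 (3 * i) \<noteq> 0 \<or> arrs s' 1 (3 * i + 1) \<noteq> 0"
    proof (rule ccontr)
      assume "\<not> ?thesis"
      then have "?S = {0, arrs s' 1 (3 * i + 2)}" by simp
      with c have "card {0, arrs s' 1 (3 * i + 2)} = 3" by simp
      then show False by (simp add: card_insert_if split: if_splits)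
    qed
    then have "3 * i \<in> changed 1 s s' \<or> 3 * i + 1 \<in> changed 1 s s'" using assms(2) by (simp add: changed_def)
    moreover have "3 * i div 3 = i" "(3 * i + 1) div 3 = i" by simp_all
    ultimately show "i \<in> (\<lambda>j. j div 3) ` changed 1 s s'" by (elim disjE) (metis imageI)+
  qed
  then have "card {..<regs s' 0} \<le> card ((\<lambda>j. j div 3) ` changed 1 s s')" by (intro card_mono) (use ch in auto)
  also have "\<dots> \<le> card (changed 1 s s')" using ch(1) by (rule card_image_le)
  finally show ?thesis using ch(2) by (simp add: listed_def)
qed

text \<open>A complete graph has at least as many triangles as edges, so the algorithm has to write
  one triangle per edge.\<close>

lemma lists_m_triangles_lower:
  assumes p: "lists_m_triangles p B" and N: "6 \<le> N"
  shows "real (N choose 2) \<le> B (N choose 2)"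
proof -
  define E where "E = {e. e \<subseteq> {..<N} \<and> card e = 2}"
  have cE: "card E = N choose 2" unfolding E_def by (simp add: n_subsets)
  have finE: "finite E" unfolding E_def by (rule finite_subset[of _ "Pow {..<N}"]) auto
  have mem: "{x, y} \<in> E" if "x < N" "y < N" "x \<noteq> y" for x y using that by (simp add: E_def)
  have ne: "E \<noteq> {}" using mem[of 0 1] N by auto
  have g: "graph N E" unfolding graph_def
  proof (intro conjI ballI equalityI subsetI)
    fix e assume "e \<in> E"
    then show "card e = 2" by (simp add: E_def)
  next
    fix x assume "x \<in> \<Union>E"
    then show "x \<in> {..<N}" by (auto simp: E_def)
  next
    fix x assume x: "x \<in> {..<N}"
    define y where "y = (if x = 0 then 1 else 0 :: nat)"
    have "{x, y} \<in> E" by (rule mem) (use x N in \<open>auto simp: y_def\<close>)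
    then show "x \<in> \<Union>E" by blast
  qed
  obtain xs where xs: "set xs = E" "distinct xs" using finite_distinct_list[OF finE] by blast
  define es where "es = map (\<lambda>e. (Min e, Max e)) xs"
  have "map (\<lambda>(u, v). {u, v}) es = map (\<lambda>e. e) xs" unfolding es_def map_map
  proof (rule map_cong[OF refl])
    fix e assume "e \<in> set xs"
    then obtain x y where "e = {x, y}" using xs(1) by (auto simp: E_def card_2_iff)
    then show "((\<lambda>(u, v). {u, v}) \<circ> (\<lambda>e. (Min e, Max e))) e = e" using doubleton_min_max by simp
  qed
  then have el: "edge_list E es" using xs by (simp add: edge_list_def)
  have sub: "{T. T \<subseteq> {..<N} \<and> card T = 3} \<subseteq> triangles E" by (auto simp: triangles_def intro!: mem)
  have fin: "finite (triangles E)"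
  proof (rule finite_triangles[OF finE])
    fix e assume "e \<in> E"
    then have "e \<subseteq> {..<N}" by (simp add: E_def)
    then show "finite e" by (rule finite_subset) simp
  qed
  \<comment> \<open>Binomial coefficients increase up to half of N, and 3 is at most that half for N
    \<ge> 6.\<close>
  have "N choose 2 \<le> N choose 3" by (rule binomial_mono) (use N in auto)
  also have "\<dots> = card {T. T \<subseteq> {..<N} \<and> card T = 3}" by (simp add: n_subsets)
  also have "\<dots> \<le> card (triangles E)" by (rule card_mono[OF fin sub])
  finally have le: "card E \<le> card (triangles E)" by (simp add: cE)
  have p': "halts_within p [N, card E] es (B (card E))" "\<And>\<omega>. lists_correctly p [N, card E] es (card E) E \<omega>"
    using p[unfolded lists_m_triangles_def, rule_format, of N E es] g el ne by (auto simp: Let_def)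
  obtain T s where T: "exec p (init [N, card E] es undefined) T s" "real T \<le> B (card E)"
    using p'(1) unfolding halts_within_def by blast
  obtain T' s' where T': "exec p (init [N, card E] es undefined) T' s'" "lists_up_to (card E) E (listed s')"
    using p'(2)[of undefined] unfolding lists_correctly_def by blast
  have "s = s'" using exec_deterministic[OF T(1) T'(1)] by simp
  with T'(2) le have s: "length (listed s) = card E" "set (listed s) \<subseteq> triangles E" by (auto simp: lists_up_to_def)
  have "length (listed s) \<le> T"
    by (rule length_listed_le[OF T(1)]) (use s(2) in \<open>auto simp: init_def triangles_def\<close>)
  then show ?thesis using s(1) T(2) cE by simp
qed

text \<open>On complete graphs x edges need time x. If c were below 1, half of the gap would absorb
  the logarithms and the other half would give an unbounded quantity x powr \<delta> a constant
  bound.\<close>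

lemma exponent_ge_1:
  assumes "lists_m_triangles p (\<lambda>m. C * real m powr c * log 2 (real m + 1) ^ k)"
  shows "1 \<le> c"
proof (rule ccontr)
  assume c: "\<not> 1 \<le> c"
  define \<delta> where "\<delta> = (1 - c) / 2"
  have \<delta>: "0 < \<delta>" "\<delta> + (c + \<delta>) = 1" using c by (simp_all add: \<delta>_def field_simps)
  \<comment> \<open>Chosen such that the k-th power of the logarithm is bounded by a multiple of x
    powr \<delta>; the denominator k + 1 avoids division by zero.\<close>
  define e where "e = \<delta> / (real k + 1)"
  have e: "0 < e" "e * real k \<le> \<delta>" using \<delta> by (simp_all add: e_def field_simps)
  \<comment> \<open>From ln (x + 1) \<le> (x + 1) powr e / e together with x + 1 \<le> 2 *
    x.\<close>
  define D where "D = 2 powr e / (e * ln 2)"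
  have D: "0 \<le> D" using e by (simp add: D_def)
  have log_le: "log 2 (x + 1) \<le> D * x powr e" if "1 \<le> x" for x
  proof -
    have "ln (x + 1) \<le> (x + 1) powr e / e" using that e(1) by (intro ln_powr_bound) auto
    also have "\<dots> \<le> (2 * x) powr e / e" using that e(1) by (intro divide_right_mono powr_mono2) auto
    also have "\<dots> = 2 powr e * x powr e / e" using that by (simp add: powr_mult)
    finally have "ln (x + 1) / ln 2 \<le> 2 powr e * x powr e / e / ln 2" by (rule divide_right_mono) simp
    then show ?thesis by (simp add: log_def D_def)
  qed
  have bound: "real N powr \<delta> \<le> \<bar>C\<bar> * D ^ k" if N: "6 \<le> N" for N
  proof -
    define x where "x = real (N choose 2)"
    have "N choose 1 \<le> N choose 2" by (rule binomial_mono) (use N in auto)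
    then have xN: "real N \<le> x" by (simp add: x_def)
    have x1: "1 \<le> x" using xN N by linarith
    have log0: "0 \<le> log 2 (x + 1)" using x1 by simp
    have "x \<le> C * x powr c * log 2 (x + 1) ^ k" using lists_m_triangles_lower[OF assms N] by (simp add: x_def)
    also have "\<dots> \<le> \<bar>C\<bar> * x powr c * (D * x powr e) ^ k"
      using log_le[OF x1] log0 by (intro mult_mono power_mono mult_right_mono) auto
    also have "(D * x powr e) ^ k = D ^ k * x powr (e * real k)"
      using x1 by (simp add: power_mult_distrib powr_powr flip: powr_realpow)
    also have "\<bar>C\<bar> * x powr c * (D ^ k * x powr (e * real k)) \<le> \<bar>C\<bar> * x powr c * (D ^ k * x powr \<delta>)"
      using e(2) x1 D by (intro mult_left_mono powr_mono) auto
    also have "\<dots> = \<bar>C\<bar> * D ^ k * x powr (c + \<delta>)" by (simp add: powr_add)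
    finally have le: "x \<le> \<bar>C\<bar> * D ^ k * x powr (c + \<delta>)" .
    have "x powr \<delta> * x powr (c + \<delta>) = x" unfolding powr_add[symmetric] \<delta>(2) using x1 by simp
    with le have "x powr \<delta> * x powr (c + \<delta>) \<le> \<bar>C\<bar> * D ^ k * x powr (c + \<delta>)" by simp
    then have "x powr \<delta> \<le> \<bar>C\<bar> * D ^ k" by (rule mult_right_le_imp_le) (use x1 in simp)
    moreover have "real N powr \<delta> \<le> x powr \<delta>" using xN \<delta>(1) by (intro powr_mono2) auto
    ultimately show ?thesis by linarith
  qed
  define A where "A = \<bar>C\<bar> * D ^ k + 1"
  have A: "0 < A" using D by (simp add: A_def add_nonneg_pos)
  obtain N :: nat where N: "max 6 (A powr (1 / \<delta>)) < real N" using reals_Archimedean2 by blast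
  have "A = (A powr (1 / \<delta>)) powr \<delta>" using A \<delta>(1) by (simp add: powr_powr)
  also have "\<dots> < real N powr \<delta>" using N \<delta>(1) by (intro powr_less_mono2) auto
  also have "\<dots> \<le> \<bar>C\<bar> * D ^ k" by (rule bound) (use N in linarith)
  finally show False by (simp add: A_def)
qed

section \<open>The complete program\<close>

text \<open>The value of \<open>e\<close>, provided it is at most that of register 30; in contrast to \<open>e\<close> itself,
  the expression is always additive.\<close>

definition clip :: "aexp \<Rightarrow> aexp" where
  "clip e = Bin Sub (Reg 30) (Bin Sub (Reg 30) e)"

lemma clip_simps [simp]:
  "main_exp (clip e) \<longleftrightarrow> main_exp e" "additive (clip e)" "aval e s \<le> regs s 30 \<Longrightarrow> aval (clip e) s = aval e s"
  by (simp_all add: clip_def)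

definition put :: "aexp \<Rightarrow> aexp \<Rightarrow> com" where
  "put x y = Seq (Store 2 (Reg 5) x) (Seq (Store 3 (Reg 5) y) (Assign 5 (Bin Add (Reg 5) (Const 1))))"

text \<open>The endpoints are sorted before lifting. Sums of two registers are not additive
  expressions, so they are clipped by the maximum 3 * n in register 30, which they do not
  exceed.\<close>

definition add_edge :: com where
  "add_edge = Seq (Assign 13 (Arr 0 (Bin Mul (Const 2) (Reg 12))))
    (Seq (Assign 14 (Arr 0 (Bin Add (Bin Mul (Const 2) (Reg 12)) (Const 1))))
    (Seq (If (Bin Less (Reg 14) (Reg 13)) (Seq (Assign 24 (Reg 13)) (Seq (Assign 13 (Reg 14)) (Assign 14 (Reg 24)))) Skip)
    (Seq (put (Reg 13) (clip (Bin Add (Reg 14) (Reg 0))))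
    (Seq (put (clip (Bin Add (Reg 13) (Reg 0))) (clip (Bin Add (Bin Add (Reg 14) (Reg 0)) (Reg 0))))
         (put (Reg 13) (clip (Bin Add (Bin Add (Reg 14) (Reg 0)) (Reg 0))))))))"

lemma add_edge_simps [simp]:
  "straight add_edge" "wregs add_edge = {5, 13, 14, 24}" "warrs add_edge = {2, 3}" "csize add_edge = 16"
  by (auto simp: add_edge_def put_def)

lemma sval_add_edge:
  assumes "regs s 0 = n" "regs s 30 = 3 * n" "regs s 12 = j" "arrs s 0 (2 * j) = u" "arrs s 0 (2 * j + 1) = v"
    "u < n" "v < n" "regs s 5 = q"
  shows "regs (sval add_edge s) 5 = q + 3 \<and>
    arrs (sval add_edge s) 2 = (arrs s 2)(q := min u v, Suc q := min u v + n, Suc (Suc q) := min u v) \<and>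
    arrs (sval add_edge s) 3 = (arrs s 3)(q := max u v + n, Suc q := max u v + n + n, Suc (Suc q) := max u v + n + n)"
  using assms by (cases "v < u") (simp_all add: add_edge_def put_def min_def max_def)

text \<open>Each halving of m adds 3 to register 15, which started at 9; this computes L = 3 *
  \<open>floorlog 2 m\<close> + 9 additively.\<close>

definition count_bits :: com where
  "count_bits = While (Bin Less (Const 0) (Reg 24))
     (Seq (Assign 24 (Bin Div (Reg 24) (Const 2))) (Assign 15 (Bin Add (Reg 15) (Const 3))))"

lemma reach_count_bits:
  assumes "regs s 24 = m"
  shows "reach count_bits s (real (floorlog 2 m) * 3 + 1) 0 (\<lambda>s'. regs s' 15 = regs s 15 + 3 * floorlog 2 m)"
proof -
  let ?P = "\<lambda>i s'. regs s' 24 = m div 2 ^ i \<and> regs s' 15 = regs s 15 + 3 * i"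
  let ?b = "Seq (Assign 24 (Bin Div (Reg 24) (Const 2))) (Assign 15 (Bin Add (Reg 15) (Const 3)))"
  have "reach count_bits s (real (floorlog 2 m) * (1 + 2) + 1) (real (floorlog 2 m) * 0)
    (\<lambda>s'. regs s' 15 = regs s 15 + 3 * floorlog 2 m)"
    unfolding count_bits_def
  proof (rule reach_While[where P = ?P])
    show "?P 0 s" using assms by simp
  next
    fix i and s' :: state assume i: "i < floorlog 2 m" and P: "?P i s'"
    have "2 ^ (Suc i - 1) \<le> m" by (rule floorlog_geD) (use i in auto)
    then have "0 < m div 2 ^ i" by (simp add: div_greater_zero_iff)
    moreover have "reach ?b s' (csize ?b) 0 (?P (Suc i))"
    proof (rule reach_straight)
      have "m div 2 ^ i div 2 = m div 2 ^ Suc i" by (simp add: div_mult2_eq[symmetric] mult.commute)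
      then show "?P (Suc i) (sval ?b s')" using P by simp
    qed simp
    ultimately show "aval (Bin Less (Const 0) (Reg 24)) s' \<noteq> 0 \<and> reach ?b s' 2 0 (?P (Suc i))" using P by simp
  next
    fix s' :: state assume "?P (floorlog 2 m) s'"
    then show "aval (Bin Less (Const 0) (Reg 24)) s' = 0 \<and> regs s' 15 = regs s 15 + 3 * floorlog 2 m"
      using less_power_floorlog[of m] by simp
  qed simp_all
  then show ?thesis by simp
qed

text \<open>The number 3 * n is produced by adding the constant 3 in a loop, because a product is
  not additive. Of the root node only the end of its segment has to be stored; its start, class and
  flag are zero already.\<close>

definition prepare :: com where
  "prepare = Seq (Seq (Assign 15 (Const 9)) (Assign 24 (Reg 1))) (Seq count_bits (Seq (Assign 12 (Const 0))
     (Seq (for_loop 12 0 (Assign 30 (Bin Add (Reg 30) (Const 3)))) (Seq (Assign 12 (Const 0))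
     (Seq (for_loop 12 1 add_edge) (Seq (Store 5 (Const 0) (Reg 5)) (Assign 4 (Const 1))))))))"

lemma reach_add_edges:
  assumes s: "regs s 12 = 0" "regs s 1 = length es" "regs s 0 = n" "regs s 30 = 3 * n" "regs s 5 = 0"
    and arr: "\<And>i. i < length es \<Longrightarrow> arrs s 0 (2 * i) = fst (es ! i) \<and> arrs s 0 (2 * i + 1) = snd (es ! i)"
    and es: "\<And>u v. (u, v) \<in> set es \<Longrightarrow> u < n \<and> v < n"
  shows "reach (for_loop 12 1 add_edge) s (real (length es) * 18 + 1) 0 (\<lambda>s'.
    (regs s' 5 = 3 * length es \<and> pool s' 0 (3 * length es) = lift_edges n es) \<and> keeps {5, 12, 13, 14, 24} {2, 3} s s')"
proof -
  let ?P = "\<lambda>j s'. regs s' 5 = 3 * j \<and> pool s' 0 (3 * j) = lift_edges n (take j es)"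
  have "reach (for_loop 12 1 add_edge) s (real (length es - 0) * (real (csize add_edge) + 2) + 1) 0
    (\<lambda>s'. ?P (length es) s' \<and> regs s' 12 = length es \<and> keeps (insert 12 (wregs add_edge)) (warrs add_edge) s s')"
  proof (rule reach_for_straight[where P = ?P])
    show "?P 0 s" using s by (simp add: pool_def lift_edges_def)
  next
    fix j s' assume j: "j < length es" "regs s' 12 = j" and k: "keeps (insert 12 (wregs add_edge)) (warrs add_edge) s s'" and P: "?P j s'"
    obtain u v where e: "es ! j = (u, v)" by (cases "es ! j")
    have uv: "u < n" "v < n" using es[of u v] nth_mem[OF j(1)] e by auto
    have a: "arrs s' 0 = arrs s 0" "regs s' 0 = n" "regs s' 30 = 3 * n"
      using keeps_arrs[OF k, of 0] keeps_regs[OF k, of 0] keeps_regs[OF k, of 30] s by simp_all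
    have a0: "arrs s' 0 (2 * j) = u" "arrs s' 0 (2 * j + 1) = v" using arr[OF j(1)] e a(1) by simp_all
    note ae = sval_add_edge[OF a(2,3) j(2) a0 uv conjunct1[OF P]]
    let ?s = "set_reg 12 (Suc j) (sval add_edge s')"
    have three: "3 * Suc j = Suc (Suc (Suc (3 * j)))" by simp
    have "pool ?s 0 (3 * j) = pool s' 0 (3 * j)" by (rule pool_cong) (simp add: ae)
    also have "\<dots> = lift_edges n (take j es)" using P by simp
    finally have old: "pool ?s 0 (3 * j) = lift_edges n (take j es)" .
    have "pool ?s 0 (3 * Suc j) = pool ?s 0 (3 * j) @ [(arrs ?s 2 (3 * j), arrs ?s 3 (3 * j)),
        (arrs ?s 2 (Suc (3 * j)), arrs ?s 3 (Suc (3 * j))), (arrs ?s 2 (Suc (Suc (3 * j))), arrs ?s 3 (Suc (Suc (3 * j))))]"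
      unfolding pool_def three by (simp add: upt_Suc_append)
    also have "\<dots> = lift_edges n (take j es) @ lift_edge n (u, v)"
      unfolding old by (simp add: ae lift_edge_def mult_2)
    also have "\<dots> = lift_edges n (take (Suc j) es)"
      unfolding take_Suc_conv_app_nth[OF j(1)] lift_edges_snoc e ..
    finally show "?P (Suc j) ?s" by (simp add: ae)
  qed (use s in auto)
  then show ?thesis by (rule reach_mono) (auto simp: insert_commute)
qed

lemma reach_prepare:
  assumes es: "\<And>u v. (u, v) \<in> set es \<Longrightarrow> u < n \<and> v < n"
  shows "reach prepare (init [n, length es, t] es \<omega>)
    (real (floorlog 2 (length es)) * 3 + real n * 3 + real (length es) * 18 + 9) 0
    (search_state n (length es) t (3 * floorlog 2 (length es) + 9) K [(0, False, lift_edges n es)] [] [])"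
proof -
  define m s0 where "m = length es" and "s0 = init [n, m, t] es \<omega>"
  define s1 where "s1 = sval (Seq (Assign 15 (Const 9)) (Assign 24 (Reg 1))) s0"
  define L where "L = 3 * floorlog 2 m + 9"
  let ?for1 = "for_loop 12 0 (Assign 30 (Bin Add (Reg 30) (Const 3)))"
  let ?end = "Seq (Store 5 (Const 0) (Reg 5)) (Assign 4 (Const 1))"
  let ?Q = "search_state n m t L K [(0, False, lift_edges n es)] [] []"
  have r0: "regs s0 0 = n" "regs s0 1 = m" "regs s0 2 = t" "\<And>r. 3 \<le> r \<Longrightarrow> regs s0 r = 0"
    "\<And>a i. a \<noteq> 0 \<Longrightarrow> arrs s0 a i = 0"
    by (simp_all add: s0_def init_def)
  have k1: "keeps {15, 24} {} s0 s1" unfolding s1_def using sval_keeps[of "Seq (Assign 15 (Const 9)) (Assign 24 (Reg 1))" s0] by (simp add: insert_commute)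
  have s1: "regs s1 24 = m" "regs s1 15 = 9" using r0 by (simp_all add: s1_def)
  have fin: "?Q (sval ?end s)" if k: "keeps {5, 12, 13, 14, 15, 24, 30} {2, 3} s0 s" and L: "regs s 15 = L"
    and P: "regs s 5 = 3 * m" "pool s 0 (3 * m) = lift_edges n es" for s
  proof -
    have a: "\<And>b. b \<notin> {2, 3} \<Longrightarrow> arrs s b = arrs s0 b" "\<And>r. r \<notin> {5, 12, 13, 14, 15, 24, 30} \<Longrightarrow> regs s r = regs s0 r"
      using k by (simp_all add: keeps_def)
    have "pool (sval ?end s) 0 (3 * m) = pool s 0 (3 * m)" by (rule pool_cong) simp
    then show ?thesis unfolding search_state_def stack_ok_def olist_def fresh_from_def
      using L P r0 by (auto simp: a)
  qed
  have C: "reach (Seq (for_loop 12 1 add_edge) ?end) s (real m * 18 + 1 + 2) 0 ?Q"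
    if k: "keeps {12, 15, 24, 30} {} s0 s" and L: "regs s 15 = L" and c: "regs s 12 = 0" "regs s 30 = 3 * n" for s
  proof -
    have a: "arrs s = arrs s0" "\<And>r. r \<notin> {12, 15, 24, 30} \<Longrightarrow> regs s r = regs s0 r"
      using k by (simp_all add: keeps_def fun_eq_iff)
    have "reach (for_loop 12 1 add_edge) s (real m * 18 + 1) 0 (\<lambda>s'.
      (regs s' 5 = 3 * m \<and> pool s' 0 (3 * m) = lift_edges n es) \<and> keeps {5, 12, 13, 14, 24} {2, 3} s s')"
      unfolding m_def
    proof (rule reach_add_edges)
      fix i assume "i < length es"
      then show "arrs s 0 (2 * i) = fst (es ! i) \<and> arrs s 0 (2 * i + 1) = snd (es ! i)"
        by (simp add: a s0_def init_def)
    qed (use a r0 c es in \<open>auto simp: m_def\<close>)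
    then have "reach (for_loop 12 1 add_edge) s (real m * 18 + 1) 0 (\<lambda>s'. ?Q (sval ?end s'))"
    proof (rule reach_mono)
      fix s' assume s': "(regs s' 5 = 3 * m \<and> pool s' 0 (3 * m) = lift_edges n es) \<and> keeps {5, 12, 13, 14, 24} {2, 3} s s'"
      have "keeps {5, 12, 13, 14, 15, 24, 30} {2, 3} s0 s'"
        by (rule keeps_trans[OF keeps_mono[OF k] keeps_mono[OF conjunct2[OF s']]]) auto
      moreover have "regs s' 15 = L" using keeps_regs[OF conjunct2[OF s'], of 15] L by simp
      ultimately show "?Q (sval ?end s')" using s' by (intro fin) auto
    qed simp_all
    from reach_straight_Seq[where q = ?end and Q = ?Q, OF _ this] show ?thesis by simp
  qed
  have B: "reach (Seq ?for1 (Seq (Assign 12 (Const 0)) (Seq (for_loop 12 1 add_edge) ?end))) s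
      (real n * 3 + 1 + (1 + (real m * 18 + 1 + 2))) (0 + 0) ?Q"
    if k: "keeps {12, 15, 24} {} s0 s" and L: "regs s 15 = L" and c: "regs s 12 = 0" for s
  proof (rule reach_Seq)
    let ?body = "Assign 30 (Bin Add (Reg 30) (Const 3))"
    have a: "regs s 0 = n" "regs s 30 = 0" using keeps_regs[OF k, of 0] keeps_regs[OF k, of 30] r0 by simp_all
    have "reach ?for1 s (real (n - 0) * (real (csize ?body) + 2) + 1) 0
      (\<lambda>s'. regs s' 30 = 3 * n \<and> regs s' 12 = n \<and> keeps (insert 12 (wregs ?body)) (warrs ?body) s s')"
      by (rule reach_for_straight[where P = "\<lambda>j s'. regs s' 30 = 3 * j"]) (use a c in auto)
    then show "reach ?for1 s (real n * 3 + 1) 0 (\<lambda>s'. reach (Seq (Assign 12 (Const 0)) (Seq (for_loop 12 1 add_edge) ?end)) s'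
      (1 + (real m * 18 + 1 + 2)) 0 ?Q)"
    proof (rule reach_mono)
      fix s' assume s': "regs s' 30 = 3 * n \<and> regs s' 12 = n \<and> keeps (insert 12 (wregs ?body)) (warrs ?body) s s'"
      let ?s = "sval (Assign 12 (Const 0)) s'"
      have k': "keeps {12, 30} {} s s'" using s' by simp
      have "keeps {12, 15, 24, 30} {} s0 s'"
        by (rule keeps_trans[OF keeps_mono[OF k] keeps_mono[OF k']]) auto
      then have "keeps {12, 15, 24, 30} {} s0 ?s" by (simp add: keeps_def)
      moreover have "regs ?s 15 = L" using keeps_regs[OF k', of 15] L by simp
      ultimately have "reach (Seq (for_loop 12 1 add_edge) ?end) ?s (real m * 18 + 1 + 2) 0 ?Q"
        using s' by (intro C) auto
      then have "reach (Seq (Assign 12 (Const 0)) (Seq (for_loop 12 1 add_edge) ?end)) s'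
        (real (csize (Assign 12 (Const 0))) + (real m * 18 + 1 + 2)) 0 ?Q"
        by (rule reach_Seq_straight[rotated]) simp
      then show "reach (Seq (Assign 12 (Const 0)) (Seq (for_loop 12 1 add_edge) ?end)) s' (1 + (real m * 18 + 1 + 2)) 0 ?Q" by simp
    qed simp_all
  qed
  let ?rest = "Seq (Assign 12 (Const 0)) (Seq ?for1 (Seq (Assign 12 (Const 0)) (Seq (for_loop 12 1 add_edge) ?end)))"
  have "reach (Seq count_bits ?rest) s1 (real (floorlog 2 m) * 3 + 1 + (1 + (real n * 3 + 1 + (1 + (real m * 18 + 1 + 2))))) (0 + 0) ?Q"
  proof (rule reach_Seq)
    show "reach count_bits s1 (real (floorlog 2 m) * 3 + 1) 0
      (\<lambda>s'. reach ?rest s' (1 + (real n * 3 + 1 + (1 + (real m * 18 + 1 + 2)))) 0 ?Q)"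
      using reach_keeps[OF reach_count_bits[OF s1(1)]]
    proof (rule reach_mono)
      fix s' assume s': "regs s' 15 = regs s1 15 + 3 * floorlog 2 m \<and> keeps (wregs count_bits) (warrs count_bits) s1 s'"
      let ?s = "sval (Assign 12 (Const 0)) s'"
      have k': "keeps {24, 15} {} s1 s'" using s' by (simp add: count_bits_def insert_commute)
      have "keeps {12, 15, 24} {} s0 s'"
        by (rule keeps_trans[OF keeps_mono[OF k1] keeps_mono[OF k']]) auto
      then have "keeps {12, 15, 24} {} s0 ?s" by (simp add: keeps_def)
      moreover have "regs ?s 15 = L" using s' s1 by (simp add: L_def)
      ultimately have "reach (Seq ?for1 (Seq (Assign 12 (Const 0)) (Seq (for_loop 12 1 add_edge) ?end))) ?s
        (real n * 3 + 1 + (1 + (real m * 18 + 1 + 2))) (0 + 0) ?Q" by (intro B) auto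
      then have "reach ?rest s' (real (csize (Assign 12 (Const 0))) + (real n * 3 + 1 + (1 + (real m * 18 + 1 + 2)))) (0 + 0) ?Q"
        by (rule reach_Seq_straight[rotated]) simp
      then show "reach ?rest s' (1 + (real n * 3 + 1 + (1 + (real m * 18 + 1 + 2)))) 0 ?Q" by simp
    qed simp_all
  qed
  then have "reach prepare s0 (real (csize (Seq (Assign 15 (Const 9)) (Assign 24 (Reg 1)))) +
    (real (floorlog 2 m) * 3 + 1 + (1 + (real n * 3 + 1 + (1 + (real m * 18 + 1 + 2)))))) (0 + 0) ?Q"
    unfolding prepare_def s1_def by (rule reach_Seq_straight[rotated]) simp
  then show ?thesis unfolding s0_def m_def L_def by (rule reach_mono) simp_all
qed

text \<open>The last subproblem solved may raise the number of listed triangles above t. Reducing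
  the returned count cuts off the surplus.\<close>

definition trim_output :: com where
  "trim_output = If (Bin Less (Reg 2) (Reg 3)) (Assign 0 (Reg 2)) (Assign 0 (Reg 3))"

lemma listed_trim_output: "listed (sval trim_output s) = take (regs s 2) (olist s)"
  by (auto simp: trim_output_def listed_def olist_def take_map take_upt)

definition lister :: "com \<Rightarrow> com" where
  "lister S = Seq prepare (Seq (search S) trim_output)"

lemma lists_up_to_take:
  assumes "finite (triangles E)" "distinct Ts" "set Ts \<subseteq> triangles E" "t \<le> length Ts \<or> set Ts = triangles E"
  shows "lists_up_to t E (take t Ts)"
proof -
  have c: "length Ts = card (set Ts)" using assms(2) by (simp add: distinct_card)
  have "length Ts \<le> card (triangles E)" unfolding c by (rule card_mono[OF assms(1,3)])
  then have "length (take t Ts) = min t (card (triangles E))" using assms(4) c by (elim disjE) simp_all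
  then show ?thesis using assms(2,3) set_take_subset[of t Ts] by (auto simp: lists_up_to_def)
qed

lemma edge_list_mem:
  assumes "graph n E" "edge_list E es" "(u, v) \<in> set es"
  shows "u < n \<and> v < n \<and> u \<noteq> v"
proof -
  have "(\<lambda>(u, v). {u, v}) (u, v) \<in> (\<lambda>(u, v). {u, v}) ` set es" by (rule imageI[OF assms(3)])
  then have "{u, v} \<in> E" using assms(2) by (simp add: edge_list_def)
  then have "card {u, v} = 2" "{u, v} \<subseteq> {..<n}" using assms(1) unfolding graph_def by blast+
  then show ?thesis by (cases "u = v") auto
qed

lemma reach_lister:
  fixes t :: nat
  defines "L \<equiv> \<lambda>m. 3 * floorlog 2 m + 9"
  assumes G: "graph n E" "edge_list E es" "length es = m" "1 \<le> m"
    and S: "solver S n m (L m) K rich ks us"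
    and K: "1 + (36 * (real (L m))\<^sup>2 + 2) * 2 ^ L m + 1 < real K" and L: "3 * level_bound m (L m) (L m) < 1"
    and ks: "0 \<le> ks" and us: "\<And>k. 0 \<le> us k" "\<And>k. k \<le> 3 * m \<Longrightarrow> us k \<le> Ub * \<phi> k"
    and \<phi>: "\<And>k. real (max 1 k) \<le> \<phi> k" and Ub: "0 \<le> Ub"
    and W: "\<And>ns Ts act done. search_inv n m (L m) t rich (lift_edges n es) ns Ts act done \<Longrightarrow> (\<Sum>k\<leftarrow>done. \<phi> k) \<le> W"
  shows "reach (lister S) (init [n, m, t] es \<omega>)
    (real (floorlog 2 m) * 3 + real n * 3 + real m * 18 + 9 + ((36 * (real (L m))\<^sup>2 + 4) * (2 * ks + 42) * W + 1 + 3))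
    (0 + Ub * W) (\<lambda>s'. lists_up_to t E (listed s'))"
proof -
  let ?l = "lift_edges n es" and ?img = "\<lambda>T. (\<lambda>x. x mod n) ` T"
  have ok: "u < n \<and> v < n \<and> u \<noteq> v" if "(u, v) \<in> set es" for u v using edge_list_mem[OF G(1,2) that] .
  obtain e where "e \<in> set es" using G(3,4) by (cases es) auto
  then have n: "0 < n" using ok[of "fst e" "snd e"] by auto
  have d: "distinct (map (\<lambda>(u, v). {u, v}) es)" using G(2) by (simp add: edge_list_def)
  have E: "E = edge_set es" using G(2) by (simp add: edge_list_def edge_set_def)
  have props: "tripartite n ?l" "\<And>\<sigma>. \<sigma> < 3 \<Longrightarrow> avoiding n \<sigma> ?l = m"
    using lift_edges_props[OF n ok d] G(3) by auto
  have inv: "search_inv n m (L m) t rich ?l [(0, False, ?l)] [] [] []"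
    by (rule search_inv_init) (use props G(3) in \<open>auto simp: length_lift_edges\<close>)
  show ?thesis unfolding lister_def
  proof (rule reach_Seq)
    have "reach prepare (init [n, m, t] es \<omega>) (real (floorlog 2 m) * 3 + real n * 3 + real m * 18 + 9) 0
      (search_state n m t (L m) K [(0, False, ?l)] [] [])"
      using reach_prepare[of es n t \<omega> K] ok unfolding G(3) L_def by blast
    then show "reach prepare (init [n, m, t] es \<omega>) (real (floorlog 2 m) * 3 + real n * 3 + real m * 18 + 9) 0
      (\<lambda>s'. reach (Seq (search S) trim_output) s' ((36 * (real (L m))\<^sup>2 + 4) * (2 * ks + 42) * W + 1 + 3) (Ub * W)
         (\<lambda>s'. lists_up_to t E (listed s')))"
    proof (rule reach_mono)
      fix s assume st: "search_state n m t (L m) K [(0, False, ?l)] [] [] s"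
      have "reach (search S) s ((36 * (real (L m))\<^sup>2 + 4) * (2 * ks + 42) * W + 1) (Ub * W) (\<lambda>s'. \<exists>Ts.
        regs s' 2 = t \<and> olist s' = map ?img Ts \<and> distinct Ts \<and> set Ts \<subseteq> triangles (edge_set ?l) \<and>
        (t \<le> length Ts \<or> set Ts = triangles (edge_set ?l)))"
        by (rule reach_search[OF S st inv K _ L ks us \<phi> Ub W]) (simp_all add: L_def)
      then have "reach (search S) s ((36 * (real (L m))\<^sup>2 + 4) * (2 * ks + 42) * W + 1) (Ub * W)
        (\<lambda>s'. lists_up_to t E (listed (sval trim_output s')))"
      proof (rule reach_mono)
        fix s' assume "\<exists>Ts. regs s' 2 = t \<and> olist s' = map ?img Ts \<and> distinct Ts \<and> set Ts \<subseteq> triangles (edge_set ?l) \<and>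
          (t \<le> length Ts \<or> set Ts = triangles (edge_set ?l))"
        then obtain Ts where Ts: "regs s' 2 = t" "olist s' = map ?img Ts" "distinct Ts" "set Ts \<subseteq> triangles (edge_set ?l)"
          "t \<le> length Ts \<or> set Ts = triangles (edge_set ?l)" by blast
        note tl = triangles_lift[OF n ok d]
        show "lists_up_to t E (listed (sval trim_output s'))" unfolding listed_trim_output Ts(1,2) E
        proof (rule lists_up_to_take)
          show "distinct (map ?img Ts)" using Ts(3) inj_on_subset[OF tl(2) Ts(4)] by (simp add: distinct_map)
          show "set (map ?img Ts) \<subseteq> triangles (edge_set es)" unfolding set_map by (rule order_trans[OF image_mono[OF Ts(4)] equalityD1[OF tl(1)]])
          show "t \<le> length (map ?img Ts) \<or> set (map ?img Ts) = triangles (edge_set es)"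
            using Ts(5) tl(1) by (elim disjE) simp_all
        qed simp
      qed simp_all
      from reach_straight_Seq[where q = trim_output and Q = "\<lambda>s'. lists_up_to t E (listed s')", OF _ this]
      show "reach (Seq (search S) trim_output) s ((36 * (real (L m))\<^sup>2 + 4) * (2 * ks + 42) * W + 1 + 3) (Ub * W)
         (\<lambda>s'. lists_up_to t E (listed s'))" by (simp add: trim_output_def add.assoc)
    qed simp_all
  qed
qed

section \<open>Polylogarithmic factors\<close>

text \<open>The bound is in terms of t, uniformly in m \<le> t. Closure under sums and products
  spares explicit polylogarithmic constants.\<close>

definition plog :: "(nat \<Rightarrow> nat \<Rightarrow> real) \<Rightarrow> bool" where
  "plog f \<longleftrightarrow> (\<exists>C k. 0 \<le> C \<and> (\<forall>m t. 1 \<le> m \<longrightarrow> m \<le> t \<longrightarrow> 0 \<le> f m t \<and> f m t \<le> C * log 2 (real t + 1) ^ k))"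

lemma log_ge_1: "1 \<le> t \<Longrightarrow> 1 \<le> log 2 (real t + 1)"
  by simp

lemma plog_const: "0 \<le> a \<Longrightarrow> plog (\<lambda>m t. a)"
  unfolding plog_def by (intro exI[of _ a] exI[of _ 0]) simp

lemma plog_log: "plog (\<lambda>m t. log 2 (real t + 1))"
  unfolding plog_def by (intro exI[of _ 1] exI[of _ "1 :: nat"]) simp

lemma plog_le:
  "plog f \<Longrightarrow> (\<And>m t. 1 \<le> m \<Longrightarrow> m \<le> t \<Longrightarrow> 0 \<le> g m t) \<Longrightarrow> (\<And>m t. 1 \<le> m \<Longrightarrow> m \<le> t \<Longrightarrow> g m t \<le> f m t) \<Longrightarrow> plog g"
  unfolding plog_def by (meson order_trans)

lemma plog_add:
  assumes "plog f" "plog g"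
  shows "plog (\<lambda>m t. f m t + g m t)"
proof -
  obtain C k where f: "0 \<le> C" "\<And>m t. 1 \<le> m \<Longrightarrow> m \<le> t \<Longrightarrow> 0 \<le> f m t \<and> f m t \<le> C * log 2 (real t + 1) ^ k"
    using assms(1) unfolding plog_def by blast
  obtain D l where g: "0 \<le> D" "\<And>m t. 1 \<le> m \<Longrightarrow> m \<le> t \<Longrightarrow> 0 \<le> g m t \<and> g m t \<le> D * log 2 (real t + 1) ^ l"
    using assms(2) unfolding plog_def by blast
  show ?thesis unfolding plog_def
  proof (rule exI[of _ "C + D"], rule exI[of _ "k + l"], intro conjI allI impI)
    fix m t :: nat assume mt: "1 \<le> m" "m \<le> t"
    then have l: "1 \<le> log 2 (real t + 1)" by (intro log_ge_1) simp
    have "C * log 2 (real t + 1) ^ k \<le> C * log 2 (real t + 1) ^ (k + l)"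
      "D * log 2 (real t + 1) ^ l \<le> D * log 2 (real t + 1) ^ (k + l)"
      using l f(1) g(1) by (auto intro!: mult_left_mono power_increasing)
    then show "f m t + g m t \<le> (C + D) * log 2 (real t + 1) ^ (k + l)"
      using f(2)[OF mt] g(2)[OF mt] unfolding distrib_right by linarith
    show "0 \<le> f m t + g m t" using f(2)[OF mt] g(2)[OF mt] by simp
  qed (use f g in simp)
qed

lemma plog_mult:
  assumes "plog f" "plog g"
  shows "plog (\<lambda>m t. f m t * g m t)"
proof -
  obtain C k where f: "0 \<le> C" "\<And>m t. 1 \<le> m \<Longrightarrow> m \<le> t \<Longrightarrow> 0 \<le> f m t \<and> f m t \<le> C * log 2 (real t + 1) ^ k"
    using assms(1) unfolding plog_def by blast
  obtain D l where g: "0 \<le> D" "\<And>m t. 1 \<le> m \<Longrightarrow> m \<le> t \<Longrightarrow> 0 \<le> g m t \<and> g m t \<le> D * log 2 (real t + 1) ^ l"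
    using assms(2) unfolding plog_def by blast
  show ?thesis unfolding plog_def
  proof (rule exI[of _ "C * D"], rule exI[of _ "k + l"], intro conjI allI impI)
    fix m t :: nat assume mt: "1 \<le> m" "m \<le> t"
    then have l: "1 \<le> log 2 (real t + 1)" by (intro log_ge_1) simp
    have "f m t * g m t \<le> (C * log 2 (real t + 1) ^ k) * (D * log 2 (real t + 1) ^ l)"
      using f(2)[OF mt] g(2)[OF mt] l f(1) by (intro mult_mono) auto
    then show "f m t * g m t \<le> C * D * log 2 (real t + 1) ^ (k + l)" by (simp add: power_add mult_ac)
    show "0 \<le> f m t * g m t" using f(2)[OF mt] g(2)[OF mt] by simp
  qed (use f g in simp)
qed

lemma plog_power: "plog f \<Longrightarrow> plog (\<lambda>m t. f m t ^ k)"
  by (induction k) (auto intro: plog_const plog_mult)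

lemma floorlog_le_log:
  assumes "1 \<le> a" "a \<le> t"
  shows "real (floorlog 2 a) \<le> log 2 (real t + 1) + 1"
proof -
  have "2 ^ (floorlog 2 a - 1) \<le> a" using floorlog_bounds[of a 2] assms by simp
  then have "real (2 ^ (floorlog 2 a - 1)) \<le> real a" by (rule of_nat_mono)
  then have "real (floorlog 2 a - 1) \<le> log 2 (real a)" by (intro le_log_of_power) simp_all
  also have "\<dots> \<le> log 2 (real t + 1)" using assms by simp
  finally show ?thesis by linarith
qed

lemma plog_floorlog: "plog (\<lambda>m t. real (floorlog 2 m))"
  by (rule plog_le[OF plog_add[OF plog_log plog_const[of 1]]]) (auto intro: floorlog_le_log)

lemma plog_val_cost: "plog (\<lambda>m t. real (val_cost m))" "plog (\<lambda>m t. real (val_cost t))"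
proof -
  have p: "plog (\<lambda>m t. log 2 (real t + 1) + 2)" by (intro plog_add plog_log plog_const) simp
  have "real (val_cost m) \<le> log 2 (real t + 1) + 2" "real (val_cost t) \<le> log 2 (real t + 1) + 2" if "1 \<le> m" "m \<le> t" for m t
    using floorlog_le_log[OF that] floorlog_le_log[of t t] that by (simp_all add: val_cost_def)
  then show "plog (\<lambda>m t. real (val_cost m))" "plog (\<lambda>m t. real (val_cost t))" by (auto intro: plog_le[OF p])
qed

lemmas plog_intros = plog_add plog_mult plog_power plog_log plog_floorlog plog_val_cost

lemma val_cost_power: "val_cost (a ^ e) \<le> 2 + e * val_cost a"
proof (induction e)
  case 0
  then show ?case by (simp add: val_cost_def floorlog_le_iff)
next
  case (Suc e)
  then show ?case using val_cost_mult[of a "a ^ e"] by simp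
qed

section \<open>The running time\<close>

text \<open>The lower bound absorbs the linear time for preparation, and the upper bound makes the
  whole run polynomial in t, so that all numbers have logarithmic length.\<close>

lemma target_bounds:
  fixes m t :: nat and c :: real
  assumes c: "1 \<le> c" and m: "1 \<le> m" "m \<le> t" and dom: "c \<le> 3 / 2 \<or> real t \<le> real m powr (3 / 2)"
  shows "real m \<le> real m powr (3 * c - 3) * real t powr (3 - 2 * c)"
    "real m powr (3 * c - 3) * real t powr (3 - 2 * c) \<le> real t powr c"
proof -
  have m': "1 \<le> real m" "real m \<le> real t" "0 < real t" using m by auto
  have sum: "real m powr (3 * c - 3) * real m powr (3 - 2 * c) = real m powr c"
    "real t powr (3 * c - 3) * real t powr (3 - 2 * c) = real t powr c" by (simp_all flip: powr_add)
  show "real m \<le> real m powr (3 * c - 3) * real t powr (3 - 2 * c)"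
  proof (cases "c \<le> 3 / 2")
    case True
    have "real m powr 1 \<le> real m powr c" using c m' by (intro powr_mono) auto
    also have "\<dots> \<le> real m powr (3 * c - 3) * real t powr (3 - 2 * c)"
      unfolding sum(1)[symmetric] using True m' by (intro mult_left_mono powr_mono2) auto
    finally show ?thesis using m' by simp
  next
    case False
    have "real m powr 1 \<le> real m powr (3 / 2)" using m' by (intro powr_mono) auto
    also have "\<dots> = real m powr (3 * c - 3) * (real m powr (3 / 2)) powr (3 - 2 * c)"
      unfolding powr_powr powr_add[symmetric] by (simp add: field_simps)
    also have "\<dots> \<le> real m powr (3 * c - 3) * real t powr (3 - 2 * c)"
      using False dom m' by (intro mult_left_mono powr_mono2') auto
    finally show ?thesis using m' by simp
  qed
  show "real m powr (3 * c - 3) * real t powr (3 - 2 * c) \<le> real t powr c"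
  proof (cases "c \<le> 3 / 2")
    case True
    show ?thesis unfolding sum(2)[symmetric] using c m' by (intro mult_right_mono powr_mono2) auto
  next
    case False
    have "real m powr (3 * c - 3) * real t powr (3 - 2 * c) \<le> real m powr (3 * c - 3) * real m powr (3 - 2 * c)"
      using False m' by (intro mult_left_mono powr_mono2') auto
    also have "\<dots> \<le> real t powr c" unfolding sum(1) using c m' by (intro powr_mono2) auto
    finally show ?thesis .
  qed
qed

lemma floorlog_le_self: "floorlog 2 m \<le> m"
  by (rule floorlog_leI) simp_all

text \<open>Up to small terms the number of visits is at most (36 * L^2 + 2) * 2^L. As L \<le> 12 *
  m and 2^L \<le> 4096 * m^3, this is at most 21241856 * m^5, for which 2^26 * m^5 slices leave
  enough room.\<close>

lemma capacity:
  fixes m :: nat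
  defines "L \<equiv> 3 * floorlog 2 m + 9"
  assumes m: "1 \<le> m"
  shows "1 + (36 * (real L)\<^sup>2 + 2) * 2 ^ L + 1 < real (67108864 * m ^ 5)"
proof -
  let ?f = "floorlog 2 m"
  have "0 < ?f" using m by (simp add: floorlog_eq_zero_iff[THEN iffD1] neq0_conv[symmetric] floorlog_eq_zero_iff)
  then have "(2::nat) ^ ?f = 2 * 2 ^ (?f - 1)" by (cases ?f) simp_all
  moreover have "2 ^ (?f - 1) \<le> m" using floorlog_bounds[of m 2] m by simp
  ultimately have "(2::nat) ^ ?f \<le> 2 * m" by simp
  then have "real (2 ^ ?f) \<le> real (2 * m)" by (rule of_nat_mono)
  then have f: "(2::real) ^ ?f \<le> 2 * real m" by simp
  have m1: "1 \<le> real m" using m by simp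
  have "(2::real) ^ L = 512 * (2 ^ ?f) ^ 3" by (simp add: L_def power_add flip: power_mult)
  also have "\<dots> \<le> 512 * (2 * real m) ^ 3" using f by (intro mult_left_mono power_mono) auto
  finally have L1: "2 ^ L \<le> 4096 * real m ^ 3" by (simp add: power_mult_distrib)
  have "real L \<le> 12 * real m" using floorlog_le_self[of m] m unfolding L_def by simp
  then have "(real L)\<^sup>2 \<le> (12 * real m)\<^sup>2" by (rule power_mono) simp
  then have "36 * (real L)\<^sup>2 + 2 \<le> 5184 * (real m)\<^sup>2 + 2 * (real m)\<^sup>2"
    using one_le_power[OF m1, of 2] unfolding power_mult_distrib by simp
  then have "(36 * (real L)\<^sup>2 + 2) * 2 ^ L \<le> (5186 * (real m)\<^sup>2) * (4096 * real m ^ 3)"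
    using L1 by (intro mult_mono) auto
  also have "\<dots> = 21241856 * real m ^ 5" by (simp flip: power_add)
  finally have "(36 * (real L)\<^sup>2 + 2) * 2 ^ L \<le> 21241856 * real m ^ 5" .
  moreover have "1 \<le> real m ^ 5" by (rule one_le_power[OF m1])
  ultimately show ?thesis unfolding of_nat_mult of_nat_power of_nat_numeral by linarith
qed

text \<open>The origin of the number of levels: three levels per bit of m divide 18 * m by at least
  m, and nine more divide it by 64 > 18. So nodes of the last level have less than one edge.\<close>

lemma level_bound_last:
  fixes m :: nat
  defines "L \<equiv> 3 * floorlog 2 m + 9"
  shows "3 * level_bound m L L < 1"
proof -
  let ?f = "floorlog 2 m"
  have "3 * level_bound m L L \<le> level_size m L" by (rule level_bound_le) (simp_all add: L_def)
  also have "\<dots> = 18 * real m * ((mu ^ 3) ^ ?f * (mu ^ 3) ^ 3)"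
    by (simp add: level_size_def L_def power_add flip: power_mult)
  also have "\<dots> = 18 / 64 * (real m / 4 ^ ?f)" unfolding mu_cube by (simp add: power_divide)
  also have "\<dots> \<le> 18 / 64 * 1"
  proof -
    have "real m < real (2 ^ ?f)" unfolding of_nat_less_iff by (rule less_power_floorlog)
    then have "real m < 2 ^ ?f" by simp
    also have "\<dots> \<le> 4 ^ ?f" by (rule power_mono) simp_all
    finally show ?thesis by (intro mult_left_mono) simp_all
  qed
  finally show ?thesis by simp
qed

text \<open>Without isolated vertices the edges, having two endpoints each, cover everything. This
  lets all bounds in n be replaced by bounds in m.\<close>

lemma graph_vertices_le:
  assumes "graph n E"
  shows "n \<le> 2 * card E"
proof -
  have "card (\<Union>E) \<le> sum card E" by (rule card_Union_le_sum_card)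
  then show ?thesis using assms by (simp add: graph_def)
qed

lemma log_le_self: "log 2 (real t + 1) \<le> real t"
proof -
  have "t + 1 \<le> 2 ^ t" by (simp add: Suc_le_eq)
  then have "real (t + 1) \<le> real (2 ^ t)" by (rule of_nat_mono)
  then have "real t + 1 \<le> 2 powr real t" by (simp add: powr_realpow)
  then show ?thesis by (simp add: log_le_iff)
qed

text \<open>A run makes at most A m times the target many steps, which is polynomial in t, so memory
  stays below Cn * t ^ e and each step costs a polylogarithmic number of bits. External time is
  polylogarithmic times the target as well.\<close>

lemma monte_carlo_lister:
  fixes c d ks :: real
  assumes c: "1 \<le> c" "rich \<and> d = c \<and> c \<le> 3 / 2 \<or> d = 1 \<and> 3 / 2 < c"
    and S: "\<And>n m. 1 \<le> m \<Longrightarrow> n \<le> 2 * m \<Longrightarrow> solver S n m (3 * floorlog 2 m + 9) (67108864 * m ^ 5) rich ks (us m)"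
    and ks: "0 \<le> ks" and us: "\<And>m k. 0 \<le> us m k" "\<And>m k. 1 \<le> m \<Longrightarrow> k \<le> 3 * m \<Longrightarrow> us m k \<le> Ub m * real (max 1 k) powr d"
    and Ub: "\<And>m. 0 \<le> Ub m" "plog (\<lambda>m t. Ub m)"
  shows "\<exists>C k. monte_carlo_lists_triangles (lister S)
    {(m, t). m \<le> t \<and> (c \<le> 3 / 2 \<or> real t \<le> real m powr (3 / 2))}
    (\<lambda>m t. C * real m powr (3 * c - 3) * real t powr (3 - 2 * c) * log 2 (real t + 1) ^ k)"
proof -
  define X where "X m t = real m powr (3 * c - 3) * real t powr (3 - 2 * c)" for m t
  define L where "L m = 3 * floorlog 2 m + 9" for m
  define g w where "g = cincr (lister S)" and "w = cweight (lister S)"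
  define Wf where "Wf m = 100 * (36 * (real (L m))\<^sup>2 + 2) * (real (L m) + 1)" for m
  define A where "A m = 40 + (36 * (real (L m))\<^sup>2 + 4) * (2 * ks + 42) * Wf m" for m
  have d: "1 \<le> d" using c by auto
  have pL: "plog (\<lambda>m t. real (L m))" unfolding L_def of_nat_add of_nat_mult by (intro plog_intros plog_const) simp_all
  have pW: "plog (\<lambda>m t. Wf m)" unfolding Wf_def by (intro plog_intros plog_const pL) simp_all
  have pA: "plog (\<lambda>m t. A m)" unfolding A_def using ks by (intro plog_intros plog_const pL pW) simp_all
  obtain CA kA where CA: "0 \<le> CA" "\<And>m t. 1 \<le> m \<Longrightarrow> m \<le> t \<Longrightarrow> 0 \<le> A m \<and> A m \<le> CA * log 2 (real t + 1) ^ kA"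
    using pA unfolding plog_def by blast
  define e where "e = kA + nat \<lceil>c\<rceil>"
  define Cn where "Cn = nat \<lceil>2 + real g * CA\<rceil>"
  define V where "V t = val_cost Cn + (2 + e * val_cost t)" for t
  define F where "F m t = A m * (real w * real (V t)) + Ub m * Wf m" for m t
  have pF: "plog F" unfolding F_def V_def of_nat_add of_nat_mult
    by (intro plog_intros plog_const pA pW Ub(2)) simp_all
  then obtain C k where CF: "\<And>m t. 1 \<le> m \<Longrightarrow> m \<le> t \<Longrightarrow> F m t \<le> C * log 2 (real t + 1) ^ k"
    unfolding plog_def by blast
  have key: "\<exists>T s. exec (lister S) (init [n, m, t] es \<omega>) T s \<and>
      real T \<le> C * real m powr (3 * c - 3) * real t powr (3 - 2 * c) * log 2 (real t + 1) ^ k \<and> lists_up_to t E (listed s)"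
    if G: "graph n E" "E \<noteq> {}" "edge_list E es" "card E = m" "m \<le> t" "c \<le> 3 / 2 \<or> real t \<le> real m powr (3 / 2)" for n E es m t \<omega>
  proof -
    have "finite E" using G(3) by (auto simp: edge_list_def)
    then have m: "1 \<le> m" using G(2,4) by (auto simp: Suc_le_eq card_gt_0_iff)
    have len: "length es = m"
      using G(3,4) distinct_card[of "map (\<lambda>(u, v). {u, v}) es"] by (simp add: edge_list_def)
    have n: "n \<le> 2 * m" using graph_vertices_le[OF G(1)] G(4) by simp
    have X: "real m \<le> X m t" "X m t \<le> real t powr c"
      using target_bounds[OF c(1) m G(5,6)] by (simp_all add: X_def)
    have W: "(\<Sum>k\<leftarrow>done. real (max 1 k) powr d) \<le> Wf m * X m t"
      if "search_inv n m (L m) t rich (lift_edges n es) ns Ts act done" for ns Ts act "done"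
      unfolding Wf_def X_def
      by (rule done_cost[OF that m G(5)]) (use c G(6) len in \<open>auto simp: L_def length_lift_edges\<close>)
    define k0 where "k0 = real (floorlog 2 m) * 3 + real n * 3 + real m * 18 + 9 +
      ((36 * (real (L m))\<^sup>2 + 4) * (2 * ks + 42) * (Wf m * X m t) + 1 + 3)"
    have "reach (lister S) (init [n, m, t] es \<omega>) k0 (0 + Ub m * (Wf m * X m t)) (\<lambda>s'. lists_up_to t E (listed s'))"
      unfolding k0_def L_def
    proof (rule reach_lister[OF G(1,3) len m S[OF m n] capacity[OF m] level_bound_last ks us(1) us(2)[OF m] _ Ub(1)])
      show "real (max 1 k) \<le> real (max 1 k) powr d" for k :: nat
        using powr_mono[OF d, of "real (max 1 k)"] by simp
      show "(\<Sum>k\<leftarrow>done. real (max 1 k) powr d) \<le> Wf m * X m t"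
        if "search_inv n m (3 * floorlog 2 m + 9) t rich (lift_edges n es) ns Ts act done" for ns Ts act "done"
        using W[of ns Ts act "done"] that by (simp add: L_def)
    qed
    then obtain k' u' s' where st: "steps (lister S) (init [n, m, t] es \<omega>) k' u' s'" and k': "real k' \<le> k0"
      and u': "real u' \<le> Ub m * (Wf m * X m t)" and res: "lists_up_to t E (listed s')"
      unfolding reach_def by auto
    have "real (floorlog 2 m) * 3 + real n * 3 + real m * 18 + 9 + 4 \<le> 40 * X m t"
      using floorlog_le_self[of m] n m X(1) by linarith
    then have "k0 \<le> A m * X m t" unfolding k0_def A_def by (simp add: algebra_simps)
    with k' have kA: "real k' \<le> A m * X m t" by linarith
    \<comment> \<open>Initially memory contains n, m, t and vertices below n, and n \<le> 2 * m
      \<le> 2 * t.\<close>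
    have bm: "bounded_mem (2 * t) (init [n, m, t] es \<omega>)"
      unfolding bounded_mem_def
    proof (intro conjI allI impI)
      fix r :: nat assume "r < 40"
      have "r = 0 \<or> r = 1 \<or> r = 2 \<or> 3 \<le> r" by linarith
      then show "regs (init [n, m, t] es \<omega>) r \<le> 2 * t" using n G(5) by (elim disjE) (simp_all add: init_def)
    next
      fix a i :: nat assume "a < 20"
      have "fst (es ! j) < n \<and> snd (es ! j) < n" if "j < length es" for j
        using edge_list_mem[OF G(1,3), of "fst (es ! j)" "snd (es ! j)"] nth_mem[OF that] by simp
      from this[of "i div 2"] show "arrs (init [n, m, t] es \<omega>) a i \<le> 2 * t"
        using n G(5) by (auto simp: init_def less_mult_imp_div_less mult.commute)
    qed
    obtain T where T: "exec (lister S) (init [n, m, t] es \<omega>) T s'" "T \<le> k' * (w * val_cost (2 * t + g * k')) + u'"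
      using steps_exec[OF st bm order_refl, of g w] by (auto simp: g_def w_def)
    have t1: "1 \<le> real t" using m G(5) by linarith
    have "real k' \<le> (CA * log 2 (real t + 1) ^ kA) * real t powr c"
      by (rule order_trans[OF kA mult_mono]) (use CA(2)[OF m G(5)] X m in auto)
    also have "\<dots> \<le> (CA * real t ^ kA) * real t ^ nat \<lceil>c\<rceil>"
    proof (rule mult_mono)
      show "CA * log 2 (real t + 1) ^ kA \<le> CA * real t ^ kA"
        using CA(1) log_le_self[of t] t1 by (intro mult_left_mono power_mono) auto
      have "real t powr c \<le> real t powr real (nat \<lceil>c\<rceil>)" using t1 c(1) by (intro powr_mono) linarith+
      then show "real t powr c \<le> real t ^ nat \<lceil>c\<rceil>" using t1 by (simp add: powr_realpow)
    qed (use CA(1) in auto)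
    finally have k2: "real k' \<le> CA * real t ^ e" by (simp add: e_def power_add mult.assoc)
    have "real t ^ 1 \<le> real t ^ e" using t1 c(1) by (intro power_increasing) (simp_all add: e_def, linarith)
    then have "real t \<le> real t ^ e" by (simp only: power_one_right)
    moreover have "real g * real k' \<le> real g * (CA * real t ^ e)" by (rule mult_left_mono[OF k2]) simp
    ultimately have "real (2 * t + g * k') \<le> 2 * real t ^ e + real g * (CA * real t ^ e)"
      unfolding of_nat_add of_nat_mult of_nat_numeral by linarith
    also have "\<dots> = (2 + real g * CA) * real t ^ e" by (simp add: algebra_simps)
    also have "\<dots> \<le> real Cn * real t ^ e" by (rule mult_right_mono) (simp_all add: Cn_def real_nat_ceiling_ge)
    finally have "real (2 * t + g * k') \<le> real (Cn * t ^ e)" by simp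
    then have "2 * t + g * k' \<le> Cn * t ^ e" by (simp only: of_nat_le_iff)
    \<comment> \<open>Powers of t become multiples of its bit length, so the cost per step is
      polylogarithmic.\<close>
    from val_cost_mono[OF this] have V: "val_cost (2 * t + g * k') \<le> V t"
      using val_cost_mult[of Cn "t ^ e"] val_cost_power[of t e] unfolding V_def by linarith
    have "real T \<le> real k' * (real w * real (val_cost (2 * t + g * k'))) + real u'"
      using of_nat_mono[OF T(2), where 'a = real] by (simp only: of_nat_mult of_nat_add)
    also have "\<dots> \<le> (A m * X m t) * (real w * real (V t)) + Ub m * (Wf m * X m t)"
      using kA V u' by (intro add_mono mult_mono) auto
    also have "\<dots> = F m t * X m t" by (simp add: F_def algebra_simps)
    also have "\<dots> \<le> (C * log 2 (real t + 1) ^ k) * X m t"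
      by (rule mult_right_mono[OF CF[OF m G(5)]]) (simp add: X_def)
    finally show ?thesis using T(1) res by (intro exI[of _ T] exI[of _ s']) (simp add: X_def mult_ac)
  qed
  \<comment> \<open>The program is correct for every coin sequence, so the event is the whole space
    and has probability 1.\<close>
  have "prob_space coin_space" unfolding coin_space_def
    by (intro prob_space.prob_space_stream_space measure_pmf.prob_space_axioms)
  then have prob: "measure coin_space (space coin_space) = 1" by (rule prob_space.prob_space)
  have "monte_carlo_lists_triangles (lister S)
    {(m, t). m \<le> t \<and> (c \<le> 3 / 2 \<or> real t \<le> real m powr (3 / 2))}
    (\<lambda>m t. C * real m powr (3 * c - 3) * real t powr (3 - 2 * c) * log 2 (real t + 1) ^ k)"
    unfolding monte_carlo_lists_triangles_def Let_def
  proof (intro allI impI conjI; elim conjE)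
    fix n E es t assume G: "graph n E" "E \<noteq> {}" "edge_list E es"
      and "(card E, t) \<in> {(m, t). m \<le> t \<and> (c \<le> 3 / 2 \<or> real t \<le> real m powr (3 / 2))}"
    then have D: "card E \<le> t" "c \<le> 3 / 2 \<or> real t \<le> real (card E) powr (3 / 2)" by auto
    note key' = key[OF G refl D]
    show "halts_within (lister S) [n, card E, t] es
      (C * real (card E) powr (3 * c - 3) * real t powr (3 - 2 * c) * log 2 (real t + 1) ^ k)"
      unfolding halts_within_def
    proof
      fix \<omega>
      from key'[of \<omega>] show "\<exists>T s. exec (lister S) (init [n, card E, t] es \<omega>) T s \<and>
        real T \<le> C * real (card E) powr (3 * c - 3) * real t powr (3 - 2 * c) * log 2 (real t + 1) ^ k" by blast
    qed
    have "lists_correctly (lister S) [n, card E, t] es t E \<omega>" for \<omega>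
      using key'[of \<omega>] unfolding lists_correctly_def by blast
    then have "{\<omega> \<in> space coin_space. lists_correctly (lister S) [n, card E, t] es t E \<omega>} = space coin_space" by simp
    then show "2 / 3 \<le> measure coin_space {\<omega> \<in> space coin_space. lists_correctly (lister S) [n, card E, t] es t E \<omega>}"
      using prob by simp
  qed
  then show ?thesis by blast
qed

lemma lists_m_triangles_mono:
  assumes "lists_m_triangles p B" "\<And>m. B m \<le> B' m"
  shows "lists_m_triangles p B'"
proof -
  have "halts_within p xs es (B m) \<Longrightarrow> halts_within p xs es (B' m)" for xs es m
    unfolding halts_within_def using assms(2)[of m] by (meson order_trans)
  then show ?thesis using assms(1) unfolding lists_m_triangles_def Let_def by blast
qed

text \<open>A product is not additive and cannot be assigned to a register. The capacity is
  therefore an expression in register 1 that is inserted wherever a slice is accessed.\<close>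

definition capacity_exp :: aexp where
  "capacity_exp = Bin Mul (Const 67108864) (Bin Mul (Reg 1) (Bin Mul (Reg 1) (Bin Mul (Reg 1) (Bin Mul (Reg 1) (Reg 1)))))"

lemma capacity_exp_simps:
  "main_exp capacity_exp" "reads_only capacity_exp 1" "aval capacity_exp s = 67108864 * regs s 1 ^ 5"
proof -
  have "x ^ 5 = x * (x * (x * (x * x)))" for x :: nat by (simp add: eval_nat_numeral)
  then show "aval capacity_exp s = 67108864 * regs s 1 ^ 5" by (simp add: capacity_exp_def)
qed (simp_all add: capacity_exp_def reads_only_def)

theorem theorem6:
  fixes c :: real
  assumes "\<exists>p C k. deterministic p \<and>
    lists_m_triangles p (\<lambda>m. C * real m powr c * log 2 (real m + 1) ^ k)"
  shows "\<exists>q C k. monte_carlo_lists_triangles q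
    {(m, t). m \<le> t \<and> (c \<le> 3 / 2 \<or> real t \<le> real m powr (3 / 2))}
    (\<lambda>m t. C * real m powr (3 * c - 3) * real t powr (3 - 2 * c) * log 2 (real t + 1) ^ k)"
proof -
  obtain p C k where p: "deterministic p" "lists_m_triangles p (\<lambda>m. C * real m powr c * log 2 (real m + 1) ^ k)"
    using assms by blast
  have c: "1 \<le> c" by (rule exponent_ge_1[OF p(2)])
  show ?thesis
  proof (cases "c \<le> 3 / 2")
    case True
    let ?K = "\<lambda>m :: nat. 67108864 * m ^ 5"
    \<comment> \<open>The absolute value of C makes the time bound nonnegative, as required of a
      solver.\<close>
    define Bp where "Bp m = \<bar>C\<bar> * real m powr c * log 2 (real m + 1) ^ k" for m
    have Bp0: "0 \<le> Bp m" for m by (simp add: Bp_def)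
    have pB: "lists_m_triangles p Bp"
      by (rule lists_m_triangles_mono[OF p(2)]) (auto simp: Bp_def intro!: mult_right_mono)
    \<comment> \<open>A reference state containing only m, in which the cost of the capacity
      expression is measured; any state with m in register 1 gives the same cost.\<close>
    define z where "z m = init [0, m] [] undefined" for m
    have z: "regs (z m) 1 = m" "bounded_mem m (z m)" for m
      by (auto simp: z_def init_def bounded_mem_def less_Suc_eq numeral_2_eq_2)
    define aK where "aK m = acost capacity_exp (z m)" for m
    define r where "r = read_weight capacity_exp"
    define us where "us m j = real (aK m + 4 * val_cost (?K m) + 3) * Bp j + real (val_cost (?K m) + 1) +
      real j * (3 * real (r * val_cost (?K m)))" for m j
    \<comment> \<open>The time for a node of j edges divided by its weight. The logarithm of j is
      replaced by that of 3 * m, the largest size of a node.\<close>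
    define Ub where "Ub m = real (aK m + 4 * val_cost (?K m) + 3) * (\<bar>C\<bar> * log 2 (real (3 * m) + 1) ^ k) +
      real (val_cost (?K m) + 1) + 3 * real (r * val_cost (?K m))" for m
    have K: "aval capacity_exp s = ?K m \<and> acost capacity_exp s = aK m" if "regs s 1 = m" for s m
      using capacity_exp_simps(2)[unfolded reads_only_def, rule_format, of s "z m"] that z(1)[of m] capacity_exp_simps(3)[of s]
      by (simp add: aK_def)
    have S: "solver (solve_by p capacity_exp) n m L (?K m) True (real (70 + max 2 (com_regs p))) (us m)"
      if "1 \<le> m" "n \<le> 2 * m" for n m L
    proof -
      have "m * 1 \<le> m * m ^ 4" using that by (intro mult_left_mono) simp_all
      also have "m * m ^ 4 = m ^ 5" by (simp flip: power_Suc)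
      finally have "m \<le> m ^ 5" by simp
      then show ?thesis unfolding us_def r_def
        by (intro solver_solve_by[OF p(1) pB capacity_exp_simps(1,2) K _ _ _ Bp0]) (use that in auto)
    qed
    have aK: "real (aK m) \<le> real (eweight capacity_exp) * real (val_cost m)" for m
      using acost_le[OF capacity_exp_simps(1) z(2)[of m]] unfolding aK_def of_nat_mult[symmetric] of_nat_le_iff .
    have vK: "real (val_cost (?K m)) \<le> real (vweight capacity_exp) * real (val_cost m)" for m
      using val_cost_aval[OF capacity_exp_simps(1) z(2)[of m]] unfolding capacity_exp_simps(3) z(1) of_nat_mult[symmetric] of_nat_le_iff .
    have p1: "plog (\<lambda>m t. real (aK m))"
      by (rule plog_le[of "\<lambda>m t. real (eweight capacity_exp) * real (val_cost m)"])
        (use aK in \<open>auto intro!: plog_intros plog_const\<close>)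
    have p2: "plog (\<lambda>m t. real (val_cost (?K m)))"
      by (rule plog_le[of "\<lambda>m t. real (vweight capacity_exp) * real (val_cost m)"])
        (use vK in \<open>auto intro!: plog_intros plog_const\<close>)
    have p3: "plog (\<lambda>m t. log 2 (real (3 * m) + 1))"
    proof (rule plog_le[of "\<lambda>m t. 2 + log 2 (real t + 1)"])
      fix m t :: nat assume "1 \<le> m" "m \<le> t"
      then have "log 2 (real (3 * m) + 1) \<le> log 2 (2 ^ 2 * (real t + 1))" by simp
      also have "\<dots> = 2 + log 2 (real t + 1)" by (simp only: log_mult log_nat_power) (simp add: log_mult)
      finally show "log 2 (real (3 * m) + 1) \<le> 2 + log 2 (real t + 1)" .
    qed (auto intro!: plog_intros plog_const)
    have "\<exists>C k. monte_carlo_lists_triangles (lister (solve_by p capacity_exp))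
      {(m, t). m \<le> t \<and> (c \<le> 3 / 2 \<or> real t \<le> real m powr (3 / 2))}
      (\<lambda>m t. C * real m powr (3 * c - 3) * real t powr (3 - 2 * c) * log 2 (real t + 1) ^ k)"
    proof (rule monte_carlo_lister[where rich = True and d = c and us = us and Ub = Ub, OF c _ S])
      show "plog (\<lambda>m t. Ub m)" unfolding Ub_def of_nat_add of_nat_mult
        by (intro plog_intros plog_const p1 p2 p3[unfolded of_nat_mult]) simp_all
      show "us m j \<le> Ub m * real (max 1 j) powr c" if "1 \<le> m" "j \<le> 3 * m" for m j
      proof -
        let ?\<phi> = "real (max 1 j) powr c"
        have "real (max 1 j) powr 1 \<le> ?\<phi>" using c by (intro powr_mono) auto
        then have \<phi>: "1 \<le> ?\<phi>" "real j \<le> ?\<phi>" by simp_all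
        have "real j powr c \<le> ?\<phi>" using c by (intro powr_mono2) auto
        moreover have "log 2 (real j + 1) ^ k \<le> log 2 (real (3 * m) + 1) ^ k"
          using that by (intro power_mono) auto
        ultimately have Bpj: "Bp j \<le> \<bar>C\<bar> * ?\<phi> * log 2 (real (3 * m) + 1) ^ k"
          unfolding Bp_def by (intro mult_mono) auto
        have ring: "x * (y * q * l) + v * q + q * z = (x * (y * l) + v + z) * q" for x y q l v z :: real
          by (simp add: algebra_simps)
        have "us m j \<le> real (aK m + 4 * val_cost (?K m) + 3) * (\<bar>C\<bar> * ?\<phi> * log 2 (real (3 * m) + 1) ^ k) +
          real (val_cost (?K m) + 1) * ?\<phi> + ?\<phi> * (3 * real (r * val_cost (?K m)))"
          unfolding us_def using \<phi> Bpj mult_left_mono[OF \<phi>(1), of "real (val_cost (?K m) + 1)"]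
          by (intro add_mono mult_left_mono mult_right_mono) simp_all
        then show ?thesis unfolding Ub_def ring[symmetric] .
      qed
    qed (use True Bp0 in \<open>simp_all add: us_def Ub_def\<close>)
    then show ?thesis by blast
  next
    case False
    \<comment> \<open>Here the given algorithm serves only to supply the value of c; there is no
      external time, and nodes have linear cost.\<close>
    have "\<exists>C k. monte_carlo_lists_triangles (lister solve_single)
      {(m, t). m \<le> t \<and> (c \<le> 3 / 2 \<or> real t \<le> real m powr (3 / 2))}
      (\<lambda>m t. C * real m powr (3 * c - 3) * real t powr (3 - 2 * c) * log 2 (real t + 1) ^ k)"
      by (rule monte_carlo_lister[where rich = False and d = 1 and us = "\<lambda>_ _. 0" and Ub = "\<lambda>_. 0", OF c _ solver_solve_single])
        (use False in \<open>auto intro: plog_const\<close>)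
    then show ?thesis by blast
  qed
qed

end
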